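(* Let $r$ be a positive integer, let $\lambda=[\lambda_1,\ldots,\lambda_n]$ be a partition of $r$ of length $n$, let $j$ be an integer with $0\le j\le\min\{n,r-n-1\}$, and set $d=r+n-j$. Then the following equality holds set-theoretically in $\mathbb{P}^d=\mathbb{P}(\mathbb{C}[x,y]_d)$: $$\overline{\varPsi_{d,r}^{-1}(\mathrm{CH}_j(\Delta_\lambda))}=\bigcup_{\lambda'\in\mathcal{D}_j(\lambda)}\overline{\varPsi_{d,r-j}^{-1}\bigl(\Xi_0^{\,r-j-n-1}(\Delta_{\lambda'})\bigr)}.$$
   Context: Everything is over $\mathbb{C}$. Write $R=\mathbb{C}[x,y]$ and $D=\mathbb{C}[\partial_x,\partial_y]$, with $D$ acting on $R$ by differentiation. $\mathbb{G}(l,\mathbb{P}^N)=\mathbb{G}(l,N)$ is the Grassmannian of $l$-dimensional projective subspaces of $\mathbb{P}^N$. Bars denote closures. Partitions. A partition of $s$ is an unordered list of positive integers with sum $s$. For $\lambda=[\lambda_1,\ldots,\lambda_n]$, $$\mathcal{D}_j(\lambda)=\{[\lambda_1-\iota_1,\ldots,\lambda_n-\iota_n]:\iota_i\in\{0,1\},\ \iota_1+\cdots+\iota_n=j\},$$ where zero entries are dropped; its elements are partitions of $r-j$ of length at most $n$. Coincident root loci. For a partition $\mu=[\mu_1,\ldots,\mu_m]$ of $s$, $\Delta_\mu\subset\mathbb{P}^s=\mathbb{P}(D_s)$ is the $m$-dimensional irreducible variety of forms of degree $s$ (up to scalars) that factor as $\prod_{i=1}^m\ell_i^{\mu_i}$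 with $\ell_i$ nonzero linear forms. Apolar maps. For $f\in R_d$ let $(f^\perp)_s=\{g\in D_s: g(f)=0\}$. For $d\ge s\ge d-s$, the linear map $D_s\to R_{d-s}$, $g\mapsto g(f)$, has maximal rank $d-s+1$ for general $f$, and the apolar map is the rational map $$\varPsi_{d,s}:\mathbb{P}^d=\mathbb{P}(R_d)\dashrightarrow\mathbb{G}(2s-d-1,\mathbb{P}(D_s)),\qquad f\mapsto\mathbb{P}((f^\perp)_s),$$ defined on the locus where this linear map has maximal rank (in coordinates, it is given by the maximal minors of the catalecticant matrix); preimages are taken in this locus. Higher associated varieties. Let $X\subset\mathbb{P}^N$ be an irreducible projective variety of dimension $m$, and let $T_xX$ be its embedded projective tangent space at $x$. For $0\le j\le m$, $\mathrm{CH}_j(X)\subset\mathbb{G}(N-m-1+j,N)$ is the closure of the set of $(N-m-1+j)$-dimensional subspaces $H$ such that $H\cap X\ne\emptyset$ and $\dim(H\cap T_xX)\ge j$ for some smooth point $x\in H\cap X$. For $0\le l\le N$, $\Xi_0^l(X)\subset\mathbb{G}(l,N)$ is the closure of the set of $l$-dimensional subspaces containing some smooth point of $X$. Thus $\mathrm{CH}_j(\Delta_\lambda)\subset\mathbb{G}(r-n-1+j,r)$ is formed with $\Delta_\lambda\subset\mathbb{P}^r$, and $\Xi_0^{\,r-j-n-1}(\Delta_{\lambda'})\subset\mathbb{G}(r-j-n-1,r-j)$ is formed with $\Delta_{\lambda'}\subset\mathbb{P}^{r-j}$. *)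

theory Defs
  imports
    "HOL-Library.Multiset"
    "HOL-Analysis.Abstract_Topology"
    "HOL-Computational_Algebra.Polynomial"
    "Jordan_Normal_Form.Determinant"
begin

section \<open>Binary forms and differentiation\<close>

text \<open>
  \<open>\<complex>[x,y]\<close> is represented as \<open>\<complex>[x][y]\<close>: the coefficient of \<open>x\<^sup>i y\<^sup>k\<close> in \<open>f\<close> is
  \<open>coeff (coeff f k) i\<close>. The same type serves for \<open>D = \<complex>[\<partial>\<^sub>x,\<partial>\<^sub>y]\<close>, where that number is the
  coefficient of \<open>\<partial>\<^sub>x\<^sup>i \<partial>\<^sub>y\<^sup>k\<close>.
\<close>

type_synonym bipoly = "complex poly poly"

global_interpretation bipoly: vector_space "\<lambda>(c::complex) (f::bipoly). smult [:c:] f"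
  by unfold_locales (simp_all add: smult_add_right smult_add_left [symmetric] one_pCons [symmetric] mult.commute)

definition forms :: "nat \<Rightarrow> bipoly set" where
  "forms d = {f. \<forall>i k. coeff (coeff f k) i \<noteq> 0 \<longrightarrow> i + k = d}"

definition partial_x :: "bipoly \<Rightarrow> bipoly" where
  "partial_x f = map_poly pderiv f"

definition partial_y :: "bipoly \<Rightarrow> bipoly" where
  "partial_y f = pderiv f"

definition apply_diff :: "bipoly \<Rightarrow> bipoly \<Rightarrow> bipoly" where
  "apply_diff g f =
     (\<Sum>k\<le>degree g. \<Sum>i\<le>degree (coeff g k).
        smult [:coeff (coeff g k) i:] ((partial_x ^^ i) ((partial_y ^^ k) f)))"

section \<open>Projective spaces and Grassmannians with their Zariski topologies\<close>

text \<open>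
  The ambient projective space \<open>P\<^sup>N\<close> is the projectivisation of \<open>forms N\<close>. A projective subspace
  is represented by the linear subspace lying over it, so \<open>G(l,N)\<close> is \<open>Gr N (l + 1)\<close>, a point
  of \<open>P\<^sup>N\<close> is a line in \<open>forms N\<close>, and a point \<open>x\<close> lies on a projective subspace \<open>H\<close>
  iff \<open>x \<subseteq> H\<close>.
\<close>

definition Gr :: "nat \<Rightarrow> nat \<Rightarrow> bipoly set set" where
  "Gr N k = {W. bipoly.subspace W \<and> W \<subseteq> forms N \<and> bipoly.dim W = k}"

text \<open>Homogeneous polynomial functions of degree \<open>e\<close> in the variables indexed by \<open>J\<close>.\<close>

inductive hom_poly :: "'i set \<Rightarrow> nat \<Rightarrow> (('i \<Rightarrow> complex) \<Rightarrow> complex) \<Rightarrow> bool"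
  for J :: "'i set" where
  const: "hom_poly J 0 (\<lambda>z. c)"
| var: "i \<in> J \<Longrightarrow> hom_poly J 1 (\<lambda>z. z i)"
| add: "hom_poly J e F \<Longrightarrow> hom_poly J e G \<Longrightarrow> hom_poly J e (\<lambda>z. F z + G z)"
| mult: "hom_poly J e F \<Longrightarrow> hom_poly J e' G \<Longrightarrow> hom_poly J (e + e') (\<lambda>z. F z * G z)"

text \<open>
  Zariski topology on \<open>A\<close>, where \<open>hc p\<close> is the set of all vectors of homogeneous coordinates
  of the point \<open>p\<close>; these agree up to a nonzero scalar, so whether \<open>F\<close> vanishes at \<open>p\<close>
  does not depend on the choice.
\<close>

definition zariski :: "'i set \<Rightarrow> ('p \<Rightarrow> ('i \<Rightarrow> complex) set) \<Rightarrow> 'p set \<Rightarrow> 'p topology" where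
  "zariski J hc A =
     topology_generated_by {{p \<in> A. \<exists>z \<in> hc p. F z \<noteq> 0} | e F. hom_poly J e F}"

definition coords :: "nat \<Rightarrow> bipoly \<Rightarrow> nat \<Rightarrow> complex" where
  "coords N f i = coeff (coeff f i) (N - i)"

definition zariski_proj :: "nat \<Rightarrow> bipoly set topology" where
  "zariski_proj N = zariski {..N} (\<lambda>x. coords N ` (x - {0})) (Gr N 1)"

definition pluecker :: "nat \<Rightarrow> nat \<Rightarrow> (nat \<Rightarrow> bipoly) \<Rightarrow> nat set \<Rightarrow> complex" where
  "pluecker N k w I =
     det (mat k k (\<lambda>(a, b). coords N (w a) (sorted_list_of_set I ! b)))"

definition zariski_Gr :: "nat \<Rightarrow> nat \<Rightarrow> bipoly set topology" where
  "zariski_Gr N k =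
     zariski {I. I \<subseteq> {..N} \<and> card I = k}
       (\<lambda>W. {pluecker N k w | w. bipoly.span (w ` {..<k}) = W}) (Gr N k)"

section \<open>Dimension, tangent spaces and smooth points\<close>

definition irreducible_in :: "'p topology \<Rightarrow> 'p set \<Rightarrow> bool" where
  "irreducible_in T Z \<longleftrightarrow> Z \<noteq> {} \<and> Z \<subseteq> topspace T \<and>
     (\<forall>A B. closedin T A \<and> closedin T B \<and> Z \<subseteq> A \<union> B \<longrightarrow> Z \<subseteq> A \<or> Z \<subseteq> B)"

definition krull_dim :: "'p topology \<Rightarrow> nat" where
  "krull_dim T =
     Sup {k. \<exists>Z. (\<forall>i\<le>k. closedin T (Z i) \<and> irreducible_in T (Z i)) \<and>
                  (\<forall>i<k. Z i \<subset> Z (Suc i))}"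

definition var_dim :: "nat \<Rightarrow> bipoly set set \<Rightarrow> nat" where
  "var_dim N X = krull_dim (subtopology (zariski_proj N) X)"

text \<open>
  The linear subspace over the embedded projective tangent space: all \<open>v\<close> with \<open>dF\<^sub>u(v) = 0\<close> for
  every homogeneous \<open>F\<close> in the ideal of \<open>X\<close>, where \<open>u\<close> spans \<open>x\<close>.
\<close>

definition tangent_space :: "nat \<Rightarrow> bipoly set set \<Rightarrow> bipoly set \<Rightarrow> bipoly set" where
  "tangent_space N X x =
     {v \<in> forms N. \<forall>e F. hom_poly {..N} e F \<and> (\<forall>y \<in> X. \<forall>u \<in> y - {0}. F (coords N u) = 0) \<longrightarrow>
        (\<forall>u \<in> x - {0}.
           ((\<lambda>t. F (coords N (u + smult [:t:] v))) has_field_derivative 0) (at 0))}"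

definition smooth_point :: "nat \<Rightarrow> bipoly set set \<Rightarrow> bipoly set \<Rightarrow> bool" where
  "smooth_point N X x \<longleftrightarrow> x \<in> X \<and> bipoly.dim (tangent_space N X x) = var_dim N X + 1"

section \<open>Higher associated varieties\<close>

text \<open>
  Linear dimensions are projective dimensions plus one: \<open>CH N j X\<close> lies in
  \<open>G(N-m-1+j, N) = Gr N (N-m+j)\<close>, and \<open>dim (H \<inter> T\<^sub>x X) \<ge> j\<close> becomes \<open>\<ge> j + 1\<close>.
  The condition that \<open>H\<close> meets \<open>X\<close> is implied by \<open>x \<subseteq> H\<close>.
\<close>

definition CH :: "nat \<Rightarrow> nat \<Rightarrow> bipoly set set \<Rightarrow> bipoly set set" where
  "CH N j X = (let k = N - var_dim N X + j in
     zariski_Gr N k closure_of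
       {H \<in> Gr N k. \<exists>x. smooth_point N X x \<and> x \<subseteq> H \<and>
                         bipoly.dim (H \<inter> tangent_space N X x) \<ge> j + 1})"

definition Xi0 :: "nat \<Rightarrow> nat \<Rightarrow> bipoly set set \<Rightarrow> bipoly set set" where
  "Xi0 N l X = zariski_Gr N (l + 1) closure_of
     {H \<in> Gr N (l + 1). \<exists>x. smooth_point N X x \<and> x \<subseteq> H}"

section \<open>Partitions and coincident root loci\<close>

definition is_partition :: "nat multiset \<Rightarrow> nat \<Rightarrow> bool" where
  "is_partition mu s \<longleftrightarrow> 0 \<notin># mu \<and> sum_mset mu = s"

text \<open>\<open>D_set j lam\<close> is the set \<open>\<D>\<^sub>j(\<lambda>)\<close>; \<open>ls\<close> is an arbitrary ordering of \<open>lam\<close>.\<close>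

definition D_set :: "nat \<Rightarrow> nat multiset \<Rightarrow> nat multiset set" where
  "D_set j lam =
     {filter_mset (\<lambda>a. a \<noteq> 0) (mset (map2 (-) ls is)) | ls is.
        mset ls = lam \<and> length is = length ls \<and> set is \<subseteq> {0, 1} \<and> sum_list is = j}"

definition coincident_root_locus :: "nat multiset \<Rightarrow> bipoly set set" where
  "coincident_root_locus mu =
     {bipoly.span {\<Prod>i<length ms. L i ^ (ms ! i)} | ms L.
        mset ms = mu \<and> (\<forall>i<length ms. L i \<in> forms 1 \<and> L i \<noteq> 0)}"

section \<open>Apolar maps\<close>

text \<open>
  A point of \<open>P\<^sup>d\<close> is a line \<open>x\<close>; annihilating \<open>x\<close> means annihilating any generator \<open>f\<close> of it.
\<close>

definition apolar_domain :: "nat \<Rightarrow> nat \<Rightarrow> bipoly set set" where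
  "apolar_domain d s =
     {bipoly.span {f} | f. f \<in> forms d \<and> f \<noteq> 0 \<and>
        bipoly.dim ((\<lambda>g. apply_diff g f) ` forms s) = d - s + 1}"

definition apolar_map :: "nat \<Rightarrow> bipoly set \<Rightarrow> bipoly set" where
  "apolar_map s x = {g \<in> forms s. \<forall>f \<in> x. apply_diff g f = 0}"

definition apolar_preimage :: "nat \<Rightarrow> nat \<Rightarrow> bipoly set set \<Rightarrow> bipoly set set" where
  "apolar_preimage d s S = {x \<in> apolar_domain d s. apolar_map s x \<in> S}"

end

theory Submission
  imports Defs "HOL-Library.Function_Algebras" "HOL-Library.Product_Plus"
    "HOL-Computational_Algebra.Fundamental_Theorem_Algebra" "HOL-Combinatorics.List_Permutation"
begin

text \<open>
  Set \<open>x = 1\<close>. A form of degree \<open>N\<close> becomes a polynomial of degree at most \<open>N\<close>, and a form \<open>f\<close> of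
  degree \<open>d\<close> is recorded by the sequence \<open>a\<^sub>k = k! (d - k)! f\<^sub>k\<close>, where \<open>f\<^sub>k\<close> is its coefficient of
  \<open>x\<^sup>d\<^sup>-\<^sup>k y\<^sup>k\<close>. Differential operators then act through the shift of sequences: a form of degree \<open>s\<close>
  with polynomial \<open>p\<close> kills \<open>f\<close> iff \<open>p\<close> sends \<open>a\<close> to a sequence that vanishes at every \<open>m\<close> with
  \<open>m + s \<le> d\<close> (\<open>apply_diff_eq_0_iff\<close>). The formal degree \<open>s\<close> may exceed \<open>degree p\<close>; the difference
  counts the roots at infinity.

  The equality is one fact about such sequences. Let \<open>l\<^sub>1, \<dots>, l\<^sub>n\<close> be linear forms, \<open>P\<close> the product
  of the \<open>l\<^sub>i\<^bsup>\<lambda>\<^sub>i - 1\<^esup>\<close> and \<open>L\<close> the product of the \<open>l\<^sub>i\<close>. At the point \<open>P L\<close> of the locus, if it is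
  smooth, the tangent space is \<open>P \<cdot> D\<^sub>n\<close>. Let \<open>H\<close> be the space of operators of degree \<open>r\<close> that kill
  \<open>f\<close>, and let \<open>F = P(f)\<close>, a form of degree \<open>2 n - j\<close>. Then \<open>H\<close> contains \<open>P L\<close> iff \<open>L\<close> kills \<open>F\<close>,
  and \<open>H\<close> meets \<open>P \<cdot> D\<^sub>n\<close> in linear dimension at least \<open>j + 1\<close> iff the map \<open>D\<^sub>n \<rightarrow> R\<^sub>n\<^sub>-\<^sub>j\<close>, \<open>g \<mapsto> g(F)\<close>,
  is not onto, that is (transpose it) iff some nonzero form of degree \<open>n - j\<close> kills \<open>F\<close>. If a form
  of degree \<open>e\<close> and a product of \<open>m\<close> linear forms kill a form of degree at least \<open>e + m\<close>, then at
  most \<open>e\<close> of the linear factors suffice (\<open>annihilating_subproduct\<close>). So \<open>f\<close> is killed by \<open>P\<close>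
  times the product of the \<open>l\<^sub>i\<close> over \<open>n - j\<close> indices, and that is a point of the locus of a
  partition in \<open>\<D>\<^sub>j(\<lambda>)\<close>. Conversely, if such a product \<open>q\<close> of degree \<open>r - j\<close> kills \<open>f\<close>, then \<open>H\<close>
  contains \<open>q \<cdot> D\<^sub>j\<close>, a subspace of \<open>P \<cdot> D\<^sub>n\<close> of dimension \<open>j + 1\<close> that contains \<open>P L\<close>.

  Both sides are defined by closures, and these need three more ingredients.

  The conditions on \<open>H\<close> must pass to limits. They ask for points on projective lines that satisfy
  polynomial equations, and such existential conditions are closed (\<open>closed_cond_project\<close>, the
  elimination theorem for products of projective lines). Tangency is brought into this form in
  \<open>CH_upper\<close>: \<open>H\<close> meets every image of \<open>D\<^sub>n\<^sub>-\<^sub>j\<close> in \<open>P \<cdot> D\<^sub>n\<close>, and the elements of \<open>D\<^sub>n\<^sub>-\<^sub>j\<close> are products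
  of linear forms. In the other direction every \<open>H\<close> that contains \<open>q \<cdot> D\<^sub>j\<close> has to be a limit of
  subspaces that are tangent at a smooth point: move the linear forms along a line towards a
  general position and carry \<open>H\<close> along with the multiples of \<open>q\<close>
  (\<open>in_closure_of_Gr_by_moving_factor\<close>).

  A form killed by \<open>q\<close> need not lie in the domain of the apolar map, which consists of the forms
  that no nonzero operator of a certain low degree kills. Inside the space of forms killed by \<open>q\<close>
  membership in the domain is generic (\<open>generic_perturbation\<close>), again by
  \<open>annihilating_subproduct\<close>; hence such a form is a limit of forms in the domain.

  Finally the dimension of the locus and its smooth points have to be known. The dimension is the
  number \<open>n\<close> of factors: specialising one factor after the other gives a chain of \<open>n + 1\<close> closed
  irreducible sets, and a longer chain would give too many algebraically independent homogeneous
  functions, which is excluded by counting the monomials of bounded degree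
  (\<open>hom_indep_card_bound\<close>). At a general point the equations of minimal degree between the
  coordinates cut the tangent space down to linear dimension \<open>n + 1\<close>
  (\<open>generically_small_tangent_space\<close>), and then it equals \<open>P \<cdot> D\<^sub>n\<close>.
\<close>

section \<open>Linear algebra inside finite-dimensional subspaces\<close>

context vector_space
begin

lemma finite_independent_in_span: "independent A \<Longrightarrow> A \<subseteq> span B \<Longrightarrow> finite B \<Longrightarrow> finite A"
  using independent_span_bound by blast

text \<open>
  The inclusion in the span of a finite set is essential: \<open>dim\<close> is zero on subspaces of infinite
  dimension.
\<close>
lemma dim_mono_in_span:
  assumes "V \<subseteq> W" "W \<subseteq> span B" "finite B"
  shows "dim V \<le> dim W"
proof -
  obtain C where C: "C \<subseteq> V" "independent C" "V \<subseteq> span C" "card C = dim V"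
    using basis_exists by blast
  obtain D where D: "D \<subseteq> W" "independent D" "W \<subseteq> span D" "card D = dim W"
    using basis_exists by blast
  have "finite D" using D assms finite_independent_in_span by blast
  moreover have "C \<subseteq> span D" using C D assms by blast
  ultimately show ?thesis using C D independent_span_bound by metis
qed

lemma subspace_eq_of_dim_le:
  assumes "V \<subseteq> W" "W \<subseteq> span B" "finite B" "subspace V" "dim W \<le> dim V"
  shows "V = W"
proof (rule ccontr)
  assume "V \<noteq> W"
  then obtain x where x: "x \<in> W" "x \<notin> V" using assms by blast
  obtain C where C: "C \<subseteq> V" "independent C" "V \<subseteq> span C" "card C = dim V"
    using basis_exists by blast
  have sp: "span C = V" using C assms(4) span_minimal by blast
  have ind: "independent (insert x C)" using x sp C(2) by (simp add: independent_insertI)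
  obtain D where D: "D \<subseteq> W" "independent D" "W \<subseteq> span D" "card D = dim W"
    using basis_exists by blast
  have fD: "finite D" using D assms finite_independent_in_span by blast
  have "insert x C \<subseteq> span D" using C D assms(1) x by blast
  then have le: "card (insert x C) \<le> card D" and fin: "finite (insert x C)"
    using independent_span_bound[OF fD ind] by simp_all
  have "x \<notin> C" using x C(1) by blast
  then show False using le fin D C assms(5) by simp
qed

lemma functional_separating_exists:
  assumes "x \<notin> span S"
  shows "\<exists>phi. Vector_Spaces.linear scale (*) phi \<and> (\<forall>s\<in>S. phi s = 0) \<and> phi x = 1"
proof -
  interpret F: vector_space "(*) :: 'a \<Rightarrow> 'a \<Rightarrow> 'a"
    by unfold_locales (simp_all add: algebra_simps)
  interpret P: vector_space_pair scale "(*) :: 'a \<Rightarrow> 'a \<Rightarrow> 'a" ..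
  obtain C where C: "C \<subseteq> S" "independent C" "S \<subseteq> span C"
    using maximal_independent_subset by blast
  have xC: "x \<notin> span C" using assms C(1) span_mono by blast
  then have ind: "independent (insert x C)" using C by (simp add: independent_insertI)
  obtain g where g: "Vector_Spaces.linear scale (*) g" "\<forall>y\<in>insert x C. g y = (if y = x then 1 else 0)"
    using P.linear_independent_extend[OF ind, of "\<lambda>y. if y = x then 1 else 0"] by blast
  have "x \<notin> C" using xC span_base by blast
  then have gC: "\<forall>y\<in>C. g y = 0" using g(2) by auto
  have "\<forall>s\<in>S. g s = 0"
    using P.linear_eq_0_on_span[OF g(1), of C] gC C(3) by blast
  then show ?thesis using g by auto
qed

text \<open>Comparing two expansions of \<open>z\<close> gives a relation in \<open>C\<close>.\<close>
lemma spans_of_disjoint_parts_meet_trivially: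
  assumes "independent C" "finite C" "K \<subseteq> C" "z \<in> span K" "z \<in> span (C - K)"
  shows "z = 0"
proof -
  have fin: "finite K" "finite (C - K)" using assms finite_subset by auto
  obtain u where u: "z = (\<Sum>v\<in>C-K. scale (u v) v)" using assms fin span_finite by auto
  obtain w where w: "z = (\<Sum>v\<in>K. scale (w v) v)" using assms fin span_finite by auto
  define q where "q v = (if v \<in> K then - w v else u v)" for v
  have "(\<Sum>v\<in>C. scale (q v) v) = (\<Sum>v\<in>C-K. scale (q v) v) + (\<Sum>v\<in>K. scale (q v) v)"
    using sum.subset_diff[OF assms(3,2)] by blast
  also have "(\<Sum>v\<in>C-K. scale (q v) v) = z" unfolding u by (rule sum.cong) (auto simp: q_def)
  also have "(\<Sum>v\<in>K. scale (q v) v) = - z" unfolding w by (simp add: q_def sum_negf)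
  finally have "(\<Sum>v\<in>C. scale (q v) v) = 0" by simp
  then have "\<And>v. v \<in> C \<Longrightarrow> q v = 0" using independentD[OF assms(1,2) order_refl] by blast
  then have "u v = 0" if "v \<in> C - K" for v using that unfolding q_def by (metis DiffD1 DiffD2)
  then show ?thesis unfolding u by (intro sum.neutral) auto
qed

text \<open>
  The pigeonhole principle of linear algebra, for families rather than sets: if \<open>f\<close> is not
  injective on \<open>A\<close>, then two equal members already give a relation.
\<close>
lemma nontrivial_relation:
  assumes "finite A" "finite B" "\<And>a. a \<in> A \<Longrightarrow> f a \<in> span B" "card B < card A"
  shows "\<exists>c. (\<exists>a\<in>A. c a \<noteq> 0) \<and> (\<Sum>a\<in>A. scale (c a) (f a)) = 0"
proof (cases "inj_on f A")
  case False
  then obtain a b where ab: "a \<in> A" "b \<in> A" "a \<noteq> b" "f a = f b" unfolding inj_on_def by blast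
  define c where "c i = (if i = a then 1 else if i = b then -1 else (0::'a))" for i
  have "(\<Sum>i\<in>A. scale (c i) (f i)) = (\<Sum>i\<in>{a,b}. scale (c i) (f i))"
    by (rule sum.mono_neutral_right) (use ab assms c_def in auto)
  also have "\<dots> = 0" using ab by (simp add: c_def)
  finally show ?thesis using ab c_def by (intro exI[of _ c]) auto
next
  case True
  have "\<not> independent (f ` A)"
  proof
    assume "independent (f ` A)"
    moreover have "f ` A \<subseteq> span B" using assms by blast
    ultimately have "card (f ` A) \<le> card B" using independent_span_bound assms(2) by blast
    then show False using card_image[OF True] assms by simp
  qed
  then obtain u where u: "\<exists>v\<in>f ` A. u v \<noteq> 0" "(\<Sum>v\<in>f ` A. scale (u v) v) = 0"
    using dependent_finite[of "f ` A"] assms(1) by auto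
  have "(\<Sum>a\<in>A. scale (u (f a)) (f a)) = 0"
    using u(2) unfolding sum.reindex[OF True] by (simp add: comp_def)
  then show ?thesis using u(1) by (intro exI[of _ "\<lambda>a. u (f a)"]) auto
qed

text \<open>
  Concatenated bases of the two subspaces are too many vectors to be independent. In a relation
  between them the part from \<open>U\<close> equals minus the part from \<open>W\<close>; this is a common vector, and it
  is nonzero because each basis is independent.
\<close>
lemma subspaces_meet:
  assumes "subspace U" "subspace W" "U \<subseteq> span B" "W \<subseteq> span B" "finite B" "card B < dim U + dim W"
  shows "\<exists>x. x \<noteq> 0 \<and> x \<in> U \<and> x \<in> W"
proof -
  obtain C where C: "C \<subseteq> U" "independent C" "U \<subseteq> span C" "card C = dim U"
    using basis_exists by blast
  obtain D where D: "D \<subseteq> W" "independent D" "W \<subseteq> span D" "card D = dim W"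
    using basis_exists by blast
  have fin: "finite C" "finite D"
    using C D assms finite_independent_in_span by (meson order_trans)+
  have "\<exists>c. (\<exists>a\<in>C <+> D. c a \<noteq> 0) \<and> (\<Sum>a\<in>C <+> D. scale (c a) (case a of Inl x \<Rightarrow> x | Inr x \<Rightarrow> x)) = 0"
    by (rule nontrivial_relation[where B=B]) (use fin C D assms in \<open>auto simp: card_Plus\<close>)
  then obtain c where c: "\<exists>a\<in>C <+> D. c a \<noteq> 0"
    "(\<Sum>a\<in>C <+> D. scale (c a) (case a of Inl x \<Rightarrow> x | Inr x \<Rightarrow> x)) = 0" by blast
  define x where "x = (\<Sum>a\<in>C. scale (c (Inl a)) a)"
  define y where "y = (\<Sum>a\<in>D. scale (c (Inr a)) a)"
  have xy: "x + y = 0" using c(2) fin unfolding x_def y_def by (simp add: sum.Plus)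
  have xU: "x \<in> U" unfolding x_def using C(1) assms(1) by (intro subspace_sum subspace_scale) auto
  have yW: "y \<in> W" unfolding y_def using D(1) assms(2) by (intro subspace_sum subspace_scale) auto
  have "x = - y" using xy by (simp add: eq_neg_iff_add_eq_0)
  then have xW: "x \<in> W" using yW assms(2) subspace_neg by blast
  have "x \<noteq> 0"
  proof
    assume x0: "x = 0"
    then have y0: "y = 0" using xy by simp
    have "\<forall>a\<in>C. c (Inl a) = 0"
      using independentD[OF C(2) fin(1) order_refl x0[unfolded x_def]] by blast
    moreover have "\<forall>a\<in>D. c (Inr a) = 0"
      using independentD[OF D(2) fin(2) order_refl y0[unfolded y_def]] by blast
    ultimately show False using c(1) by auto
  qed
  then show ?thesis using xU xW by blast
qed

end

text \<open>
  Rank and nullity for the restriction of \<open>f\<close> to a subspace of finite dimension: extend a basis of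
  the kernel to a basis of \<open>V\<close>; then \<open>f\<close> is injective on the span of the new vectors.
\<close>
lemma (in vector_space_pair) dim_kernel_plus_image:
  assumes lf: "Vector_Spaces.linear s1 s2 f" and V: "vs1.subspace V" "V \<subseteq> vs1.span B" "finite B"
  shows "vs1.dim {x \<in> V. f x = 0} + vs2.dim (f ` V) = vs1.dim V"
proof -
  interpret f: Vector_Spaces.linear s1 s2 f by (rule lf)
  let ?K = "{x \<in> V. f x = 0}"
  obtain K where K: "K \<subseteq> ?K" "vs1.independent K" "?K \<subseteq> vs1.span K" "card K = vs1.dim ?K"
    using vs1.basis_exists by blast
  obtain C where C: "K \<subseteq> C" "C \<subseteq> V" "vs1.independent C" "V \<subseteq> vs1.span C"
    using vs1.maximal_independent_subset_extend[of K V] K by blast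
  have fC: "finite C" using C V vs1.finite_independent_in_span by (meson order_trans)
  have dimV: "card C = vs1.dim V" using C vs1.basis_card_eq_dim by blast
  have sub: "vs1.span (C - K) \<subseteq> V" using C V vs1.span_minimal by (metis Diff_subset subset_trans)
  have inj: "inj_on f (vs1.span (C - K))"
  proof (rule inj_onI)
    fix x y assume xy: "x \<in> vs1.span (C - K)" "y \<in> vs1.span (C - K)" "f x = f y"
    let ?z = "x - y"
    have z: "?z \<in> vs1.span (C - K)" using xy vs1.span_diff by blast
    then have "?z \<in> ?K" using sub xy by (auto simp: f.diff)
    then have zK: "?z \<in> vs1.span K" using K by blast
    have "?z = 0" by (rule vs1.spans_of_disjoint_parts_meet_trivially[OF C(3) fC C(1) zK z])
    then show "x = y" by simp
  qed
  have ind: "vs2.independent (f ` (C - K))"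
    using linear_independent_injective_image[OF lf _ inj] vs1.independent_mono[OF C(3)] by blast
  have "f ` C \<subseteq> vs2.span (f ` (C - K))"
  proof
    fix z assume "z \<in> f ` C"
    then obtain v where v: "v \<in> C" "z = f v" by blast
    show "z \<in> vs2.span (f ` (C - K))"
    proof (cases "v \<in> K")
      case True
      then have "z = 0" using K(1) v by auto
      then show ?thesis using vs2.span_zero by simp
    next
      case False
      then have "z \<in> f ` (C - K)" using v by blast
      then show ?thesis by (rule vs2.span_base)
    qed
  qed
  then have "vs2.span (f ` C) \<subseteq> vs2.span (f ` (C - K))"
    by (intro vs2.span_minimal) simp_all
  then have fV: "f ` V \<subseteq> vs2.span (f ` (C - K))"
    using C(4) f.span_image[of C] by (metis image_mono order_trans)
  have "f ` (C - K) \<subseteq> f ` V" using C(2) by (intro image_mono) auto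
  then have "vs2.dim (f ` V) = card (f ` (C - K))"
    using ind fV by (simp add: vs2.basis_card_eq_dim)
  also have "\<dots> = card (C - K)"
    using inj vs1.span_superset by (meson card_image inj_on_subset)
  also have "\<dots> = card C - card K"
    using fC C(1) finite_subset card_Diff_subset by metis
  finally show ?thesis using card_mono[OF fC C(1)] dimV K(4) by linarith
qed

section \<open>Binary forms as univariate polynomials\<close>

abbreviation (input) scale_form :: "complex \<Rightarrow> bipoly \<Rightarrow> bipoly" where
  "scale_form \<equiv> \<lambda>c f. smult [:c:] f"

definition dehom :: "bipoly \<Rightarrow> complex poly" where
  "dehom f = map_poly (\<lambda>p. poly p 1) f"

text \<open>
  Homogenisation to the formal degree \<open>N\<close>, the inverse of \<open>dehom\<close> on polynomials of degree at most
  \<open>N\<close>. A drop in degree becomes a power of \<open>x\<close>.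
\<close>
definition homog :: "nat \<Rightarrow> complex poly \<Rightarrow> bipoly" where
  "homog N p = (\<Sum>k\<le>N. monom (monom (coeff p k) (N - k)) k)"

lemma coeff_dehom: "coeff (dehom f) k = poly (coeff f k) 1"
  by (simp add: dehom_def coeff_map_poly)

lemma dehom_0 [simp]: "dehom 0 = 0" by (simp add: dehom_def)
lemma dehom_1 [simp]: "dehom 1 = 1" by (rule poly_eqI) (simp add: coeff_dehom one_pCons coeff_pCons split: nat.split)
lemma dehom_add: "dehom (f + g) = dehom f + dehom g" by (rule poly_eqI) (simp add: coeff_dehom)
lemma dehom_smult: "dehom (smult [:c:] f) = smult c (dehom f)" by (rule poly_eqI) (simp add: coeff_dehom)
lemma dehom_mult: "dehom (f * g) = dehom f * dehom g" by (rule poly_eqI) (simp add: coeff_dehom coeff_mult poly_sum)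
lemma dehom_power: "dehom (f ^ n) = dehom f ^ n" by (induction n) (simp_all add: dehom_mult)
lemma dehom_prod: "dehom (prod F A) = (\<Prod>a\<in>A. dehom (F a))"
  by (induction A rule: infinite_finite_induct) (simp_all add: dehom_mult)
lemma formsD: "f \<in> forms N \<Longrightarrow> coeff f k = (if k \<le> N then monom (coords N f k) (N - k) else 0)"
proof (rule poly_eqI)
  fix n assume "f \<in> forms N"
  then have "coeff (coeff f k) n \<noteq> 0 \<Longrightarrow> n + k = N" by (simp add: forms_def)
  then show "coeff (coeff f k) n = coeff (if k \<le> N then monom (coords N f k) (N - k) else 0) n"
    by (cases "n + k = N") (auto simp: coords_def)
qed

lemma coeff_dehom_forms: "f \<in> forms N \<Longrightarrow> coeff (dehom f) k = (if k \<le> N then coords N f k else 0)"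
  by (simp add: coeff_dehom formsD poly_monom)

lemma degree_dehom: "f \<in> forms N \<Longrightarrow> degree (dehom f) \<le> N"
  by (rule degree_le) (simp add: coeff_dehom_forms)

lemma dehom_inj: "f \<in> forms N \<Longrightarrow> g \<in> forms N \<Longrightarrow> dehom f = dehom g \<Longrightarrow> f = g"
  by (rule poly_eqI) (metis coeff_dehom_forms formsD)

lemma dehom_eq_0_iff: "f \<in> forms N \<Longrightarrow> dehom f = 0 \<longleftrightarrow> f = 0"
  using dehom_inj[of f N 0] by (auto simp: forms_def)

lemma coeff_homog: "coeff (homog N p) k = (if k \<le> N then monom (coeff p k) (N - k) else 0)"
  unfolding homog_def coeff_sum by (simp add: if_distrib[of "\<lambda>x. x = _"] cong: if_cong)

lemma homog_forms [simp]: "homog N p \<in> forms N"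
  unfolding forms_def by (auto simp: coeff_homog split: if_splits)

lemma dehom_homog: "degree p \<le> N \<Longrightarrow> dehom (homog N p) = p"
  by (rule poly_eqI) (auto simp: coeff_dehom coeff_homog poly_monom coeff_eq_0)

lemma coords_homog: "k \<le> N \<Longrightarrow> coords N (homog N p) k = coeff p k"
  by (simp add: coords_def coeff_homog)

lemma homog_add: "homog N (p + q) = homog N p + homog N q"
  by (simp add: homog_def add_monom[symmetric] sum.distrib)
lemma homog_smult: "homog N (smult c p) = smult [:c:] (homog N p)"
  by (rule poly_eqI) (simp add: coeff_homog smult_monom)
lemma homog_0 [simp]: "homog N 0 = 0" by (simp add: homog_def)
lemma homog_eq_0_iff: "degree p \<le> N \<Longrightarrow> homog N p = 0 \<longleftrightarrow> p = 0"
  using dehom_homog by fastforce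

lemma subspace_forms: "bipoly.subspace (forms N)"
proof (rule bipoly.subspaceI)
  show "0 \<in> forms N" by (simp add: forms_def)
  fix f g :: bipoly and c :: complex
  assume f: "f \<in> forms N"
  show "smult [:c:] f \<in> forms N" using f by (auto simp: forms_def)
  assume g: "g \<in> forms N"
  show "f + g \<in> forms N"
  proof -
    have "i + k = N" if "coeff (coeff f k) i + coeff (coeff g k) i \<noteq> 0" for i k
      using that f g unfolding forms_def by (cases "coeff (coeff f k) i = 0") auto
    then show ?thesis by (simp add: forms_def)
  qed
qed

lemma forms_mult: assumes "f \<in> forms a" "g \<in> forms b" shows "f * g \<in> forms (a + b)"
proof -
  have "i + k = a + b" if nz: "coeff (coeff (f * g) k) i \<noteq> 0" for i k
  proof -
    have "(\<Sum>l\<le>k. \<Sum>m\<le>i. coeff (coeff f l) m * coeff (coeff g (k - l)) (i - m)) \<noteq> 0"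
      using nz by (simp add: coeff_mult coeff_sum)
    then obtain l where l: "l \<le> k" "(\<Sum>m\<le>i. coeff (coeff f l) m * coeff (coeff g (k - l)) (i - m)) \<noteq> 0"
      using sum.not_neutral_contains_not_neutral by (metis (no_types, lifting) atMost_iff)
    then obtain m where m: "m \<le> i" "coeff (coeff f l) m * coeff (coeff g (k - l)) (i - m) \<noteq> 0"
      using sum.not_neutral_contains_not_neutral by (metis (no_types, lifting) atMost_iff)
    then have "m + l = a" "(i - m) + (k - l) = b" using assms by (auto simp: forms_def)
    then show ?thesis using l m by linarith
  qed
  then show ?thesis by (simp add: forms_def)
qed

lemma coords_add: "coords N (f + g) k = coords N f k + coords N g k" by (simp add: coords_def)
lemma coords_smult: "coords N (smult [:c:] f) k = c * coords N f k" by (simp add: coords_def)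
lemma coords_0: "coords N 0 k = 0" by (simp add: coords_def)
lemma coords_sum: "coords N (sum f A) k = (\<Sum>a\<in>A. coords N (f a) k)"
  by (induction A rule: infinite_finite_induct) (simp_all add: coords_add coords_0)

lemma forms_eqI: "f \<in> forms N \<Longrightarrow> g \<in> forms N \<Longrightarrow> (\<And>k. k \<le> N \<Longrightarrow> coords N f k = coords N g k) \<Longrightarrow> f = g"
  by (rule poly_eqI) (simp add: formsD)

definition mono_form :: "nat \<Rightarrow> nat \<Rightarrow> bipoly" where "mono_form N k = homog N (monom 1 k)"

lemma mono_form_forms [simp]: "mono_form N k \<in> forms N" by (simp add: mono_form_def)
lemma coords_mono_form: "i \<le> N \<Longrightarrow> coords N (mono_form N k) i = (if i = k then 1 else 0)"
  by (simp add: mono_form_def coords_homog)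

lemma forms_expand: assumes "f \<in> forms N" shows "f = (\<Sum>k\<le>N. smult [:coords N f k:] (mono_form N k))"
proof (rule forms_eqI[of _ N])
  show "(\<Sum>k\<le>N. smult [:coords N f k:] (mono_form N k)) \<in> forms N"
    by (intro bipoly.subspace_sum subspace_forms bipoly.subspace_scale) auto
  fix k assume "k \<le> N"
  then show "coords N f k = coords N (\<Sum>k\<le>N. smult [:coords N f k:] (mono_form N k)) k"
    by (simp add: coords_sum coords_smult coords_mono_form if_distrib[of "\<lambda>x. _ * x"] cong: if_cong)
qed (use assms in auto)

lemma inj_mono_form: "inj_on (mono_form N) {..N}"
  by (rule inj_onI) (metis atMost_iff coords_mono_form one_neq_zero)

lemma independent_mono_form: "bipoly.independent (mono_form N ` {..N})"
proof (subst bipoly.dependent_finite, simp, safe)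
  fix u k assume s: "(\<Sum>v\<in>mono_form N ` {..N}. smult [:u v:] v) = 0" and k: "k \<le> N" and nz: "u (mono_form N k) \<noteq> 0"
  have "(\<Sum>i\<le>N. smult [:u (mono_form N i):] (mono_form N i)) = 0"
    using s by (simp add: sum.reindex[OF inj_mono_form])
  then have "coords N (\<Sum>i\<le>N. smult [:u (mono_form N i):] (mono_form N i)) k = 0" by (simp add: coords_0)
  then show False using k nz
    by (simp add: coords_sum coords_smult coords_mono_form if_distrib[of "\<lambda>x. _ * x"] cong: if_cong)
qed

lemma span_mono_form: "bipoly.span (mono_form N ` {..N}) = forms N"
proof
  show "bipoly.span (mono_form N ` {..N}) \<subseteq> forms N"
    by (rule bipoly.span_minimal) (auto simp: subspace_forms)
  show "forms N \<subseteq> bipoly.span (mono_form N ` {..N})"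
  proof
    fix f assume "f \<in> forms N"
    then have "f = (\<Sum>k\<le>N. smult [:coords N f k:] (mono_form N k))" by (rule forms_expand)
    also have "\<dots> \<in> bipoly.span (mono_form N ` {..N})"
      by (intro bipoly.span_sum bipoly.span_scale bipoly.span_base) auto
    finally show "f \<in> bipoly.span (mono_form N ` {..N})" .
  qed
qed

lemma dim_forms: "bipoly.dim (forms N) = N + 1"
  using bipoly.dim_span_eq_card_independent[OF independent_mono_form[of N]]
  unfolding span_mono_form card_image[OF inj_mono_form] by simp

lemma dim_mono_forms: "V \<subseteq> W \<Longrightarrow> W \<subseteq> forms N \<Longrightarrow> bipoly.dim V \<le> bipoly.dim W"
  using bipoly.dim_mono_in_span[of V W "mono_form N ` {..N}"] unfolding span_mono_form by blast

lemma subspace_eq_forms: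
  "V \<subseteq> W \<Longrightarrow> W \<subseteq> forms N \<Longrightarrow> bipoly.subspace V \<Longrightarrow> bipoly.dim W \<le> bipoly.dim V \<Longrightarrow> V = W"
  using bipoly.subspace_eq_of_dim_le[of V W "mono_form N ` {..N}"] unfolding span_mono_form by blast

lemma finite_independent_forms: "bipoly.independent A \<Longrightarrow> A \<subseteq> forms N \<Longrightarrow> finite A"
  using bipoly.finite_independent_in_span[of A "mono_form N ` {..N}"] unfolding span_mono_form by blast

section \<open>Sequences annihilated by products of linear forms\<close>

text \<open>
  The polynomial \<open>p\<close> with its indeterminate acting as the shift of sequences.
\<close>
definition act :: "complex poly \<Rightarrow> (nat \<Rightarrow> complex) \<Rightarrow> nat \<Rightarrow> complex" where
  "act p a m = (\<Sum>k\<le>degree p. coeff p k * a (k + m))"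

text \<open>
  Here \<open>s\<close> is the formal degree of \<open>p\<close>, so a drop in degree is a root at infinity. Only the
  entries \<open>a 0, \<dots>, a d\<close> matter. When they come from a form of degree \<open>d\<close>, this says that the
  operator with polynomial \<open>p\<close> and degree \<open>s\<close> kills the form.
\<close>
definition annih :: "nat \<Rightarrow> nat \<Rightarrow> complex poly \<Rightarrow> (nat \<Rightarrow> complex) \<Rightarrow> bool" where
  "annih d s p a \<longleftrightarrow> (\<forall>m. m + s \<le> d \<longrightarrow> act p a m = 0)"

text \<open>
  The linear form \<open>a x + b y\<close> for \<open>v = (a, b)\<close>. For \<open>v = (1, 0)\<close> it is the constant \<open>1\<close>, the form
  with its root at infinity, which still counts as a factor of degree one.
\<close>
definition lin :: "complex \<times> complex \<Rightarrow> complex poly" where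
  "lin v = [:fst v, snd v:]"

lemma lin_eq_0_iff [simp]: "lin v = 0 \<longleftrightarrow> v = 0"
  by (cases v) (auto simp: lin_def zero_prod_def)

lemma degree_lin: "degree (lin v) \<le> 1" by (simp add: lin_def)

lemma degree_prod_lin: "degree (\<Prod>i\<in>A. lin (v i)) \<le> card A"
proof (cases "finite A")
  case True
  have "degree (\<Prod>i\<in>A. lin (v i)) \<le> (\<Sum>i\<in>A. degree (lin (v i)))"
    using degree_prod_sum_le[OF True] by (simp add: comp_def)
  also have "\<dots> \<le> (\<Sum>i\<in>A. 1)" by (intro sum_mono degree_lin)
  finally show ?thesis by simp
qed simp

lemma act_bound: "degree p \<le> n \<Longrightarrow> act p a m = (\<Sum>k\<le>n. coeff p k * a (k + m))"
  unfolding act_def by (rule sum.mono_neutral_left) (auto simp: coeff_eq_0)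

lemma act_0 [simp]: "act 0 a m = 0" by (simp add: act_def)

lemma act_pCons: "act (pCons c p) a m = c * a m + act p a (Suc m)"
proof -
  have "act (pCons c p) a m = (\<Sum>k\<le>Suc (degree p). coeff (pCons c p) k * a (k + m))"
    by (rule act_bound) (simp add: degree_pCons_le)
  also have "\<dots> = c * a m + act p a (Suc m)"
    unfolding sum.atMost_Suc_shift by (simp add: act_def)
  finally show ?thesis .
qed

lemma act_1 [simp]: "act 1 a = a" by (rule ext) (simp add: one_pCons act_pCons)

lemma act_add: "act (p + q) a m = act p a m + act q a m"
proof -
  let ?n = "max (degree p) (degree q)"
  have "act (p + q) a m = (\<Sum>k\<le>?n. coeff (p + q) k * a (k + m))"
    by (rule act_bound) (rule degree_add_le_max)
  moreover have "act p a m = (\<Sum>k\<le>?n. coeff p k * a (k + m))" "act q a m = (\<Sum>k\<le>?n. coeff q k * a (k + m))"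
    by (rule act_bound, simp)+
  ultimately show ?thesis by (simp add: sum.distrib algebra_simps)
qed

lemma act_smult: "act (smult c p) a m = c * act p a m"
  by (cases "c = 0") (simp_all add: act_def sum_distrib_left algebra_simps)

lemma act_seq_add: "act p (\<lambda>m. a m + b m) m = act p a m + act p b m"
  by (simp add: act_def sum.distrib algebra_simps)

lemma act_seq_scale: "act p (\<lambda>m. c * a m) m = c * act p a m"
  by (simp add: act_def sum_distrib_left algebra_simps)

lemma act_seq_sum: "finite I \<Longrightarrow> act p (\<lambda>m. \<Sum>i\<in>I. a i m) m = (\<Sum>i\<in>I. act p (a i) m)"
  by (induction I rule: finite_induct) (simp_all add: act_def sum.distrib algebra_simps)

lemma act_mult: "act (p * q) a = act p (act q a)"
proof (induction p arbitrary: a rule: pCons_induct)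
  case 0
  then show ?case by (auto simp: fun_eq_iff)
next
  case (pCons c p)
  have "act (pCons c p * q) a m = act (pCons c p) (act q a) m" for m
    using fun_cong[OF pCons(2), of a "Suc m"]
    by (simp add: act_add act_smult act_pCons)
  then show ?case by blast
qed

lemma act_lin: "act (lin v) a m = fst v * a m + snd v * a (Suc m)"
  by (simp add: lin_def act_pCons)

lemma act_monom: "act (monom 1 k) a m = a (k + m)"
proof -
  have "act (monom 1 k) a m = (\<Sum>i\<le>k. coeff (monom 1 k) i * a (i + m))"
    by (rule act_bound) (simp add: degree_monom_le)
  also have "\<dots> = (\<Sum>i\<le>k. if i = k then a (i + m) else 0)" by (intro sum.cong) auto
  finally show ?thesis by simp
qed

lemma act_zero_range:
  assumes "degree p \<le> s" "\<And>k. k \<le> M \<Longrightarrow> a k = 0" "m + s \<le> M"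
  shows "act p a m = 0"
  unfolding act_bound[OF assms(1)] using assms by (intro sum.neutral) auto

lemma annih_mult:
  assumes "annih d s p a" "degree q \<le> t"
  shows "annih d (s + t) (q * p) a"
  unfolding annih_def act_mult
proof safe
  fix m assume m: "m + (s + t) \<le> d"
  show "act q (act p a) m = 0"
    by (rule act_zero_range[OF assms(2), of "d - s"]) (use assms(1) m in \<open>auto simp: annih_def\<close>)
qed

text \<open>
  A linear recurrence of order one determines a sequence up to a scalar: it is geometric, or
  concentrated at the last index \<open>M\<close> when the root of the linear form is at infinity.
\<close>
lemma kernel_of_linear_form:
  assumes "v \<noteq> 0" "\<And>m. m < M \<Longrightarrow> act (lin v) a m = 0"
  shows "\<exists>x y c. (x, y) \<noteq> (0::complex, 0::complex) \<and> fst v * y + snd v * x = 0 \<and> (y = 1 \<or> (x = 1 \<and> y = 0)) \<and>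
           (\<forall>m\<le>M. a m = c * (x ^ m * y ^ (M - m)))"
proof (cases "snd v = 0")
  case True
  then have f: "fst v \<noteq> 0" using assms(1) by (cases v) (auto simp: zero_prod_def)
  have "\<And>m. m < M \<Longrightarrow> a m = 0" using assms(2) f True by (simp add: act_lin)
  then have "a m = a M * (1 ^ m * 0 ^ (M - m))" if "m \<le> M" for m
    using that by (cases "m = M") simp_all
  note am = this
  show ?thesis
    by (rule exI[of _ 1], rule exI[of _ 0], rule exI[of _ "a M"], intro conjI allI impI am)
       (use True in simp_all)
next
  case False
  define r where "r = - fst v / snd v"
  have st: "a (Suc m) = r * a m" if "m < M" for m
    using assms(2)[OF that] False by (simp add: act_lin r_def field_simps eq_neg_iff_add_eq_0)
  have am: "m \<le> M \<Longrightarrow> a m = a 0 * (r ^ m * 1 ^ (M - m))" for m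
    by (induction m) (simp_all add: st)
  show ?thesis
    by (rule exI[of _ r], rule exI[of _ 1], rule exI[of _ "a 0"], intro conjI allI impI am)
       (use False in \<open>simp_all add: r_def\<close>)
qed

text \<open>
  The value at \<open>(x, y)\<close> of the binary form of degree \<open>D\<close> with polynomial \<open>p\<close>.
\<close>
definition hom_eval :: "nat \<Rightarrow> complex poly \<Rightarrow> complex \<Rightarrow> complex \<Rightarrow> complex" where
  "hom_eval D p x y = (\<Sum>k\<le>D. coeff p k * x ^ k * y ^ (D - k))"

lemma hom_eval_1: "degree p \<le> D \<Longrightarrow> hom_eval D p x 1 = poly p x"
  unfolding hom_eval_def poly_altdef
  by (simp, rule sum.mono_neutral_right) (auto simp: coeff_eq_0)

lemma hom_eval_inf: "hom_eval D p 1 0 = coeff p D"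
proof -
  have "hom_eval D p 1 0 = (\<Sum>k\<le>D. if k = D then coeff p k else 0)"
    unfolding hom_eval_def by (intro sum.cong) (auto simp: power_0_left)
  then show ?thesis by simp
qed

text \<open>
  The shift acts on the sequence \<open>x\<^sup>m y\<^sup>M\<^sup>-\<^sup>m\<close> as multiplication by \<open>x / y\<close>, so an operator acts
  through its value at \<open>(x, y)\<close>. Index \<open>0\<close> serves for \<open>y \<noteq> 0\<close>, the last index for \<open>x \<noteq> 0\<close>.
\<close>
lemma act_evaluation_eq_0:
  assumes "degree q \<le> D" "D \<le> M" "\<And>m. m + D \<le> M \<Longrightarrow> act q (\<lambda>m. x ^ m * y ^ (M - m)) m = 0"
    and "(x, y) \<noteq> (0, 0)"
  shows "hom_eval D q x y = 0"
proof -
  have "act q (\<lambda>m. x ^ m * y ^ (M - m)) m = x ^ m * y ^ (M - D - m) * hom_eval D q x y" if "m + D \<le> M" for m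
  proof -
    have "x ^ (k + m) * y ^ (M - (k + m)) = x ^ m * y ^ (M - D - m) * (x ^ k * y ^ (D - k))" if "k \<le> D" for k
    proof -
      have "M - (k + m) = (M - D - m) + (D - k)" using that \<open>m + D \<le> M\<close> by simp
      then show ?thesis by (simp add: power_add)
    qed
    then show ?thesis unfolding act_bound[OF assms(1)] hom_eval_def sum_distrib_left
      by (intro sum.cong) auto
  qed
  from this[of 0] this[of "M - D"] show ?thesis using assms by auto
qed

lemma linear_factor_exists:
  assumes "p \<noteq> 0" "degree p \<le> Suc D"
  obtains v q where "v \<noteq> 0" "p = lin v * q" "degree q \<le> D" "q \<noteq> 0"
proof (cases "degree p \<le> D")
  case True
  show ?thesis
    by (rule that[of "(1,0)" p]) (use True assms in \<open>auto simp: lin_def zero_prod_def one_pCons[symmetric]\<close>)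
next
  case False
  then have "\<not> constant (poly p)" using assms by (simp add: constant_degree)
  then obtain r where "poly p r = 0" using fundamental_theorem_of_algebra by blast
  then obtain q where q: "p = [:- r, 1:] * q" unfolding poly_eq_0_iff_dvd by (elim dvdE)
  then have "q \<noteq> 0" using assms by auto
  moreover from this have "degree p = Suc (degree q)" unfolding q by (subst degree_mult_eq) auto
  ultimately show ?thesis using assms q
    by (intro that[of "(- r, 1)" q]) (auto simp: lin_def zero_prod_def)
qed

lemma linear_factorization:
  assumes "p \<noteq> 0" "degree p \<le> Suc D"
  shows "\<exists>v. (\<forall>i<Suc D. v i \<noteq> 0) \<and> p = (\<Prod>i<Suc D. lin (v i))"
  using assms
proof (induction D arbitrary: p)
  case 0
  then have "p = lin (coeff p 0, coeff p 1)"
    by (intro poly_eqI) (auto simp: lin_def coeff_pCons coeff_eq_0 split: nat.split)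
  then show ?case using 0 by (intro exI[of _ "\<lambda>_. (coeff p 0, coeff p 1)"]) (metis lin_eq_0_iff lessThan_Suc lessThan_0 prod.insert finite.emptyI empty_iff prod.empty mult.right_neutral)
next
  case (Suc D)
  obtain w q where w: "w \<noteq> 0" "p = lin w * q" "degree q \<le> Suc D" "q \<noteq> 0"
    using linear_factor_exists[OF Suc(2,3)] by blast
  obtain v where v: "\<forall>i<Suc D. v i \<noteq> 0" "q = (\<Prod>i<Suc D. lin (v i))" using Suc(1)[OF w(4,3)] by blast
  have "(\<Prod>i<Suc D. lin ((v(Suc D := w)) i)) = (\<Prod>i<Suc D. lin (v i))" by (rule prod.cong) auto
  then have "p = (\<Prod>i<Suc (Suc D). lin ((v(Suc D := w)) i))"
    unfolding prod.lessThan_Suc[of _ "Suc D"] w(2) v(2) by (simp add: mult.commute)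
  then show ?case using v(1) w(1) by (intro exI[of _ "v(Suc D := w)"]) (auto simp: less_Suc_eq)
qed

text \<open>
  Remove one factor \<open>l\<close> and apply the statement to \<open>l(a)\<close>, which is killed by the remaining
  factors. If \<open>l\<close> divides \<open>p\<close>, then the quotient kills \<open>l(a)\<close>; this drops both degrees by one, and
  \<open>l\<close> is put back at the end. Otherwise \<open>p\<close> still kills \<open>l(a)\<close> and induction gives a product \<open>Q\<close>
  of at most \<open>e\<close> remaining factors that kills \<open>l(a)\<close>. Now \<open>Q(a)\<close> is killed by \<open>l\<close>, so it is a
  multiple of the evaluation sequence at the root of \<open>l\<close>. It is also killed by \<open>p\<close>, which does not
  vanish at that root. Hence \<open>Q(a) = 0\<close>, and \<open>Q\<close> alone kills \<open>a\<close>. The bound on \<open>d\<close> ensures that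
  \<open>Q(a)\<close> is long enough for \<open>p\<close> to act on it.
\<close>
lemma annihilating_subproduct:
  fixes v :: "'i \<Rightarrow> complex \<times> complex"
  assumes "finite A" "\<And>i. i \<in> A \<Longrightarrow> v i \<noteq> 0" "p \<noteq> 0" "degree p \<le> e" "e + card A \<le> d"
    "annih d e p a" "annih d (card A) (\<Prod>i\<in>A. lin (v i)) a"
  shows "\<exists>B\<subseteq>A. card B \<le> e \<and> annih d (card B) (\<Prod>i\<in>B. lin (v i)) a"
  using assms
proof (induction A arbitrary: p e d a rule: finite_induct)
  case empty
  then show ?case by (intro exI[of _ "{}"]) auto
next
  case (insert i A)
  let ?l = "lin (v i)"
  let ?b = "act ?l a"
  have cA: "card (insert i A) = Suc (card A)" using insert by simp
  then have d1: "1 \<le> d" using insert.prems(4) by simp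
  have annA: "annih (d - 1) (card A) (\<Prod>i\<in>A. lin (v i)) ?b"
    unfolding annih_def
  proof safe
    fix m assume "m + card A \<le> d - 1"
    then have "m + card (insert i A) \<le> d" using cA d1 by simp
    then have "act (\<Prod>i\<in>insert i A. lin (v i)) a m = 0" using insert.prems(6) unfolding annih_def by blast
    then show "act (\<Prod>i\<in>A. lin (v i)) ?b m = 0" using insert.hyps
      by (simp add: act_mult[symmetric] mult.commute)
  qed
  have lift: "annih d (Suc (card B)) (\<Prod>i\<in>insert i B. lin (v i)) a"
    if B: "B \<subseteq> A" "annih (d - 1) (card B) (\<Prod>i\<in>B. lin (v i)) ?b" for B
  proof -
    have "finite B" "i \<notin> B" using B insert.hyps finite_subset by auto
    then have "(\<Prod>i\<in>insert i B. lin (v i)) = (\<Prod>i\<in>B. lin (v i)) * ?l" by (simp add: mult.commute)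
    then show ?thesis using B(2) unfolding annih_def by (auto simp: act_mult)
  qed
  show ?case
  \<comment> \<open>divisibility as forms of degree \<open>e\<close>: if \<open>l\<close> has its root at infinity, the quotient is \<open>p\<close>
     itself with smaller formal degree\<close>
  proof (cases "\<exists>q. p = ?l * q \<and> q \<noteq> 0 \<and> Suc (degree q) \<le> e")
    case True
    then obtain q where "p = ?l * q" "q \<noteq> 0" "Suc (degree q) \<le> e" by blast
    then have q: "p = ?l * q" "q \<noteq> 0" "degree q \<le> e - 1" "1 \<le> e" by simp_all
    have "annih (d - 1) (e - 1) q ?b" unfolding annih_def
    proof safe
      fix m assume "m + (e - 1) \<le> d - 1"
      then have "m + e \<le> d" using q(4) d1 by simp
      then have "act p a m = 0" using insert.prems(5) by (simp add: annih_def)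
      then show "act q ?b m = 0" by (simp add: q(1) act_mult[symmetric] mult.commute)
    qed
    then have "\<exists>B\<subseteq>A. card B \<le> e - 1 \<and> annih (d - 1) (card B) (\<Prod>i\<in>B. lin (v i)) ?b"
      using insert.prems(1,4) q annA cA by (intro insert.IH[of q]) auto
    then obtain B where B: "B \<subseteq> A" "card B \<le> e - 1" "annih (d - 1) (card B) (\<Prod>i\<in>B. lin (v i)) ?b"
      by blast
    have "finite B" "i \<notin> B" using B insert.hyps finite_subset by auto
    then show ?thesis using lift[OF B(1) B(3)] B(1,2) q(4)
      by (intro exI[of _ "insert i B"]) (simp add: subset_insertI2)
  next
    case False
    have annb: "annih (d - 1) e p ?b" unfolding annih_def
    proof safe
      fix m assume "m + e \<le> d - 1"
      then have "act p a m = 0" "act p a (Suc m) = 0" using insert.prems(5) d1 by (auto simp: annih_def)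
      then have "act ?l (act p a) m = 0" by (simp add: act_lin)
      then show "act p ?b m = 0" by (simp add: act_mult[symmetric] mult.commute)
    qed
    then have "\<exists>B\<subseteq>A. card B \<le> e \<and> annih (d - 1) (card B) (\<Prod>i\<in>B. lin (v i)) ?b"
      using insert.prems(1-4) annA cA by (intro insert.IH[of p]) auto
    then obtain B where B: "B \<subseteq> A" "card B \<le> e" "annih (d - 1) (card B) (\<Prod>i\<in>B. lin (v i)) ?b"
      by blast
    have fB: "finite B" "i \<notin> B" using B insert.hyps finite_subset by auto
    have cB: "card B \<le> card A" using B insert.hyps card_mono by blast
    define g where "g = act (\<Prod>i\<in>B. lin (v i)) a"
    define M where "M = d - card B"
    have eM: "e \<le> M" using cB insert.prems(4) cA by (simp add: M_def)
    have lg: "act ?l g m = 0" if "m < M" for m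
    proof -
      have "act (\<Prod>i\<in>B. lin (v i)) ?b m = 0" using B(3) that by (auto simp: annih_def M_def)
      then show ?thesis by (simp add: g_def act_mult[symmetric] mult.commute)
    qed
    have pg: "act p g m = 0" if "m + e \<le> M" for m
    proof -
      have "annih d (e + card B) ((\<Prod>i\<in>B. lin (v i)) * p) a"
        by (rule annih_mult[OF insert.prems(5) degree_prod_lin])
      then have "act ((\<Prod>i\<in>B. lin (v i)) * p) a m = 0"
        using that eM cB insert.prems(4) cA by (auto simp: annih_def M_def)
      then show ?thesis by (simp add: g_def act_mult[symmetric] mult.commute)
    qed
    \<comment> \<open>the geometric sequence attached to the root \<open>(x, y)\<close> of \<open>l\<close>\<close>
    obtain x y c where xy: "(x, y) \<noteq> (0, 0)" "fst (v i) * y + snd (v i) * x = 0" "y = 1 \<or> (x = 1 \<and> y = 0)"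
      "\<forall>m\<le>M. g m = c * (x ^ m * y ^ (M - m))"
      using kernel_of_linear_form[OF insert.prems(1)[of i] lg] by blast
    have "c = 0"
    proof (rule ccontr)
      assume c: "c \<noteq> 0"
      have "act p (\<lambda>m. x ^ m * y ^ (M - m)) m = 0" if "m + e \<le> M" for m
      proof -
        have "c * act p (\<lambda>m. x ^ m * y ^ (M - m)) m = act p g m"
          unfolding act_bound[OF insert.prems(3)] sum_distrib_left
          using that xy(4) by (intro sum.cong) auto
        then show ?thesis using pg[OF that] c by simp
      qed
      then have h0: "hom_eval e p x y = 0" using act_evaluation_eq_0[OF insert.prems(3) eM] xy(1) by blast
      show False
      proof (cases "y = 1")
        case True
        then have "poly p x = 0" using h0 hom_eval_1 insert.prems(3) by simp
        then obtain q where q: "p = [:- x, 1:] * q" unfolding poly_eq_0_iff_dvd by (elim dvdE)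
        have q0: "q \<noteq> 0" using q insert.prems(2) by auto
        have s: "fst (v i) = - snd (v i) * x" using xy(2) True by (simp add: eq_neg_iff_add_eq_0)
        then have s0: "snd (v i) \<noteq> 0" using insert.prems(1)[of i] by (cases "v i") (auto simp: zero_prod_def)
        have "?l = smult (snd (v i)) [:- x, 1:]" using s by (simp add: lin_def)
        then have "?l * smult (inverse (snd (v i))) q = smult (snd (v i) * inverse (snd (v i))) p"
          unfolding q by (simp only: mult_smult_left mult_smult_right smult_smult mult.commute[of "snd (v i)"])
        then have "p = ?l * smult (inverse (snd (v i))) q" using s0 by simp
        moreover have "degree p = Suc (degree q)" using q0 unfolding q by (subst degree_mult_eq) auto
        ultimately show False using False s0 q0 insert.prems(3)
          by (metis Suc_le_eq degree_smult_eq inverse_nonzero_iff_nonzero smult_eq_0_iff less_eq_Suc_le)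
      next
        case y: False
        then have xy1: "x = 1" "y = 0" using xy(3) by auto
        then have "coeff p e = 0" using h0 hom_eval_inf by simp
        then have de: "Suc (degree p) \<le> e" using insert.prems(2,3)
          by (metis Suc_leI le_neq_implies_less leading_coeff_0_iff)
        have s0: "snd (v i) = 0" using xy(2) xy1 by simp
        then have f0: "fst (v i) \<noteq> 0" using insert.prems(1)[of i] by (cases "v i") (auto simp: zero_prod_def)
        have "p = ?l * smult (inverse (fst (v i))) p" using s0 f0 by (simp add: lin_def)
        then show False using False de f0 insert.prems(2)
          by (metis degree_smult_eq inverse_nonzero_iff_nonzero smult_eq_0_iff)
      qed
    qed
    then have "annih d (card B) (\<Prod>i\<in>B. lin (v i)) a" using xy(4) unfolding annih_def M_def g_def by auto
    then show ?thesis using B by (intro exI[of _ B]) auto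
  qed
qed

text \<open>
  A sequence killed by a form generates an evaluation sequence at one of the roots of that form:
  peel off linear factors one by one until the next factor kills everything. At most \<open>D - 1\<close>
  factors are peeled off, which is the bound on the loss \<open>E - M\<close> of length.
\<close>
lemma annihilator_root:
  assumes "p \<noteq> 0" "degree p \<le> D" "annih E D p a" "k \<le> E" "a k \<noteq> 0"
  shows "\<exists>x y s M. (x, y) \<noteq> (0::complex, 0::complex) \<and> hom_eval D p x y = 0 \<and> (y = 1 \<or> (x = 1 \<and> y = 0)) \<and> M \<le> E \<and> degree s \<le> E - M \<and> E < M + D \<and>
           (\<forall>m\<le>M. act s a m = x ^ m * y ^ (M - m))"
  using assms
proof (induction D arbitrary: p E a k)
  case 0
  then obtain c where c: "p = [:c:]" "c \<noteq> 0" by (metis degree_eq_zeroE le_zero_eq pCons_0_0)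
  then have "act p a k = c * a k" by (simp add: act_pCons)
  then show ?case using 0 c by (auto simp: annih_def)
next
  case (Suc D)
  obtain v q where v: "v \<noteq> 0" "p = lin v * q" "degree q \<le> D" "q \<noteq> 0"
    using linear_factor_exists[OF Suc(2,3)] by blast
  have lift: "hom_eval (Suc D) p x y = (fst v * y + snd v * x) * hom_eval D q x y" if "y = 1 \<or> (x = 1 \<and> y = 0)" for x y
    using that
  proof
    assume y: "y = 1"
    show ?thesis using hom_eval_1[OF Suc(3)] hom_eval_1[OF v(3)] unfolding y v(2) by (simp add: lin_def algebra_simps)
  next
    assume "x = 1 \<and> y = 0"
    then show ?thesis using v(3) by (simp add: hom_eval_inf v(2) lin_def coeff_eq_0)
  qed
  let ?b = "act (lin v) a"
  show ?case
  proof (cases "\<exists>m<E. ?b m \<noteq> 0")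
    case False
    then obtain x y c where xy: "(x, y) \<noteq> (0, 0)" "fst v * y + snd v * x = 0" "y = 1 \<or> (x = 1 \<and> y = 0)"
      "\<forall>m\<le>E. a m = c * (x ^ m * y ^ (E - m))"
      using kernel_of_linear_form[OF v(1), of E a] by blast
    have "c \<noteq> 0" using xy(4) Suc(5,6) by auto
    then show ?thesis using xy lift[OF xy(3)]
      by (intro exI[of _ x] exI[of _ y] exI[of _ "[:1 / c:]"] exI[of _ E]) (auto simp: act_pCons)
  next
    case True
    then obtain m where m: "m \<le> E - 1" "?b m \<noteq> 0" "1 \<le> E" by (auto simp: Suc_le_eq) (metis Suc_leI Suc_pred gr_zeroI not_less_zero less_Suc_eq_le)
    have annb: "annih (E - 1) D q ?b" using Suc(4) m(3) unfolding annih_def v(2)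
      by (auto simp: act_mult[symmetric] mult.commute)
    then obtain x y s M where xy: "(x, y) \<noteq> (0, 0)" "hom_eval D q x y = 0" "y = 1 \<or> (x = 1 \<and> y = 0)" "M \<le> E - 1"
      "degree s \<le> E - 1 - M" "E - 1 < M + D" "\<forall>m\<le>M. act s ?b m = x ^ m * y ^ (M - m)"
      using Suc(1)[OF v(4,3) annb m(1,2)] by blast
    have "degree (s * lin v) \<le> E - M"
      using degree_mult_le[of s "lin v"] degree_lin[of v] xy(4,5) m(3) by linarith
    moreover have "act (s * lin v) a = act s ?b" by (rule act_mult)
    moreover have "M \<le> E" "E < M + Suc D" using xy(4,6) m(3) by linarith+
    ultimately show ?thesis using xy(1,2,3,7) lift[OF xy(3)]
      by (intro exI[of _ x] exI[of _ y] exI[of _ "s * lin v"] exI[of _ M]) simp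
  qed
qed

text \<open>
  A projective Nullstellensatz in one variable. The assumption says that in no degree \<open>E\<close> the
  multiples of the forms in \<open>Q\<close> span all forms.

  The finitely many roots of one nonzero form \<open>p\<close> in \<open>Q\<close> are candidates. If none is a common root,
  choose for each root a form that does not vanish there. In large degree the sequence killed by
  all of them generates the evaluation sequence at some root of \<open>p\<close>, and the form chosen for this
  root does not kill it.
\<close>
lemma common_root_of_annihilators:
  fixes Q :: "(nat \<times> complex poly) set"
  assumes deg: "\<And>D q. (D, q) \<in> Q \<Longrightarrow> degree q \<le> D"
    and annih: "\<And>E. \<exists>a. (\<exists>k\<le>E. a k \<noteq> 0) \<and> (\<forall>(D, q)\<in>Q. D \<le> E \<longrightarrow> annih E D q a)"
  shows "\<exists>x y. (x, y) \<noteq> (0, 0) \<and> (\<forall>(D, q)\<in>Q. hom_eval D q x y = 0)"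
proof (cases "\<exists>(D, p)\<in>Q. p \<noteq> 0")
  case False
  then show ?thesis by (intro exI[of _ 1] exI[of _ 0]) (auto simp: hom_eval_def)
next
  case True
  then obtain D p where p: "(D, p) \<in> Q" "p \<noteq> 0" by auto
  show ?thesis
  proof (rule ccontr)
    assume no: "\<not> ?thesis"
    define R :: "(complex \<times> complex) set" where "R = insert (1, 0) ((\<lambda>r. (r, 1)) ` {r. poly p r = 0})"
    have fR: "finite R" unfolding R_def using poly_roots_finite[OF p(2)] by simp
    have "\<forall>z\<in>R. \<exists>w\<in>Q. hom_eval (fst w) (snd w) (fst z) (snd z) \<noteq> 0"
    proof
      fix z assume "z \<in> R"
      then have "(fst z, snd z) \<noteq> (0, 0)" by (auto simp: R_def)
      then show "\<exists>w\<in>Q. hom_eval (fst w) (snd w) (fst z) (snd z) \<noteq> 0" using no by fastforce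
    qed
    then obtain w where w: "\<And>z. z \<in> R \<Longrightarrow> w z \<in> Q \<and> hom_eval (fst (w z)) (snd (w z)) (fst z) (snd z) \<noteq> 0"
      by metis
    \<comment> \<open>large enough that after losing at most \<open>D - 1\<close> entries the sequence still has room for
       every chosen form\<close>
    define E where "E = D + (\<Sum>z\<in>R. fst (w z))"
    have bd: "fst (w z) \<le> E - D" if "z \<in> R" for z
      using member_le_sum[OF that, of "\<lambda>z. fst (w z)"] fR by (simp add: E_def)
    obtain a k where a: "k \<le> E" "a k \<noteq> 0" "\<forall>(D, q)\<in>Q. D \<le> E \<longrightarrow> annih E D q a" using annih by blast
    have annp: "annih E D p a" using a(3) p(1) by (auto simp: E_def)
    obtain x y s M where xy: "(x, y) \<noteq> (0, 0)" "hom_eval D p x y = 0" "y = 1 \<or> (x = 1 \<and> y = 0)" "M \<le> E"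
      "degree s \<le> E - M" "E < M + D" "\<forall>m\<le>M. act s a m = x ^ m * y ^ (M - m)"
      using annihilator_root[OF p(2) deg[OF p(1)] annp a(1,2)] by blast
    have zR: "(x, y) \<in> R"
      using xy(2,3) hom_eval_1[OF deg[OF p(1)], of x] by (auto simp: R_def)
    obtain D' q where q: "w (x, y) = (D', q)" by fastforce
    have qQ: "(D', q) \<in> Q" "hom_eval D' q x y \<noteq> 0" using w[OF zR] q by auto
    have D': "D' \<le> M" using bd[OF zR] q xy(6) by simp
    have annq: "annih E D' q a" using a(3) qQ(1) D' xy(4) by auto
    have "act q (\<lambda>m. x ^ m * y ^ (M - m)) m = 0" if m: "m + D' \<le> M" for m
    proof -
      have "act q (\<lambda>m. x ^ m * y ^ (M - m)) m = act q (act s a) m"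
        unfolding act_bound[OF deg[OF qQ(1)]] using m xy(7) by (intro sum.cong) auto
      also have "\<dots> = act (s * q) a m" by (simp add: act_mult[symmetric] mult.commute)
      also have "\<dots> = 0" using annih_mult[OF annq xy(5)] m xy(4) unfolding annih_def by auto
      finally show ?thesis .
    qed
    then show False using act_evaluation_eq_0[OF deg[OF qQ(1)] D' _ xy(1)] qQ(2) by blast
  qed
qed

text \<open>
  Solve the recurrence; if the root of the linear form is at infinity, it is division by a
  constant.
\<close>
lemma act_lin_surj: assumes "v \<noteq> 0" shows "\<exists>a. act (lin v) a = b"
proof (cases "snd v = 0")
  case True
  then have "fst v \<noteq> 0" using assms by (cases v) (auto simp: zero_prod_def)
  then show ?thesis using True by (intro exI[of _ "\<lambda>m. b m / fst v"]) (auto simp: act_lin fun_eq_iff)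
next
  case False
  define a where "a = rec_nat 0 (\<lambda>m x. (b m - fst v * x) / snd v)"
  have "act (lin v) a m = b m" for m using False by (simp add: act_lin a_def)
  then show ?thesis by blast
qed

lemma act_prod_surj:
  assumes "finite A" "\<And>i. i \<in> A \<Longrightarrow> v i \<noteq> 0"
  shows "\<exists>a. act (\<Prod>i\<in>A. lin (v i)) a = b"
  using assms
proof (induction A arbitrary: b rule: finite_induct)
  case empty
  then show ?case by auto
next
  case (insert i A)
  obtain c where c: "act (lin (v i)) c = b" using act_lin_surj insert by blast
  obtain a where "act (\<Prod>i\<in>A. lin (v i)) a = c" using insert by blast
  then show ?case using c insert by (intro exI[of _ a]) (simp add: act_mult)
qed

text \<open>
  A sequence killed by the whole product but not by the product without the factor \<open>i\<close>: pull the
  evaluation sequence at the root of factor \<open>i\<close> back along the other factors, which act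
  surjectively.
\<close>
lemma exactly_annihilated_sequence:
  fixes v :: "'i \<Rightarrow> complex \<times> complex"
  assumes "finite A" "\<And>i. i \<in> A \<Longrightarrow> v i \<noteq> 0" "i \<in> A" "card A \<le> d"
  shows "\<exists>a m. annih d (card A) (\<Prod>i\<in>A. lin (v i)) a \<and> m + (card A - 1) \<le> d \<and> act (\<Prod>i\<in>A-{i}. lin (v i)) a m \<noteq> 0"
proof -
  define M where "M = d - (card A - 1)"
  have cA: "1 \<le> card A" using assms by (metis One_nat_def Suc_leI card_gt_0_iff empty_iff)
  define b where "b m = (if snd (v i) = 0 then (if m = M then 1 else 0) else (- fst (v i) / snd (v i)) ^ m)" for m
  obtain a where a: "act (\<Prod>i\<in>A-{i}. lin (v i)) a = b" using act_prod_surj[of "A - {i}" v b] assms by auto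
  have lb: "act (lin (v i)) b m = 0" if "m < M" for m
    using that by (auto simp: act_lin b_def)
  have "(\<Prod>i\<in>A. lin (v i)) = lin (v i) * (\<Prod>i\<in>A-{i}. lin (v i))"
    using assms by (simp add: prod.remove)
  then have "annih d (card A) (\<Prod>i\<in>A. lin (v i)) a"
    unfolding annih_def act_mult a using lb cA by (auto simp: act_mult a M_def)
  moreover obtain m where "m \<le> M" "b m \<noteq> 0"
    using that[of "if snd (v i) = 0 then M else 0"] by (simp add: b_def split: if_splits)
  moreover from this have "m + (card A - 1) \<le> d" using assms(4) cA by (simp add: M_def)
  ultimately show ?thesis unfolding a[symmetric] by blast
qed

text \<open>
  Add to \<open>f\<close>, with generic coefficients, sequences \<open>c i\<close> killed by the product but not by the
  product without factor \<open>i\<close>. If the sum were killed by a form of degree at most \<open>n\<close>, then by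
  \<open>annihilating_subproduct\<close> it would be killed by a product of at most \<open>n < s\<close> of the factors,
  hence by the product without some factor \<open>i\<close>. For each \<open>i\<close> that is one polynomial equation in
  \<open>t\<close>, and its coefficient at \<open>t\<^sup>i\<^sup>+\<^sup>1\<close> is nonzero by the choice of \<open>c i\<close>. Powers of one parameter
  are used because closures are tested on curves.
\<close>
lemma generic_perturbation:
  fixes v :: "nat \<Rightarrow> complex \<times> complex"
  assumes v: "\<And>i. i < s \<Longrightarrow> v i \<noteq> 0" and n: "n < s" "n + s \<le> d"
    and f: "annih d s (\<Prod>i<s. lin (v i)) f"
  shows "\<exists>c. finite {t. \<not> (annih d s (\<Prod>i<s. lin (v i)) (\<lambda>m. f m + (\<Sum>i<s. t ^ Suc i * c i m)) \<and>
           (\<forall>g. g \<noteq> 0 \<and> degree g \<le> n \<longrightarrow> \<not> annih d n g (\<lambda>m. f m + (\<Sum>i<s. t ^ Suc i * c i m))))}"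
proof -
  let ?A = "{..<s}"
  have "\<forall>i\<in>?A. \<exists>a m. annih d s (\<Prod>i<s. lin (v i)) a \<and> m + (s - 1) \<le> d \<and> act (\<Prod>i\<in>?A-{i}. lin (v i)) a m \<noteq> 0"
    using exactly_annihilated_sequence[of ?A v _ d] v n by auto
  then obtain c M where c: "\<And>i. i < s \<Longrightarrow> annih d s (\<Prod>i<s. lin (v i)) (c i)" 
    "\<And>i. i < s \<Longrightarrow> M i + (s - 1) \<le> d" "\<And>i. i < s \<Longrightarrow> act (\<Prod>i\<in>?A-{i}. lin (v i)) (c i) (M i) \<noteq> 0"
    by (metis lessThan_iff)
  let ?f = "\<lambda>t m. f m + (\<Sum>i<s. t ^ Suc i * c i m)"
  have actf: "act p (?f t) m = act p f m + (\<Sum>i<s. t ^ Suc i * act p (c i) m)" for p t m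
    by (simp add: act_seq_add act_seq_sum act_seq_scale del: power_Suc)
  have good: "annih d s (\<Prod>i<s. lin (v i)) (?f t)" for t
    using f c(1) unfolding annih_def actf by (auto intro!: sum.neutral)
  define P where "P i = pCons (act (\<Prod>i\<in>?A-{i}. lin (v i)) f (M i)) (\<Sum>k<s. monom (act (\<Prod>i\<in>?A-{i}. lin (v i)) (c k) (M i)) k)" for i
  have polyP: "poly (P i) t = act (\<Prod>i\<in>?A-{i}. lin (v i)) (?f t) (M i)" for i t
    unfolding actf P_def by (simp add: poly_sum poly_monom sum_distrib_left algebra_simps)
  have "P i \<noteq> 0" if "i < s" for i
  proof -
    have "coeff (P i) (Suc i) = act (\<Prod>i\<in>?A-{i}. lin (v i)) (c i) (M i)"
      unfolding P_def by (simp add: coeff_sum that)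
    then show ?thesis using c(3)[OF that] by auto
  qed
  then have fin: "finite (\<Union>i<s. {t. poly (P i) t = 0})" using poly_roots_finite by blast
  have "\<not> annih d n g (?f t)" if t: "\<forall>i<s. poly (P i) t \<noteq> 0" and g: "g \<noteq> 0" "degree g \<le> n" for t g
  proof
    assume "annih d n g (?f t)"
    then obtain B where B: "B \<subseteq> ?A" "card B \<le> n" "annih d (card B) (\<Prod>i\<in>B. lin (v i)) (?f t)"
      using annihilating_subproduct[of ?A v g n d "?f t"] g v n good[of t] by auto
    have fB: "finite B" using B(1) finite_subset by blast
    have "B \<noteq> ?A" using B(2) n(1) by auto
    then obtain i where i: "i < s" "i \<notin> B" using B(1) by auto
    let ?C = "?A - {i} - B"
    have un: "?A - {i} = ?C \<union> B" using B(1) i by auto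
    have "(\<Prod>i\<in>?A-{i}. lin (v i)) = (\<Prod>i\<in>?C. lin (v i)) * (\<Prod>i\<in>B. lin (v i))"
      using fB by (subst un, subst prod.union_disjoint) auto
    moreover have "s - 1 = card B + card ?C"
    proof -
      have "card (?A - {i}) = card ?C + card B" using fB by (subst un, subst card_Un_disjoint) auto
      then show ?thesis using i by simp
    qed
    ultimately have "annih d (s - 1) (\<Prod>i\<in>?A-{i}. lin (v i)) (?f t)"
      using annih_mult[OF B(3) degree_prod_lin[of v ?C]] by simp
    then have "act (\<Prod>i\<in>?A-{i}. lin (v i)) (?f t) (M i) = 0" using c(2)[OF i(1)] unfolding annih_def by blast
    then show False using t i(1) polyP by simp
  qed
  then have "{t. \<not> (annih d s (\<Prod>i<s. lin (v i)) (?f t) \<and> (\<forall>g. g \<noteq> 0 \<and> degree g \<le> n \<longrightarrow> \<not> annih d n g (?f t)))}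
     \<subseteq> (\<Union>i<s. {t. poly (P i) t = 0})" using good by fastforce
  then show ?thesis using fin finite_subset by blast
qed

section \<open>Determinants and linear dependence\<close>

lemma det_eq_0_iff_right:
  fixes M :: "nat \<Rightarrow> nat \<Rightarrow> complex"
  shows "det (mat k k (\<lambda>(i, c). M i c)) = 0 \<longleftrightarrow> (\<exists>u. (\<exists>c<k. u c \<noteq> 0) \<and> (\<forall>i<k. (\<Sum>c<k. M i c * u c) = 0))"
proof -
  let ?A = "mat k k (\<lambda>(i, c). M i c)"
  have ent: "(?A *\<^sub>v x) $ i = (\<Sum>c<k. M i c * x $ c)" if "i < k" "x \<in> carrier_vec k" for x i
    using that by (simp add: scalar_prod_def lessThan_atLeast0)
  show ?thesis unfolding det_0_iff_vec_prod_zero[of ?A k, simplified]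
  proof
    assume "\<exists>x. x \<in> carrier_vec k \<and> x \<noteq> 0\<^sub>v k \<and> ?A *\<^sub>v x = 0\<^sub>v k"
    then obtain x where x: "x \<in> carrier_vec k" "x \<noteq> 0\<^sub>v k" "?A *\<^sub>v x = 0\<^sub>v k" by blast
    have "\<exists>c<k. x $ c \<noteq> 0" using x(1,2) by (metis carrier_vecD eq_vecI index_zero_vec)
    moreover have "\<forall>i<k. (\<Sum>c<k. M i c * x $ c) = 0" using ent[OF _ x(1)] x(3) by (metis index_zero_vec(1))
    ultimately show "\<exists>u. (\<exists>c<k. u c \<noteq> 0) \<and> (\<forall>i<k. (\<Sum>c<k. M i c * u c) = 0)" by (intro exI[of _ "\<lambda>c. x $ c"]) blast
  next
    assume "\<exists>u. (\<exists>c<k. u c \<noteq> 0) \<and> (\<forall>i<k. (\<Sum>c<k. M i c * u c) = 0)"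
    then obtain u where u: "\<exists>c<k. u c \<noteq> 0" "\<forall>i<k. (\<Sum>c<k. M i c * u c) = 0" by blast
    let ?x = "vec k u"
    have "?x \<noteq> 0\<^sub>v k" using u(1) by (metis index_vec index_zero_vec(1))
    moreover have "?A *\<^sub>v ?x = 0\<^sub>v k"
    proof (rule eq_vecI)
      fix i assume i: "i < dim_vec (0\<^sub>v k)"
      then have "(?A *\<^sub>v ?x) $ i = (\<Sum>c<k. M i c * ?x $ c)" by (intro ent) auto
      also have "\<dots> = 0" using u(2) i by simp
      finally show "(?A *\<^sub>v ?x) $ i = 0\<^sub>v k $ i" using i by simp
    qed simp
    ultimately show "\<exists>x. x \<in> carrier_vec k \<and> x \<noteq> 0\<^sub>v k \<and> ?A *\<^sub>v x = 0\<^sub>v k" by (intro exI[of _ ?x]) auto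
  qed
qed

lemma det_eq_0_iff_left:
  fixes M :: "nat \<Rightarrow> nat \<Rightarrow> complex"
  shows "det (mat k k (\<lambda>(i, c). M i c)) = 0 \<longleftrightarrow> (\<exists>u. (\<exists>i<k. u i \<noteq> 0) \<and> (\<forall>c<k. (\<Sum>i<k. u i * M i c) = 0))"
proof -
  have "det (mat k k (\<lambda>(i, c). M i c)) = det (transpose_mat (mat k k (\<lambda>(i, c). M i c)))"
    by (rule det_transpose[symmetric]) auto
  also have "transpose_mat (mat k k (\<lambda>(i, c). M i c)) = mat k k (\<lambda>(i, c). M c i)"
    by (rule eq_matI) auto
  finally show ?thesis using det_eq_0_iff_right[of k "\<lambda>i c. M c i"] by (simp add: mult.commute)
qed

text \<open>
  If no nonzero functional on forms of degree \<open>E\<close> vanishes on \<open>S\<close>, then \<open>S\<close> spans, and a basis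
  taken from \<open>S\<close> is an invertible matrix of coefficients.
\<close>
lemma rows_with_nonzero_det:
  fixes S :: "complex poly set"
  assumes deg: "\<And>p. p \<in> S \<Longrightarrow> degree p \<le> E"
    and full: "\<And>a. (\<And>p. p \<in> S \<Longrightarrow> (\<Sum>k\<le>E. coeff p k * a k) = 0) \<Longrightarrow> \<forall>k\<le>E. a k = (0::complex)"
  shows "\<exists>rows. (\<forall>i<Suc E. rows i \<in> S) \<and> det (mat (Suc E) (Suc E) (\<lambda>(i, c). coeff (rows i) c)) \<noteq> 0"
proof -
  let ?S = "homog E ` S"
  have mS: "mono_form E k \<in> bipoly.span ?S" if k: "k \<le> E" for k
  proof (rule ccontr)
    assume "\<not> ?thesis"
    then obtain phi where phi: "Vector_Spaces.linear scale_form (*) phi"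
      "\<forall>s\<in>?S. phi s = 0" "phi (mono_form E k) = 1"
      using bipoly.functional_separating_exists by blast
    interpret phi: Vector_Spaces.linear scale_form "(*)" phi by (rule phi(1))
    have "(\<Sum>k\<le>E. coeff p k * phi (mono_form E k)) = 0" if p: "p \<in> S" for p
    proof -
      have "phi (homog E p) = phi (\<Sum>k\<le>E. smult [:coords E (homog E p) k:] (mono_form E k))"
        using forms_expand[OF homog_forms] by metis
      also have "\<dots> = (\<Sum>k\<le>E. coeff p k * phi (mono_form E k))"
        by (simp add: phi.sum phi.scale coords_homog)
      finally show ?thesis using phi(2) p by simp
    qed
    then show False using full[of "\<lambda>k. phi (mono_form E k)"] k phi(3) by auto
  qed
  obtain B where B: "B \<subseteq> ?S" "bipoly.independent B" "?S \<subseteq> bipoly.span B"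
    using bipoly.maximal_independent_subset by blast
  have "B \<subseteq> forms E" using B(1) by auto
  then have fB: "finite B" using finite_independent_forms B(2) by blast
  have "mono_form E ` {..E} \<subseteq> bipoly.span B" using mS B(3) bipoly.span_minimal[of ?S "bipoly.span B"] by auto
  then have "card (mono_form E ` {..E}) \<le> card B" using bipoly.independent_span_bound[OF fB independent_mono_form] by blast
  then have "Suc E \<le> card B" by (simp add: card_image[OF inj_mono_form])
  then obtain C where C: "C \<subseteq> B" "card C = Suc E" "finite C" by (rule obtain_subset_with_card_n)
  obtain h where h: "bij_betw h {0..<Suc E} C" using ex_bij_betw_nat_finite[OF C(3)] C(2) by auto
  have "\<forall>i<Suc E. \<exists>p\<in>S. h i = homog E p" 
  proof safe
    fix i assume "i < Suc E"
    then have "h i \<in> C" using h by (auto simp: bij_betw_def)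
    then show "\<exists>p\<in>S. h i = homog E p" using C(1) B(1) by blast
  qed
  then obtain rows where rows: "\<And>i. i < Suc E \<Longrightarrow> rows i \<in> S \<and> h i = homog E (rows i)" by metis
  have "det (mat (Suc E) (Suc E) (\<lambda>(i, c). coeff (rows i) c)) \<noteq> 0"
  proof
    assume "det (mat (Suc E) (Suc E) (\<lambda>(i, c). coeff (rows i) c)) = 0"
    then obtain u i0 where u: "i0 < Suc E" "u i0 \<noteq> 0" "\<forall>c<Suc E. (\<Sum>i<Suc E. u i * coeff (rows i) c) = 0"
      unfolding det_eq_0_iff_left by blast
    have z: "(\<Sum>i<Suc E. smult [:u i:] (h i)) = 0"
    proof (rule forms_eqI[of _ E])
      show "(\<Sum>i<Suc E. smult [:u i:] (h i)) \<in> forms E"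
        using rows by (intro bipoly.subspace_sum subspace_forms bipoly.subspace_scale) auto
      show "0 \<in> forms E" using subspace_forms bipoly.subspace_0 by blast
      fix k assume "k \<le> E"
      then have "coords E (\<Sum>i<Suc E. smult [:u i:] (h i)) k = (\<Sum>i<Suc E. u i * coeff (rows i) k)"
        unfolding coords_sum coords_smult using rows by (intro sum.cong) (auto simp: coords_homog)
      then show "coords E (\<Sum>i<Suc E. smult [:u i:] (h i)) k = coords E 0 k" using u(3) \<open>k \<le> E\<close> by (simp add: coords_0)
    qed
    have inj: "inj_on h {..<Suc E}" and im: "h ` {..<Suc E} = C" using h by (auto simp: bij_betw_def lessThan_atLeast0)
    let ?w = "\<lambda>x. u (inv_into {..<Suc E} h x)"
    have "(\<Sum>x\<in>C. smult [:?w x:] x) = (\<Sum>i<Suc E. smult [:?w (h i):] (h i))"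
      unfolding im[symmetric] by (subst sum.reindex[OF inj]) (simp add: comp_def)
    also have "\<dots> = (\<Sum>i<Suc E. smult [:u i:] (h i))"
      by (rule sum.cong) (auto simp: inv_into_f_f[OF inj])
    finally have "(\<Sum>x\<in>C. smult [:?w x:] x) = 0" using z by simp
    moreover have "h i0 \<in> C" using im u(1) by blast
    ultimately have "?w (h i0) = 0" using bipoly.independentD[OF B(2) C(3) C(1), of ?w "h i0"] by blast
    then show False using u(1,2) inv_into_f_f[OF inj] by simp
  qed
  then show ?thesis using rows by blast
qed

section \<open>Elimination theory on products of projective lines\<close>

text \<open>
  Polynomial functions that are homogeneous of degree \<open>e\<close> in the coordinates \<open>y\<close> and of degree
  \<open>dl i\<close> in the point \<open>v i\<close> of the \<open>i\<close>-th projective line. The zero function has every degree;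
  without the rule \<open>zero\<close> this would fail for coefficients that vanish identically.
\<close>
inductive multihom :: "'i set \<Rightarrow> nat \<Rightarrow> nat \<Rightarrow> (nat \<Rightarrow> nat) \<Rightarrow>
    (('i \<Rightarrow> complex) \<Rightarrow> (nat \<Rightarrow> complex \<times> complex) \<Rightarrow> complex) \<Rightarrow> bool"
  for J :: "'i set" and m :: nat where
  zero: "multihom J m e dl (\<lambda>y v. 0)"
| const: "multihom J m 0 (\<lambda>_. 0) (\<lambda>y v. c)"
| yvar: "i \<in> J \<Longrightarrow> multihom J m 1 (\<lambda>_. 0) (\<lambda>y v. y i)"
| fst: "i < m \<Longrightarrow> multihom J m 0 (\<lambda>l. if l = i then 1 else 0) (\<lambda>y v. fst (v i))"
| snd: "i < m \<Longrightarrow> multihom J m 0 (\<lambda>l. if l = i then 1 else 0) (\<lambda>y v. snd (v i))"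
| add: "multihom J m e dl F \<Longrightarrow> multihom J m e dl G \<Longrightarrow> multihom J m e dl (\<lambda>y v. F y v + G y v)"
| mult: "multihom J m e dl F \<Longrightarrow> multihom J m e' dl' G \<Longrightarrow>
    multihom J m (e + e') (\<lambda>l. dl l + dl' l) (\<lambda>y v. F y v * G y v)"

lemma multihom_cong: "multihom J m e dl F \<Longrightarrow> (\<And>i. i < m \<Longrightarrow> v i = w i) \<Longrightarrow> F y v = F y w"
  by (induction rule: multihom.induct) auto

lemma multihom_cmult: assumes "multihom J m e dl F" shows "multihom J m e dl (\<lambda>y v. c * F y v)"
  using multihom.mult[OF multihom.const[of J m c] assms] by simp

lemma multihom_sum: "(\<And>a. a \<in> A \<Longrightarrow> multihom J m e dl (F a)) \<Longrightarrow> multihom J m e dl (\<lambda>y v. \<Sum>a\<in>A. F a y v)"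
  by (induction A rule: infinite_finite_induct) (auto intro: multihom.zero multihom.add)

lemma multihom_prod:
  "(\<And>a. a \<in> A \<Longrightarrow> multihom J m (e a) (dl a) (F a)) \<Longrightarrow>
   multihom J m (\<Sum>a\<in>A. e a) (\<lambda>l. \<Sum>a\<in>A. dl a l) (\<lambda>y v. \<Prod>a\<in>A. F a y v)"
proof (induction A rule: infinite_finite_induct)
  case (insert a A)
  then show ?case using multihom.mult[of J m "e a" "dl a" "F a" "\<Sum>a\<in>A. e a" "\<lambda>l. \<Sum>a\<in>A. dl a l" "\<lambda>y v. \<Prod>a\<in>A. F a y v"] by simp
qed (use multihom.const[of J m 1] in auto)

lemma multihom_det:
  assumes "\<And>i c. i < n \<Longrightarrow> c < n \<Longrightarrow> multihom J m (e i) (dl i) (M i c)"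
  shows "multihom J m (\<Sum>i<n. e i) (\<lambda>l. \<Sum>i<n. dl i l) (\<lambda>y v. det (mat n n (\<lambda>(i, c). M i c y v)))"
proof -
  have "det (mat n n (\<lambda>(i, c). M i c y v)) =
      (\<Sum>p\<in>{p. p permutes {0..<n}}. signof p * (\<Prod>i<n. M i (p i) y v))" for y v
  proof -
    have "det (mat n n (\<lambda>(i, c). M i c y v)) = (\<Sum>p\<in>{p. p permutes {0..<n}}. signof p * (\<Prod>i = 0..<n. mat n n (\<lambda>(i, c). M i c y v) $$ (i, p i)))"
      by (simp add: det_def)
    also have "\<dots> = (\<Sum>p\<in>{p. p permutes {0..<n}}. signof p * (\<Prod>i<n. M i (p i) y v))"
    proof (intro sum.cong arg_cong2[of _ _ _ _ "(*)"] refl prod.cong)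
      fix p i assume p: "p \<in> {p. p permutes {0..<n}}" and i: "i \<in> {..<n}"
      have "p i < n" using p i permutes_in_image[of p "{0..<n}" i] by simp
      then show "mat n n (\<lambda>(i, c). M i c y v) $$ (i, p i) = M i (p i) y v" using i by simp
    qed (simp add: lessThan_atLeast0)
    finally show ?thesis .
  qed
  moreover have "multihom J m (\<Sum>i<n. e i) (\<lambda>l. \<Sum>i<n. dl i l)
     (\<lambda>y v. \<Sum>p\<in>{p. p permutes {0..<n}}. signof p * (\<Prod>i<n. M i (p i) y v))"
    by (intro multihom_sum multihom_cmult multihom_prod assms)
       (auto simp: permutes_in_image[of _ "{0..<n}", simplified])
  ultimately show ?thesis by simp
qed

lemma coeff_mult_top:
  assumes "degree p \<le> D" "degree q \<le> D'"
  shows "coeff (p * q) (D + D') = coeff p D * coeff (q :: complex poly) D'"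
proof (cases "degree p = D \<and> degree q = D'")
  case True
  then show ?thesis using coeff_mult_degree_sum by blast
next
  case False
  then have "degree p < D \<or> degree q < D'" using assms by auto
  then have "coeff p D * coeff q D' = 0" by (auto simp: coeff_eq_0)
  moreover have "degree (p * q) < D + D'" using False assms degree_mult_le[of p q] by auto
  ultimately show ?thesis by (simp add: coeff_eq_0)
qed

lemma hom_eval_0: "hom_eval D p x 0 = coeff p D * x ^ D"
proof -
  have "hom_eval D p x 0 = (\<Sum>k\<le>D. if k = D then coeff p k * x ^ k else 0)"
    unfolding hom_eval_def by (intro sum.cong) auto
  then show ?thesis by simp
qed

lemma hom_eval_nonzero: assumes "degree p \<le> D" "y \<noteq> 0" shows "hom_eval D p x y = y ^ D * poly p (x / y)"
proof -
  have "poly p (x / y) = (\<Sum>k\<le>D. coeff p k * (x / y) ^ k)"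
    unfolding poly_altdef using assms by (intro sum.mono_neutral_left) (auto simp: coeff_eq_0)
  then have "y ^ D * poly p (x / y) = (\<Sum>k\<le>D. y ^ D * (coeff p k * (x / y) ^ k))"
    by (simp add: sum_distrib_left)
  also have "\<dots> = hom_eval D p x y" unfolding hom_eval_def
    using assms(2) by (intro sum.cong) (auto simp: power_diff power_divide field_simps)
  finally show ?thesis by simp
qed

lemma hom_eval_mult:
  assumes "degree p \<le> D" "degree q \<le> D'"
  shows "hom_eval (D + D') (p * q) x y = hom_eval D p x y * hom_eval D' q x y"
proof (cases "y = 0")
  case True
  then show ?thesis by (simp add: hom_eval_0 coeff_mult_top[OF assms] power_add algebra_simps)
next
  case False
  have "degree (p * q) \<le> D + D'" using assms degree_mult_le[of p q] by linarith
  then show ?thesis using False assms by (simp add: hom_eval_nonzero power_add algebra_simps)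
qed

lemma hom_eval_add: "hom_eval D (p + q) x y = hom_eval D p x y + hom_eval D q x y"
  by (simp add: hom_eval_def sum.distrib algebra_simps)

lemma hom_eval_monom_mult:
  assumes "degree p \<le> D" "k + D \<le> E"
  shows "hom_eval E (monom 1 k * p) x y = x ^ k * y ^ (E - k - D) * hom_eval D p x y"
proof -
  have one: "hom_eval j 1 x y = y ^ j" for j
  proof -
    have "hom_eval j 1 x y = (\<Sum>k\<le>j. if k = 0 then y ^ j else 0)"
      unfolding hom_eval_def by (intro sum.cong) (auto simp: one_pCons coeff_pCons split: nat.split)
    then show ?thesis by simp
  qed
  have mono: "hom_eval k (monom 1 k) x y = x ^ k"
  proof -
    have "hom_eval k (monom 1 k) x y = (\<Sum>i\<le>k. if i = k then x ^ i else 0)"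
      unfolding hom_eval_def by (intro sum.cong) auto
    then show ?thesis by simp
  qed
  have "hom_eval (D + (E - k - D)) (p * 1) x y = hom_eval D p x y * y ^ (E - k - D)"
    unfolding one[symmetric] by (rule hom_eval_mult) (use assms in auto)
  moreover have "hom_eval (k + (E - k)) (monom 1 k * p) x y = hom_eval k (monom 1 k) x y * hom_eval (E - k) p x y"
    by (rule hom_eval_mult) (use assms in \<open>auto simp: degree_monom_le\<close>)
  ultimately show ?thesis using assms by (simp add: mono)
qed

text \<open>
  Read as a binary form in the point on the last line, its coefficients are functions of the
  remaining variables.
\<close>
lemma multihom_expand_last:
  assumes "multihom J (Suc m) e dl F"
  shows "\<exists>P. (\<forall>y v. degree (P y v) \<le> dl m) \<and> (\<forall>k. multihom J m e (dl(m := 0)) (\<lambda>y v. coeff (P y v) k)) \<and>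
           (\<forall>y v. F y v = hom_eval (dl m) (P y v) (fst (v m)) (snd (v m)))"
  using assms
proof (induction rule: multihom.induct)
  case (zero e dl)
  then show ?case by (intro exI[of _ "\<lambda>_ _. 0"]) (auto simp: hom_eval_def intro: multihom.zero)
next
  case (const c)
  have c: "multihom J m 0 ((\<lambda>_. 0)(m := 0)) (\<lambda>y v. coeff [:c:] k)" for k
    using multihom.const[of J m "coeff [:c:] k"] by (simp add: fun_upd_def)
  show ?case by (rule exI[of _ "\<lambda>_ _. [:c:]"], intro conjI allI c) (simp_all add: hom_eval_def)
next
  case (yvar i)
  have c: "multihom J m 1 ((\<lambda>_. 0)(m := 0)) (\<lambda>y v. coeff [:y i:] k)" for k
    by (cases k) (use multihom.yvar[OF yvar, of m] multihom.zero in \<open>auto simp: fun_upd_def\<close>)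
  show ?case by (rule exI[of _ "\<lambda>y _. [:y i:]"], intro conjI allI c) (simp_all add: hom_eval_def)
next
  case (fst i)
  show ?case
  proof (cases "i = m")
    case True
    have c: "multihom J m 0 ((\<lambda>l. if l = i then 1 else 0)(m := 0)) (\<lambda>y v. coeff [:0, 1:] k)" for k
      using multihom.const[of J m "coeff [:0, 1:] k"] True by (simp add: fun_upd_def cong: if_cong)
    show ?thesis by (rule exI[of _ "\<lambda>_ _. [:0, 1:]"], intro conjI allI c) (simp_all add: hom_eval_def True)
  next
    case False
    then have "i < m" using fst by simp
    have eq: "(\<lambda>l. if l = i then 1 else 0)(m := 0) = (\<lambda>l. if l = i then 1 else (0::nat))" using False by auto
    have "multihom J m 0 (\<lambda>l. if l = i then 1 else 0) (\<lambda>y v. coeff [:fst (v i):] k)" for k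
      by (cases k) (use multihom.fst[OF \<open>i < m\<close>, of J] multihom.zero in auto)
    then show ?thesis using False unfolding eq by (intro exI[of _ "\<lambda>_ v. [:fst (v i):]"]) (auto simp: hom_eval_def)
  qed
next
  case (snd i)
  show ?case
  proof (cases "i = m")
    case True
    have c: "multihom J m 0 ((\<lambda>l. if l = i then 1 else 0)(m := 0)) (\<lambda>y v. coeff [:1:] k)" for k
      using multihom.const[of J m "coeff [:1:] k"] True by (simp add: fun_upd_def cong: if_cong)
    show ?thesis by (rule exI[of _ "\<lambda>_ _. [:1:]"], intro conjI allI c) (simp_all add: hom_eval_def True)
  next
    case False
    then have "i < m" using snd by simp
    have eq: "(\<lambda>l. if l = i then 1 else 0)(m := 0) = (\<lambda>l. if l = i then 1 else (0::nat))" using False by auto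
    have "multihom J m 0 (\<lambda>l. if l = i then 1 else 0) (\<lambda>y v. coeff [:snd (v i):] k)" for k
      by (cases k) (use multihom.snd[OF \<open>i < m\<close>, of J] multihom.zero in auto)
    then show ?thesis using False unfolding eq by (intro exI[of _ "\<lambda>_ v. [:snd (v i):]"]) (auto simp: hom_eval_def)
  qed
next
  case (add e dl F G)
  obtain P where P: "\<And>y v. degree (P y v) \<le> dl m" "\<And>k. multihom J m e (dl(m := 0)) (\<lambda>y v. coeff (P y v) k)"
    "\<And>y v. F y v = hom_eval (dl m) (P y v) (fst (v m)) (snd (v m))" using add.IH(1) by blast
  obtain Q where Q: "\<And>y v. degree (Q y v) \<le> dl m" "\<And>k. multihom J m e (dl(m := 0)) (\<lambda>y v. coeff (Q y v) k)"
    "\<And>y v. G y v = hom_eval (dl m) (Q y v) (fst (v m)) (snd (v m))" using add.IH(2) by blast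
  have c: "multihom J m e (dl(m := 0)) (\<lambda>y v. coeff (P y v + Q y v) k)" for k
    using multihom.add[OF P(2) Q(2)] by simp
  have d: "degree (P y v + Q y v) \<le> dl m" for y v using P(1) Q(1) degree_add_le by blast
  show ?case by (rule exI[of _ "\<lambda>y v. P y v + Q y v"], intro conjI allI c d) (simp add: hom_eval_add P(3) Q(3))
next
  case (mult e dl F e' dl' G)
  obtain P where P: "\<And>y v. degree (P y v) \<le> dl m" "\<And>k. multihom J m e (dl(m := 0)) (\<lambda>y v. coeff (P y v) k)"
    "\<And>y v. F y v = hom_eval (dl m) (P y v) (fst (v m)) (snd (v m))" using mult.IH(1) by blast
  obtain Q where Q: "\<And>y v. degree (Q y v) \<le> dl' m" "\<And>k. multihom J m e' (dl'(m := 0)) (\<lambda>y v. coeff (Q y v) k)"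
    "\<And>y v. G y v = hom_eval (dl' m) (Q y v) (fst (v m)) (snd (v m))" using mult.IH(2) by blast
  have eq: "(\<lambda>l. dl l + dl' l)(m := 0) = (\<lambda>l. (dl(m := 0)) l + (dl'(m := 0)) l)" by auto
  have c: "multihom J m (e + e') ((\<lambda>l. dl l + dl' l)(m := 0)) (\<lambda>y v. coeff (P y v * Q y v) k)" for k
    unfolding coeff_mult eq by (intro multihom_sum multihom.mult P Q)
  have d: "degree (P y v * Q y v) \<le> dl m + dl' m" for y v
    using P(1)[of y v] Q(1)[of y v] degree_mult_le[of "P y v" "Q y v"] by linarith
  show ?case by (rule exI[of _ "\<lambda>y v. P y v * Q y v"], intro conjI allI c d) (simp add: hom_eval_mult[OF P(1) Q(1)] P(3) Q(3))
qed

text \<open>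
  Zero sets of families of arbitrary size, so that intersections are closed conditions by
  definition.
\<close>
definition closed_cond :: "'i set \<Rightarrow> nat \<Rightarrow> (('i \<Rightarrow> complex) \<Rightarrow> (nat \<Rightarrow> complex \<times> complex) \<Rightarrow> bool) \<Rightarrow> bool" where
  "closed_cond J m C \<longleftrightarrow> (\<exists>\<F>. (\<forall>F\<in>\<F>. \<exists>e dl. multihom J m e dl F) \<and> (\<forall>y v. C y v \<longleftrightarrow> (\<forall>F\<in>\<F>. F y v = 0)))"

lemma closed_cond_eq_0: "multihom J m e dl F \<Longrightarrow> closed_cond J m (\<lambda>y v. F y v = 0)"
  unfolding closed_cond_def by (intro exI[of _ "{F}"]) auto

lemma closed_cond_all:
  assumes "\<And>a. a \<in> A \<Longrightarrow> closed_cond J m (C a)"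
  shows "closed_cond J m (\<lambda>y v. \<forall>a\<in>A. C a y v)"
proof -
  obtain \<F> where F: "\<And>a. a \<in> A \<Longrightarrow> (\<forall>F\<in>\<F> a. \<exists>e dl. multihom J m e dl F) \<and> (\<forall>y v. C a y v \<longleftrightarrow> (\<forall>F\<in>\<F> a. F y v = 0))"
    using assms unfolding closed_cond_def by metis
  then show ?thesis unfolding closed_cond_def by (intro exI[of _ "\<Union>a\<in>A. \<F> a"]) auto
qed

lemma closed_cond_conj:
  assumes "closed_cond J m C" "closed_cond J m D"
  shows "closed_cond J m (\<lambda>y v. C y v \<and> D y v)"
proof -
  have "closed_cond J m (\<lambda>y v. \<forall>b\<in>UNIV. (if b then C else D) y v)"
    by (rule closed_cond_all) (use assms in auto)
  moreover have "(\<lambda>y v. \<forall>b\<in>UNIV. (if b then C else D) y v) = (\<lambda>y v. C y v \<and> D y v)"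
    by (intro ext) (auto split: if_splits)
  ultimately show ?thesis by simp
qed

lemma closed_cond_cong:
  assumes "closed_cond J m C" "\<And>i. i < m \<Longrightarrow> v i = w i"
  shows "C y v \<longleftrightarrow> C y w"
proof -
  obtain \<F> where F: "\<And>F. F \<in> \<F> \<Longrightarrow> \<exists>e dl. multihom J m e dl F" "\<And>y v. C y v \<longleftrightarrow> (\<forall>F\<in>\<F>. F y v = 0)"
    using assms(1) unfolding closed_cond_def by blast
  have "F y v = F y w" if "F \<in> \<F>" for F using F(1)[OF that] multihom_cong assms(2) by blast
  then show ?thesis unfolding F(2) by metis
qed

text \<open>
  The main theorem of elimination theory for one projective line. View the equations as binary
  forms \<open>P F y v\<close> in the last point. They have a common root iff in no degree \<open>E\<close> their multiples
  span all binary forms, that is, iff all maximal minors of the matrices of these multiples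
  vanish. A common root gives a nonzero vector in the kernel; the converse is
  \<open>common_root_of_annihilators\<close>. The minors are multihomogeneous in the remaining variables.
\<close>
lemma closed_cond_project_line:
  assumes "closed_cond J (Suc m) C"
  shows "closed_cond J m (\<lambda>y v. \<exists>p. p \<noteq> 0 \<and> C y (v(m := p)))"
proof -
  obtain \<F> where F: "\<And>F. F \<in> \<F> \<Longrightarrow> \<exists>e dl. multihom J (Suc m) e dl F" "\<And>y v. C y v \<longleftrightarrow> (\<forall>F\<in>\<F>. F y v = 0)"
    using assms unfolding closed_cond_def by blast
  have "\<forall>F\<in>\<F>. \<exists>e dl P. (\<forall>y v. degree (P y v) \<le> dl m) \<and> (\<forall>k. multihom J m e (dl(m := 0)) (\<lambda>y v. coeff (P y v) k)) \<and>
           (\<forall>y v. F y v = hom_eval (dl m) (P y v) (fst (v m)) (snd (v m)))"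
    using F(1) multihom_expand_last by blast
  then obtain e dl P where P: "\<And>F y v. F \<in> \<F> \<Longrightarrow> degree (P F y v) \<le> dl F m"
    "\<And>F k. F \<in> \<F> \<Longrightarrow> multihom J m (e F) ((dl F)(m := 0)) (\<lambda>y v. coeff (P F y v) k)"
    "\<And>F y v. F \<in> \<F> \<Longrightarrow> F y v = hom_eval (dl F m) (P F y v) (fst (v m)) (snd (v m))"
    by metis
  \<comment> \<open>the minor of the multiples of \<open>Fs i\<close> by the \<open>k i\<close>-th power of the coordinate, in degree
     \<open>E\<close>\<close>
  define D where "D Fs k E y v = det (mat (Suc E) (Suc E) (\<lambda>(i, c). coeff (monom 1 (k i) * P (Fs i) y v) c))"
    for Fs and k :: "nat \<Rightarrow> nat" and E :: nat and y v
  define ok where "ok Fs k E \<longleftrightarrow> (\<forall>i<Suc E. Fs i \<in> \<F> \<and> k i + dl (Fs i) m \<le> E)" for Fs and k :: "nat \<Rightarrow> nat" and E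
  have Pm: "P F y (v(m := p)) = P F y v" if "F \<in> \<F>" for F y v p
  proof (rule poly_eqI)
    fix c show "coeff (P F y (v(m := p))) c = coeff (P F y v) c"
      by (rule multihom_cong[OF P(2)[OF that]]) auto
  qed
  have mD: "\<exists>e dl. multihom J m e dl (D Fs k E)" if "ok Fs k E" for Fs k E
  proof -
    have "multihom J m (\<Sum>i<Suc E. e (Fs i)) (\<lambda>l. \<Sum>i<Suc E. ((dl (Fs i))(m := 0)) l) (\<lambda>y v. det (mat (Suc E) (Suc E) (\<lambda>(i, c). coeff (monom 1 (k i) * P (Fs i) y v) c)))"
    proof (rule multihom_det)
      fix i c assume i: "i < Suc E"
      show "multihom J m (e (Fs i)) ((dl (Fs i))(m := 0)) (\<lambda>y v. coeff (monom 1 (k i) * P (Fs i) y v) c)"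
        using that i P(2)[of "Fs i"] multihom.zero unfolding coeff_monom_mult ok_def by (cases "c < k i") auto
    qed
    then show ?thesis unfolding D_def[abs_def] by blast
  qed
  have main: "(\<exists>p. p \<noteq> 0 \<and> C y (v(m := p))) \<longleftrightarrow> (\<forall>Fs k E. ok Fs k E \<longrightarrow> D Fs k E y v = 0)" for y v
  proof
    assume "\<exists>p. p \<noteq> 0 \<and> C y (v(m := p))"
    then obtain p where p: "p \<noteq> 0" "C y (v(m := p))" by blast
    have root: "hom_eval (dl F m) (P F y v) (fst p) (snd p) = 0" if "F \<in> \<F>" for F
    proof -
      have "F y (v(m := p)) = 0" using p(2) that unfolding F(2) by blast
      then show ?thesis using P(3)[OF that, of y "v(m := p)"] by (simp add: Pm[OF that])
    qed
    show "\<forall>Fs k E. ok Fs k E \<longrightarrow> D Fs k E y v = 0"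
    proof safe
      fix Fs k E assume ok: "ok Fs k E"
      let ?u = "\<lambda>c. fst p ^ c * snd p ^ (E - c)"
      have "(\<Sum>c<Suc E. coeff (monom 1 (k i) * P (Fs i) y v) c * ?u c) = 0" if i: "i < Suc E" for i
      proof -
        have "(\<Sum>c<Suc E. coeff (monom 1 (k i) * P (Fs i) y v) c * ?u c) = hom_eval E (monom 1 (k i) * P (Fs i) y v) (fst p) (snd p)"
          by (simp add: hom_eval_def lessThan_Suc_atMost mult.assoc)
        also have "\<dots> = 0" using ok i root[of "Fs i"] hom_eval_monom_mult[OF P(1)] unfolding ok_def by auto
        finally show ?thesis .
      qed
      moreover have "\<exists>c<Suc E. ?u c \<noteq> 0"
      proof (cases "snd p = 0")
        case True
        then have "fst p \<noteq> 0" using p(1) by (cases p) (auto simp: zero_prod_def)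
        then show ?thesis by (intro exI[of _ E]) auto
      next
        case False
        then show ?thesis by (intro exI[of _ 0]) auto
      qed
      ultimately show "D Fs k E y v = 0" unfolding D_def det_eq_0_iff_right by (intro exI[of _ ?u]) blast
    qed
  next
    assume D0: "\<forall>Fs k E. ok Fs k E \<longrightarrow> D Fs k E y v = 0"
    define Q where "Q = (\<lambda>F. (dl F m, P F y v)) ` \<F>"
    have "\<exists>a. (\<exists>k\<le>E. a k \<noteq> 0) \<and> (\<forall>(d, q)\<in>Q. d \<le> E \<longrightarrow> annih E d q a)" for E
    proof (rule ccontr)
      assume no: "\<not> ?thesis"
      let ?S = "{monom 1 k * P F y v | F k. F \<in> \<F> \<and> k + dl F m \<le> E}"
      have dS: "degree p \<le> E" if pS: "p \<in> ?S" for p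
      proof -
        obtain F k where Fk: "p = monom 1 k * P F y v" "F \<in> \<F>" "k + dl F m \<le> E"
          using pS by blast
        have "degree p \<le> degree (monom (1::complex) k) + degree (P F y v)" unfolding Fk(1) by (rule degree_mult_le)
        then show ?thesis using P(1)[OF Fk(2), of y v] Fk(3) degree_monom_le[of "1::complex" k] by linarith
      qed
      \<comment> \<open>if no sequence is killed by all equations in degree \<open>E\<close>, then their multiples span, so
         some minor is nonzero\<close>
      have "\<exists>rows. (\<forall>i<Suc E. rows i \<in> ?S) \<and> det (mat (Suc E) (Suc E) (\<lambda>(i, c). coeff (rows i) c)) \<noteq> 0"
      proof (rule rows_with_nonzero_det)
        fix a :: "nat \<Rightarrow> complex" assume a: "\<And>p. p \<in> ?S \<Longrightarrow> (\<Sum>k\<le>E. coeff p k * a k) = 0"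
        have "annih E (dl F m) (P F y v) a" if "F \<in> \<F>" for F
          unfolding annih_def
        proof safe
          fix k assume k: "k + dl F m \<le> E"
          have mem: "monom 1 k * P F y v \<in> ?S" using that k by blast
          have "act (P F y v) a k = act (monom 1 k * P F y v) a 0" by (simp add: act_mult act_monom)
          also have "\<dots> = (\<Sum>i\<le>E. coeff (monom 1 k * P F y v) i * a (i + 0))" by (rule act_bound[OF dS[OF mem]])
          also have "\<dots> = 0" using a[OF mem] by simp
          finally show "act (P F y v) a k = 0" .
        qed
        then show "\<forall>k\<le>E. a k = 0" using no unfolding Q_def by blast
      qed (rule dS)
      then obtain rows where rows: "\<And>i. i < Suc E \<Longrightarrow> \<exists>F k. rows i = monom 1 k * P F y v \<and> F \<in> \<F> \<and> k + dl F m \<le> E"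
        "det (mat (Suc E) (Suc E) (\<lambda>(i, c). coeff (rows i) c)) \<noteq> 0" by blast
      then obtain Fs k where Fs: "\<And>i. i < Suc E \<Longrightarrow> rows i = monom 1 (k i) * P (Fs i) y v \<and> Fs i \<in> \<F> \<and> k i + dl (Fs i) m \<le> E"
        by metis
      have "mat (Suc E) (Suc E) (\<lambda>(i, c). coeff (rows i) c) = mat (Suc E) (Suc E) (\<lambda>(i, c). coeff (monom 1 (k i) * P (Fs i) y v) c)"
        using Fs by (intro eq_matI) auto
      then have "D Fs k E y v \<noteq> 0" using rows(2) unfolding D_def by simp
      moreover have "ok Fs k E" using Fs unfolding ok_def by blast
      ultimately show False using D0 by blast
    qed
    moreover have "degree q \<le> d" if "(d, q) \<in> Q" for d q using that P(1) unfolding Q_def by auto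
    ultimately obtain x z where xz: "(x, z) \<noteq> (0, 0)" "\<forall>(d, q)\<in>Q. hom_eval d q x z = 0"
      using common_root_of_annihilators[of Q] by blast
    have "C y (v(m := (x, z)))" unfolding F(2)
    proof
      fix F assume "F \<in> \<F>"
      then show "F y (v(m := (x, z))) = 0" using P(3)[of F y "v(m := (x, z))"] xz(2) by (auto simp: Pm Q_def)
    qed
    then show "\<exists>p. p \<noteq> 0 \<and> C y (v(m := p))" using xz(1) by (intro exI[of _ "(x, z)"]) (auto simp: zero_prod_def)
  qed
  then have "\<forall>y v. (\<exists>p. p \<noteq> 0 \<and> C y (v(m := p))) \<longleftrightarrow> (\<forall>G\<in>{D Fs k E | Fs k E. ok Fs k E}. G y v = 0)"
    (is "\<forall>y v. ?L y v \<longleftrightarrow> ?R y v")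
  proof (intro allI)
    fix y v
    have "?R y v \<longleftrightarrow> (\<forall>Fs k E. ok Fs k E \<longrightarrow> D Fs k E y v = 0)" by blast
    then show "?L y v \<longleftrightarrow> ?R y v" unfolding main by blast
  qed
  moreover have "\<forall>G\<in>{D Fs k E | Fs k E. ok Fs k E}. \<exists>e dl. multihom J m e dl G" using mD by auto
  ultimately show ?thesis unfolding closed_cond_def by blast
qed

text \<open>Eliminate the points on the last \<open>l\<close> lines one at a time.\<close>
lemma closed_cond_project:
  assumes "closed_cond J (m + l) C"
  shows "closed_cond J m (\<lambda>y v. \<exists>w. (\<forall>i<m. w i = v i) \<and> (\<forall>i. m \<le> i \<and> i < m + l \<longrightarrow> w i \<noteq> 0) \<and> C y w)"
  using assms
proof (induction l arbitrary: C)
  case 0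
  have "(\<lambda>y v. \<exists>w. (\<forall>i<m. w i = v i) \<and> (\<forall>i. m \<le> i \<and> i < m + 0 \<longrightarrow> w i \<noteq> 0) \<and> C y w) = C"
  proof (intro ext iffI)
    fix y v assume "\<exists>w. (\<forall>i<m. w i = v i) \<and> (\<forall>i. m \<le> i \<and> i < m + 0 \<longrightarrow> w i \<noteq> 0) \<and> C y w"
    then obtain w where "\<forall>i<m. w i = v i" "C y w" by blast
    then show "C y v" using closed_cond_cong[OF 0, of w v] by simp
  qed (auto simp only: add_0_right not_less[symmetric])
  then show ?case using 0 by simp
next
  case (Suc l)
  have c1: "closed_cond J (m + l) (\<lambda>y v. \<exists>p. p \<noteq> 0 \<and> C y (v(m + l := p)))"
    using closed_cond_project_line[of J "m + l" C] Suc.prems by simp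
  have "(\<exists>w. (\<forall>i<m. w i = v i) \<and> (\<forall>i. m \<le> i \<and> i < m + Suc l \<longrightarrow> w i \<noteq> 0) \<and> C y w) \<longleftrightarrow>
    (\<exists>w. (\<forall>i<m. w i = v i) \<and> (\<forall>i. m \<le> i \<and> i < m + l \<longrightarrow> w i \<noteq> 0) \<and> (\<exists>p. p \<noteq> 0 \<and> C y (w(m + l := p))))" for y v
  proof
    assume "\<exists>w. (\<forall>i<m. w i = v i) \<and> (\<forall>i. m \<le> i \<and> i < m + Suc l \<longrightarrow> w i \<noteq> 0) \<and> C y w"
    then obtain w where w: "\<forall>i<m. w i = v i" "\<forall>i. m \<le> i \<and> i < m + Suc l \<longrightarrow> w i \<noteq> 0" "C y w" by blast
    then show "\<exists>w. (\<forall>i<m. w i = v i) \<and> (\<forall>i. m \<le> i \<and> i < m + l \<longrightarrow> w i \<noteq> 0) \<and> (\<exists>p. p \<noteq> 0 \<and> C y (w(m + l := p)))"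
      by (intro exI[of _ w] conjI exI[of _ "w (m + l)"]) auto
  next
    assume "\<exists>w. (\<forall>i<m. w i = v i) \<and> (\<forall>i. m \<le> i \<and> i < m + l \<longrightarrow> w i \<noteq> 0) \<and> (\<exists>p. p \<noteq> 0 \<and> C y (w(m + l := p)))"
    then obtain w p where w: "\<forall>i<m. w i = v i" "\<forall>i. m \<le> i \<and> i < m + l \<longrightarrow> w i \<noteq> 0" "p \<noteq> 0" "C y (w(m + l := p))" by blast
    then show "\<exists>w. (\<forall>i<m. w i = v i) \<and> (\<forall>i. m \<le> i \<and> i < m + Suc l \<longrightarrow> w i \<noteq> 0) \<and> C y w"
      by (intro exI[of _ "w(m + l := p)"]) (auto simp: less_Suc_eq)
  qed
  then show ?case using Suc.IH[OF c1] by presburger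
qed

lemma hom_poly_0: assumes "J \<noteq> {}" shows "hom_poly J e (\<lambda>z. 0)"
proof -
  obtain i where i: "i \<in> J" using assms by blast
  have "hom_poly J e (\<lambda>z. 0)" for e
  proof (induction e)
    case 0 show ?case by (rule hom_poly.const)
  next
    case (Suc e)
    show ?case using hom_poly.mult[OF Suc hom_poly.var[OF i]] by simp
  qed
  then show ?thesis .
qed

lemma multihom_no_lines: "multihom J 0 e dl F \<Longrightarrow> J \<noteq> {} \<Longrightarrow> hom_poly J e (\<lambda>y. F y v)"
  by (induction rule: multihom.induct) (auto intro: hom_poly_0 hom_poly.intros hom_poly.var[unfolded One_nat_def])

text \<open>
  With no line left, a closed condition is an intersection of projective hypersurfaces.
\<close>
lemma closed_cond_no_lines:
  assumes "closed_cond J 0 C" "J \<noteq> {}"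
  shows "\<exists>\<H>. (\<forall>H\<in>\<H>. \<exists>e. hom_poly J e H) \<and> (\<forall>y v. C y v \<longleftrightarrow> (\<forall>H\<in>\<H>. H y = 0))"
proof -
  obtain \<F> where F: "\<And>F. F \<in> \<F> \<Longrightarrow> \<exists>e dl. multihom J 0 e dl F" "\<And>y v. C y v \<longleftrightarrow> (\<forall>F\<in>\<F>. F y v = 0)"
    using assms unfolding closed_cond_def by blast
  have key: "F y v = F y (\<lambda>_. 0)" if "F \<in> \<F>" for F y v
    using F(1)[OF that] multihom_cong by blast
  have "\<forall>y v. C y v \<longleftrightarrow> (\<forall>H\<in>(\<lambda>F y. F y (\<lambda>_. 0)) ` \<F>. H y = 0)"
  proof (intro allI)
    fix y v
    have "C y v \<longleftrightarrow> (\<forall>F\<in>\<F>. F y (\<lambda>_. 0) = 0)"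
      unfolding F(2) by (intro ball_cong refl arg_cong[of _ _ "\<lambda>x. x = 0"] key)
    then show "C y v \<longleftrightarrow> (\<forall>H\<in>(\<lambda>F y. F y (\<lambda>_. 0)) ` \<F>. H y = 0)" by simp
  qed
  moreover have "\<forall>H\<in>(\<lambda>F y. F y (\<lambda>_. 0)) ` \<F>. \<exists>e. hom_poly J e H"
    using F(1) multihom_no_lines[OF _ assms(2)] by blast
  ultimately show ?thesis by blast
qed

section \<open>Zariski topologies\<close>

lemma openin_zariski_basic:
  "hom_poly J e F \<Longrightarrow> openin (zariski J hc A) {p \<in> A. \<exists>z \<in> hc p. F z \<noteq> 0}"
  unfolding zariski_def by (rule topology_generated_by_Basis) blast

lemma topspace_zariski: assumes "\<And>p. p \<in> A \<Longrightarrow> hc p \<noteq> {}" shows "topspace (zariski J hc A) = A"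
proof
  show "topspace (zariski J hc A) \<subseteq> A" unfolding zariski_def topology_generated_by_topspace by auto
  have "A = {p \<in> A. \<exists>z \<in> hc p. (\<lambda>z. 1::complex) z \<noteq> 0}" using assms by auto
  then have "openin (zariski J hc A) A" using openin_zariski_basic[OF hom_poly.const[of J 1], of hc A] by simp
  then show "A \<subseteq> topspace (zariski J hc A)" by (rule openin_subset)
qed

lemma closedin_zariski:
  assumes ne: "\<And>p. p \<in> A \<Longrightarrow> hc p \<noteq> {}" and H: "\<And>H. H \<in> \<H> \<Longrightarrow> \<exists>e. hom_poly J e H"
  shows "closedin (zariski J hc A) {p \<in> A. \<forall>z \<in> hc p. \<forall>H\<in>\<H>. H z = 0}"
proof -
  have "A - {p \<in> A. \<forall>z \<in> hc p. \<forall>H\<in>\<H>. H z = 0} = (\<Union>H\<in>\<H>. {p \<in> A. \<exists>z \<in> hc p. H z \<noteq> 0})" by auto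
  moreover have "openin (zariski J hc A) (\<Union>H\<in>\<H>. {p \<in> A. \<exists>z \<in> hc p. H z \<noteq> 0})"
    using H openin_zariski_basic by (intro openin_Union) fast
  moreover have "topspace (zariski J hc A) = A" by (rule topspace_zariski) (rule ne)
  ultimately show ?thesis unfolding closedin_def by auto
qed

text \<open>
  Polynomial functions of one parameter. They vanish at finitely many parameters or identically,
  which is how genericity is used throughout.
\<close>
definition poly_fun :: "(complex \<Rightarrow> complex) \<Rightarrow> bool" where
  "poly_fun f \<longleftrightarrow> (\<exists>P. \<forall>t. f t = poly P t)"

lemma poly_fun_const [simp]: "poly_fun (\<lambda>t. c)" unfolding poly_fun_def by (intro exI[of _ "[:c:]"]) simp
lemma poly_fun_id [simp]: "poly_fun (\<lambda>t. t)" unfolding poly_fun_def by (intro exI[of _ "[:0,1:]"]) simp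
lemma poly_fun_add: "poly_fun f \<Longrightarrow> poly_fun g \<Longrightarrow> poly_fun (\<lambda>t. f t + g t)"
  unfolding poly_fun_def by (metis poly_add)
lemma poly_fun_mult: "poly_fun f \<Longrightarrow> poly_fun g \<Longrightarrow> poly_fun (\<lambda>t. f t * g t)"
  unfolding poly_fun_def by (metis poly_mult)
lemma poly_fun_diff: "poly_fun f \<Longrightarrow> poly_fun g \<Longrightarrow> poly_fun (\<lambda>t. f t - g t)"
  unfolding poly_fun_def by (metis poly_diff)
lemma poly_fun_power: "poly_fun f \<Longrightarrow> poly_fun (\<lambda>t. f t ^ n)"
  by (induction n) (simp_all add: poly_fun_mult)
lemma poly_fun_sum: "(\<And>a. a \<in> A \<Longrightarrow> poly_fun (f a)) \<Longrightarrow> poly_fun (\<lambda>t. \<Sum>a\<in>A. f a t)"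
  by (induction A rule: infinite_finite_induct) (auto intro: poly_fun_add)
lemma poly_fun_prod: "(\<And>a. a \<in> A \<Longrightarrow> poly_fun (f a)) \<Longrightarrow> poly_fun (\<lambda>t. \<Prod>a\<in>A. f a t)"
  by (induction A rule: infinite_finite_induct) (auto intro: poly_fun_mult)

lemma finite_zeros_poly_fun: assumes "poly_fun f" "f s \<noteq> 0" shows "finite {t. f t = 0}"
proof -
  obtain P where P: "\<And>t. f t = poly P t" using assms unfolding poly_fun_def by blast
  then have "P \<noteq> 0" using assms(2) by auto
  then show ?thesis using poly_roots_finite P by simp
qed

lemma hom_poly_cong: "hom_poly J e F \<Longrightarrow> (\<And>i. i \<in> J \<Longrightarrow> y i = z i) \<Longrightarrow> F y = F z"
  by (induction rule: hom_poly.induct) auto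

lemma hom_poly_curve: "hom_poly J e F \<Longrightarrow> (\<And>i. i \<in> J \<Longrightarrow> poly_fun (\<lambda>t. z t i)) \<Longrightarrow> poly_fun (\<lambda>t. F (z t))"
  by (induction rule: hom_poly.induct) (auto intro: poly_fun_add poly_fun_mult)

text \<open>
  A curve with polynomial homogeneous coordinates that starts in an open set leaves it at finitely
  many parameters only. The curve may leave \<open>A\<close> at finitely many parameters. Coordinates are
  required for every choice \<open>z0\<close> at the start, because a basic open set only says that some choice
  is not a zero of \<open>F\<close>.
\<close>
lemma zariski_open_curve:
  assumes U: "openin (zariski J hc A) U" and p0: "p s \<in> U"
    and curve: "\<And>z0. z0 \<in> hc (p s) \<Longrightarrow> \<exists>z. (\<forall>i\<in>J. poly_fun (\<lambda>t. z t i)) \<and> (\<forall>i\<in>J. z s i = z0 i) \<and>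
       finite {t. \<not> (p t \<in> A \<and> z t \<in> hc (p t))}"
  shows "finite {t. p t \<notin> U}"
proof -
  have "generate_topology_on {{p \<in> A. \<exists>z \<in> hc p. F z \<noteq> 0} | e F. hom_poly J e F} U"
    using U unfolding zariski_def openin_topology_generated_by_iff .
  then show ?thesis using p0
  proof (induction rule: generate_topology_on.induct)
    case Empty
    then show ?case by simp
  next
    case (Int a b)
    then have "finite ({t. p t \<notin> a} \<union> {t. p t \<notin> b})" by simp
    then show ?case by (rule rev_finite_subset) auto
  next
    case (UN K)
    then obtain k where "k \<in> K" "p s \<in> k" by blast
    then have "finite {t. p t \<notin> k}" using UN by blast
    then show ?case by (rule rev_finite_subset) (use \<open>k \<in> K\<close> in auto)
  next
    case (Basis B)
    then obtain e F where F: "hom_poly J e F" "B = {p \<in> A. \<exists>z \<in> hc p. F z \<noteq> 0}" by blast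
    then obtain z0 where z0: "z0 \<in> hc (p s)" "F z0 \<noteq> 0" using Basis by blast
    obtain z where z: "\<forall>i\<in>J. poly_fun (\<lambda>t. z t i)" "\<forall>i\<in>J. z s i = z0 i" "finite {t. \<not> (p t \<in> A \<and> z t \<in> hc (p t))}"
      using curve[OF z0(1)] by blast
    have "F (z s) \<noteq> 0" using hom_poly_cong[OF F(1), of "z s" z0] z(2) z0(2) by simp
    then have "finite {t. F (z t) = 0}" using finite_zeros_poly_fun hom_poly_curve[OF F(1)] z(1) by blast
    then have "finite ({t. \<not> (p t \<in> A \<and> z t \<in> hc (p t))} \<union> {t. F (z t) = 0})" using z(3) by simp
    then show ?case by (rule rev_finite_subset) (auto simp: F(2))
  qed
qed

text \<open>
  All but finitely many parameters lie in a given neighbourhood and all but finitely many lie in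
  \<open>S\<close>, and the field is infinite.
\<close>
lemma in_closure_of_curve:
  assumes top: "p s \<in> topspace (zariski J hc A)"
    and curve: "\<And>z0. z0 \<in> hc (p s) \<Longrightarrow> \<exists>z. (\<forall>i\<in>J. poly_fun (\<lambda>t. z t i)) \<and> (\<forall>i\<in>J. z s i = z0 i) \<and>
       finite {t. \<not> (p t \<in> A \<and> z t \<in> hc (p t))}"
    and S: "finite {t. p t \<notin> S}"
  shows "p s \<in> zariski J hc A closure_of S"
  unfolding in_closure_of
proof (intro conjI allI impI)
  fix T assume T: "p s \<in> T \<and> openin (zariski J hc A) T"
  have "finite {t. p t \<notin> T}" using zariski_open_curve[of J hc A T p s] T curve by blast
  then have "finite ({t. p t \<notin> T} \<union> {t. p t \<notin> S})" using S by simp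
  then obtain t where "t \<notin> {t. p t \<notin> T} \<union> {t. p t \<notin> S}"
    using ex_new_if_finite infinite_UNIV_char_0 by blast
  then show "\<exists>y. y \<in> S \<and> y \<in> T" by blast
qed (rule top)

section \<open>Pluecker coordinates\<close>

text \<open>Independence of families, so that a repeated vector counts as dependent.\<close>
definition indep_fam :: "nat \<Rightarrow> (nat \<Rightarrow> bipoly) \<Rightarrow> bool" where
  "indep_fam k w \<longleftrightarrow> (\<forall>u. (\<Sum>a<k. smult [:u a:] (w a)) = 0 \<longrightarrow> (\<forall>a<k. u a = 0))"

lemma indep_fam_basis:
  assumes "indep_fam k w"
  shows "inj_on w {..<k}" "bipoly.independent (w ` {..<k})"
proof -
  show inj: "inj_on w {..<k}"
  proof (rule inj_onI, rule ccontr)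
    fix a b assume ab: "a \<in> {..<k}" "b \<in> {..<k}" "w a = w b" "a \<noteq> b"
    define u where "u i = (if i = a then 1 else if i = b then -1 else (0::complex))" for i
    have "(\<Sum>i<k. smult [:u i:] (w i)) = (\<Sum>i\<in>{a,b}. smult [:u i:] (w i))"
      by (rule sum.mono_neutral_right) (use ab u_def in auto)
    also have "\<dots> = 0" using ab by (simp add: u_def smult_add_left[symmetric])
    finally have "u a = 0" using assms ab(1) unfolding indep_fam_def by blast
    then show False by (simp add: u_def)
  qed
  show "bipoly.independent (w ` {..<k})"
  proof (subst bipoly.dependent_finite, simp, safe)
    fix u a assume s: "(\<Sum>v\<in>w ` {..<k}. smult [:u v:] v) = 0" and a: "a < k" and nz: "u (w a) \<noteq> 0"
    have "(\<Sum>i<k. smult [:u (w i):] (w i)) = 0" using s by (simp add: sum.reindex[OF inj])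
    then have "\<forall>a<k. u (w a) = 0" using assms unfolding indep_fam_def by (elim allE[of _ "\<lambda>i. u (w i)"]) simp
    then show False using a nz by blast
  qed
qed

lemma indep_fam_dim: "indep_fam k w \<Longrightarrow> bipoly.dim (bipoly.span (w ` {..<k})) = k"
  using indep_fam_basis[of k w] bipoly.dim_span_eq_card_independent[of "w ` {..<k}"] card_image[of w "{..<k}"] by simp

lemma indep_fam_of_dim:
  assumes "bipoly.dim (bipoly.span (w ` {..<k})) = k"
  shows "indep_fam k w"
proof (rule ccontr)
  assume "\<not> ?thesis"
  then obtain u a where u: "(\<Sum>i<k. smult [:u i:] (w i)) = 0" "a < k" "u a \<noteq> 0" unfolding indep_fam_def by blast
  let ?R = "w ` ({..<k} - {a})"
  have "smult [:u a:] (w a) = - (\<Sum>i\<in>{..<k}-{a}. smult [:u i:] (w i))"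
    using u(1) sum.remove[of "{..<k}" a "\<lambda>i. smult [:u i:] (w i)"] u(2) by (simp add: eq_neg_iff_add_eq_0)
  also have "\<dots> \<in> bipoly.span ?R"
    by (intro bipoly.span_neg bipoly.span_sum bipoly.span_scale bipoly.span_base) auto
  finally have "smult [:inverse (u a):] (smult [:u a:] (w a)) \<in> bipoly.span ?R" by (rule bipoly.span_scale)
  then have "w a \<in> bipoly.span ?R" using u(3) by (simp add: one_pCons[symmetric])
  then have "w ` {..<k} \<subseteq> bipoly.span ?R" by (auto intro: bipoly.span_base)
  then have "bipoly.span (w ` {..<k}) \<subseteq> bipoly.span ?R" by (intro bipoly.span_minimal) simp_all
  then have "bipoly.dim (bipoly.span (w ` {..<k})) \<le> card ?R" by (intro bipoly.dim_le_card) auto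
  also have "\<dots> \<le> card ({..<k} - {a})" by (rule card_image_le) simp
  also have "\<dots> < k" using u(2) by simp
  finally show False using assms by simp
qed

lemma sorted_list_of_set_nth_mem:
  "finite I \<Longrightarrow> b < card I \<Longrightarrow> sorted_list_of_set I ! b \<in> I"
  by (metis nth_mem set_sorted_list_of_set length_sorted_list_of_set)

lemma sum_coords_eq_0:
  assumes "det (mat k k (\<lambda>(a, b). coords N (w a) (sorted_list_of_set I ! b))) \<noteq> 0"
    and "(\<Sum>a<k. smult [:u a:] (w a)) = 0" "card I = k" "finite I" "a < k"
  shows "u a = (0::complex)"
proof (rule ccontr)
  assume "u a \<noteq> 0"
  moreover have "(\<Sum>a<k. u a * coords N (w a) (sorted_list_of_set I ! b)) = 0" for b
    using arg_cong[OF assms(2), of "\<lambda>f. coords N f (sorted_list_of_set I ! b)"]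
    by (simp add: coords_sum coords_smult coords_0)
  ultimately have "det (mat k k (\<lambda>(a, b). coords N (w a) (sorted_list_of_set I ! b))) = 0"
    unfolding det_eq_0_iff_left using assms(5) by blast
  then show False using assms(1) by simp
qed

lemma indep_fam_of_pluecker:
  assumes "pluecker N k w I \<noteq> 0" "card I = k" "finite I"
  shows "indep_fam k w"
  unfolding indep_fam_def using sum_coords_eq_0[of k N w I] assms unfolding pluecker_def by blast

text \<open>
  Steinitz exchange: extend the family to a basis of \<open>forms N\<close> by monomials. The indices of the
  monomials that were not added form a nonzero minor, for a combination of the family that
  vanishes at these indices lies in the span of the added monomials.
\<close>
lemma pluecker_nonzero:
  assumes w: "\<And>a. a < k \<Longrightarrow> w a \<in> forms N" and ind: "indep_fam k w"
  obtains I where "I \<subseteq> {..N}" "card I = k" "pluecker N k w I \<noteq> 0"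
proof -
  let ?B = "w ` {..<k}" and ?M = "mono_form N ` {..N}"
  note B = indep_fam_basis[OF ind]
  obtain C where C: "?B \<subseteq> C" "C \<subseteq> ?B \<union> ?M" "bipoly.independent C" "?B \<union> ?M \<subseteq> bipoly.span C"
    using bipoly.maximal_independent_subset_extend[of ?B "?B \<union> ?M"] B(2) by blast
  have Cf: "C \<subseteq> forms N" using C(2) w by auto
  then have fC: "finite C" using C(3) finite_independent_forms by blast
  have "forms N \<subseteq> bipoly.span C" using C(4) bipoly.span_minimal[of ?M "bipoly.span C"] by (simp add: span_mono_form)
  then have cC: "card C = N + 1" using bipoly.basis_card_eq_dim[OF Cf _ C(3)] dim_forms by simp
  define Ic where "Ic = {i. i \<le> N \<and> mono_form N i \<in> C - ?B}"
  have imIc: "mono_form N ` Ic = C - ?B" using C(2) by (auto simp: Ic_def)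
  have "card Ic = card (C - ?B)" unfolding imIc[symmetric]
    by (rule card_image[symmetric]) (rule inj_on_subset[OF inj_mono_form], auto simp: Ic_def)
  also have "\<dots> = N + 1 - k" using card_Diff_subset[of ?B C] C(1) cC card_image[OF B(1)] by simp
  finally have cIc: "card Ic = N + 1 - k" .
  have kN: "k \<le> N + 1" using card_mono[OF fC C(1)] cC card_image[OF B(1)] by simp
  define I where "I = {..N} - Ic"
  have sub: "Ic \<subseteq> {..N}" by (auto simp: Ic_def)
  then have cI: "card I = k" unfolding I_def using card_Diff_subset[of Ic "{..N}"] cIc kN finite_subset[OF sub] by simp
  have fI: "finite I" by (simp add: I_def)
  have "pluecker N k w I \<noteq> 0"
  proof
    assume "pluecker N k w I = 0"
    then obtain u a0 where u: "a0 < k" "u a0 \<noteq> 0" "\<forall>b<k. (\<Sum>a<k. u a * coords N (w a) (sorted_list_of_set I ! b)) = 0"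
      unfolding pluecker_def det_eq_0_iff_left by blast
    let ?f = "\<Sum>a<k. smult [:u a:] (w a)"
    have ff: "?f \<in> forms N" by (intro bipoly.subspace_sum subspace_forms bipoly.subspace_scale) (use w in auto)
    have f0: "coords N ?f i = 0" if "i \<in> I" for i
    proof -
      have "i \<in> set (sorted_list_of_set I)" using that fI by simp
      then obtain b where "b < length (sorted_list_of_set I)" and bi: "sorted_list_of_set I ! b = i"
        unfolding in_set_conv_nth by blast
      then have "b < k" using cI by simp
      then show ?thesis using u(3) bi by (auto simp: coords_sum coords_smult)
    qed
    have "?f = (\<Sum>k\<le>N. smult [:coords N ?f k:] (mono_form N k))" by (rule forms_expand[OF ff])
    also have "\<dots> = (\<Sum>k\<in>Ic. smult [:coords N ?f k:] (mono_form N k))"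
      using sub f0 by (intro sum.mono_neutral_right) (auto simp: I_def)
    also have "\<dots> \<in> bipoly.span (C - ?B)"
      unfolding imIc[symmetric] by (intro bipoly.span_sum bipoly.span_scale bipoly.span_base) auto
    finally have "?f \<in> bipoly.span (C - ?B)" .
    moreover have "?f \<in> bipoly.span ?B" by (intro bipoly.span_sum bipoly.span_scale bipoly.span_base) auto
    ultimately have "?f = 0" using bipoly.spans_of_disjoint_parts_meet_trivially[OF C(3) fC C(1)] by blast
    then show False using ind u(1,2) unfolding indep_fam_def by blast
  qed
  then show ?thesis using that[of I] cI by (auto simp: I_def)
qed

lemma remove1_nth_nth:
  assumes "distinct xs" "b < length xs" "c < length xs - 1"
  shows "remove1 (xs ! b) xs ! c = xs ! (if c < b then c else Suc c)"
proof -
  have eq: "xs = take b xs @ xs ! b # drop (Suc b) xs" using assms(2) by (rule id_take_nth_drop)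
  have "xs ! b \<notin> set (take b xs)" using assms(1,2)
    by (subst (asm) eq) auto
  then have "remove1 (xs ! b) xs = take b xs @ drop (Suc b) xs"
    by (subst (2) eq) (simp add: remove1_append)
  then show ?thesis using assms(2,3) by (auto simp: nth_append)
qed

lemma pluecker_expand_last:
  assumes J: "finite J" "card J = Suc k"
  shows "pluecker N (Suc k) (w(k := q)) J =
    (\<Sum>b<Suc k. (-1) ^ (k + b) * coords N q (sorted_list_of_set J ! b) * pluecker N k w (J - {sorted_list_of_set J ! b}))"
proof -
  let ?xs = "sorted_list_of_set J"
  let ?A = "mat (Suc k) (Suc k) (\<lambda>(a, b). coords N ((w(k := q)) a) (?xs ! b))"
  have "det ?A = (\<Sum>b<Suc k. ?A $$ (k, b) * cofactor ?A k b)"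
    by (rule laplace_expansion_row) auto
  also have "\<dots> = (\<Sum>b<Suc k. (-1) ^ (k + b) * coords N q (?xs ! b) * pluecker N k w (J - {?xs ! b}))"
  proof (rule sum.cong[OF refl])
    fix b assume "b \<in> {..<Suc k}"
    then have b: "b < Suc k" by simp
    have "sorted_list_of_set (J - {?xs ! b}) ! c = ?xs ! (if c < b then c else Suc c)" if "c < k" for c
      using remove1_nth_nth[of ?xs b c] that b J by (simp add: sorted_list_of_set_remove)
    then have "mat_delete ?A k b = mat k k (\<lambda>(a, c). coords N (w a) (sorted_list_of_set (J - {?xs ! b}) ! c))"
      unfolding mat_delete_def by (intro eq_matI) auto
    then have "cofactor ?A k b = (-1) ^ (k + b) * pluecker N k w (J - {?xs ! b})"
      unfolding cofactor_def pluecker_def by simp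
    then show "?A $$ (k, b) * cofactor ?A k b = (-1) ^ (k + b) * coords N q (?xs ! b) * pluecker N k w (J - {?xs ! b})"
      using b by simp
  qed
  finally show ?thesis unfolding pluecker_def .
qed

definition pluecker_index :: "nat \<Rightarrow> nat \<Rightarrow> nat set set" where
  "pluecker_index N k = {I. I \<subseteq> {..N} \<and> card I = k}"

text \<open>
  Membership of a vector in a subspace, expressed in the Pluecker coordinates \<open>y\<close> of the subspace:
  the maximal minors of the matrix enlarged by one row, expanded along that row.
\<close>
definition incident :: "nat \<Rightarrow> nat \<Rightarrow> (nat set \<Rightarrow> complex) \<Rightarrow> complex poly \<Rightarrow> bool" where
  "incident N k y p \<longleftrightarrow> (\<forall>J\<in>pluecker_index N (Suc k).
     (\<Sum>b<Suc k. (-1) ^ (k + b) * coeff p (sorted_list_of_set J ! b) * y (J - {sorted_list_of_set J ! b})) = 0)"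

definition pluecker_coords :: "nat \<Rightarrow> nat \<Rightarrow> bipoly set \<Rightarrow> (nat set \<Rightarrow> complex) set" where
  "pluecker_coords N k W = {pluecker N k w | w. bipoly.span (w ` {..<k}) = W}"

lemma pluecker_coordsE:
  assumes "H \<in> Gr N k" "z \<in> pluecker_coords N k H"
  obtains w where "z = pluecker N k w" "bipoly.span (w ` {..<k}) = H" "indep_fam k w" "\<And>a. a < k \<Longrightarrow> w a \<in> H"
proof -
  obtain w where w: "z = pluecker N k w" "bipoly.span (w ` {..<k}) = H" using assms(2) unfolding pluecker_coords_def by blast
  have "indep_fam k w" using assms(1) w(2) by (intro indep_fam_of_dim) (simp add: Gr_def)
  moreover have "\<And>a. a < k \<Longrightarrow> w a \<in> H" unfolding w(2)[symmetric] by (intro bipoly.span_base) auto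
  ultimately show ?thesis using that w by blast
qed

lemma incident_iff:
  assumes H: "H \<in> Gr N k" and z: "z \<in> pluecker_coords N k H" and p: "degree p \<le> N"
  shows "incident N k z p \<longleftrightarrow> homog N p \<in> H"
proof -
  obtain w where w: "z = pluecker N k w" "bipoly.span (w ` {..<k}) = H" "indep_fam k w" "\<And>a. a < k \<Longrightarrow> w a \<in> H"
    using pluecker_coordsE[OF H z] by blast
  let ?q = "homog N p" and ?w = "w(k := homog N p)"
  have HF: "H \<subseteq> forms N" "bipoly.subspace H" using H by (auto simp: Gr_def)
  have "incident N k z p \<longleftrightarrow> (\<forall>J\<in>pluecker_index N (Suc k). pluecker N (Suc k) ?w J = 0)"
    unfolding incident_def w(1)
  proof (intro ball_cong refl)
    fix J assume J: "J \<in> pluecker_index N (Suc k)"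
    then have fJ: "finite J" "card J = Suc k" "J \<subseteq> {..N}" by (auto simp: pluecker_index_def finite_subset)
    have "coords N ?q (sorted_list_of_set J ! b) = coeff p (sorted_list_of_set J ! b)" if "b < Suc k" for b
      using sorted_list_of_set_nth_mem[OF fJ(1), of b] that fJ by (intro coords_homog) auto
    then have "pluecker N (Suc k) ?w J = (\<Sum>b<Suc k. (-1) ^ (k + b) * coeff p (sorted_list_of_set J ! b) * pluecker N k w (J - {sorted_list_of_set J ! b}))"
      unfolding pluecker_expand_last[OF fJ(1,2)] by (intro sum.cong) auto
    then show "((\<Sum>b<Suc k. (-1) ^ (k + b) * coeff p (sorted_list_of_set J ! b) * pluecker N k w (J - {sorted_list_of_set J ! b})) = 0)
       \<longleftrightarrow> pluecker N (Suc k) ?w J = 0" by simp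
  qed
  also have "\<dots> \<longleftrightarrow> \<not> indep_fam (Suc k) ?w"
  proof
    assume a: "\<forall>J\<in>pluecker_index N (Suc k). pluecker N (Suc k) ?w J = 0"
    show "\<not> indep_fam (Suc k) ?w"
    proof
      assume ind: "indep_fam (Suc k) ?w"
      have "\<And>a. a < Suc k \<Longrightarrow> ?w a \<in> forms N" using w(4) HF by (auto simp: less_Suc_eq)
      from pluecker_nonzero[OF this ind] show False using a unfolding pluecker_index_def by blast
    qed
  next
    assume "\<not> indep_fam (Suc k) ?w"
    moreover have "finite J" "card J = Suc k" if "J \<in> pluecker_index N (Suc k)" for J
      using that by (auto simp: pluecker_index_def finite_subset)
    ultimately show "\<forall>J\<in>pluecker_index N (Suc k). pluecker N (Suc k) ?w J = 0"
      using indep_fam_of_pluecker[of N "Suc k" ?w] by blast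
  qed
  also have "\<dots> \<longleftrightarrow> ?q \<in> H"
  proof
    assume "?q \<in> H"
    then have "?q \<in> bipoly.span (w ` {..<k})" using w(2) by simp
    moreover have "?w ` {..<Suc k} = insert ?q (w ` {..<k})"
      by (auto simp: lessThan_Suc)
    ultimately have "bipoly.span (?w ` {..<Suc k}) = H" using w(2) by (simp add: bipoly.span_redundant)
    then have "bipoly.dim (bipoly.span (?w ` {..<Suc k})) = k" using H by (simp add: Gr_def)
    then show "\<not> indep_fam (Suc k) ?w" using indep_fam_dim[of "Suc k" ?w] by auto
  next
    assume "\<not> indep_fam (Suc k) ?w"
    then obtain u a where u: "(\<Sum>i<Suc k. smult [:u i:] (?w i)) = 0" "a < Suc k" "u a \<noteq> 0" unfolding indep_fam_def by blast
    have s: "(\<Sum>i<k. smult [:u i:] (w i)) + smult [:u k:] ?q = 0" using u(1) by simp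
    have "u k \<noteq> 0"
    proof
      assume "u k = 0"
      then have "(\<Sum>i<k. smult [:u i:] (w i)) = 0" using s by simp
      then show False using w(3) u(2,3) \<open>u k = 0\<close> unfolding indep_fam_def by (metis less_SucE)
    qed
    have "smult [:u k:] ?q = - (\<Sum>i<k. smult [:u i:] (w i))" using s by (simp add: eq_neg_iff_add_eq_0 add.commute)
    also have "\<dots> \<in> H" using w(4) HF(2)
      by (intro bipoly.subspace_neg bipoly.subspace_sum bipoly.subspace_scale) auto
    finally have inH: "smult [:u k:] ?q \<in> H" .
    have "smult [:inverse (u k):] (smult [:u k:] ?q) \<in> H" by (rule bipoly.subspace_scale[OF HF(2) inH])
    then show "?q \<in> H" using \<open>u k \<noteq> 0\<close> by (simp add: one_pCons[symmetric])
  qed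
  finally show ?thesis .
qed

lemma closed_cond_incident:
  assumes "\<And>c. c \<le> N \<Longrightarrow> multihom (pluecker_index N k) m 0 dl (\<lambda>y v. coeff (f v) c)"
  shows "closed_cond (pluecker_index N k) m (\<lambda>y v. incident N k y (f v))"
  unfolding incident_def
proof (intro closed_cond_all)
  fix J assume J: "J \<in> pluecker_index N (Suc k)"
  then have fJ: "finite J" "card J = Suc k" "J \<subseteq> {..N}" by (auto simp: pluecker_index_def finite_subset)
  have "multihom (pluecker_index N k) m (0 + 1) (\<lambda>l. dl l + 0)
     (\<lambda>y v. ((-1) ^ (k + b) * coeff (f v) (sorted_list_of_set J ! b)) * y (J - {sorted_list_of_set J ! b}))" if "b < Suc k" for b
  proof (intro multihom.mult multihom_cmult multihom.yvar)
    have m: "sorted_list_of_set J ! b \<in> J" using sorted_list_of_set_nth_mem[OF fJ(1), of b] that fJ by simp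
    then show "multihom (pluecker_index N k) m 0 dl (\<lambda>y v. coeff (f v) (sorted_list_of_set J ! b))" using fJ(3) by (intro assms) auto
    show "J - {sorted_list_of_set J ! b} \<in> pluecker_index N k" using m fJ by (auto simp: pluecker_index_def)
  qed
  then show "closed_cond (pluecker_index N k) m (\<lambda>y v. (\<Sum>b<Suc k. (-1) ^ (k + b) * coeff (f v) (sorted_list_of_set J ! b) * y (J - {sorted_list_of_set J ! b})) = 0)"
    by (intro closed_cond_eq_0 multihom_sum) auto
qed

lemma zariski_Gr_alt: "zariski_Gr N k = zariski (pluecker_index N k) (pluecker_coords N k) (Gr N k)"
  unfolding zariski_Gr_def pluecker_index_def pluecker_coords_def ..

lemma pluecker_coords_nonempty: assumes "W \<in> Gr N k" shows "pluecker_coords N k W \<noteq> {}"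
proof -
  obtain B where B: "B \<subseteq> W" "bipoly.independent B" "W \<subseteq> bipoly.span B" "card B = bipoly.dim W"
    using bipoly.basis_exists by blast
  have W: "W \<subseteq> forms N" "bipoly.subspace W" "bipoly.dim W = k" using assms by (auto simp: Gr_def)
  have "finite B" using B W finite_independent_forms by blast
  then obtain w where "bij_betw w {0..<k} B" using ex_bij_betw_nat_finite B(4) W(3) by metis
  then have "w ` {..<k} = B" by (auto simp: bij_betw_def lessThan_atLeast0)
  moreover have "bipoly.span B = W" using B W bipoly.span_minimal by blast
  ultimately show ?thesis unfolding pluecker_coords_def by blast
qed

lemma topspace_zariski_Gr: "topspace (zariski_Gr N k) = Gr N k"
  unfolding zariski_Gr_alt by (rule topspace_zariski) (rule pluecker_coords_nonempty)

lemma pluecker_index_nonempty: "k \<le> N + 1 \<Longrightarrow> pluecker_index N k \<noteq> {}"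
proof -
  assume "k \<le> N + 1"
  then have "{..<k} \<in> pluecker_index N k" by (auto simp: pluecker_index_def)
  then show ?thesis by blast
qed

text \<open>
  A property of subspaces that is a closed condition on Pluecker coordinates passes to the
  closure.
\<close>
lemma closure_of_Gr_subset:
  assumes C: "closed_cond (pluecker_index N k) 0 C" and k: "k \<le> N + 1"
    and K: "\<And>H z v. H \<in> Gr N k \<Longrightarrow> z \<in> pluecker_coords N k H \<Longrightarrow> C z v \<longleftrightarrow> K H"
    and S: "S \<subseteq> {H \<in> Gr N k. K H}"
  shows "zariski_Gr N k closure_of S \<subseteq> {H \<in> Gr N k. K H}"
proof (rule closure_of_minimal[OF S])
  obtain \<H> where H: "\<And>F. F \<in> \<H> \<Longrightarrow> \<exists>e. hom_poly (pluecker_index N k) e F" "\<And>y v. C y v \<longleftrightarrow> (\<forall>H\<in>\<H>. H y = 0)"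
    using closed_cond_no_lines[OF C pluecker_index_nonempty[OF k]] by blast
  have "{H \<in> Gr N k. K H} = {p \<in> Gr N k. \<forall>z \<in> pluecker_coords N k p. \<forall>H\<in>\<H>. H z = 0}"
  proof (rule Collect_cong, rule conj_cong[OF refl])
    fix H assume HG: "H \<in> Gr N k"
    obtain z0 where "z0 \<in> pluecker_coords N k H" using pluecker_coords_nonempty[OF HG] by blast
    moreover have "\<forall>z\<in>pluecker_coords N k H. K H \<longleftrightarrow> (\<forall>F\<in>\<H>. F z = 0)"
      using K[OF HG] H(2) by metis
    ultimately show "K H \<longleftrightarrow> (\<forall>z\<in>pluecker_coords N k H. \<forall>F\<in>\<H>. F z = 0)" by blast
  qed
  then show "closedin (zariski_Gr N k) {H \<in> Gr N k. K H}"
    unfolding zariski_Gr_alt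
    using closedin_zariski[where hc = "pluecker_coords N k", OF pluecker_coords_nonempty H(1)] by simp
qed

text \<open>A polynomial whose coefficients depend polynomially on a parameter.\<close>
definition poly_curve :: "(complex \<Rightarrow> complex poly) \<Rightarrow> bool" where
  "poly_curve q \<longleftrightarrow> (\<forall>c. poly_fun (\<lambda>t. coeff (q t) c))"

lemma poly_fun_det:
  assumes "\<And>i c. i < n \<Longrightarrow> c < n \<Longrightarrow> poly_fun (\<lambda>t. M i c t)"
  shows "poly_fun (\<lambda>t. det (mat n n (\<lambda>(i, c). M i c t)))"
proof -
  have "det (mat n n (\<lambda>(i, c). M i c t)) =
      (\<Sum>p\<in>{p. p permutes {0..<n}}. signof p * (\<Prod>i<n. M i (p i) t))" for t
  proof -
    have "det (mat n n (\<lambda>(i, c). M i c t)) = (\<Sum>p\<in>{p. p permutes {0..<n}}. signof p * (\<Prod>i = 0..<n. mat n n (\<lambda>(i, c). M i c t) $$ (i, p i)))"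
      by (simp add: det_def)
    also have "\<dots> = (\<Sum>p\<in>{p. p permutes {0..<n}}. signof p * (\<Prod>i<n. M i (p i) t))"
    proof (intro sum.cong arg_cong2[of _ _ _ _ "(*)"] refl prod.cong)
      fix p i assume p: "p \<in> {p. p permutes {0..<n}}" and i: "i \<in> {..<n}"
      have "p i < n" using p i permutes_in_image[of p "{0..<n}" i] by simp
      then show "mat n n (\<lambda>(i, c). M i c t) $$ (i, p i) = M i (p i) t" using i by simp
    qed (simp add: lessThan_atLeast0)
    finally show ?thesis .
  qed
  moreover have "poly_fun (\<lambda>t. \<Sum>p\<in>{p. p permutes {0..<n}}. signof p * (\<Prod>i<n. M i (p i) t))"
    by (intro poly_fun_sum poly_fun_mult poly_fun_const poly_fun_prod assms)
       (auto simp: permutes_in_image[of _ "{0..<n}", simplified])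
  ultimately show ?thesis by simp
qed

text \<open>
  Division by \<open>q 0\<close>, cut off at degree \<open>j\<close>, recovers \<open>c\<close> from \<open>q 0 \<cdot> c\<close>. Adding \<open>q t - q 0\<close> times
  this quotient is a linear map \<open>A t\<close> with polynomial dependence on \<open>t\<close>; it is the identity at
  \<open>t = 0\<close>, and it carries \<open>q 0 \<cdot> c\<close> to \<open>q t \<cdot> c\<close>. The images of \<open>H\<close> under \<open>A t\<close> form a curve
  through \<open>H\<close>, of constant dimension up to finitely many \<open>t\<close>, whose members contain the multiples
  of \<open>q t\<close>.
\<close>
lemma in_closure_of_Gr_by_moving_factor:
  assumes q: "poly_curve q" "\<And>t. degree (q t) + j \<le> N" "q 0 \<noteq> 0"
    and H: "H \<in> Gr N k" "\<And>c. degree c \<le> j \<Longrightarrow> homog N (q 0 * c) \<in> H"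
    and S: "finite {t. \<not> (\<forall>H'\<in>Gr N k. (\<forall>c. degree c \<le> j \<longrightarrow> homog N (q t * c) \<in> H') \<longrightarrow> H' \<in> S)}"
  shows "H \<in> zariski_Gr N k closure_of S"
proof -
  define pr where "pr f = poly_cutoff (Suc j) (dehom f div q 0)" for f
  define A where "A t f = f + homog N ((q t - q 0) * pr f)" for t f
  have degpr: "degree (pr f) \<le> j" for f
    unfolding pr_def by (intro degree_le) (simp add: coeff_poly_cutoff)
  have pr_add: "pr (f + g) = pr f + pr g" for f g
    by (rule poly_eqI) (simp add: pr_def coeff_poly_cutoff dehom_add poly_div_add_left)
  have pr_smult: "pr (smult [:c:] f) = smult c (pr f)" for c f
    by (rule poly_eqI) (simp add: pr_def coeff_poly_cutoff dehom_smult div_smult_left)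
  have pr_q: "pr (homog N (q 0 * c)) = c" if "degree c \<le> j" for c
  proof -
    have "degree (q 0 * c) \<le> N" using degree_mult_le[of "q 0" c] q(2)[of 0] that by linarith
    then have "dehom (homog N (q 0 * c)) div q 0 = c" using q(3) by (simp add: dehom_homog)
    then show ?thesis using that by (intro poly_eqI) (auto simp: pr_def coeff_poly_cutoff coeff_eq_0)
  qed
  have A0: "A 0 f = f" for f by (simp add: A_def)
  have A_add: "A t (f + g) = A t f + A t g" for t f g
    by (simp only: A_def pr_add distrib_left homog_add add_ac)
  have A_smult: "A t (smult [:c:] f) = smult [:c:] (A t f)" for t c f
    by (simp add: A_def pr_smult homog_smult smult_add_right)
  have A_lin: "Vector_Spaces.linear scale_form scale_form (A t)" for t
    by unfold_locales (simp_all add: A_add A_smult)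
  have A_q: "A t (homog N (q 0 * c)) = homog N (q t * c)" if "degree c \<le> j" for t c
    unfolding A_def pr_q[OF that] homog_add[symmetric] by (simp add: algebra_simps)
  have HF: "H \<subseteq> forms N" using H(1) by (auto simp: Gr_def)
  have A_forms: "A t f \<in> forms N" if "f \<in> forms N" for t f
    unfolding A_def by (rule bipoly.subspace_add[OF subspace_forms that homog_forms])
  have coordsA: "poly_fun (\<lambda>t. coords N (A t f) i)" if "i \<le> N" for f i
  proof -
    have "coords N (A t f) i = coords N f i + (\<Sum>l\<le>i. (coeff (q t) l - coeff (q 0) l) * coeff (pr f) (i - l))" for t
      using that by (simp add: A_def coords_add coords_homog coeff_mult)
    moreover have "poly_fun (\<lambda>t. coords N f i + (\<Sum>l\<le>i. (coeff (q t) l - coeff (q 0) l) * coeff (pr f) (i - l)))"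
      using q(1) unfolding poly_curve_def
      by (intro poly_fun_add poly_fun_sum poly_fun_mult poly_fun_diff poly_fun_const) auto
    ultimately show ?thesis by simp
  qed
  have curve: "\<exists>z. (\<forall>I\<in>pluecker_index N k. poly_fun (\<lambda>t. z t I)) \<and> (\<forall>I\<in>pluecker_index N k. z 0 I = z0 I) \<and>
       finite {t. \<not> (A t ` H \<in> Gr N k \<and> z t \<in> pluecker_coords N k (A t ` H))}" if z0: "z0 \<in> pluecker_coords N k H" for z0
  proof -
    obtain w where w: "z0 = pluecker N k w" "bipoly.span (w ` {..<k}) = H" "indep_fam k w" "\<And>a. a < k \<Longrightarrow> w a \<in> H"
      using pluecker_coordsE[OF H(1) z0] by blast
    have wF: "\<And>a. a < k \<Longrightarrow> w a \<in> forms N" using w(4) HF by blast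
    define z where "z t = pluecker N k (\<lambda>a. A t (w a))" for t
    have pz: "poly_fun (\<lambda>t. z t I)" if I: "I \<in> pluecker_index N k" for I
    proof -
      have fI: "finite I" "card I = k" "I \<subseteq> {..N}" using I by (auto simp: pluecker_index_def finite_subset)
      have "sorted_list_of_set I ! b \<le> N" if "b < k" for b
        using sorted_list_of_set_nth_mem[OF fI(1), of b] that fI by auto
      then show ?thesis unfolding z_def pluecker_def by (intro poly_fun_det coordsA) auto
    qed
    \<comment> \<open>one Pluecker coordinate that does not vanish at \<open>t = 0\<close> bounds the bad parameters\<close>
    obtain I0 where I0: "I0 \<subseteq> {..N}" "card I0 = k" "pluecker N k w I0 \<noteq> 0" using pluecker_nonzero[OF wF w(3)] by blast
    have "z 0 I0 \<noteq> 0" using I0(3) by (simp add: z_def A0)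
    then have fin: "finite {t. z t I0 = 0}" using finite_zeros_poly_fun[OF pz] I0 by (auto simp: pluecker_index_def)
    have "A t ` H \<in> Gr N k \<and> z t \<in> pluecker_coords N k (A t ` H)" if "z t I0 \<noteq> 0" for t
    proof -
      interpret A: Vector_Spaces.linear scale_form scale_form "A t"
        by (rule A_lin)
      have im: "(\<lambda>a. A t (w a)) ` {..<k} = A t ` w ` {..<k}" by (simp add: image_image)
      have sp: "bipoly.span ((\<lambda>a. A t (w a)) ` {..<k}) = A t ` H" unfolding im A.span_image w(2) ..
      have "indep_fam k (\<lambda>a. A t (w a))"
        using indep_fam_of_pluecker[of N k _ I0] that I0 finite_subset[OF I0(1)] unfolding z_def by auto
      from indep_fam_dim[OF this] have "bipoly.dim (A t ` H) = k" unfolding sp .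
      moreover have "bipoly.subspace (A t ` H)" unfolding sp[symmetric] by simp
      moreover have "A t ` H \<subseteq> forms N" using HF A_forms by auto
      ultimately show ?thesis using sp unfolding Gr_def pluecker_coords_def z_def by blast
    qed
    then have "finite {t. \<not> (A t ` H \<in> Gr N k \<and> z t \<in> pluecker_coords N k (A t ` H))}"
      by (intro finite_subset[OF _ fin]) auto
    then show ?thesis using pz w(1) by (intro exI[of _ z]) (simp add: z_def A0)
  qed
  have HA0: "A 0 ` H = H" by (simp add: A0)
  obtain z0 where "z0 \<in> pluecker_coords N k H" using pluecker_coords_nonempty[OF H(1)] by blast
  then have finG: "finite {t. A t ` H \<notin> Gr N k}" using curve[of z0] by (auto elim!: rev_finite_subset)
  have "A t ` H \<in> S" if "A t ` H \<in> Gr N k" "\<forall>H'\<in>Gr N k. (\<forall>c. degree c \<le> j \<longrightarrow> homog N (q t * c) \<in> H') \<longrightarrow> H' \<in> S" for t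
  proof -
    have "\<forall>c. degree c \<le> j \<longrightarrow> homog N (q t * c) \<in> A t ` H" using A_q H(2) by (metis image_eqI)
    then show ?thesis using that by blast
  qed
  then have "{t. A t ` H \<notin> S} \<subseteq> {t. A t ` H \<notin> Gr N k} \<union>
     {t. \<not> (\<forall>H'\<in>Gr N k. (\<forall>c. degree c \<le> j \<longrightarrow> homog N (q t * c) \<in> H') \<longrightarrow> H' \<in> S)}" by blast
  then have finS: "finite {t. A t ` H \<notin> S}" using finG S finite_subset by blast
  have "A 0 ` H \<in> zariski_Gr N k closure_of S"
    unfolding zariski_Gr_alt
    by (rule in_closure_of_curve[where p = "\<lambda>t. A t ` H"])
       (use H(1) curve finS topspace_zariski_Gr zariski_Gr_alt in \<open>auto simp: HA0\<close>)
  then show ?thesis by (simp add: HA0)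
qed

section \<open>Points of projective space\<close>

lemma span_single: "bipoly.span {f} = {smult [:c:] f | c. True}"
  by (auto simp: bipoly.span_singleton)

lemma point_in_Gr: assumes "f \<in> forms N" "f \<noteq> 0" shows "bipoly.span {f} \<in> Gr N 1"
proof -
  have "bipoly.span {f} \<subseteq> forms N" using assms by (intro bipoly.span_minimal subspace_forms) auto
  moreover have "bipoly.dim (bipoly.span {f}) = 1"
    using bipoly.dim_span_eq_card_independent[of "{f}"] assms by simp
  ultimately show ?thesis by (simp add: Gr_def)
qed

lemma point_of_Gr: assumes "x \<in> Gr N 1" obtains f where "f \<in> forms N" "f \<noteq> 0" "x = bipoly.span {f}"
proof -
  obtain B where B: "B \<subseteq> x" "bipoly.independent B" "x \<subseteq> bipoly.span B" "card B = bipoly.dim x"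
    using bipoly.basis_exists by blast
  have x: "x \<subseteq> forms N" "bipoly.subspace x" "bipoly.dim x = 1" using assms by (auto simp: Gr_def)
  obtain f where f: "B = {f}" using B(4) x(3) card_1_singletonE by metis
  have "f \<noteq> 0" using B(2) f by auto
  moreover have "x = bipoly.span {f}" using B f x bipoly.span_minimal by blast
  ultimately show ?thesis using that B f x by blast
qed

lemma topspace_zariski_proj: "topspace (zariski_proj N) = Gr N 1"
  unfolding zariski_proj_def
proof (rule topspace_zariski)
  fix x assume "x \<in> Gr N 1"
  then obtain f where "f \<noteq> 0" "x = bipoly.span {f}" using point_of_Gr by metis
  then show "coords N ` (x - {0}) \<noteq> {}" using bipoly.span_base[of f "{f}"] by blast
qed

lemma coords_nonzero: "f \<in> forms N \<Longrightarrow> f \<noteq> 0 \<Longrightarrow> \<exists>i\<le>N. coords N f i \<noteq> 0"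
  using forms_eqI[of f N 0] subspace_forms bipoly.subspace_0 by (metis coords_0)

lemma point_curve:
  assumes f: "\<And>t. f t \<in> forms N" "\<And>i. i \<le> N \<Longrightarrow> poly_fun (\<lambda>t. coords N (f t) i)" "f s \<noteq> 0"
    and z0: "z0 \<in> coords N ` (bipoly.span {f s} - {0})"
  shows "\<exists>z. (\<forall>i\<in>{..N}. poly_fun (\<lambda>t. z t i)) \<and> (\<forall>i\<in>{..N}. z s i = z0 i) \<and>
       finite {t. \<not> (bipoly.span {f t} \<in> Gr N 1 \<and> z t \<in> coords N ` (bipoly.span {f t} - {0}))}"
proof -
  obtain x where x: "x \<in> bipoly.span {f s}" "x \<noteq> 0" "z0 = coords N x" using z0 by blast
  obtain c where "x = smult [:c:] (f s)" using x(1) by (auto simp: span_single)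
  then have c: "z0 = coords N (smult [:c:] (f s))" "smult [:c:] (f s) \<noteq> 0" using x by simp_all
  define z where "z t = coords N (smult [:c:] (f t))" for t
  have pz: "poly_fun (\<lambda>t. z t i)" if "i \<le> N" for i
    using f(2)[OF that] by (simp add: z_def coords_smult poly_fun_mult)
  obtain i where i: "i \<le> N" "coords N (f s) i \<noteq> 0" using coords_nonzero[OF f(1,3)] by blast
  have fin: "finite {t. coords N (f t) i = 0}" by (rule finite_zeros_poly_fun[OF f(2)]) (use i in auto)
  have "bipoly.span {f t} \<in> Gr N 1 \<and> z t \<in> coords N ` (bipoly.span {f t} - {0})" if "coords N (f t) i \<noteq> 0" for t
  proof -
    have nz: "f t \<noteq> 0" using that by (auto simp: coords_0)
    have "c \<noteq> 0" using c(2) by auto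
    then have "smult [:c:] (f t) \<in> bipoly.span {f t} - {0}" using nz by (auto simp: span_single)
    then show ?thesis using point_in_Gr[OF f(1) nz] unfolding z_def by blast
  qed
  then have "finite {t. \<not> (bipoly.span {f t} \<in> Gr N 1 \<and> z t \<in> coords N ` (bipoly.span {f t} - {0}))}"
    by (intro finite_subset[OF _ fin]) auto
  then show ?thesis using pz by (intro exI[of _ z]) (auto simp: z_def c(1))
qed

lemma in_closure_of_proj_curve:
  assumes f: "\<And>t. f t \<in> forms N" "\<And>i. i \<le> N \<Longrightarrow> poly_fun (\<lambda>t. coords N (f t) i)" "f s \<noteq> 0"
    and S: "finite {t. bipoly.span {f t} \<notin> S}"
  shows "bipoly.span {f s} \<in> zariski_proj N closure_of S"
  unfolding zariski_proj_def
proof (rule in_closure_of_curve[where p = "\<lambda>t. bipoly.span {f t}", OF _ _ S])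
  show "bipoly.span {f s} \<in> topspace (zariski {..N} (\<lambda>x. coords N ` (x - {0})) (Gr N 1))"
    using topspace_zariski_proj point_in_Gr[OF f(1,3)] unfolding zariski_proj_def by simp
qed (use point_curve[OF f] in blast)

section \<open>Apolarity in coordinates\<close>

text \<open>
  With the factorials, differentiation becomes a pure shift of the index. Entries beyond \<open>d\<close> are
  irrelevant and set to zero.
\<close>
definition apolar_seq :: "nat \<Rightarrow> bipoly \<Rightarrow> nat \<Rightarrow> complex" where
  "apolar_seq d f k = (if k \<le> d then fact k * fact (d - k) * coords d f k else 0)"

lemma coeff_partial_x_pow:
  "fact l * coeff (coeff ((partial_x ^^ i) f) k) l = fact (l + i) * coeff (coeff f k) (l + i)"
proof (induction i arbitrary: l)
  case (Suc i)
  have "fact l * coeff (coeff ((partial_x ^^ Suc i) f) k) l = fact (Suc l) * coeff (coeff ((partial_x ^^ i) f) k) (Suc l)"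
    by (simp add: partial_x_def coeff_map_poly coeff_pderiv algebra_simps)
  then show ?case using Suc[of "Suc l"] by (simp add: mult_ac)
qed simp

lemma coeff_partial_y_pow:
  "fact m * coeff (coeff ((partial_y ^^ k) f) m) l = fact (m + k) * coeff (coeff f (m + k)) l"
proof (induction k arbitrary: m)
  case (Suc k)
  have "fact m * coeff (coeff ((partial_y ^^ Suc k) f) m) l = fact (Suc m) * coeff (coeff ((partial_y ^^ k) f) (Suc m)) l"
    by (simp add: partial_y_def coeff_pderiv of_nat_poly algebra_simps)
  then show ?case using Suc[of "Suc m"] by (simp add: mult_ac)
qed simp

lemma apply_diff_form:
  assumes g: "g \<in> forms s"
  shows "apply_diff g f = (\<Sum>k\<le>s. smult [:coords s g k:] ((partial_x ^^ (s - k)) ((partial_y ^^ k) f)))"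
proof -
  have inner: "(\<Sum>i\<le>degree (coeff g k). smult [:coeff (coeff g k) i:] ((partial_x ^^ i) ((partial_y ^^ k) f))) =
      smult [:coords s g k:] ((partial_x ^^ (s - k)) ((partial_y ^^ k) f))" if "k \<le> s" for k
  proof (cases "coords s g k = 0")
    case True
    then show ?thesis using formsD[OF g, of k] that by simp
  next
    case False
    then have "coeff g k = monom (coords s g k) (s - k)" "degree (coeff g k) = s - k"
      using formsD[OF g, of k] that by (simp_all add: degree_monom_eq)
    then have "(\<Sum>i\<le>degree (coeff g k). smult [:coeff (coeff g k) i:] ((partial_x ^^ i) ((partial_y ^^ k) f))) =
      (\<Sum>i\<le>s - k. if i = s - k then smult [:coords s g k:] ((partial_x ^^ i) ((partial_y ^^ k) f)) else 0)"
      by (intro sum.cong) auto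
    then show ?thesis by simp
  qed
  have dg: "degree g \<le> s" by (rule degree_le) (simp add: formsD[OF g])
  have "apply_diff g f = (\<Sum>k\<le>s. \<Sum>i\<le>degree (coeff g k). smult [:coeff (coeff g k) i:] ((partial_x ^^ i) ((partial_y ^^ k) f)))"
    unfolding apply_diff_def using dg by (intro sum.mono_neutral_left) (auto simp: coeff_eq_0)
  then show ?thesis using inner by simp
qed

text \<open>
  In these coordinates \<open>g(f)\<close> is the contraction of the sequence of \<open>f\<close> by the polynomial of \<open>g\<close>.
\<close>
lemma coeff_apply_diff:
  assumes g: "g \<in> forms s" and f: "f \<in> forms d" and s: "s \<le> d"
  shows "fact m * fact l * coeff (coeff (apply_diff g f) m) l = (if m + l + s = d then act (dehom g) (apolar_seq d f) m else 0)"
proof -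
  have tm: "fact m * fact l * coeff (coeff ((partial_x ^^ (s - k)) ((partial_y ^^ k) f)) m) l =
      (if m + l + s = d then apolar_seq d f (m + k) else 0)" if k: "k \<le> s" for k
  proof -
    have "fact m * fact l * coeff (coeff ((partial_x ^^ (s - k)) ((partial_y ^^ k) f)) m) l =
       fact (l + (s - k)) * (fact m * coeff (coeff ((partial_y ^^ k) f) m) (l + (s - k)))"
      using coeff_partial_x_pow[of l "s - k" "(partial_y ^^ k) f" m] by (simp add: mult_ac)
    also have "\<dots> = fact (l + (s - k)) * fact (m + k) * coeff (coeff f (m + k)) (l + (s - k))"
      using coeff_partial_y_pow[of m k f "l + (s - k)"] by (simp add: mult_ac)
    also have "\<dots> = (if m + l + s = d then apolar_seq d f (m + k) else 0)"
    proof (cases "m + l + s = d")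
      case True
      then have "d - (m + k) = l + (s - k)" "m + k \<le> d" using k by auto
      then show ?thesis using True by (simp add: apolar_seq_def coords_def mult_ac)
    next
      case False
      then have "coeff (coeff f (m + k)) (l + (s - k)) = 0" using f k unfolding forms_def
        by (smt (verit, best) add.assoc add.commute le_add_diff_inverse mem_Collect_eq)
      then show ?thesis using False by simp
    qed
    finally show ?thesis .
  qed
  have "fact m * fact l * coeff (coeff (apply_diff g f) m) l =
     (\<Sum>k\<le>s. coords s g k * (fact m * fact l * coeff (coeff ((partial_x ^^ (s - k)) ((partial_y ^^ k) f)) m) l))"
    unfolding apply_diff_form[OF g] by (simp add: coeff_sum sum_distrib_left mult_ac)
  also have "\<dots> = (\<Sum>k\<le>s. coords s g k * (if m + l + s = d then apolar_seq d f (m + k) else 0))"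
    by (intro sum.cong) (auto simp: tm)
  also have "\<dots> = (if m + l + s = d then act (dehom g) (apolar_seq d f) m else 0)"
    unfolding act_bound[OF degree_dehom[OF g]] using coeff_dehom_forms[OF g] by (auto simp: add.commute intro!: sum.cong)
  finally show ?thesis .
qed

lemma apply_diff_in_forms:
  assumes "g \<in> forms s" "f \<in> forms d" "s \<le> d"
  shows "apply_diff g f \<in> forms (d - s)"
proof -
  have "l + m = d - s" if "coeff (coeff (apply_diff g f) m) l \<noteq> 0" for m l
  proof -
    have "fact m * fact l * coeff (coeff (apply_diff g f) m) l \<noteq> 0" using that by simp
    then have "m + l + s = d" using coeff_apply_diff[OF assms, of m l] by (auto split: if_splits)
    then show ?thesis by simp
  qed
  then show ?thesis unfolding forms_def by blast
qed

lemma coords_apply_diff: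
  assumes "g \<in> forms s" "f \<in> forms d" "s \<le> d" "m + s \<le> d"
  shows "fact m * fact (d - s - m) * coords (d - s) (apply_diff g f) m = act (dehom g) (apolar_seq d f) m"
  using coeff_apply_diff[OF assms(1-3), of m "d - s - m"] assms(4) by (simp add: coords_def)

lemma apply_diff_eq_0_iff:
  assumes "g \<in> forms s" "f \<in> forms d" "s \<le> d"
  shows "apply_diff g f = 0 \<longleftrightarrow> annih d s (dehom g) (apolar_seq d f)"
proof
  assume "apply_diff g f = 0"
  then show "annih d s (dehom g) (apolar_seq d f)" unfolding annih_def
    using coords_apply_diff[OF assms] by (auto simp: coords_0)
next
  assume a: "annih d s (dehom g) (apolar_seq d f)"
  show "apply_diff g f = 0"
  proof (rule forms_eqI[OF apply_diff_in_forms[OF assms]])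
    show "0 \<in> forms (d - s)" using subspace_forms bipoly.subspace_0 by blast
    fix m assume m: "m \<le> d - s"
    then have "fact m * fact (d - s - m) * coords (d - s) (apply_diff g f) m = 0"
      using coords_apply_diff[OF assms, of m] a assms(3) by (auto simp: annih_def)
    then show "coords (d - s) (apply_diff g f) m = coords (d - s) 0 m" by (simp add: coords_0)
  qed
qed

lemma apolar_seq_smult: "apolar_seq d (smult [:c:] f) = (\<lambda>k. c * apolar_seq d f k)"
  by (rule ext) (simp add: apolar_seq_def coords_smult)

lemma apolar_map_span:
  assumes "f \<in> forms d" "s \<le> d"
  shows "apolar_map s (bipoly.span {f}) = {g \<in> forms s. annih d s (dehom g) (apolar_seq d f)}"
proof -
  have "(\<forall>h\<in>bipoly.span {f}. apply_diff g h = 0) \<longleftrightarrow> annih d s (dehom g) (apolar_seq d f)" if g: "g \<in> forms s" for g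
  proof
    assume "\<forall>h\<in>bipoly.span {f}. apply_diff g h = 0"
    then have "apply_diff g f = 0" by (simp add: bipoly.span_base)
    then show "annih d s (dehom g) (apolar_seq d f)" using apply_diff_eq_0_iff[OF g assms] by simp
  next
    assume a: "annih d s (dehom g) (apolar_seq d f)"
    show "\<forall>h\<in>bipoly.span {f}. apply_diff g h = 0"
    proof
      fix h assume "h \<in> bipoly.span {f}"
      then obtain c where h: "h = smult [:c:] f" by (auto simp: span_single)
      have "h \<in> forms d" using assms(1) h subspace_forms bipoly.subspace_scale by blast
      moreover have "annih d s (dehom g) (apolar_seq d h)" using a unfolding h apolar_seq_smult annih_def
        by (simp add: act_seq_scale)
      ultimately show "apply_diff g h = 0" using apply_diff_eq_0_iff[OF g _ assms(2)] by blast
    qed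
  qed
  then show ?thesis unfolding apolar_map_def by blast
qed

text \<open>The inverse of \<open>apolar_seq\<close> on the entries up to \<open>d\<close>.\<close>
definition form_of_seq :: "nat \<Rightarrow> (nat \<Rightarrow> complex) \<Rightarrow> bipoly" where
  "form_of_seq d a = homog d (\<Sum>k\<le>d. monom (a k / (fact k * fact (d - k))) k)"

lemma form_of_seq_forms [simp]: "form_of_seq d a \<in> forms d" by (simp add: form_of_seq_def)

lemma coords_form_of_seq: "k \<le> d \<Longrightarrow> coords d (form_of_seq d a) k = a k / (fact k * fact (d - k))"
  by (simp add: form_of_seq_def coords_homog coeff_sum if_distrib[of "\<lambda>x. x = _"])

lemma apolar_seq_form_of_seq: "k \<le> d \<Longrightarrow> apolar_seq d (form_of_seq d a) k = a k"
  by (simp add: apolar_seq_def coords_form_of_seq)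

lemma annih_cong:
  assumes "degree p \<le> s" "\<And>k. k \<le> d \<Longrightarrow> a k = b k"
  shows "annih d s p a \<longleftrightarrow> annih d s p b"
proof -
  have "act p a m = act p b m" if "m + s \<le> d" for m
    unfolding act_bound[OF assms(1)] using assms(2) that by (intro sum.cong) auto
  then show ?thesis by (simp add: annih_def)
qed

lemma form_of_seq_apolar_seq: "f \<in> forms d \<Longrightarrow> form_of_seq d (apolar_seq d f) = f"
  by (rule forms_eqI[of _ d]) (auto simp: coords_form_of_seq apolar_seq_def)

text \<open>
  This agrees with \<open>apply_diff\<close> for operators of degree \<open>s\<close> but is visibly linear in the operator,
  since its summation bounds do not depend on the operator.
\<close>
definition contraction :: "nat \<Rightarrow> bipoly \<Rightarrow> bipoly \<Rightarrow> bipoly" where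
  "contraction s f g = (\<Sum>k\<le>s. smult [:coords s g k:] ((partial_x ^^ (s - k)) ((partial_y ^^ k) f)))"

lemma linear_contraction:
  "Vector_Spaces.linear scale_form scale_form (contraction s f)"
proof (unfold_locales, goal_cases)
  case (1 a b)
  have "[:x + y:] = [:x:] + [:y:]" for x y :: complex by simp
  then show ?case by (simp only: contraction_def coords_add smult_add_left sum.distrib)
next
  case (2 c a)
  have "[:x * y:] = [:x:] * [:y:]" for x y :: complex by simp
  then show ?case by (simp only: contraction_def coords_smult smult_smult[symmetric] bipoly.scale_sum_right)
qed

text \<open>
  The catalecticant of \<open>f\<close> in degrees \<open>s\<close> and \<open>d - s\<close> is the transpose of the one in degrees
  \<open>d - s\<close> and \<open>s\<close>: both come from the bilinear form \<open>(g, h) \<mapsto> (g h)(f)\<close>. So the first is onto iff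
  the second is injective.
\<close>
lemma apolar_nondegenerate_iff:
  assumes f: "f \<in> forms d" and s: "s \<le> d"
  shows "bipoly.dim ((\<lambda>g. apply_diff g f) ` forms s) = d - s + 1 \<longleftrightarrow>
    (\<forall>h. h \<noteq> 0 \<and> degree h \<le> d - s \<longrightarrow> \<not> annih d (d - s) h (apolar_seq d f))"
proof -
  let ?T = "contraction s f" and ?a = "apolar_seq d f"
  interpret T: Vector_Spaces.linear scale_form scale_form ?T
    by (rule linear_contraction)
  have T: "apply_diff g f = ?T g" if "g \<in> forms s" for g using apply_diff_form[OF that] by (simp add: contraction_def)
  then have im: "(\<lambda>g. apply_diff g f) ` forms s = ?T ` forms s" by (intro image_cong) auto
  have sub: "?T ` forms s \<subseteq> forms (d - s)" using T apply_diff_in_forms[OF _ f s] by force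
  have ss: "bipoly.subspace (?T ` forms s)" by (rule T.subspace_image) (rule subspace_forms)
  have pairing: "act (dehom g) (act h ?a) 0 = (\<Sum>c\<le>d - s. coeff h c * (fact c * fact (d - s - c) * coords (d - s) (?T g) c))"
    if g: "g \<in> forms s" and h: "degree h \<le> d - s" for g h
  proof -
    have "act (dehom g) (act h ?a) 0 = act h (act (dehom g) ?a) 0" by (simp add: act_mult[symmetric] mult.commute)
    also have "\<dots> = (\<Sum>c\<le>d - s. coeff h c * (fact c * fact (d - s - c) * coords (d - s) (?T g) c))"
      unfolding act_bound[OF h] using coords_apply_diff[OF g f s] T[OF g] s by (intro sum.cong) auto
    finally show ?thesis .
  qed
  have "bipoly.dim (?T ` forms s) = d - s + 1 \<longleftrightarrow> ?T ` forms s = forms (d - s)"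
    using subspace_eq_forms[OF sub order_refl ss] dim_forms[of "d - s"] by (metis order_refl)
  also have "\<dots> \<longleftrightarrow> (\<forall>h. h \<noteq> 0 \<and> degree h \<le> d - s \<longrightarrow> \<not> annih d (d - s) h ?a)"
  proof
    assume surj: "?T ` forms s = forms (d - s)"
    show "\<forall>h. h \<noteq> 0 \<and> degree h \<le> d - s \<longrightarrow> \<not> annih d (d - s) h ?a"
    proof safe
      fix h :: "complex poly" assume h: "h \<noteq> 0" "degree h \<le> d - s" "annih d (d - s) h ?a"
      have "coeff h c0 = 0" if c0: "c0 \<le> d - s" for c0
      proof -
        obtain g where g: "g \<in> forms s" "?T g = mono_form (d - s) c0" using surj mono_form_forms by (metis imageE)
        have "act (dehom g) (act h ?a) 0 = 0"
          by (rule act_zero_range[OF degree_dehom[OF g(1)], of s]) (use h(3) s in \<open>auto simp: annih_def\<close>)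
        then have "(\<Sum>c\<le>d - s. coeff h c * (fact c * fact (d - s - c) * coords (d - s) (mono_form (d - s) c0) c)) = 0"
          using pairing[OF g(1) h(2)] g(2) by simp
        moreover have "(\<Sum>c\<le>d - s. coeff h c * (fact c * fact (d - s - c) * coords (d - s) (mono_form (d - s) c0) c)) =
           (\<Sum>c\<le>d - s. if c = c0 then coeff h c0 * (fact c0 * fact (d - s - c0)) else 0)"
          by (intro sum.cong) (auto simp: coords_mono_form)
        ultimately show ?thesis using c0 by simp
      qed
      then have "h = 0" using h(2) by (intro poly_eqI) (metis coeff_0 coeff_eq_0 leI le_less_trans)
      then show False using h(1) by simp
    qed
  next
    assume nd: "\<forall>h. h \<noteq> 0 \<and> degree h \<le> d - s \<longrightarrow> \<not> annih d (d - s) h ?a"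
    show "?T ` forms s = forms (d - s)"
    proof (rule ccontr)
      assume "?T ` forms s \<noteq> forms (d - s)"
      then obtain x where x: "x \<in> forms (d - s)" "x \<notin> ?T ` forms s" using sub by blast
      then have "x \<notin> bipoly.span (?T ` forms s)" using bipoly.span_minimal[OF order_refl ss] by blast
      then obtain phi where phi: "Vector_Spaces.linear scale_form (*) phi"
        "\<forall>y\<in>?T ` forms s. phi y = 0" "phi x = 1"
        using bipoly.functional_separating_exists by blast
      interpret phi: Vector_Spaces.linear scale_form "(*)" phi by (rule phi(1))
      \<comment> \<open>the form of degree \<open>d - s\<close> that represents the functional \<open>phi\<close>, rescaled by the
         factorials of \<open>apolar_seq\<close>\<close>
      define h where "h = (\<Sum>c\<le>d - s. monom (phi (mono_form (d - s) c) / (fact c * fact (d - s - c))) c)"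
      have ch: "coeff h c = (if c \<le> d - s then phi (mono_form (d - s) c) / (fact c * fact (d - s - c)) else 0)" for c
        by (simp add: h_def coeff_sum)
      have dh: "degree h \<le> d - s" by (rule degree_le) (simp add: ch)
      have ex: "phi y = (\<Sum>c\<le>d - s. coeff h c * (fact c * fact (d - s - c) * coords (d - s) y c))" if "y \<in> forms (d - s)" for y
      proof -
        have "phi y = phi (\<Sum>c\<le>d - s. smult [:coords (d - s) y c:] (mono_form (d - s) c))" using forms_expand[OF that] by simp
        also have "\<dots> = (\<Sum>c\<le>d - s. coords (d - s) y c * phi (mono_form (d - s) c))" by (simp add: phi.sum phi.scale)
        also have "\<dots> = (\<Sum>c\<le>d - s. coeff h c * (fact c * fact (d - s - c) * coords (d - s) y c))"
          by (intro sum.cong) (auto simp: ch)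
        finally show ?thesis .
      qed
      have "h \<noteq> 0" using ex[OF x(1)] phi(3) by auto
      moreover have "annih d (d - s) h ?a" unfolding annih_def
      proof safe
        fix m assume "m + (d - s) \<le> d"
        then have m: "m \<le> s" using s by simp
        let ?g = "homog s (monom 1 m)"
        have dg: "dehom ?g = monom 1 m" using m by (intro dehom_homog) (simp add: degree_monom_eq)
        have "act h ?a m = act (dehom ?g) (act h ?a) 0" by (simp add: dg act_monom)
        also have "\<dots> = phi (?T ?g)"
        proof -
          have "?T ?g \<in> forms (d - s)" using sub homog_forms by blast
          then show ?thesis using pairing[OF homog_forms dh] ex by simp
        qed
        also have "\<dots> = 0" using phi(2) by auto
        finally show "act h ?a m = 0" .
      qed
      ultimately show False using nd dh by blast
    qed
  qed
  finally show ?thesis unfolding im .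
qed

lemma apolar_domain_iff:
  assumes "s \<le> d"
  shows "x \<in> apolar_domain d s \<longleftrightarrow> (\<exists>f. f \<in> forms d \<and> f \<noteq> 0 \<and> x = bipoly.span {f} \<and>
     (\<forall>h. h \<noteq> 0 \<and> degree h \<le> d - s \<longrightarrow> \<not> annih d (d - s) h (apolar_seq d f)))"
  unfolding apolar_domain_def using apolar_nondegenerate_iff[OF _ assms] by blast

lemma apolar_map_in_Gr:
  assumes f: "f \<in> forms d" and s: "s \<le> d" "d - s \<le> s"
    and nd: "\<forall>h. h \<noteq> 0 \<and> degree h \<le> d - s \<longrightarrow> \<not> annih d (d - s) h (apolar_seq d f)"
  shows "apolar_map s (bipoly.span {f}) \<in> Gr s (2 * s - d)"
proof -
  let ?T = "contraction s f"
  interpret T: Vector_Spaces.linear scale_form scale_form ?T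
    by (rule linear_contraction)
  interpret VP: vector_space_pair scale_form scale_form ..
  have T: "apply_diff g f = ?T g" if "g \<in> forms s" for g using apply_diff_form[OF that] by (simp add: contraction_def)
  then have im: "(\<lambda>g. apply_diff g f) ` forms s = ?T ` forms s" by (intro image_cong) auto
  have eq: "apolar_map s (bipoly.span {f}) = {g \<in> forms s. ?T g = 0}"
    unfolding apolar_map_span[OF f s(1)] using apply_diff_eq_0_iff[OF _ f s(1)] T by auto
  have "bipoly.dim {g \<in> forms s. ?T g = 0} + bipoly.dim (?T ` forms s) = bipoly.dim (forms s)"
    by (rule VP.dim_kernel_plus_image[OF linear_contraction subspace_forms, of _ "mono_form s ` {..s}"]) (simp_all add: span_mono_form)
  moreover have "bipoly.dim (?T ` forms s) = d - s + 1" using apolar_nondegenerate_iff[OF f s(1)] nd im by simp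
  ultimately have "bipoly.dim {g \<in> forms s. ?T g = 0} = 2 * s - d" using s by (simp add: dim_forms)
  moreover have "bipoly.subspace {g \<in> forms s. ?T g = 0}"
    using subspace_forms[of s] T.add T.scale unfolding bipoly.subspace_def by auto
  ultimately show ?thesis unfolding eq Gr_def by auto
qed

section \<open>Parametrised coincident root loci\<close>

text \<open>
  Exponents may be zero, so that subtracting a vector of zeros and ones from a partition needs no
  reindexing.
\<close>
definition root_product :: "nat list \<Rightarrow> (nat \<Rightarrow> complex \<times> complex) \<Rightarrow> complex poly" where
  "root_product es v = (\<Prod>i<length es. lin (v i) ^ (es ! i))"

abbreviation (input) root_point :: "nat list \<Rightarrow> (nat \<Rightarrow> complex \<times> complex) \<Rightarrow> bipoly set" where
  "root_point es v \<equiv> bipoly.span {homog (sum_list es) (root_product es v)}"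

definition root_locus :: "nat list \<Rightarrow> bipoly set set" where
  "root_locus es = {(root_point es v) | v. \<forall>i<length es. v i \<noteq> 0}"

lemma degree_lin_power: "degree (lin v ^ n) \<le> n"
  by (metis degree_lin degree_power_le mult.commute mult_1 mult_le_mono2 order_trans)

lemma degree_prod_le_sum:
  assumes "\<And>a. a \<in> A \<Longrightarrow> degree (f a :: complex poly) \<le> n a"
  shows "degree (prod f A) \<le> sum n A"
  using assms
proof (induction A rule: infinite_finite_induct)
  case (insert a A)
  then have "degree (f a * prod f A) \<le> n a + sum n A"
    using degree_mult_le[of "f a" "prod f A"] insert.prems[of a] insert.IH by fastforce
  then show ?case using insert by simp
qed auto

lemma degree_root_product: "degree (root_product es v) \<le> sum_list es"
  unfolding root_product_def sum_list_sum_nth lessThan_atLeast0[symmetric]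
  by (rule degree_prod_le_sum) (rule degree_lin_power)

lemma root_product_nonzero: "(\<And>i. i < length es \<Longrightarrow> v i \<noteq> 0) \<Longrightarrow> root_product es v \<noteq> 0"
  by (simp add: root_product_def)

lemma forms_1: "1 \<in> forms 0" by (auto simp: forms_def one_pCons coeff_pCons split: nat.splits)

lemma forms_power: "f \<in> forms a \<Longrightarrow> f ^ n \<in> forms (a * n)"
  by (induction n) (use forms_1 forms_mult in auto)

lemma forms_prod: "(\<And>i. i \<in> A \<Longrightarrow> f i \<in> forms (n i)) \<Longrightarrow> prod f A \<in> forms (sum n A)"
  by (induction A rule: infinite_finite_induct) (use forms_1 forms_mult in auto)

lemma homog_root_product:
  assumes "\<And>i. i < length es \<Longrightarrow> L i \<in> forms 1 \<and> dehom (L i) = lin (v i)"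
  shows "(\<Prod>i<length es. L i ^ (es ! i)) = homog (sum_list es) (root_product es v)"
proof (rule dehom_inj[of _ "sum_list es"])
  have "(\<Prod>i<length es. L i ^ (es ! i)) \<in> forms (\<Sum>i<length es. es ! i)"
    using assms forms_power[of "L _" 1] by (intro forms_prod) auto
  then show "(\<Prod>i<length es. L i ^ (es ! i)) \<in> forms (sum_list es)"
    by (simp add: sum_list_sum_nth lessThan_atLeast0)
  show "dehom (\<Prod>i<length es. L i ^ (es ! i)) = dehom (homog (sum_list es) (root_product es v))"
    unfolding dehom_homog[OF degree_root_product] using assms by (simp add: dehom_prod dehom_power root_product_def)
qed simp

text \<open>The order of the parts is immaterial: permute the linear forms accordingly.\<close>
lemma coincident_root_locus_conv: "coincident_root_locus (mset es) = root_locus es"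
proof
  show "root_locus es \<subseteq> coincident_root_locus (mset es)"
  proof
    fix x assume "x \<in> root_locus es"
    then obtain v where v: "x = (root_point es v)" "\<forall>i<length es. v i \<noteq> 0" unfolding root_locus_def by blast
    let ?L = "\<lambda>i. homog 1 (lin (v i))"
    have "(\<Prod>i<length es. ?L i ^ (es ! i)) = homog (sum_list es) (root_product es v)"
      by (rule homog_root_product) (simp add: dehom_homog[OF degree_lin] del: One_nat_def)
    moreover have "\<forall>i<length es. ?L i \<in> forms 1 \<and> ?L i \<noteq> 0"
      using v(2) by (simp add: homog_eq_0_iff[OF degree_lin] del: One_nat_def)
    ultimately show "x \<in> coincident_root_locus (mset es)"
      unfolding coincident_root_locus_def v(1) by (intro CollectI exI[of _ es] exI[of _ ?L]) simp
  qed
  show "coincident_root_locus (mset es) \<subseteq> root_locus es"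
  proof
    fix x assume "x \<in> coincident_root_locus (mset es)"
    then obtain ms L where ms: "mset ms = mset es" "x = bipoly.span {\<Prod>i<length ms. L i ^ (ms ! i)}"
      "\<forall>i<length ms. L i \<in> forms 1 \<and> L i \<noteq> 0" unfolding coincident_root_locus_def by blast
    obtain f where f: "bij_betw f {..<length es} {..<length ms}" "\<forall>i<length es. es ! i = ms ! f i"
      using permutation_Ex_bij[of es ms] ms(1) by auto
    define v where "v i = (coords 1 (L (f i)) 0, coords 1 (L (f i)) 1)" for i
    have fi: "f i < length ms" if "i < length es" for i using f(1) that by (auto simp: bij_betw_def)
    have L: "L (f i) \<in> forms 1 \<and> dehom (L (f i)) = lin (v i)" if "i < length es" for i
    proof -
      have LF: "L (f i) \<in> forms 1" using ms(3) fi[OF that] by blast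
      have "dehom (L (f i)) = lin (v i)"
        by (rule poly_eqI) (auto simp: coeff_dehom_forms[OF LF] lin_def v_def coeff_pCons split: nat.split)
      then show ?thesis using LF by blast
    qed
    have "v i \<noteq> 0" if "i < length es" for i
      using L[OF that] ms(3) fi[OF that] dehom_eq_0_iff lin_eq_0_iff by metis
    moreover have "(\<Prod>i<length ms. L i ^ (ms ! i)) = (\<Prod>i<length es. L (f i) ^ (ms ! f i))"
      by (rule prod.reindex_bij_betw[OF f(1), symmetric])
    moreover have "\<dots> = (\<Prod>i<length es. L (f i) ^ (es ! i))" using f(2) by (intro prod.cong) auto
    moreover have "\<dots> = homog (sum_list es) (root_product es v)" by (rule homog_root_product) (rule L)
    ultimately show "x \<in> root_locus es" unfolding root_locus_def ms(2) by auto
  qed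
qed

text \<open>
  Parts equal to zero contribute a factor one; the linear form at such an index is arbitrary.
\<close>
lemma root_locus_drop_zeros: "coincident_root_locus (filter_mset (\<lambda>a. a \<noteq> 0) (mset es)) = root_locus es"
proof -
  let ?fs = "filter (\<lambda>a. a \<noteq> 0) es" and ?zs = "filter (\<lambda>a. a = 0) es"
  have z: "?zs = replicate (length ?zs) 0" by (rule replicate_eqI[symmetric, THEN sym]) auto
  have m: "mset (?fs @ ?zs) = mset es"
    by (simp add: multiset_partition[of "mset es" "\<lambda>a. a \<noteq> 0", symmetric] mset_filter)
  have len: "length (?fs @ ?zs) = length ?fs + length ?zs" by simp
  have sl: "sum_list (?fs @ ?zs) = sum_list ?fs" by (subst z) (simp add: sum_list_replicate)
  have rpz: "root_product (?fs @ ?zs) v = root_product ?fs v" for v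
  proof -
    have "root_product (?fs @ ?zs) v = (\<Prod>i<length ?fs. lin (v i) ^ ((?fs @ ?zs) ! i))"
      unfolding root_product_def
    proof (rule prod.mono_neutral_right)
      show "\<forall>i\<in>{..<length (?fs @ ?zs)} - {..<length ?fs}. lin (v i) ^ ((?fs @ ?zs) ! i) = 1"
      proof
        fix i assume i: "i \<in> {..<length (?fs @ ?zs)} - {..<length ?fs}"
        then have "\<not> i < length ?fs" "i - length ?fs < length ?zs" by auto
        then have "(?fs @ ?zs) ! i \<in> set ?zs" by (metis nth_append nth_mem)
        then show "lin (v i) ^ ((?fs @ ?zs) ! i) = 1" by auto
      qed
    qed auto
    also have "\<dots> = root_product ?fs v" unfolding root_product_def by (intro prod.cong) (auto simp: nth_append)
    finally show ?thesis .
  qed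
  have "root_locus (?fs @ ?zs) = root_locus ?fs"
  proof
    show "root_locus (?fs @ ?zs) \<subseteq> root_locus ?fs" unfolding root_locus_def rpz sl by auto
    show "root_locus ?fs \<subseteq> root_locus (?fs @ ?zs)"
    proof
      fix x assume "x \<in> root_locus ?fs"
      then obtain v where v: "x = bipoly.span {homog (sum_list ?fs) (root_product ?fs v)}" "\<forall>i<length ?fs. v i \<noteq> 0" unfolding root_locus_def by blast
      define w where "w i = (if i < length ?fs then v i else (1, 0))" for i
      have "root_product ?fs w = root_product ?fs v" unfolding root_product_def w_def by (intro prod.cong) auto
      moreover have "\<forall>i<length (?fs @ ?zs). w i \<noteq> 0" using v(2) by (auto simp: w_def zero_prod_def)
      ultimately show "x \<in> root_locus (?fs @ ?zs)" unfolding root_locus_def rpz sl v(1) by (intro CollectI exI[of _ w]) simp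
    qed
  qed
  moreover have "root_locus (?fs @ ?zs) = root_locus es"
    using coincident_root_locus_conv[of "?fs @ ?zs"] coincident_root_locus_conv[of es] m by simp
  ultimately show ?thesis using coincident_root_locus_conv[of ?fs] by simp
qed

lemma poly_curve_mult: "poly_curve p \<Longrightarrow> poly_curve q \<Longrightarrow> poly_curve (\<lambda>t. p t * q t)"
  unfolding poly_curve_def coeff_mult by (intro allI poly_fun_sum poly_fun_mult) auto

lemma poly_curve_const [simp]: "poly_curve (\<lambda>t. p)" by (simp add: poly_curve_def)

lemma poly_curve_power: "poly_curve p \<Longrightarrow> poly_curve (\<lambda>t. p t ^ n)"
  by (induction n) (simp_all add: poly_curve_mult)

lemma poly_curve_prod: "(\<And>a. a \<in> A \<Longrightarrow> poly_curve (p a)) \<Longrightarrow> poly_curve (\<lambda>t. \<Prod>a\<in>A. p a t)"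
  by (induction A rule: infinite_finite_induct) (auto intro: poly_curve_mult)

text \<open>
  The line through two tuples of linear forms; a general point of it is again a tuple of nonzero
  linear forms.
\<close>
definition line :: "(nat \<Rightarrow> complex \<times> complex) \<Rightarrow> (nat \<Rightarrow> complex \<times> complex) \<Rightarrow> complex \<Rightarrow> nat \<Rightarrow> complex \<times> complex" where
  "line v w t i = (fst (v i) + t * (fst (w i) - fst (v i)), snd (v i) + t * (snd (w i) - snd (v i)))"

lemma line_0 [simp]: "line v w 0 = v" and line_1 [simp]: "line v w 1 = w"
  by (auto simp: line_def fun_eq_iff)

lemma poly_curve_lin_line: "poly_curve (\<lambda>t. lin (line v w t i))"
proof -
  have "poly_fun (\<lambda>t. coeff (lin (line v w t i)) c)" for c
    unfolding lin_def line_def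
    by (cases c; cases "c - 1") (auto intro!: poly_fun_add poly_fun_mult)
  then show ?thesis by (simp add: poly_curve_def)
qed

lemma poly_curve_root_product_line: "poly_curve (\<lambda>t. root_product es (line v w t))"
  unfolding root_product_def by (intro poly_curve_prod poly_curve_power poly_curve_lin_line)

lemma finite_line_zero:
  assumes "v i \<noteq> 0 \<or> w i \<noteq> 0"
  shows "finite {t. line v w t i = 0}"
proof -
  have pf: "poly_fun (\<lambda>t. fst (line v w t i))" "poly_fun (\<lambda>t. snd (line v w t i))"
    by (auto simp: line_def intro!: poly_fun_add poly_fun_mult)
  from assms obtain s where "line v w s i \<noteq> 0" by (metis line_0 line_1)
  then have "fst (line v w s i) \<noteq> 0 \<or> snd (line v w s i) \<noteq> 0" by (simp add: prod_eq_iff)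
  then show ?thesis
  proof
    assume "fst (line v w s i) \<noteq> 0"
    from finite_zeros_poly_fun[OF pf(1) this] show ?thesis by (rule rev_finite_subset) auto
  next
    assume "snd (line v w s i) \<noteq> 0"
    from finite_zeros_poly_fun[OF pf(2) this] show ?thesis by (rule rev_finite_subset) auto
  qed
qed

lemma finite_line_degenerate:
  assumes "\<And>i. i < n \<Longrightarrow> v i \<noteq> 0 \<or> w i \<noteq> 0"
  shows "finite {t. \<not> (\<forall>i<n. line v w t i \<noteq> 0)}"
proof -
  have "{t. \<not> (\<forall>i<n. line v w t i \<noteq> 0)} = (\<Union>i<n. {t. line v w t i = 0})" by auto
  then show ?thesis using finite_line_zero assms by auto
qed

text \<open>
  Polynomials whose coefficients are multihomogeneous in points of \<open>m\<close> projective lines, all of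
  the same degrees \<open>dl\<close>.
\<close>
definition multihom_poly :: "'i set \<Rightarrow> nat \<Rightarrow> (nat \<Rightarrow> nat) \<Rightarrow> ((nat \<Rightarrow> complex \<times> complex) \<Rightarrow> complex poly) \<Rightarrow> bool" where
  "multihom_poly J m dl f \<longleftrightarrow> (\<forall>c. multihom J m 0 dl (\<lambda>y v. coeff (f v) c))"

lemma multihom_poly_const: "multihom_poly J m (\<lambda>_. 0) (\<lambda>v. p)"
  unfolding multihom_poly_def by (auto intro: multihom.const)

lemma multihom_poly_mult: "multihom_poly J m dl f \<Longrightarrow> multihom_poly J m dl' g \<Longrightarrow> multihom_poly J m (\<lambda>l. dl l + dl' l) (\<lambda>v. f v * g v)"
  unfolding multihom_poly_def coeff_mult
proof (intro allI multihom_sum)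
  fix c i assume "\<forall>c. multihom J m 0 dl (\<lambda>y v. coeff (f v) c)" "\<forall>c. multihom J m 0 dl' (\<lambda>y v. coeff (g v) c)"
  then show "multihom J m 0 (\<lambda>l. dl l + dl' l) (\<lambda>y v. coeff (f v) i * coeff (g v) (c - i))"
    using multihom.mult[of J m 0 dl "\<lambda>y v. coeff (f v) i" 0 dl' "\<lambda>y v. coeff (g v) (c - i)"] by simp
qed

lemma multihom_poly_power: "multihom_poly J m dl f \<Longrightarrow> multihom_poly J m (\<lambda>l. n * dl l) (\<lambda>v. f v ^ n)"
proof (induction n)
  case 0
  then show ?case using multihom_poly_const[of J m 1] by simp
next
  case (Suc n)
  then show ?case using multihom_poly_mult[OF Suc.prems Suc.IH[OF Suc.prems]] by simp
qed

lemma multihom_poly_prod: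
  "(\<And>a. a \<in> A \<Longrightarrow> multihom_poly J m (dl a) (f a)) \<Longrightarrow> multihom_poly J m (\<lambda>l. \<Sum>a\<in>A. dl a l) (\<lambda>v. \<Prod>a\<in>A. f a v)"
proof (induction A rule: infinite_finite_induct)
  case (insert a A)
  then show ?case using multihom_poly_mult[of J m "dl a" "f a" "\<lambda>l. \<Sum>a\<in>A. dl a l" "\<lambda>v. \<Prod>a\<in>A. f a v"] by simp
qed (use multihom_poly_const[of J m 1] in simp_all)

lemma multihom_poly_lin: "i < m \<Longrightarrow> multihom_poly J m (\<lambda>l. if l = i then 1 else 0) (\<lambda>v. lin (v i))"
  unfolding multihom_poly_def
proof
  fix c assume i: "i < m"
  show "multihom J m 0 (\<lambda>l. if l = i then 1 else 0) (\<lambda>y v. coeff (lin (v i)) c)"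
  proof (cases c)
    case 0 then show ?thesis using multihom.fst[OF i, of J] by (simp add: lin_def)
  next
    case (Suc c')
    then show ?thesis using multihom.snd[OF i, of J] multihom.zero by (cases c') (simp_all add: lin_def)
  qed
qed

lemma multihom_poly_root_product:
  assumes "length es \<le> m"
  shows "multihom_poly J m (\<lambda>l. if l < length es then es ! l else 0) (root_product es)"
proof -
  have "multihom_poly J m (\<lambda>l. \<Sum>i<length es. es ! i * (if l = i then 1 else 0)) (\<lambda>v. \<Prod>i<length es. lin (v i) ^ (es ! i))"
    using assms by (intro multihom_poly_prod multihom_poly_power multihom_poly_lin) auto
  moreover have "(\<Sum>i<length es. es ! i * (if l = i then 1 else 0)) = (if l < length es then es ! l else 0)" for l
    by (simp add: if_distrib[of "\<lambda>x. _ * x"] cong: if_cong)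
  ultimately show ?thesis by (simp add: root_product_def[abs_def])
qed

lemma hom_poly_of_multihom_poly:
  "hom_poly I e F \<Longrightarrow> multihom_poly J m dl f \<Longrightarrow> multihom J m 0 (\<lambda>l. e * dl l) (\<lambda>y v. F (coeff (f v)))"
proof (induction rule: hom_poly.induct)
  case (const c)
  then show ?case using multihom.const by simp
next
  case (var i)
  then show ?case unfolding multihom_poly_def by simp
next
  case (add e F G)
  then show ?case using multihom.add by fast
next
  case (mult e F e' G)
  then show ?case
    using multihom.mult[of J m 0 "\<lambda>l. e * dl l" "\<lambda>y v. F (coeff (f v))" 0 "\<lambda>l. e' * dl l" "\<lambda>y v. G (coeff (f v))"]
    by (simp add: add_mult_distrib)
qed

section \<open>Counting functions: algebraic independence is bounded by the number of parameters\<close>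

interpretation funs: vector_space "\<lambda>(c::complex) (f::'x \<Rightarrow> complex) x. c * f x"
  by unfold_locales (auto simp: fun_eq_iff algebra_simps)

lemma sum_fun_apply: "(\<Sum>a\<in>A. f a) x = (\<Sum>a\<in>A. f a x)"
  by (induction A rule: infinite_finite_induct) auto

lemma span_mult_right:
  assumes "f \<in> funs.span B"
  shows "(\<lambda>x. f x * h x) \<in> funs.span ((\<lambda>b x. b x * h x) ` B)"
  using assms
proof (induction rule: funs.span_induct_alt)
  case base
  have "(\<lambda>x. 0 x * h x) = (0 :: 'a \<Rightarrow> complex)" by (auto simp: fun_eq_iff)
  then show ?case using funs.span_zero by simp
next
  case (step c b y)
  have eq: "(\<lambda>x. ((\<lambda>x. c * b x) + y) x * h x) = (\<lambda>x. c * (b x * h x)) + (\<lambda>x. y x * h x)"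
    by (auto simp: fun_eq_iff algebra_simps)
  have "(\<lambda>x. c * (b x * h x)) \<in> funs.span ((\<lambda>b x. b x * h x) ` B)"
    using funs.span_scale[OF funs.span_base[of "\<lambda>x. b x * h x" "(\<lambda>b x. b x * h x) ` B"], of c] step(1) by blast
  then show ?case unfolding eq using step(2) by (rule funs.span_add)
qed

text \<open>
  There are at most \<open>\<Prod>(dl i + 1)\<close> monomials of multidegree \<open>dl\<close>. Only the existence of so small a
  spanning set is stated.
\<close>
lemma multihom_span:
  "\<exists>B. finite B \<and> card B \<le> (\<Prod>i<m. dl i + 1) \<and>
    (\<forall>F. multihom ({} :: 'i set) m 0 dl F \<longrightarrow> F y \<in> funs.span (B :: ((nat \<Rightarrow> complex \<times> complex) \<Rightarrow> complex) set))"
proof (induction m arbitrary: dl)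
  case 0
  have "F y \<in> funs.span {\<lambda>v. 1}" if "multihom {} 0 0 dl F" for F
  proof -
    have eq: "F y = (\<lambda>x. F y (\<lambda>_. 0) * 1)" using multihom_cong[OF that] by auto
    have "(\<lambda>x. F y (\<lambda>_. 0) * 1) \<in> funs.span {\<lambda>v. 1}"
      by (rule funs.span_scale) (simp add: funs.span_base)
    then show ?thesis by (subst eq)
  qed
  then show ?case by (intro exI[of _ "{\<lambda>v. 1}"]) auto
next
  case (Suc m)
  obtain B :: "((nat \<Rightarrow> complex \<times> complex) \<Rightarrow> complex) set" where B: "finite B" "card B \<le> (\<Prod>i<m. (dl(m := 0)) i + 1)"
    "\<And>F. multihom ({} :: 'i set) m 0 (dl(m := 0)) F \<Longrightarrow> F y \<in> funs.span B" using Suc.IH by blast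
  define h where "h k v = fst (v m) ^ k * snd (v m) ^ (dl m - k)" for k and v :: "nat \<Rightarrow> complex \<times> complex"
  define C where "C = (\<Union>k\<le>dl m. (\<lambda>b v. b v * h k v) ` B)"
  have "card C \<le> (\<Sum>k\<le>dl m. card ((\<lambda>b v. b v * h k v) ` B))" unfolding C_def by (rule card_UN_le) simp
  also have "\<dots> \<le> (\<Sum>k\<le>dl m. card B)" by (intro sum_mono card_image_le B)
  also have "\<dots> = (dl m + 1) * card B" by simp
  also have "\<dots> \<le> (dl m + 1) * (\<Prod>i<m. (dl(m := 0)) i + 1)" using B(2) by (rule mult_le_mono2)
  also have "(\<Prod>i<m. (dl(m := 0)) i + 1) = (\<Prod>i<m. dl i + 1)" by (intro prod.cong) auto
  finally have cC: "card C \<le> (\<Prod>i<Suc m. dl i + 1)" by (simp add: mult.commute)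
  have "F y \<in> funs.span C" if F: "multihom ({} :: 'i set) (Suc m) 0 dl F" for F
  proof -
    obtain P where P: "\<And>k. multihom ({} :: 'i set) m 0 (dl(m := 0)) (\<lambda>y v. coeff (P y v) k)"
      "\<And>v. F y v = hom_eval (dl m) (P y v) (fst (v m)) (snd (v m))" using multihom_expand_last[OF F] by blast
    have "F y = (\<Sum>k\<le>dl m. (\<lambda>v. coeff (P y v) k * h k v))"
      by (rule ext) (simp add: P(2) hom_eval_def h_def mult.assoc sum_fun_apply)
    also have "\<dots> \<in> funs.span C"
    proof (rule funs.span_sum)
      fix k assume k: "k \<in> {..dl m}"
      have "(\<lambda>v. coeff (P y v) k * h k v) \<in> funs.span ((\<lambda>b v. b v * h k v) ` B)"
        by (rule span_mult_right) (rule B(3)[OF P(1)])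
      moreover have "(\<lambda>b v. b v * h k v) ` B \<subseteq> C" unfolding C_def using k by blast
      ultimately show "(\<lambda>v. coeff (P y v) k * h k v) \<in> funs.span C" using funs.span_mono by blast
    qed
    finally show ?thesis .
  qed
  then show ?case using cC B(1) by (intro exI[of _ C]) (auto simp: C_def)
qed

lemma digits_sum: "(\<Sum>b<k. (n div (B::nat) ^ b mod B) * B ^ b) = n mod B ^ k"
proof (induction k)
  case (Suc k)
  have "n mod B ^ Suc k = n mod B ^ k + B ^ k * (n div B ^ k mod B)"
    unfolding power_Suc2 mod_mult2_eq by (rule add.commute)
  then show ?case using Suc by (simp add: mult.commute)
qed simp

lemma power_dominates:
  assumes "\<And>s::nat. (s + 1) ^ k \<le> C ^ m * (s + 1) ^ m"
  shows "k \<le> m"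
proof (rule ccontr)
  assume "\<not> ?thesis"
  then obtain i where i: "k = m + Suc i" by (metis less_imp_Suc_add not_le add_Suc_right)
  let ?s = "C ^ m"
  have "(?s + 1) ^ m * (?s + 1) ^ Suc i \<le> ?s * (?s + 1) ^ m" using assms[of ?s] unfolding i power_add .
  then have "(?s + 1) ^ Suc i \<le> ?s" by (metis mult.commute mult_le_cancel2 add_is_0 one_neq_zero zero_less_power neq0_conv)
  moreover have "?s + 1 \<le> (?s + 1) ^ Suc i" by (rule self_le_power) auto
  ultimately show False by linarith
qed

text \<open>
  The functions \<open>F b\<close>, \<open>b \<in> B\<close>, satisfy no nontrivial homogeneous relation on \<open>U\<close>.
\<close>
definition hom_indep :: "(nat \<Rightarrow> complex) set \<Rightarrow> ('b \<Rightarrow> (nat \<Rightarrow> complex) \<Rightarrow> complex) \<Rightarrow> 'b set \<Rightarrow> bool" where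
  "hom_indep U F B \<longleftrightarrow> (\<forall>e G. hom_poly B e G \<and> (\<forall>z\<in>U. G (\<lambda>b. F b z) = 0) \<longrightarrow> (\<forall>y. G y = 0))"

lemma hom_poly_prod:
  "finite A \<Longrightarrow> (\<And>a. a \<in> A \<Longrightarrow> hom_poly J (e a) (F a)) \<Longrightarrow> hom_poly J (\<Sum>a\<in>A. e a) (\<lambda>z. \<Prod>a\<in>A. F a z)"
  by (induction A rule: finite_induct) (auto intro: hom_poly.mult hom_poly.const)

lemma hom_poly_power: "hom_poly J e F \<Longrightarrow> hom_poly J (n * e) (\<lambda>z. F z ^ n)"
proof (induction n)
  case 0
  then show ?case using hom_poly.const[of J 1] by simp
next
  case (Suc n)
  then show ?case using hom_poly.mult[OF Suc.prems Suc.IH[OF Suc.prems]] by simp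
qed

lemma hom_poly_cmult: "hom_poly J e F \<Longrightarrow> hom_poly J e (\<lambda>z. c * F z)"
  using hom_poly.mult[OF hom_poly.const[of J c]] by fastforce

lemma hom_poly_sum:
  "J \<noteq> {} \<Longrightarrow> (\<And>a. a \<in> A \<Longrightarrow> hom_poly J e (F a)) \<Longrightarrow> hom_poly J e (\<lambda>z. \<Sum>a\<in>A. F a z)"
  by (induction A rule: infinite_finite_induct) (auto intro: hom_poly.add hom_poly_0)

lemma hom_poly_compose:
  "hom_poly B e G \<Longrightarrow> (\<And>b. b \<in> B \<Longrightarrow> hom_poly J c (F b)) \<Longrightarrow> hom_poly J (e * c) (\<lambda>z. G (\<lambda>b. F b z))"
proof (induction rule: hom_poly.induct)
  case (mult e F e' G)
  then show ?case by (simp add: add_mult_distrib hom_poly.mult)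
qed (auto intro: hom_poly.const hom_poly.add)

lemma hom_poly_scale: "hom_poly J e F \<Longrightarrow> F (\<lambda>i. c * z i) = c ^ e * F z"
  by (induction rule: hom_poly.induct) (auto simp: algebra_simps power_add)

text \<open>
  There are \<open>(s + 1)\<^sup>k\<close> monomials in the \<open>F b\<close> with exponents at most \<open>s\<close> for \<open>b \<ge> 1\<close>, made
  homogeneous by a power of \<open>F 0\<close>. Restricted to \<open>U\<close>, that is, pulled back along \<open>f\<close>, they lie in
  a space of functions of multidegree proportional to \<open>s\<close>, of dimension at most \<open>C\<^sup>m (s + 1)\<^sup>m\<close>. If
  \<open>k > m\<close>, they are dependent for large \<open>s\<close>, which is a homogeneous relation.
\<close>
lemma hom_indep_card_bound:
  fixes F :: "nat \<Rightarrow> (nat \<Rightarrow> complex) \<Rightarrow> complex"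
  assumes F: "\<And>b. b \<le> k \<Longrightarrow> hom_poly {..N} c (F b)"
    and f: "multihom_poly ({} :: nat set) m dl f"
    and U: "U \<subseteq> {z. \<exists>a v. \<forall>i\<le>N. z i = a * coeff (f v) i}"
    and ind: "hom_indep U F {..k}"
  shows "k \<le> m"
proof -
  define C where "C = c * k * (\<Sum>i<m. dl i) + 1"
  have "(s + 1) ^ k \<le> C ^ m * (s + 1) ^ m" for s
  proof -
    let ?B = "s + 1"
    \<comment> \<open>the monomial with number \<open>n\<close> has the digits of \<open>n\<close> in base \<open>s + 1\<close> as exponents\<close>
    define dg where "dg n b = n div ?B ^ b mod ?B" for n b
    define M where "M n y = y 0 ^ (k * s - (\<Sum>b<k. dg n b)) * (\<Prod>b<k. y (Suc b) ^ dg n b)" for n and y :: "nat \<Rightarrow> complex"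
    have dg_le: "dg n b \<le> s" for n b unfolding dg_def by (metis Suc_eq_plus1 less_Suc_eq_le mod_less_divisor zero_less_Suc)
    have sdg: "(\<Sum>b<k. dg n b) \<le> k * s" for n using sum_mono[of "{..<k}" "dg n" "\<lambda>_. s"] dg_le by simp
    have hM: "hom_poly {..k} (k * s) (M n)" for n
    proof -
      have "hom_poly {..k} ((k * s - (\<Sum>b<k. dg n b)) * 1 + (\<Sum>b<k. dg n b * 1))
        (\<lambda>y. y 0 ^ (k * s - (\<Sum>b<k. dg n b)) * (\<Prod>b<k. y (Suc b) ^ dg n b))"
        by (intro hom_poly.mult hom_poly_power hom_poly_prod hom_poly.var) auto
      then show ?thesis using sdg[of n] unfolding M_def[abs_def] by simp
    qed
    define E where "E = k * s * c"
    have pull: "multihom ({} :: nat set) m 0 (\<lambda>l. E * dl l) (\<lambda>y v. M n (\<lambda>b. F b (coeff (f v))))" for n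
      unfolding E_def using hom_poly_of_multihom_poly[OF hom_poly_compose[OF hM] f, of "{..N}" c F] F by auto
    obtain Bs where Bs: "finite Bs" "card Bs \<le> (\<Prod>i<m. E * dl i + 1)"
      "\<And>G. multihom ({} :: nat set) m 0 (\<lambda>l. E * dl l) G \<Longrightarrow> G (\<lambda>_. 0) \<in> funs.span Bs"
      using multihom_span[where m = m and dl = "\<lambda>l. E * dl l" and y = "\<lambda>_. 0"] by blast
    have "?B ^ k \<le> card Bs"
    proof (rule ccontr)
      assume "\<not> ?thesis"
      then have lt: "card Bs < card {..<?B ^ k}" by simp
      have "\<exists>a. (\<exists>n\<in>{..<?B ^ k}. a n \<noteq> 0) \<and> (\<Sum>n<?B ^ k. (\<lambda>v. a n * M n (\<lambda>b. F b (coeff (f v))))) = 0"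
        using funs.nontrivial_relation[OF _ Bs(1) _ lt, of "\<lambda>n v. M n (\<lambda>b. F b (coeff (f v)))"] Bs(3)[OF pull] by simp
      then obtain a n0 where a: "n0 < ?B ^ k" "a n0 \<noteq> 0" "(\<Sum>n<?B ^ k. (\<lambda>v. a n * M n (\<lambda>b. F b (coeff (f v))))) = 0" by blast
      define G where "G y = (\<Sum>n<?B ^ k. a n * M n y)" for y
      have hG: "hom_poly {..k} (k * s) G" unfolding G_def[abs_def] by (intro hom_poly_sum hom_poly_cmult hM) auto
      have Gf: "G (\<lambda>b. F b (coeff (f v))) = 0" for v
        using fun_cong[OF a(3), of v] by (simp add: sum_fun_apply G_def)
      have "G (\<lambda>b. F b z) = 0" if zU: "z \<in> U" for z
      proof -
        obtain x v where xv: "\<forall>i\<le>N. z i = x * coeff (f v) i" using zU U by blast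
        have hGF: "hom_poly {..N} (k * s * c) (\<lambda>z. G (\<lambda>b. F b z))" by (rule hom_poly_compose[OF hG]) (use F in auto)
        have "G (\<lambda>b. F b z) = G (\<lambda>b. F b (\<lambda>i. x * coeff (f v) i))"
          using hom_poly_cong[OF hGF, of z "\<lambda>i. x * coeff (f v) i"] xv by simp
        also have "\<dots> = x ^ (k * s * c) * G (\<lambda>b. F b (coeff (f v)))" by (rule hom_poly_scale[OF hGF])
        finally show ?thesis using Gf by simp
      qed
      then have G0: "\<And>y. G y = 0" using ind hG unfolding hom_indep_def by blast
      define p where "p = (\<Sum>n<?B ^ k. monom (a n) n)"
      have "poly p x = 0" for x
      proof -
        \<comment> \<open>Kronecker substitution: this point turns the monomial with number \<open>n\<close> into \<open>x\<^sup>n\<close>, so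
           distinct monomials stay independent\<close>
        define y where "y b = (case b of 0 \<Rightarrow> 1 | Suc i \<Rightarrow> x ^ (?B ^ i))" for b
        have "M n y = x ^ n" if "n < ?B ^ k" for n
        proof -
          have "M n y = (\<Prod>b<k. x ^ (dg n b * ?B ^ b))"
            by (simp add: M_def y_def power_mult[symmetric] mult.commute)
          also have "\<dots> = x ^ (\<Sum>b<k. dg n b * ?B ^ b)" by (simp add: power_sum)
          also have "(\<Sum>b<k. dg n b * ?B ^ b) = n" unfolding dg_def digits_sum using that by simp
          finally show ?thesis .
        qed
        then have "G y = poly p x" by (simp add: G_def p_def poly_sum poly_monom)
        then show ?thesis using G0 by simp
      qed
      then have "p = 0" using poly_all_0_iff_0 by blast
      moreover have "coeff p n0 = a n0" using a(1) by (simp add: p_def coeff_sum)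
      ultimately show False using a(2) by simp
    qed
    also have "card Bs \<le> (\<Prod>i<m. E * dl i + 1)" by (rule Bs(2))
    also have "\<dots> \<le> (\<Prod>i<m. C * (s + 1))"
    proof (intro prod_mono conjI)
      fix i assume i: "i \<in> {..<m}"
      have "dl i \<le> (\<Sum>i<m. dl i)" using i by (intro member_le_sum) auto
      then have "E * dl i \<le> c * k * (\<Sum>i<m. dl i) * s" unfolding E_def by (simp add: mult_ac mult_le_mono)
      then show "E * dl i + 1 \<le> C * (s + 1)" unfolding C_def by (simp add: algebra_simps)
    qed simp
    also have "\<dots> = C ^ m * (s + 1) ^ m" by (simp only: prod_constant card_lessThan power_mult_distrib)
    finally show ?thesis .
  qed
  then show ?thesis by (rule power_dominates)
qed

section \<open>Dimension of a parametrised variety\<close>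

text \<open>All homogeneous coordinate vectors of the points of \<open>X\<close>.\<close>
definition cone :: "nat \<Rightarrow> bipoly set set \<Rightarrow> (nat \<Rightarrow> complex) set" where
  "cone N X = (\<Union>x\<in>X. coords N ` (x - {0}))"

text \<open>
  The zero function is added because over an empty set of variables \<open>hom_poly\<close> contains it in
  degree zero only.
\<close>
definition hom0 :: "'i set \<Rightarrow> nat \<Rightarrow> (('i \<Rightarrow> complex) \<Rightarrow> complex) \<Rightarrow> bool" where
  "hom0 J e F \<longleftrightarrow> F = (\<lambda>_. 0) \<or> hom_poly J e F"

text \<open>
  Homogeneous of degree \<open>e - 1\<close> and zero if \<open>e = 0\<close>. This is what quotients by a variable and
  partial derivatives satisfy.
\<close>
definition hom0_pred :: "'i set \<Rightarrow> nat \<Rightarrow> (('i \<Rightarrow> complex) \<Rightarrow> complex) \<Rightarrow> bool" where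
  "hom0_pred J e F \<longleftrightarrow> F = (\<lambda>_. 0) \<or> (\<exists>e'. e = Suc e' \<and> hom_poly J e' F)"

lemma hom_poly_mono: "hom_poly J e F \<Longrightarrow> J \<subseteq> K \<Longrightarrow> hom_poly K e F"
  by (induction rule: hom_poly.induct) (auto intro: hom_poly.intros hom_poly.var[unfolded One_nat_def])

lemma hom0_add: "hom0 J e F \<Longrightarrow> hom0 J e G \<Longrightarrow> hom0 J e (\<lambda>z. F z + G z)"
  unfolding hom0_def by (auto intro: hom_poly.add)

lemma hom0_mult: "hom0 J e F \<Longrightarrow> hom0 J e' G \<Longrightarrow> hom0 J (e + e') (\<lambda>z. F z * G z)"
  unfolding hom0_def by (auto intro: hom_poly.mult)

lemma hom0_pred_add: "hom0_pred J e F \<Longrightarrow> hom0_pred J e G \<Longrightarrow> hom0_pred J e (\<lambda>z. F z + G z)"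
  unfolding hom0_pred_def by (auto intro: hom_poly.add)

lemma hom0_pred_mult: "hom0_pred J e F \<Longrightarrow> hom0 J e' G \<Longrightarrow> hom0_pred J (e + e') (\<lambda>z. F z * G z)"
  unfolding hom0_pred_def hom0_def by (auto intro: hom_poly.mult)

lemma hom_poly_split_variable:
  "hom_poly (insert k B) e G \<Longrightarrow>
   \<exists>G0 G1. hom0 B e G0 \<and> hom0_pred (insert k B) e G1 \<and> (\<forall>y. G y = G0 y + y k * G1 y)"
proof (induction rule: hom_poly.induct)
  case (const c)
  then show ?case
    by (intro exI[of _ "\<lambda>_. c"] exI[of _ "\<lambda>_. 0"]) (auto simp: hom0_def hom0_pred_def intro: hom_poly.const)
next
  case (var i)
  show ?case
  proof (cases "i = k")
    case True
    then show ?thesis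
      by (intro exI[of _ "\<lambda>_. 0"] exI[of _ "\<lambda>_. 1"]) (auto simp: hom0_def hom0_pred_def intro: hom_poly.const)
  next
    case False
    then have "hom_poly B 1 (\<lambda>y. y i)" using var by (intro hom_poly.var) auto
    then show ?thesis
      by (intro exI[of _ "\<lambda>y. y i"] exI[of _ "\<lambda>_. 0"]) (auto simp: hom0_def hom0_pred_def)
  qed
next
  case (add e F G)
  obtain F0 F1 where F: "hom0 B e F0" "hom0_pred (insert k B) e F1" "\<And>y. F y = F0 y + y k * F1 y" using add.IH(1) by blast
  obtain G0 G1 where G: "hom0 B e G0" "hom0_pred (insert k B) e G1" "\<And>y. G y = G0 y + y k * G1 y" using add.IH(2) by blast
  have "\<forall>y. F y + G y = (F0 y + G0 y) + y k * (F1 y + G1 y)" by (simp add: F(3) G(3) algebra_simps)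
  then show ?case using hom0_add[OF F(1) G(1)] hom0_pred_add[OF F(2) G(2)]
    by (intro exI[of _ "\<lambda>y. F0 y + G0 y"] exI[of _ "\<lambda>y. F1 y + G1 y"] conjI)
next
  case (mult e F e' G)
  obtain F0 F1 where F: "hom0 B e F0" "hom0_pred (insert k B) e F1" "\<And>y. F y = F0 y + y k * F1 y" using mult.IH(1) by blast
  obtain G0 G1 where G: "hom0 B e' G0" "hom0_pred (insert k B) e' G1" "\<And>y. G y = G0 y + y k * G1 y" using mult.IH(2) by blast
  have F0: "hom0 (insert k B) e F0" using F(1) hom_poly_mono unfolding hom0_def by blast
  have G': "hom0 (insert k B) e' G" using mult.hyps unfolding hom0_def by blast
  have "hom0_pred (insert k B) (e + e') (\<lambda>y. F1 y * G y + G1 y * F0 y)"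
    using hom0_pred_add[OF hom0_pred_mult[OF F(2) G'] hom0_pred_mult[OF G(2) F0, unfolded add.commute[of e' e]]] .
  moreover have "\<forall>y. F y * G y = F0 y * G0 y + y k * (F1 y * G y + G1 y * F0 y)" by (simp add: F(3) G(3) algebra_simps)
  ultimately show ?case using hom0_mult[OF F(1) G(1)]
    by (intro exI[of _ "\<lambda>y. F0 y * G0 y"] exI[of _ "\<lambda>y. F1 y * G y + G1 y * F0 y"] conjI)
qed

lemma nonvanishing_at_point_iff:
  assumes F: "hom_poly {..N} e F" and x: "x \<in> Gr N 1" and z: "z \<in> coords N ` (x - {0})" "z' \<in> coords N ` (x - {0})"
  shows "F z = 0 \<longleftrightarrow> F z' = 0"
proof -
  obtain f where f: "f \<in> forms N" "f \<noteq> 0" "x = bipoly.span {f}" using point_of_Gr[OF x] by metis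
  have "F z = 0 \<longleftrightarrow> F (coords N f) = 0" if zz: "z \<in> coords N ` (x - {0})" for z
  proof -
    obtain u where u: "u \<in> bipoly.span {f}" "u \<noteq> 0" "z = coords N u" using zz f(3) by blast
    then obtain c where c: "u = smult [:c:] f" by (auto simp: span_single)
    have "z = (\<lambda>i. c * coords N f i)" by (simp add: u(3) c coords_smult fun_eq_iff)
    then have "F z = c ^ e * F (coords N f)" using hom_poly_scale[OF F] by simp
    moreover have "c \<noteq> 0" using u(2) c by auto
    ultimately show ?thesis by simp
  qed
  then show ?thesis using z by blast
qed

text \<open>
  Finite intersections of basic open sets are basic because the product of the equations is an
  equation; no further choice of coordinates matters by \<open>nonvanishing_at_point_iff\<close>.
\<close>
lemma open_contains_basic:
  assumes U: "openin (zariski_proj N) U" and x: "x \<in> U"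
  shows "\<exists>e F. hom_poly {..N} e F \<and> (\<exists>z \<in> coords N ` (x - {0}). F z \<noteq> 0) \<and>
    (\<forall>y\<in>Gr N 1. (\<exists>z \<in> coords N ` (y - {0}). F z \<noteq> 0) \<longrightarrow> y \<in> U)"
proof -
  have xG: "x \<in> Gr N 1" using openin_subset[OF U] x topspace_zariski_proj by blast
  have "generate_topology_on {{p \<in> Gr N 1. \<exists>z \<in> coords N ` (p - {0}). F z \<noteq> 0} | e F. hom_poly {..N} e F} U"
    using U unfolding zariski_proj_def zariski_def openin_topology_generated_by_iff .
  then show ?thesis using x
  proof (induction rule: generate_topology_on.induct)
    case Empty
    then show ?case by simp
  next
    case (Int a b)
    obtain e F z where F: "hom_poly {..N} e F" "z \<in> coords N ` (x - {0})" "F z \<noteq> 0"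
      "\<forall>y\<in>Gr N 1. (\<exists>z \<in> coords N ` (y - {0}). F z \<noteq> 0) \<longrightarrow> y \<in> a" using Int by blast
    obtain e' G z' where G: "hom_poly {..N} e' G" "z' \<in> coords N ` (x - {0})" "G z' \<noteq> 0"
      "\<forall>y\<in>Gr N 1. (\<exists>z \<in> coords N ` (y - {0}). G z \<noteq> 0) \<longrightarrow> y \<in> b" using Int by blast
    have "G z \<noteq> 0" using nonvanishing_at_point_iff[OF G(1) xG F(2) G(2)] G(3) by simp
    then have "F z * G z \<noteq> 0" using F(3) by simp
    moreover have "\<forall>y\<in>Gr N 1. (\<exists>z \<in> coords N ` (y - {0}). F z * G z \<noteq> 0) \<longrightarrow> y \<in> a \<inter> b"
    proof (intro ballI impI IntI)
      fix y assume y: "y \<in> Gr N 1" "\<exists>z \<in> coords N ` (y - {0}). F z * G z \<noteq> 0"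
      then obtain w where "w \<in> coords N ` (y - {0})" "F w \<noteq> 0" "G w \<noteq> 0" by auto
      then show "y \<in> a" "y \<in> b" using F(4) G(4) y(1) by blast+
    qed
    ultimately show ?case using hom_poly.mult[OF F(1) G(1)] F(2)
      by (intro exI[of _ "e + e'"] exI[of _ "\<lambda>z. F z * G z"] conjI) blast+
  next
    case (UN K)
    then obtain k where k: "k \<in> K" "x \<in> k" by blast
    obtain e F where F: "hom_poly {..N} e F" "\<exists>z \<in> coords N ` (x - {0}). F z \<noteq> 0"
      "\<forall>y\<in>Gr N 1. (\<exists>z \<in> coords N ` (y - {0}). F z \<noteq> 0) \<longrightarrow> y \<in> k" using UN(2)[OF k] by blast
    have "\<forall>y\<in>Gr N 1. (\<exists>z \<in> coords N ` (y - {0}). F z \<noteq> 0) \<longrightarrow> y \<in> \<Union> K" using F(3) k(1) by blast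
    then show ?case using F(1,2) by blast
  next
    case (Basis B)
    then obtain e F where F: "hom_poly {..N} e F" "B = {p \<in> Gr N 1. \<exists>z \<in> coords N ` (p - {0}). F z \<noteq> 0}" by blast
    then have "\<exists>z \<in> coords N ` (x - {0}). F z \<noteq> 0" using Basis by blast
    moreover have "\<forall>y\<in>Gr N 1. (\<exists>z \<in> coords N ` (y - {0}). F z \<noteq> 0) \<longrightarrow> y \<in> B" unfolding F(2) by blast
    ultimately show ?case using F(1) by blast
  qed
qed

context
  fixes N :: nat and X :: "bipoly set set"
  assumes XG: "X \<subseteq> Gr N 1"
begin

lemma closedin_vanishing:
  assumes "hom_poly {..N} e F"
  shows "closedin (subtopology (zariski_proj N) X) {x \<in> X. \<forall>z\<in>coords N ` (x - {0}). F z = 0}"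
proof -
  have ne: "coords N ` (p - {0}) \<noteq> {}" if pG: "p \<in> Gr N 1" for p
  proof -
    obtain f where "f \<in> forms N" "f \<noteq> 0" "p = bipoly.span {f}" by (rule point_of_Gr[OF pG])
    then show ?thesis using bipoly.span_base[of f "{f}"] by blast
  qed
  have "closedin (zariski_proj N) {p \<in> Gr N 1. \<forall>z \<in> coords N ` (p - {0}). \<forall>H\<in>{F}. H z = 0}"
    unfolding zariski_proj_def using closedin_zariski[where hc = "\<lambda>p. coords N ` (p - {0})", OF ne, of "Gr N 1" "{F}" "{..N}"] assms by blast
  moreover have "{x \<in> X. \<forall>z\<in>coords N ` (x - {0}). F z = 0} = {p \<in> Gr N 1. \<forall>z \<in> coords N ` (p - {0}). \<forall>H\<in>{F}. H z = 0} \<inter> X"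
    using XG by auto
  ultimately show ?thesis unfolding closedin_subtopology by blast
qed

lemma separating_function:
  assumes Z: "closedin (subtopology (zariski_proj N) X) Z" and x: "x \<in> X" "x \<notin> Z"
  shows "\<exists>e F. hom_poly {..N} e F \<and> (\<forall>z\<in>cone N Z. F z = 0) \<and> (\<exists>z\<in>coords N ` (x - {0}). F z \<noteq> 0)"
proof -
  obtain C where C: "closedin (zariski_proj N) C" "Z = C \<inter> X" using Z unfolding closedin_subtopology by blast
  have op: "openin (zariski_proj N) (Gr N 1 - C)" using C(1) unfolding closedin_def topspace_zariski_proj by blast
  have "x \<in> Gr N 1 - C" using x C(2) XG by blast
  from open_contains_basic[OF op this] obtain e F where F: "hom_poly {..N} e F" "\<exists>z \<in> coords N ` (x - {0}). F z \<noteq> 0"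
    "\<forall>y\<in>Gr N 1. (\<exists>z \<in> coords N ` (y - {0}). F z \<noteq> 0) \<longrightarrow> y \<in> Gr N 1 - C" by blast
  have "F z = 0" if zZ: "z \<in> cone N Z" for z
  proof (rule ccontr)
    assume "F z \<noteq> 0"
    obtain y where y: "y \<in> Z" "z \<in> coords N ` (y - {0})" using zZ unfolding cone_def by blast
    then show False using F(3) C(2) XG \<open>F z \<noteq> 0\<close> by blast
  qed
  then show ?thesis using F(1,2) by blast
qed

lemma irreducible_vanishing_product:
  assumes Z: "irreducible_in (subtopology (zariski_proj N) X) Z"
    and F: "hom_poly {..N} e F" and G: "hom_poly {..N} e' G" and FG: "\<And>z. z \<in> cone N Z \<Longrightarrow> F z * G z = 0"
  shows "(\<forall>z\<in>cone N Z. F z = 0) \<or> (\<forall>z\<in>cone N Z. G z = 0)"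
proof -
  let ?A = "\<lambda>F. {x \<in> X. \<forall>z\<in>coords N ` (x - {0}). F z = 0}"
  have ZX: "Z \<subseteq> X" using Z unfolding irreducible_in_def by auto
  have "Z \<subseteq> ?A F \<union> ?A G"
  proof
    fix x assume x: "x \<in> Z"
    then have xG: "x \<in> Gr N 1" using ZX XG by blast
    show "x \<in> ?A F \<union> ?A G"
    proof (rule ccontr)
      assume "x \<notin> ?A F \<union> ?A G"
      then obtain z z' where z: "z \<in> coords N ` (x - {0})" "F z \<noteq> 0" "z' \<in> coords N ` (x - {0})" "G z' \<noteq> 0"
        using x ZX by blast
      then have "G z \<noteq> 0" using nonvanishing_at_point_iff[OF G xG z(1,3)] by simp
      then show False using FG[of z] z(1,2) x unfolding cone_def by auto
    qed
  qed
  then have "Z \<subseteq> ?A F \<or> Z \<subseteq> ?A G"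
    using Z closedin_vanishing[OF F] closedin_vanishing[OF G] unfolding irreducible_in_def by blast
  then show ?thesis unfolding cone_def by blast
qed

text \<open>
  Choose for each step of the chain an equation of \<open>Z i\<close> that does not vanish on \<open>Z (i + 1)\<close>, and
  for the bottom a coordinate that does not vanish at some point of \<open>Z 0\<close>. These \<open>k + 1\<close> functions
  are algebraically independent on \<open>Z k\<close>: write a relation on \<open>Z (i + 1)\<close> as
  \<open>G0 + F' (i + 1) \<cdot> G1\<close> with \<open>G0\<close> free of the last function. On \<open>Z i\<close> the last function vanishes,
  so \<open>G0\<close> is a relation on \<open>Z i\<close> and thus zero. By irreducibility \<open>F' (i + 1)\<close> can be cancelled,
  and \<open>G1\<close> is a relation of smaller degree. The bound is then \<open>hom_indep_card_bound\<close>.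
\<close>
lemma chain_length_bound:
  fixes k :: nat
  assumes f: "multihom_poly ({} :: nat set) m dl f"
    and XU: "cone N X \<subseteq> {z. \<exists>a v. \<forall>i\<le>N. z i = a * coeff (f v) i}"
    and Z: "\<And>i. i \<le> k \<Longrightarrow> closedin (subtopology (zariski_proj N) X) (Z i) \<and> irreducible_in (subtopology (zariski_proj N) X) (Z i)"
    and strict: "\<And>i. i < k \<Longrightarrow> Z i \<subset> Z (Suc i)"
  shows "k \<le> m"
proof -
  have ZX: "Z i \<subseteq> X" "Z i \<noteq> {}" if "i \<le> k" for i using Z[OF that] unfolding irreducible_in_def by auto
  have "\<exists>e F. hom_poly {..N} e F \<and> (\<forall>z\<in>cone N (Z i). F z = 0) \<and> (\<exists>z\<in>cone N (Z (Suc i)). F z \<noteq> 0)" if i: "i < k" for i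
  proof -
    obtain x where x: "x \<in> Z (Suc i)" "x \<notin> Z i" using strict[OF i] by blast
    then have "x \<in> X" using ZX[of "Suc i"] i by auto
    then show ?thesis using separating_function[of "Z i" x] Z[of i] i x unfolding cone_def by fastforce
  qed
  then obtain e F where eF: "\<And>i. i < k \<Longrightarrow> hom_poly {..N} (e i) (F i)" "\<And>i z. i < k \<Longrightarrow> z \<in> cone N (Z i) \<Longrightarrow> F i z = 0"
    "\<And>i. i < k \<Longrightarrow> \<exists>z\<in>cone N (Z (Suc i)). F i z \<noteq> 0" by metis
  have cne: "cone N (Z i) \<noteq> {}" if ik: "i \<le> k" for i
  proof -
    obtain x where x: "x \<in> Z i" "x \<in> Gr N 1" using ZX[OF ik] XG by blast
    then obtain g where "g \<noteq> 0" "x = bipoly.span {g}" using point_of_Gr by metis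
    then show ?thesis using x(1) bipoly.span_base[of g "{g}"] unfolding cone_def by blast
  qed
  have e0: "e i > 0" if "i < k" for i
  proof (rule ccontr)
    assume "\<not> e i > 0"
    then have "hom_poly {..N} 0 (F i)" using eF(1)[OF that] by simp
    then have "F i z = F i (\<lambda>_. 0)" for z using hom_poly_scale[of "{..N}" 0 "F i" 0 z] by simp
    moreover obtain z0 where "z0 \<in> cone N (Z i)" using cne[of i] \<open>i < k\<close> by auto
    ultimately have "F i z = 0" for z using eF(2)[OF \<open>i < k\<close>] by metis
    then show False using eF(3)[OF that] by blast
  qed
  obtain x0 g0 where x0: "x0 \<in> Z 0" "g0 \<in> forms N" "g0 \<noteq> 0" "x0 = bipoly.span {g0}"
    using ZX[of 0] XG point_of_Gr by (metis all_not_in_conv le0 subset_iff)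
  obtain i0 where i0: "i0 \<le> N" "coords N g0 i0 \<noteq> 0" using coords_nonzero[OF x0(2,3)] by blast
  have g0c: "coords N g0 \<in> cone N (Z 0)" using x0 bipoly.span_base[of g0 "{g0}"] unfolding cone_def by blast
  \<comment> \<open>the coordinate at the bottom followed by the equations; powers bring all of them to the
     common degree \<open>E\<close>\<close>
  define G where "G i = (case i of 0 \<Rightarrow> (\<lambda>z. z i0) | Suc j \<Rightarrow> F j)" for i
  define ep where "ep i = (case i of 0 \<Rightarrow> 1 | Suc j \<Rightarrow> e j)" for i
  define E where "E = (\<Prod>i\<le>k. ep i)"
  define F' where "F' i z = G i z ^ (E div ep i)" for i z
  have ep0: "ep i > 0" if "i \<le> k" for i using that e0 by (cases i) (auto simp: ep_def)
  have E0: "E > 0" unfolding E_def using ep0 by (intro prod_pos) auto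
  have dv: "ep i dvd E" if "i \<le> k" for i unfolding E_def using that by (intro dvd_prodI) auto
  have q0: "E div ep i > 0" if "i \<le> k" for i using dv[OF that] E0 ep0[OF that] by (simp add: div_greater_zero_iff dvd_imp_le)
  have hG: "hom_poly {..N} (ep i) (G i)" if "i \<le> k" for i
    using that i0(1) eF(1) by (cases i) (auto simp: G_def ep_def intro: hom_poly.var[unfolded One_nat_def])
  have hF': "hom_poly {..N} E (F' i)" if "i \<le> k" for i
    using hom_poly_power[OF hG[OF that], of "E div ep i"] dv[OF that] unfolding F'_def[abs_def] by simp
  have van: "F' (Suc i) z = 0" if "i < k" "z \<in> cone N (Z i)" for i z
    using eF(2)[OF that] q0[of "Suc i"] that(1) by (simp add: F'_def G_def)
  have nonvan: "\<exists>z\<in>cone N (Z (Suc i)). F' (Suc i) z \<noteq> 0" if "i < k" for i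
    using eF(3)[OF that] by (auto simp: F'_def G_def)
  have ind: "i \<le> k \<Longrightarrow> hom_indep (cone N (Z i)) F' {..i}" for i
  proof (induction i)
    case 0
    show ?case unfolding hom_indep_def
    proof safe
      fix e G' y assume G': "hom_poly {..0::nat} e G'" "\<forall>z\<in>cone N (Z 0). G' (\<lambda>b. F' b z) = 0"
      have sc: "G' y = y 0 ^ e * G' (\<lambda>_. 1)" for y
        using hom_poly_cong[OF G'(1), of y "\<lambda>i. y 0 * 1"] hom_poly_scale[OF G'(1), of "y 0" "\<lambda>_. 1"] by simp
      have "G' (\<lambda>b. F' b (coords N g0)) = 0" using G'(2) g0c by blast
      moreover have "F' 0 (coords N g0) \<noteq> 0" using i0(2) by (simp add: F'_def G_def)
      ultimately have "G' (\<lambda>_. 1) = 0" using sc[of "\<lambda>b. F' b (coords N g0)"] by simp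
      then show "G' y = 0" using sc[of y] by simp
    qed
  next
    case (Suc i)
    then have ik: "i < k" and IH: "hom_indep (cone N (Z i)) F' {..i}" by auto
    have cm: "cone N (Z i) \<subseteq> cone N (Z (Suc i))" using strict[OF ik] unfolding cone_def by blast
    have "\<forall>G'. hom_poly {..Suc i} e G' \<and> (\<forall>z\<in>cone N (Z (Suc i)). G' (\<lambda>b. F' b z) = 0) \<longrightarrow> (\<forall>y. G' y = 0)" for e
    proof (induction e rule: less_induct)
      case (less e)
      show ?case
      proof (intro allI impI, elim conjE)
        fix G' y assume G': "hom_poly {..Suc i} e G'" "\<forall>z\<in>cone N (Z (Suc i)). G' (\<lambda>b. F' b z) = 0"
        have ins: "{..Suc i} = insert (Suc i) {..i}" by auto
        obtain G0 G1 where G01: "hom0 {..i} e G0" "hom0_pred {..Suc i} e G1" "\<And>y. G' y = G0 y + y (Suc i) * G1 y"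
          using hom_poly_split_variable[of "Suc i" "{..i}" e G'] G'(1) unfolding ins by blast
        have "\<forall>z\<in>cone N (Z i). G0 (\<lambda>b. F' b z) = 0"
        proof
          fix z assume z: "z \<in> cone N (Z i)"
          then have "G' (\<lambda>b. F' b z) = 0" using G'(2) cm by blast
          then show "G0 (\<lambda>b. F' b z) = 0" using van[OF ik z] G01(3) by simp
        qed
        then have G00: "G0 y = 0" for y using IH G01(1) unfolding hom_indep_def hom0_def by blast
        have "G1 y = 0" for y
        proof (cases "G1 = (\<lambda>_. 0)")
          case False
          then obtain e' where e': "e = Suc e'" "hom_poly {..Suc i} e' G1" using G01(2) unfolding hom0_pred_def by blast
          have "hom_poly {..N} (e' * E) (\<lambda>z. G1 (\<lambda>b. F' b z))"
            using hF' ik by (intro hom_poly_compose[OF e'(2)]) auto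
          moreover have "F' (Suc i) z * G1 (\<lambda>b. F' b z) = 0" if "z \<in> cone N (Z (Suc i))" for z
            using G'(2) that G01(3) G00 by simp
          ultimately have "\<forall>z\<in>cone N (Z (Suc i)). G1 (\<lambda>b. F' b z) = 0"
            using irreducible_vanishing_product[of "Z (Suc i)" E "F' (Suc i)"] Z[of "Suc i"] hF'[of "Suc i"] ik nonvan[OF ik] by fastforce
          then show ?thesis using less[of e'] e' by blast
        qed simp
        then show "G' y = 0" using G01(3) G00 by simp
      qed
    qed
    then show ?case unfolding hom_indep_def by blast
  qed
  have "cone N (Z k) \<subseteq> cone N X" using ZX(1)[of k] unfolding cone_def by blast
  then show ?thesis using hom_indep_card_bound[of k N E F' m dl f "cone N (Z k)"] hF' f XU ind[of k] by blast
qed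

end

lemma root_locus_subset_Gr: "root_locus es \<subseteq> Gr (sum_list es) 1"
proof
  fix x assume "x \<in> root_locus es"
  then obtain v where v: "x = (root_point es v)" "\<forall>i<length es. v i \<noteq> 0" unfolding root_locus_def by blast
  then have "homog (sum_list es) (root_product es v) \<noteq> 0" using root_product_nonzero homog_eq_0_iff[OF degree_root_product] by blast
  then show "x \<in> Gr (sum_list es) 1" unfolding v(1) using point_in_Gr by simp
qed

lemma cone_crlD:
  assumes "z \<in> cone (sum_list es) (root_locus es)"
  shows "\<exists>a v. a \<noteq> 0 \<and> (\<forall>i<length es. v i \<noteq> 0) \<and> (\<forall>i\<le>sum_list es. z i = a * coeff (root_product es v) i)"
proof -
  obtain x u where x: "x \<in> root_locus es" "u \<in> x" "u \<noteq> 0" "z = coords (sum_list es) u" using assms unfolding cone_def by blast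
  then obtain v where v: "x = (root_point es v)" "\<forall>i<length es. v i \<noteq> 0" unfolding root_locus_def by blast
  obtain a where a: "u = smult [:a:] (homog (sum_list es) (root_product es v))" using x(2) v(1) by (auto simp: span_single)
  then have "a \<noteq> 0" using x(3) by auto
  then show ?thesis using v(2) x(4) a by (intro exI[of _ a] exI[of _ v]) (simp add: coords_smult coords_homog)
qed

text \<open>
  Scalars are irrelevant for homogeneous functions, so vanishing may be tested on the
  parametrisation.
\<close>
lemma vanishing_on_root_locus_iff:
  assumes F: "hom_poly {..sum_list es} e F"
  shows "(\<forall>z\<in>cone (sum_list es) (root_locus es). F z = 0) \<longleftrightarrow> (\<forall>v. (\<forall>i<length es. v i \<noteq> 0) \<longrightarrow> F (coeff (root_product es v)) = 0)"
proof
  let ?N = "sum_list es"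
  assume a: "\<forall>z\<in>cone ?N (root_locus es). F z = 0"
  show "\<forall>v. (\<forall>i<length es. v i \<noteq> 0) \<longrightarrow> F (coeff (root_product es v)) = 0"
  proof safe
    fix v :: "nat \<Rightarrow> complex \<times> complex" assume v: "\<forall>i<length es. v i \<noteq> 0"
    let ?h = "homog ?N (root_product es v)"
    have "?h \<noteq> 0" using v root_product_nonzero homog_eq_0_iff[OF degree_root_product] by blast
    moreover have "bipoly.span {?h} \<in> root_locus es" using v unfolding root_locus_def by blast
    ultimately have "coords ?N ?h \<in> cone ?N (root_locus es)" using bipoly.span_base[of ?h "{?h}"] unfolding cone_def by blast
    then have "F (coords ?N ?h) = 0" using a by blast
    moreover have "F (coords ?N ?h) = F (coeff (root_product es v))" by (rule hom_poly_cong[OF F]) (simp add: coords_homog)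
    ultimately show "F (coeff (root_product es v)) = 0" by simp
  qed
next
  assume a: "\<forall>v. (\<forall>i<length es. v i \<noteq> 0) \<longrightarrow> F (coeff (root_product es v)) = 0"
  show "\<forall>z\<in>cone (sum_list es) (root_locus es). F z = 0"
  proof
    fix z assume z: "z \<in> cone (sum_list es) (root_locus es)"
    obtain b v where "b \<noteq> 0" and v: "\<And>i. i < length es \<Longrightarrow> v i \<noteq> 0" "\<And>i. i \<le> sum_list es \<Longrightarrow> z i = b * coeff (root_product es v) i"
      using cone_crlD[OF z] by blast
    have "F z = F (\<lambda>i. b * coeff (root_product es v) i)" by (rule hom_poly_cong[OF F]) (simp add: v(2))
    also have "\<dots> = b ^ e * F (coeff (root_product es v))" by (rule hom_poly_scale[OF F])
    finally show "F z = 0" using a v(1) by simp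
  qed
qed

lemma finite_zeros_on_line:
  assumes F: "hom_poly J e F" "F (coeff (root_product es (line v w s))) \<noteq> 0"
  shows "finite {t. F (coeff (root_product es (line v w t))) = 0}"
proof -
  have "poly_fun (\<lambda>t. F (coeff (root_product es (line v w t))))"
    by (rule hom_poly_curve[OF F(1)]) (use poly_curve_root_product_line in \<open>auto simp: poly_curve_def\<close>)
  then show ?thesis using finite_zeros_poly_fun F(2) by blast
qed

text \<open>
  On the line joining the two tuples of linear forms each function has finitely many zeros.
\<close>
lemma common_nonzero_on_root_locus:
  assumes F: "hom_poly J e F" "F (coeff (root_product es v)) \<noteq> 0" and v: "\<And>i. i < length es \<Longrightarrow> v i \<noteq> 0"
    and G: "hom_poly J e' G" "G (coeff (root_product es w)) \<noteq> 0"
  shows "\<exists>u. (\<forall>i<length es. u i \<noteq> 0) \<and> F (coeff (root_product es u)) * G (coeff (root_product es u)) \<noteq> 0"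
proof -
  have fin: "finite ({t. F (coeff (root_product es (line v w t))) = 0} \<union> {t. G (coeff (root_product es (line v w t))) = 0} \<union>
      {t. \<not> (\<forall>i<length es. line v w t i \<noteq> 0)})"
    using finite_zeros_on_line[OF F(1), of es v w 0] finite_zeros_on_line[OF G(1), of es v w 1] F(2) G(2)
      finite_line_degenerate[of "length es" v w] v by simp
  obtain t where "t \<notin> {t. F (coeff (root_product es (line v w t))) = 0} \<union> {t. G (coeff (root_product es (line v w t))) = 0} \<union>
      {t. \<not> (\<forall>i<length es. line v w t i \<noteq> 0)}"
    using ex_new_if_finite[OF infinite_UNIV_char_0 fin] by blast
  then show ?thesis by (intro exI[of _ "line v w t"]) auto
qed

lemma lin_01_power: "lin (0, 1) ^ n = monom 1 n"
  by (simp add: lin_def monom_altdef)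

lemma root_product_split_last:
  assumes "\<And>j. i \<le> j \<Longrightarrow> j < length es \<Longrightarrow> v j = (0, 1)" "i \<le> length es"
  shows "root_product es v = (\<Prod>j<i. lin (v j) ^ (es ! j)) * monom 1 (\<Sum>j\<in>{i..<length es}. es ! j)"
proof -
  have eq: "{..<length es} = {..<i} \<union> {i..<length es}" using assms(2) by auto
  have "root_product es v = (\<Prod>j<i. lin (v j) ^ (es ! j)) * (\<Prod>j\<in>{i..<length es}. lin (v j) ^ (es ! j))"
    unfolding root_product_def eq by (rule prod.union_disjoint) auto
  also have "(\<Prod>j\<in>{i..<length es}. lin (v j) ^ (es ! j)) = (\<Prod>j\<in>{i..<length es}. lin (0, 1) ^ (es ! j))"
    using assms(1) by (intro prod.cong) auto
  also have "\<dots> = monom 1 (\<Sum>j\<in>{i..<length es}. es ! j)"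
    unfolding power_sum[symmetric] by (rule lin_01_power)
  finally show ?thesis .
qed

text \<open>
  For the lower bound let \<open>S i\<close> consist of the points whose linear forms from index \<open>i\<close> on are the
  coordinate \<open>y\<close>. Its closure is irreducible, because two points of \<open>S i\<close> are joined by a line in
  the parameter space, on which a product of two nonzero functions is nonzero. The inclusions are
  strict: the coefficient \<open>c\<close> used below vanishes on \<open>S i\<close>, where the form is divisible by \<open>y\<^sup>c\<^sup>+\<^sup>1\<close>,
  but not on \<open>S (i + 1)\<close>. The upper bound is \<open>chain_length_bound\<close>.
\<close>
lemma var_dim_root_locus:
  assumes pos: "0 \<notin> set es"
  shows "var_dim (sum_list es) (root_locus es) = length es"
proof -
  let ?N = "sum_list es" and ?m = "length es"
  let ?X = "root_locus es"
  let ?T = "subtopology (zariski_proj ?N) ?X"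
  have XG: "?X \<subseteq> Gr ?N 1" by (rule root_locus_subset_Gr)
  have topT: "topspace ?T = ?X" using XG topspace_zariski_proj by (simp add: Int_absorb1)
  define S where "S i = {(root_point es v) | v. (\<forall>j<?m. v j \<noteq> 0) \<and> (\<forall>j. i \<le> j \<and> j < ?m \<longrightarrow> v j = (0, 1))}" for i
  define Z where "Z i = ?T closure_of (S i)" for i
  have SX: "S i \<subseteq> ?X" for i unfolding S_def root_locus_def by blast
  have SZ: "S i \<subseteq> Z i" for i unfolding Z_def by (rule closure_of_subset) (use SX topT in auto)
  have clZ: "closedin ?T (Z i)" for i unfolding Z_def by (rule closedin_closure_of)
  have neS: "S i \<noteq> {}" for i
  proof -
    have "(root_point es (\<lambda>_. (0, 1))) \<in> S i" unfolding S_def by (auto simp: zero_prod_def)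
    then show ?thesis by blast
  qed
  have irrS: "S i \<subseteq> A \<or> S i \<subseteq> B" if AB: "closedin ?T A" "closedin ?T B" "S i \<subseteq> A \<union> B" for i A B
  proof (rule ccontr)
    assume "\<not> ?thesis"
    then obtain x y where xy: "x \<in> S i" "x \<notin> A" "y \<in> S i" "y \<notin> B" by blast
    obtain v where v: "x = (root_point es v)" "\<forall>j<?m. v j \<noteq> 0" "\<forall>j. i \<le> j \<and> j < ?m \<longrightarrow> v j = (0, 1)"
      using xy(1) unfolding S_def by blast
    obtain w where w: "y = (root_point es w)" "\<forall>j<?m. w j \<noteq> 0" "\<forall>j. i \<le> j \<and> j < ?m \<longrightarrow> w j = (0, 1)"
      using xy(3) unfolding S_def by blast
    have xyX: "x \<in> ?X" "y \<in> ?X" using xy SX by blast+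
    from separating_function[OF XG AB(1) xyX(1) xy(2)]
    obtain e F where F: "hom_poly {..?N} e F" "\<forall>z\<in>cone ?N A. F z = 0" "\<exists>z\<in>coords ?N ` (x - {0}). F z \<noteq> 0"
      by blast
    from separating_function[OF XG AB(2) xyX(2) xy(4)]
    obtain e' G where G: "hom_poly {..?N} e' G" "\<forall>z\<in>cone ?N B. G z = 0" "\<exists>z\<in>coords ?N ` (y - {0}). G z \<noteq> 0"
      by blast
    have key: "F (coeff (root_product es u)) \<noteq> 0 \<longleftrightarrow> (\<exists>z\<in>coords ?N ` ((root_point es u) - {0}). F z \<noteq> 0)"
      if u: "\<forall>j<?m. u j \<noteq> 0" and F: "hom_poly {..?N} e F" for u F e
    proof -
      let ?h = "homog ?N (root_product es u)"
      have h0: "?h \<noteq> 0" using u root_product_nonzero homog_eq_0_iff[OF degree_root_product] by blast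
      have "coords ?N ?h \<in> coords ?N ` (bipoly.span {?h} - {0})" using h0 bipoly.span_base[of ?h "{?h}"] by blast
      moreover have "F (coords ?N ?h) = F (coeff (root_product es u))" by (rule hom_poly_cong[OF F]) (simp add: coords_homog)
      ultimately show ?thesis
        using nonvanishing_at_point_iff[OF F point_in_Gr[OF homog_forms h0]] by metis
    qed
    have "F (coeff (root_product es (line v w 0))) \<noteq> 0" "G (coeff (root_product es (line v w 1))) \<noteq> 0"
      using key[OF v(2) F(1)] key[OF w(2) G(1)] F(3) G(3) v(1) w(1) by simp_all
    then have fin: "finite ({t. F (coeff (root_product es (line v w t))) = 0} \<union> {t. G (coeff (root_product es (line v w t))) = 0} \<union>
      {t. \<not> (\<forall>i<?m. line v w t i \<noteq> 0)})"
      using finite_zeros_on_line[OF F(1)] finite_zeros_on_line[OF G(1)] finite_line_degenerate[of ?m v w] v(2) by blast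
    obtain t where t: "t \<notin> {t. F (coeff (root_product es (line v w t))) = 0} \<union> {t. G (coeff (root_product es (line v w t))) = 0} \<union>
      {t. \<not> (\<forall>i<?m. line v w t i \<noteq> 0)}"
      using ex_new_if_finite[OF infinite_UNIV_char_0 fin] by blast
    let ?u = "line v w t"
    have u: "\<forall>j<?m. ?u j \<noteq> 0" using t by blast
    let ?p = "(root_point es ?u)"
    have "\<forall>j. i \<le> j \<and> j < ?m \<longrightarrow> ?u j = (0, 1)" using v(3) w(3) by (simp add: line_def)
    then have "?p \<in> S i" using u unfolding S_def by blast
    then have "?p \<in> A \<or> ?p \<in> B" using AB(3) by blast
    then show False
    proof
      assume "?p \<in> A"
      then have "\<forall>z\<in>coords ?N ` (?p - {0}). F z = 0" using F(2) unfolding cone_def by blast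
      then show False using key[OF u F(1)] t by blast
    next
      assume "?p \<in> B"
      then have "\<forall>z\<in>coords ?N ` (?p - {0}). G z = 0" using G(2) unfolding cone_def by blast
      then show False using key[OF u G(1)] t by blast
    qed
  qed
  have irrZ: "irreducible_in ?T (Z i)" for i
    unfolding irreducible_in_def
  proof (intro conjI allI impI)
    show "Z i \<noteq> {}" using SZ neS by blast
    show "Z i \<subseteq> topspace ?T" unfolding Z_def by (rule closure_of_subset_topspace)
    fix A B assume AB: "closedin ?T A \<and> closedin ?T B \<and> Z i \<subseteq> A \<union> B"
    then have "S i \<subseteq> A \<or> S i \<subseteq> B" using irrS[of A B i] SZ by blast
    then show "Z i \<subseteq> A \<or> Z i \<subseteq> B" unfolding Z_def using AB closure_of_minimal by metis
  qed
  have strictZ: "Z i \<subset> Z (Suc i)" if i: "i < ?m" for i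
  proof
    have "S i \<subseteq> S (Suc i)" unfolding S_def by auto
    then show "Z i \<subseteq> Z (Suc i)" unfolding Z_def by (rule closure_of_mono)
    \<comment> \<open>the power of \<open>y\<close> that divides all forms in \<open>S (i + 1)\<close>\<close>
    define c where "c = (\<Sum>j\<in>{Suc i..<?m}. es ! j)"
    have csplit: "(\<Sum>j\<in>{i..<?m}. es ! j) = es ! i + c" unfolding c_def using i by (simp add: sum.atLeast_Suc_lessThan)
    have esi: "es ! i > 0" using pos i nth_mem by (metis gr0I)
    have "{i..<?m} \<subseteq> {..<?m}" by auto
    then have "(\<Sum>j\<in>{i..<?m}. es ! j) \<le> (\<Sum>j<?m. es ! j)" by (intro sum_mono2) auto
    then have cN: "c \<le> ?N" using csplit by (simp add: sum_list_sum_nth lessThan_atLeast0)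
    have hc: "hom_poly {..?N} 1 (\<lambda>z. z c)" using cN by (intro hom_poly.var) simp
    let ?A = "{x \<in> ?X. \<forall>z\<in>coords ?N ` (x - {0}). z c = 0}"
    have "S i \<subseteq> ?A"
    proof
      fix x assume x: "x \<in> S i"
      then obtain v where v: "x = (root_point es v)" "\<forall>j<?m. v j \<noteq> 0" "\<forall>j. i \<le> j \<and> j < ?m \<longrightarrow> v j = (0, 1)"
        unfolding S_def by blast
      have "root_product es v = (\<Prod>j<i. lin (v j) ^ (es ! j)) * monom 1 (es ! i + c)"
        using root_product_split_last[of i es v] v(3) i csplit by simp
      then have "coeff (root_product es v) c = 0" using esi by (simp add: coeff_monom_mult mult.commute)
      then have "z c = 0" if "z \<in> coords ?N ` (x - {0})" for z
        using that cN unfolding v(1) by (auto simp: span_single coords_smult coords_homog)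
      then show "x \<in> ?A" using x SX by blast
    qed
    then have ZA: "Z i \<subseteq> ?A" unfolding Z_def by (rule closure_of_minimal) (rule closedin_vanishing[OF XG hc])
    \<comment> \<open>the monomial with \<open>y\<close>-exponent \<open>c\<close>: the factors up to index \<open>i\<close> are the coordinate \<open>x\<close>,
       which dehomogenises to \<open>1\<close>\<close>
    define v where "v j = (if j \<le> i then (1, 0) else (0 :: complex, 1 :: complex))" for j
    let ?h = "homog ?N (root_product es v)"
    have v0: "\<forall>j<?m. v j \<noteq> 0" by (simp add: v_def zero_prod_def)
    have "root_product es v = (\<Prod>j<Suc i. lin (v j) ^ (es ! j)) * monom 1 c"
      unfolding c_def by (rule root_product_split_last) (use i in \<open>auto simp: v_def\<close>)
    moreover have "(\<Prod>j<Suc i. lin (v j) ^ (es ! j)) = (\<Prod>j<Suc i. 1)"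
      by (intro prod.cong) (auto simp: v_def lin_def one_pCons[symmetric])
    ultimately have "coeff (root_product es v) c = 1" by simp
    then have hc1: "coords ?N ?h c = 1" using cN by (simp add: coords_homog)
    then have "?h \<noteq> 0" by (auto simp: coords_0)
    then have "coords ?N ?h \<in> coords ?N ` (bipoly.span {?h} - {0})" using bipoly.span_base[of ?h "{?h}"] by blast
    then have "bipoly.span {?h} \<notin> Z i" using ZA hc1 by auto
    moreover have "bipoly.span {?h} \<in> S (Suc i)" unfolding S_def using v0 by (auto simp: v_def intro!: exI[of _ v])
    then have "bipoly.span {?h} \<in> Z (Suc i)" using SZ by blast
    ultimately show "Z i \<noteq> Z (Suc i)" by blast
  qed
  let ?K = "{k. \<exists>Z. (\<forall>i\<le>k. closedin ?T (Z i) \<and> irreducible_in ?T (Z i)) \<and> (\<forall>i<k. Z i \<subset> Z (Suc i))}"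
  have "?m \<in> ?K" using clZ irrZ strictZ by blast
  moreover have "k \<le> ?m" if "k \<in> ?K" for k
  proof -
    obtain W where W: "\<forall>i\<le>k. closedin ?T (W i) \<and> irreducible_in ?T (W i)" "\<forall>i<k. W i \<subset> W (Suc i)" using \<open>k \<in> ?K\<close> by blast
    have "cone ?N ?X \<subseteq> {z. \<exists>a v. \<forall>i\<le>?N. z i = a * coeff (root_product es v) i}"
    proof
      fix z assume z: "z \<in> cone ?N ?X"
      obtain a v where "a \<noteq> 0" "\<And>i. i < ?m \<Longrightarrow> v i \<noteq> 0" "\<And>i. i \<le> ?N \<Longrightarrow> z i = a * coeff (root_product es v) i"
        using cone_crlD[OF z] by blast
      then show "z \<in> {z. \<exists>a v. \<forall>i\<le>?N. z i = a * coeff (root_product es v) i}" by blast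
    qed
    then show ?thesis using chain_length_bound[OF XG multihom_poly_root_product[of es ?m, OF order_refl], of k W] W by blast
  qed
  ultimately have "Sup ?K = ?m" by (rule cSup_eq_maximum)
  then show ?thesis unfolding var_dim_def krull_dim_def .
qed

section \<open>Tangent spaces and smooth points of coincident root loci\<close>

text \<open>
  What is used of the differential \<open>dF y w\<close> of \<open>F\<close> at \<open>y\<close> in direction \<open>w\<close>: the chain rule along
  curves, linearity in \<open>w\<close>, polynomial dependence on parameters, and dependence on the coordinates
  in \<open>J\<close> only.
\<close>
definition is_differential :: "'i set \<Rightarrow> (('i \<Rightarrow> complex) \<Rightarrow> complex) \<Rightarrow> (('i \<Rightarrow> complex) \<Rightarrow> ('i \<Rightarrow> complex) \<Rightarrow> complex) \<Rightarrow> bool" where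
  "is_differential J F dF \<longleftrightarrow>
     (\<forall>z w. (\<forall>i\<in>J. ((\<lambda>t. z t i) has_field_derivative w i) (at 0)) \<longrightarrow>
        ((\<lambda>t. F (z t)) has_field_derivative dF (z 0) w) (at 0)) \<and>
     (\<forall>y w w'. dF y (\<lambda>i. w i + w' i) = dF y w + dF y w') \<and>
     (\<forall>y c w. dF y (\<lambda>i. c * w i) = c * dF y w) \<and>
     (\<forall>z w. (\<forall>i\<in>J. poly_fun (\<lambda>t. z t i)) \<and> (\<forall>i\<in>J. poly_fun (\<lambda>t. w t i)) \<longrightarrow> poly_fun (\<lambda>t. dF (z t) (w t))) \<and>
     (\<forall>y y' w w'. (\<forall>i\<in>J. y i = y' i \<and> w i = w' i) \<longrightarrow> dF y w = dF y' w')"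

lemma is_differential_chain:
  fixes F :: "('i \<Rightarrow> complex) \<Rightarrow> complex"
  assumes "is_differential J F dF" "\<And>i. i \<in> J \<Longrightarrow> ((\<lambda>t. z t i) has_field_derivative w i) (at 0)"
  shows "((\<lambda>t. F (z t)) has_field_derivative dF (z 0) w) (at 0)"
  using conjunct1[OF assms(1)[unfolded is_differential_def]] assms(2) by blast

lemma is_differential_add:
  fixes F :: "('i \<Rightarrow> complex) \<Rightarrow> complex"
  assumes "is_differential J F dF"
  shows "dF y (\<lambda>i. w i + w' i) = dF y w + dF y w'"
  using conjunct1[OF conjunct2[OF assms[unfolded is_differential_def]]] by blast

lemma is_differential_scale:
  fixes F :: "('i \<Rightarrow> complex) \<Rightarrow> complex"
  assumes "is_differential J F dF"
  shows "dF y (\<lambda>i. c * w i) = c * dF y w"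
  using conjunct1[OF conjunct2[OF conjunct2[OF assms[unfolded is_differential_def]]]] by blast

lemma is_differential_poly_fun:
  fixes F :: "('i \<Rightarrow> complex) \<Rightarrow> complex"
  assumes "is_differential J F dF" "\<And>i. i \<in> J \<Longrightarrow> poly_fun (\<lambda>t. z t i)" "\<And>i. i \<in> J \<Longrightarrow> poly_fun (\<lambda>t. w t i)"
  shows "poly_fun (\<lambda>t. dF (z t) (w t))"
  using conjunct1[OF conjunct2[OF conjunct2[OF conjunct2[OF assms(1)[unfolded is_differential_def]]]]] assms(2,3) by blast

lemma is_differential_cong:
  fixes F :: "('i \<Rightarrow> complex) \<Rightarrow> complex"
  assumes "is_differential J F dF" "\<And>i. i \<in> J \<Longrightarrow> y i = y' i" "\<And>i. i \<in> J \<Longrightarrow> w i = w' i"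
  shows "dF y w = dF y' w'"
  using conjunct2[OF conjunct2[OF conjunct2[OF conjunct2[OF assms(1)[unfolded is_differential_def]]]],
      rule_format, of y y' w w'] assms(2,3) by blast

lemma hom_poly_differential:
  fixes F :: "('i \<Rightarrow> complex) \<Rightarrow> complex"
  shows "hom_poly J e F \<Longrightarrow> \<exists>dF. is_differential J F dF"
proof (induction rule: hom_poly.induct)
  case (const c)
  show ?case by (intro exI[of _ "\<lambda>_ _. 0"]) (auto simp: is_differential_def)
next
  case (var i)
  then show ?case by (intro exI[of _ "\<lambda>_ w. w i"]) (auto simp: is_differential_def)
next
  case (add e F G)
  then obtain dF dG where d: "is_differential J F dF" "is_differential J G dG" by blast
  show ?case
    unfolding is_differential_def
  proof (intro exI[of _ "\<lambda>y w. dF y w + dG y w"] conjI allI impI)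
    fix z :: "complex \<Rightarrow> 'i \<Rightarrow> complex" and w assume a: "\<forall>i\<in>J. ((\<lambda>t. z t i) has_field_derivative w i) (at 0)"
    show "((\<lambda>t. F (z t) + G (z t)) has_field_derivative dF (z 0) w + dG (z 0) w) (at 0)"
      by (intro DERIV_add is_differential_chain[OF d(1)] is_differential_chain[OF d(2)]) (use a in auto)
  next
    fix z w :: "complex \<Rightarrow> 'i \<Rightarrow> complex" assume a: "(\<forall>i\<in>J. poly_fun (\<lambda>t. z t i)) \<and> (\<forall>i\<in>J. poly_fun (\<lambda>t. w t i))"
    show "poly_fun (\<lambda>t. dF (z t) (w t) + dG (z t) (w t))"
      by (intro poly_fun_add is_differential_poly_fun[OF d(1)] is_differential_poly_fun[OF d(2)]) (use a in auto)
  next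
    fix y y' w w' :: "'i \<Rightarrow> complex" assume a: "\<forall>i\<in>J. y i = y' i \<and> w i = w' i"
    show "dF y w + dG y w = dF y' w' + dG y' w'"
      by (intro arg_cong2[of _ _ _ _ "(+)"] is_differential_cong[OF d(1)] is_differential_cong[OF d(2)]) (use a in auto)
  qed (simp_all add: is_differential_add[OF d(1)] is_differential_add[OF d(2)] is_differential_scale[OF d(1)]
         is_differential_scale[OF d(2)] algebra_simps)
next
  case (mult e F e' G)
  then obtain dF dG where d: "is_differential J F dF" "is_differential J G dG" by blast
  show ?case
    unfolding is_differential_def
  proof (intro exI[of _ "\<lambda>y w. dF y w * G y + dG y w * F y"] conjI allI impI)
    fix z :: "complex \<Rightarrow> 'i \<Rightarrow> complex" and w assume a: "\<forall>i\<in>J. ((\<lambda>t. z t i) has_field_derivative w i) (at 0)"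
    show "((\<lambda>t. F (z t) * G (z t)) has_field_derivative dF (z 0) w * G (z 0) + dG (z 0) w * F (z 0)) (at 0)"
      by (intro DERIV_mult is_differential_chain[OF d(1)] is_differential_chain[OF d(2)]) (use a in auto)
  next
    fix z w :: "complex \<Rightarrow> 'i \<Rightarrow> complex" assume a: "(\<forall>i\<in>J. poly_fun (\<lambda>t. z t i)) \<and> (\<forall>i\<in>J. poly_fun (\<lambda>t. w t i))"
    show "poly_fun (\<lambda>t. dF (z t) (w t) * G (z t) + dG (z t) (w t) * F (z t))"
      by (intro poly_fun_add poly_fun_mult is_differential_poly_fun[OF d(1)] is_differential_poly_fun[OF d(2)]
            hom_poly_curve[OF mult.hyps(1)] hom_poly_curve[OF mult.hyps(2)]) (use a in auto)
  next
    fix y y' w w' :: "'i \<Rightarrow> complex" assume a: "\<forall>i\<in>J. y i = y' i \<and> w i = w' i"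
    show "dF y w * G y + dG y w * F y = dF y' w' * G y' + dG y' w' * F y'"
      by (intro arg_cong2[of _ _ _ _ "(+)"] arg_cong2[of _ _ _ _ "(*)"] is_differential_cong[OF d(1)] is_differential_cong[OF d(2)]
            hom_poly_cong[OF mult.hyps(1)] hom_poly_cong[OF mult.hyps(2)]) (use a in auto)
  qed (simp_all add: is_differential_add[OF d(1)] is_differential_add[OF d(2)] is_differential_scale[OF d(1)]
         is_differential_scale[OF d(2)] algebra_simps)
qed

definition differential :: "'i set \<Rightarrow> (('i \<Rightarrow> complex) \<Rightarrow> complex) \<Rightarrow> ('i \<Rightarrow> complex) \<Rightarrow> ('i \<Rightarrow> complex) \<Rightarrow> complex" where
  "differential J F = (SOME dF. is_differential J F dF)"

lemma is_differential_differential: "hom_poly J e F \<Longrightarrow> is_differential J F (differential J F)"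
  unfolding differential_def by (rule someI_ex[OF hom_poly_differential])

lemmas differential_chain = is_differential_chain[OF is_differential_differential]
lemmas differential_add = is_differential_add[OF is_differential_differential]
lemmas differential_scale = is_differential_scale[OF is_differential_differential]
lemmas differential_poly_fun = is_differential_poly_fun[OF is_differential_differential]
lemmas differential_cong = is_differential_cong[OF is_differential_differential]

text \<open>Partial derivatives of homogeneous functions are homogeneous of one degree less.\<close>
lemma hom_poly_partial:
  "hom_poly J e F \<Longrightarrow> \<exists>D. hom0_pred J e D \<and> (\<forall>y t. ((\<lambda>s. F (y(k := s))) has_field_derivative D (y(k := t))) (at t))"
proof (induction rule: hom_poly.induct)
  case (const c)
  show ?case by (intro exI[of _ "\<lambda>_. 0"]) (auto simp: hom0_pred_def)
next
  case (var i)
  show ?case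
    by (rule exI[of _ "\<lambda>_. if i = k then 1 else 0"])
       (auto simp: hom0_pred_def intro: hom_poly.const)
next
  case (add e F G)
  then obtain D D' where "hom0_pred J e D" "hom0_pred J e D'"
    "\<forall>y t. ((\<lambda>s. F (y(k := s))) has_field_derivative D (y(k := t))) (at t)"
    "\<forall>y t. ((\<lambda>s. G (y(k := s))) has_field_derivative D' (y(k := t))) (at t)" by blast
  then show ?case
    by (intro exI[of _ "\<lambda>z. D z + D' z"] conjI allI hom0_pred_add DERIV_add) blast+
next
  case (mult e F e' G)
  then obtain D D' where D: "hom0_pred J e D" "hom0_pred J e' D'"
    "\<forall>y t. ((\<lambda>s. F (y(k := s))) has_field_derivative D (y(k := t))) (at t)"
    "\<forall>y t. ((\<lambda>s. G (y(k := s))) has_field_derivative D' (y(k := t))) (at t)" by blast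
  have FG: "hom0 J e F" "hom0 J e' G" using mult.hyps by (auto simp: hom0_def)
  have "hom0_pred J (e + e') (\<lambda>z. D z * G z + D' z * F z)"
    using hom0_pred_add[OF hom0_pred_mult[OF D(1) FG(2)] hom0_pred_mult[OF D(2) FG(1), unfolded add.commute[of e' e]]] .
  moreover have "\<forall>y t. ((\<lambda>s. F (y(k := s)) * G (y(k := s))) has_field_derivative D (y(k := t)) * G (y(k := t)) + D' (y(k := t)) * F (y(k := t))) (at t)"
    using D(3,4) by (intro allI DERIV_mult) blast+
  ultimately show ?case by (intro exI[of _ "\<lambda>z. D z * G z + D' z * F z"]) blast
qed

text \<open>
  The chain rule replaces the derivative along a line by the value of the differential, which is
  linear in the direction.
\<close>
lemma tangent_space_alt:
  assumes "x \<subseteq> forms N"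
  shows "tangent_space N X x = {w \<in> forms N. \<forall>e F. hom_poly {..N} e F \<and> (\<forall>z\<in>cone N X. F z = 0) \<longrightarrow>
     (\<forall>u\<in>x - {0}. differential {..N} F (coords N u) (coords N w) = 0)}"
proof -
  have der: "((\<lambda>t. F (coords N (u + smult [:t:] w))) has_field_derivative differential {..N} F (coords N u) (coords N w)) (at 0)"
    if "hom_poly {..N} e F" for e F u w
  proof -
    have eq: "coords N (u + smult [:t:] w) = (\<lambda>i. coords N u i + t * coords N w i)" for t
      by (rule ext) (simp add: coords_add coords_smult)
    have d: "((\<lambda>t. coords N u i + t * coords N w i) has_field_derivative coords N w i) (at 0)" for i
      by (auto intro!: derivative_eq_intros)
    have "((\<lambda>t. F (\<lambda>i. coords N u i + t * coords N w i)) has_field_derivative differential {..N} F (\<lambda>i. coords N u i + 0 * coords N w i) (coords N w)) (at 0)"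
      by (rule differential_chain[OF that]) (rule d)
    then show ?thesis by (simp add: eq)
  qed
  have iff: "((\<lambda>t. F (coords N (u + smult [:t:] w))) has_field_derivative 0) (at 0) \<longleftrightarrow> differential {..N} F (coords N u) (coords N w) = 0"
    if "hom_poly {..N} e F" for e F u w
    using der[OF that, of u w] DERIV_unique by metis
  have van: "(\<forall>y\<in>X. \<forall>u\<in>y - {0}. F (coords N u) = 0) \<longleftrightarrow> (\<forall>z\<in>cone N X. F z = 0)" for F :: "(nat \<Rightarrow> complex) \<Rightarrow> complex"
    unfolding cone_def by blast
  show ?thesis unfolding tangent_space_def van using iff by blast
qed

lemma subspace_tangent_space:
  assumes "x \<subseteq> forms N"
  shows "bipoly.subspace (tangent_space N X x)"
  unfolding tangent_space_alt[OF assms]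
proof (rule bipoly.subspaceI, goal_cases)
  case 1
  have "differential {..N} F y (coords N 0) = 0" if "hom_poly {..N} e F" for e F y
  proof -
    have "coords N 0 = (\<lambda>i. 0 * coords N 0 i)" by (simp add: coords_0 fun_eq_iff)
    then show ?thesis using differential_scale[OF that, of y 0 "coords N 0"] by simp
  qed
  then show ?case using subspace_forms bipoly.subspace_0 by blast
next
  case (2 f g)
  have "coords N (f + g) = (\<lambda>i. coords N f i + coords N g i)" by (simp add: coords_add fun_eq_iff)
  then have add: "differential {..N} F y (coords N (f + g)) = differential {..N} F y (coords N f) + differential {..N} F y (coords N g)" if "hom_poly {..N} e F" for e F y
    using differential_add[OF that] by simp
  have fg: "f \<in> forms N" "g \<in> forms N" using 2 by auto
  show ?case
  proof (intro CollectI conjI allI impI ballI)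
    show "f + g \<in> forms N" by (rule bipoly.subspace_add[OF subspace_forms fg])
    fix e F u assume F: "hom_poly {..N} e F \<and> (\<forall>z\<in>cone N X. F z = 0)" and u: "u \<in> x - {0}"
    have "differential {..N} F (coords N u) (coords N f) = 0" "differential {..N} F (coords N u) (coords N g) = 0" using 2 F u by blast+
    then show "differential {..N} F (coords N u) (coords N (f + g)) = 0" using add[OF conjunct1[OF F]] by simp
  qed
next
  case (3 c f)
  have "coords N (smult [:c:] f) = (\<lambda>i. c * coords N f i)" by (simp add: coords_smult fun_eq_iff)
  then have sc: "differential {..N} F y (coords N (smult [:c:] f)) = c * differential {..N} F y (coords N f)" if "hom_poly {..N} e F" for e F y
    using differential_scale[OF that] by simp
  have f: "f \<in> forms N" using 3 by auto
  show ?case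
  proof (intro CollectI conjI allI impI ballI)
    show "smult [:c:] f \<in> forms N" by (rule bipoly.subspace_scale[OF subspace_forms f])
    fix e F u assume F: "hom_poly {..N} e F \<and> (\<forall>z\<in>cone N X. F z = 0)" and u: "u \<in> x - {0}"
    have "differential {..N} F (coords N u) (coords N f) = 0" using 3 F u by blast
    then show "differential {..N} F (coords N u) (coords N (smult [:c:] f)) = 0" using sc[OF conjunct1[OF F]] by simp
  qed
qed

lemma coeff_prod_lin_top: "coeff (\<Prod>k\<in>A. lin (v k)) (card A) = (\<Prod>k\<in>A. snd (v k))"
proof (induction A rule: infinite_finite_induct)
  case (insert k A)
  have "coeff (lin (v k) * (\<Prod>k\<in>A. lin (v k))) (1 + card A) = coeff (lin (v k)) 1 * coeff (\<Prod>k\<in>A. lin (v k)) (card A)"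
    by (rule coeff_mult_top[OF degree_lin degree_prod_lin])
  then show ?case using insert by (simp add: lin_def)
qed simp_all

text \<open>
  The products of all but one of \<open>m\<close> pairwise independent linear forms span the polynomials of
  degree below \<open>m\<close>; the full product supplies degree \<open>m\<close>. The coefficients are found by evaluation
  at the roots.
\<close>
lemma lagrange_interpolation:
  assumes m: "m > 0" and s: "\<And>i. i < m \<Longrightarrow> snd (v i) \<noteq> 0"
    and d: "\<And>i k. i < m \<Longrightarrow> k < m \<Longrightarrow> i \<noteq> k \<Longrightarrow> fst (v i) * snd (v k) \<noteq> fst (v k) * snd (v i)"
    and h: "degree h \<le> m"
  shows "\<exists>al c. h = (\<Sum>i<m. smult (al i) (\<Prod>k\<in>{..<m}-{i}. lin (v k))) + smult c (\<Prod>k<m. lin (v k))"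
proof -
  define P where "P = (\<Prod>k<m. lin (v k))"
  define g where "g i = (\<Prod>k\<in>{..<m}-{i}. lin (v k))" for i
  define r where "r i = - fst (v i) / snd (v i)" for i
  have root: "poly (lin (v k)) (r i) = 0 \<longleftrightarrow> k = i" if "i < m" "k < m" for i k
  proof -
    have "poly (lin (v k)) (r i) = (fst (v k) * snd (v i) - fst (v i) * snd (v k)) / snd (v i)"
      using s[OF that(1)] by (simp add: lin_def r_def field_simps)
    moreover have "fst (v k) * snd (v i) - fst (v i) * snd (v k) = 0 \<longleftrightarrow> k = i"
      using d[OF that] by (metis right_minus_eq)
    ultimately show ?thesis using s[OF that(1)] by simp
  qed
  have inj: "inj_on r {..<m}"
  proof (rule inj_onI)
    fix i k assume ik: "i \<in> {..<m}" "k \<in> {..<m}" "r i = r k"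
    then have "poly (lin (v k)) (r k) = 0" using root[of k k] by simp
    then have "poly (lin (v k)) (r i) = 0" using ik(3) by simp
    then show "i = k" using root[of i k] ik(1,2) by simp
  qed
  define c where "c = coeff h m / coeff P m"
  define al where "al i = poly h (r i) / poly (g i) (r i)" for i
  define R where "R = h - ((\<Sum>i<m. smult (al i) (g i)) + smult c P)"
  have cP: "coeff P m \<noteq> 0" using coeff_prod_lin_top[of v "{..<m}"] s by (simp add: P_def)
  have dg: "degree (g i) \<le> m - 1" if "i < m" for i
    using degree_prod_lin[of v "{..<m} - {i}"] that by (simp add: g_def)
  have dP: "degree P \<le> m" using degree_prod_lin[of v "{..<m}"] by (simp add: P_def)
  have R0: "poly R (r i) = 0" if i: "i < m" for i
  proof -
    have "poly (g k) (r i) = 0" if "k < m" "k \<noteq> i" for k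
      unfolding g_def poly_prod using root[OF i] that i by (intro prod_zero) auto
    then have "(\<Sum>k<m. al k * poly (g k) (r i)) = (\<Sum>k<m. if k = i then al k * poly (g k) (r i) else 0)"
      by (intro sum.cong) auto
    then have "(\<Sum>k<m. al k * poly (g k) (r i)) = al i * poly (g i) (r i)" using i by simp
    moreover have "poly (g i) (r i) \<noteq> 0" unfolding g_def poly_prod using root[OF i] by auto
    moreover have "poly P (r i) = 0" unfolding P_def poly_prod using root[OF i] i by (intro prod_zero) auto
    ultimately show ?thesis by (simp add: R_def poly_sum al_def)
  qed
  have "R = 0"
  proof (rule ccontr)
    assume nz: "R \<noteq> 0"
    have "coeff (g i) m = 0" if "i < m" for i using dg[OF that] m by (intro coeff_eq_0) auto
    then have top: "coeff R m = 0" using cP by (simp add: R_def coeff_sum c_def)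
    have "degree R \<le> m" unfolding R_def
      by (intro degree_diff_le degree_add_le degree_sum_le h)
         (use dg dP in \<open>auto intro!: order_trans[OF degree_smult_le] order_trans[OF dg] \<close>)
    then have "degree R < m" using top nz leading_coeff_0_iff le_neq_implies_less by blast
    moreover have "card {x. poly R x = 0} \<le> degree R" by (rule card_poly_roots_bound[OF nz])
    moreover have "r ` {..<m} \<subseteq> {x. poly R x = 0}" using R0 by auto
    then have "card (r ` {..<m}) \<le> card {x. poly R x = 0}" by (rule card_mono[OF poly_roots_finite[OF nz]])
    ultimately show False using card_image[OF inj] by simp
  qed
  then show ?thesis unfolding R_def P_def g_def by (intro exI[of _ al] exI[of _ c]) simp
qed

text \<open>
  For positive exponents, the factor common to the derivatives of \<open>root_product\<close> in all directions
  of the parameter space.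
\<close>
definition reduced_product :: "nat list \<Rightarrow> (nat \<Rightarrow> complex \<times> complex) \<Rightarrow> complex poly" where
  "reduced_product es v = (\<Prod>i<length es. lin (v i) ^ (es ! i - 1))"

lemma DERIV_coeff_power:
  "((\<lambda>s. coeff ((A + smult s B) ^ n * C) k) has_field_derivative of_nat n * coeff (A ^ (n - 1) * B * C) k) (at 0)"
proof (induction n arbitrary: C k)
  case (Suc n)
  have eq: "coeff ((A + smult s B) ^ Suc n * C) k = coeff ((A + smult s B) ^ n * (A * C)) k + s * coeff ((A + smult s B) ^ n * (B * C)) k" for s
    by (simp add: algebra_simps)
  have "((\<lambda>s. coeff ((A + smult s B) ^ n * (A * C)) k + s * coeff ((A + smult s B) ^ n * (B * C)) k) has_field_derivative
      of_nat n * coeff (A ^ (n - 1) * B * (A * C)) k + (1 * coeff ((A + smult 0 B) ^ n * (B * C)) k + of_nat n * coeff (A ^ (n - 1) * B * (B * C)) k * 0)) (at 0)"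
    by (intro DERIV_add DERIV_mult Suc.IH DERIV_ident)
  moreover have eq1: "of_nat n * coeff (A ^ (n - 1) * B * (A * C)) k = of_nat n * coeff (A ^ n * B * C) k"
    by (cases n) (simp_all add: mult_ac)
  have "of_nat n * coeff (A ^ (n - 1) * B * (A * C)) k + (1 * coeff ((A + smult 0 B) ^ n * (B * C)) k + of_nat n * coeff (A ^ (n - 1) * B * (B * C)) k * 0)
     = of_nat (Suc n) * coeff (A ^ (Suc n - 1) * B * C) k"
    unfolding eq1 by (simp add: algebra_simps)
  ultimately show ?case unfolding eq by simp
qed simp

lemma linear_multiples:
  "Vector_Spaces.linear scale_form scale_form
     (\<lambda>f. homog N (p * dehom f))"
  by unfold_locales (simp_all add: dehom_add dehom_smult distrib_left homog_add homog_smult)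

lemma dim_injective_image:
  assumes lf: "Vector_Spaces.linear scale_form scale_form g"
    and inj: "\<And>f. f \<in> forms m \<Longrightarrow> g f = 0 \<Longrightarrow> f = 0"
  shows "bipoly.dim (g ` forms m) = m + 1"
proof -
  interpret VP: vector_space_pair scale_form scale_form ..
  interpret L: Vector_Spaces.linear scale_form scale_form g by (rule lf)
  have "{f \<in> forms m. g f = 0} = {0}" using inj subspace_forms[of m] bipoly.subspace_0 L.zero by force
  moreover have "bipoly.dim {0} = 0" using bipoly.dim_span[of "{}"] bipoly.dim_eq_card_independent[of "{}"] bipoly.independent_empty
    by (metis bipoly.span_empty card.empty)
  ultimately show ?thesis
    using VP.dim_kernel_plus_image[OF lf subspace_forms, of m "mono_form m ` {..m}"] dim_forms[of m]
    unfolding span_mono_form by simp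
qed

lemma subspace_multiples: "bipoly.subspace ((\<lambda>f. homog N (p * dehom f)) ` forms m)"
proof -
  interpret L: Vector_Spaces.linear scale_form scale_form
    "\<lambda>f. homog N (p * dehom f)" by (rule linear_multiples)
  show ?thesis by (rule L.subspace_image) (rule subspace_forms)
qed

lemma dim_multiples:
  assumes "p \<noteq> 0" "degree p + m \<le> N"
  shows "bipoly.dim ((\<lambda>f. homog N (p * dehom f)) ` forms m) = m + 1"
proof (rule dim_injective_image[OF linear_multiples])
  fix f assume f: "f \<in> forms m" "homog N (p * dehom f) = 0"
  have "degree (p * dehom f) \<le> N" using degree_mult_le[of p "dehom f"] assms(2) degree_dehom[OF f(1)] by linarith
  then have "p * dehom f = 0" using f(2) homog_eq_0_iff by blast
  then show "f = 0" using assms(1) dehom_eq_0_iff[OF f(1)] by simp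
qed

context
  fixes es :: "nat list"
  assumes pos: "0 \<notin> set es" and ne: "es \<noteq> []"
begin

lemma es_pos: "i < length es \<Longrightarrow> es ! i > 0"
  using pos nth_mem by (metis gr0I)

lemma sum_pred: "(\<Sum>i<length es. es ! i - 1) + length es = sum_list es"
proof -
  have "(\<Sum>i<length es. es ! i - 1) + (\<Sum>i<length es. 1) = (\<Sum>i<length es. es ! i)"
    unfolding sum.distrib[symmetric] using es_pos by (intro sum.cong) force+
  then show ?thesis by (simp add: sum_list_sum_nth lessThan_atLeast0)
qed

lemma degree_reduced_product: "degree (reduced_product es v) + length es \<le> sum_list es"
proof -
  have "degree (reduced_product es v) \<le> (\<Sum>i<length es. es ! i - 1)"
    unfolding reduced_product_def by (rule degree_prod_le_sum) (rule degree_lin_power)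
  then show ?thesis using sum_pred by linarith
qed

lemma root_product_eq_reduced_product: "root_product es v = reduced_product es v * (\<Prod>i<length es. lin (v i))"
  unfolding root_product_def reduced_product_def prod.distrib[symmetric]
  using es_pos by (intro prod.cong refl) (metis Suc_diff_1 lessThan_iff power_Suc2)

text \<open>
  Move the \<open>i\<close>-th linear form along a line in direction \<open>eta\<close>. The curve stays on the cone over
  the locus, and by the product rule its velocity is a nonzero multiple of the direction in
  question.
\<close>
lemma vanishing_along_factor:
  assumes F: "hom_poly {..sum_list es} e F" and van: "\<And>v. (\<forall>i<length es. v i \<noteq> 0) \<Longrightarrow> F (coeff (root_product es v)) = 0"
    and v: "\<And>i. i < length es \<Longrightarrow> v i \<noteq> 0" and i: "i < length es" and a: "a \<noteq> 0"
  shows "differential {..sum_list es} F (\<lambda>c. a * coeff (root_product es v) c)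
    (coeff (reduced_product es v * (lin eta * (\<Prod>k\<in>{..<length es}-{i}. lin (v k))))) = 0"
proof -
  let ?m = "length es" and ?N = "sum_list es"
  define w where "w = v(i := (fst (v i) + fst eta, snd (v i) + snd eta))"
  have lw: "line v w s k = (if k = i then (fst (v i) + s * fst eta, snd (v i) + s * snd eta) else v k)" for s k
    by (simp add: line_def w_def)
  have linw: "lin (line v w s i) = lin (v i) + smult s (lin eta)" for s by (simp add: lw lin_def)
  let ?C = "\<Prod>k\<in>{..<?m}-{i}. lin (v k) ^ (es ! k)"
  have rpw: "root_product es (line v w s) = (lin (v i) + smult s (lin eta)) ^ (es ! i) * ?C" for s
  proof -
    have "root_product es (line v w s) = lin (line v w s i) ^ (es ! i) * (\<Prod>k\<in>{..<?m}-{i}. lin (line v w s k) ^ (es ! k))"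
      unfolding root_product_def using i by (intro prod.remove) auto
    also have "(\<Prod>k\<in>{..<?m}-{i}. lin (line v w s k) ^ (es ! k)) = ?C" by (intro prod.cong) (auto simp: lw)
    finally show ?thesis by (simp add: linw)
  qed
  \<comment> \<open>the moved form may become zero for one parameter; there the vanishing follows by
     continuity in the parameter\<close>
  have zero: "F (\<lambda>c. a * coeff (root_product es (line v w s)) c) = 0" for s
  proof -
    have "finite {t. \<not> (\<forall>i<?m. line v w t i \<noteq> 0)}" by (rule finite_line_degenerate) (use v in auto)
    then have fin: "finite {t. F (coeff (root_product es (line v w t))) \<noteq> 0}" by (rule rev_finite_subset) (use van in auto)
    have "F (coeff (root_product es (line v w s))) = 0"
    proof (rule ccontr)
      assume "F (coeff (root_product es (line v w s))) \<noteq> 0"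
      from finite_zeros_on_line[OF F this] fin have "finite ({t. F (coeff (root_product es (line v w t))) = 0} \<union> {t. F (coeff (root_product es (line v w t))) \<noteq> 0})" by simp
      moreover have "{t. F (coeff (root_product es (line v w t))) = 0} \<union> {t. F (coeff (root_product es (line v w t))) \<noteq> 0} = UNIV" by auto
      ultimately show False using infinite_UNIV_char_0[where 'a=complex] by simp
    qed
    then show ?thesis using hom_poly_scale[OF F, of a "coeff (root_product es (line v w s))"] by simp
  qed
  let ?w' = "\<lambda>c. a * (of_nat (es ! i) * coeff (lin (v i) ^ (es ! i - 1) * lin eta * ?C) c)"
  have "((\<lambda>s. F (\<lambda>c. a * coeff (root_product es (line v w s)) c)) has_field_derivative
      differential {..?N} F (\<lambda>c. a * coeff (root_product es (line v w 0)) c) ?w') (at 0)"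
    by (rule differential_chain[OF F]) (unfold rpw, intro DERIV_cmult DERIV_coeff_power)
  then have "((\<lambda>s. 0) has_field_derivative differential {..?N} F (\<lambda>c. a * coeff (root_product es v) c) ?w') (at 0)"
    unfolding zero by simp
  then have "differential {..?N} F (\<lambda>c. a * coeff (root_product es v) c) ?w' = 0" using DERIV_unique DERIV_const by blast
  moreover have fac: "lin (v i) ^ (es ! i - 1) * lin eta * ?C = reduced_product es v * (lin eta * (\<Prod>k\<in>{..<?m}-{i}. lin (v k)))"
  proof -
    have "?C = (\<Prod>k\<in>{..<?m}-{i}. lin (v k) ^ (es ! k - 1) * lin (v k))"
      using es_pos by (intro prod.cong refl) (metis DiffD1 Suc_diff_1 lessThan_iff power_Suc2)
    also have "\<dots> = (\<Prod>k\<in>{..<?m}-{i}. lin (v k) ^ (es ! k - 1)) * (\<Prod>k\<in>{..<?m}-{i}. lin (v k))" by (rule prod.distrib)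
    finally have C: "?C = (\<Prod>k\<in>{..<?m}-{i}. lin (v k) ^ (es ! k - 1)) * (\<Prod>k\<in>{..<?m}-{i}. lin (v k))" .
    have "reduced_product es v = lin (v i) ^ (es ! i - 1) * (\<Prod>k\<in>{..<?m}-{i}. lin (v k) ^ (es ! k - 1))"
      unfolding reduced_product_def using i by (intro prod.remove) auto
    then show ?thesis unfolding C by (simp add: mult_ac)
  qed
  ultimately have "a * (of_nat (es ! i) * differential {..?N} F (\<lambda>c. a * coeff (root_product es v) c)
    (coeff (reduced_product es v * (lin eta * (\<Prod>k\<in>{..<?m}-{i}. lin (v k)))))) = 0"
    by (simp only: differential_scale[OF F] fac)
  then show ?thesis using a es_pos[OF i] by simp
qed

text \<open>
  If the linear forms are pairwise independent with no root at infinity, every \<open>h\<close> is a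
  combination of the directions of \<open>vanishing_along_factor\<close>, by \<open>lagrange_interpolation\<close>. The
  general case follows along a line towards such a position, since the expression is polynomial in
  the parameter.
\<close>
lemma vanishing_on_multiples:
  assumes F: "hom_poly {..sum_list es} e F" and van: "\<And>v. (\<forall>i<length es. v i \<noteq> 0) \<Longrightarrow> F (coeff (root_product es v)) = 0"
    and v: "\<And>i. i < length es \<Longrightarrow> v i \<noteq> 0" and a: "a \<noteq> 0" and h: "degree h \<le> length es"
  shows "differential {..sum_list es} F (\<lambda>c. a * coeff (root_product es v) c) (coeff (reduced_product es v * h)) = 0"
proof -
  let ?m = "length es" and ?N = "sum_list es"
  have generic: "differential {..?N} F (\<lambda>c. a * coeff (root_product es v) c) (coeff (reduced_product es v * h)) = 0"
    if v: "\<And>i. i < ?m \<Longrightarrow> v i \<noteq> 0" and s: "\<And>i. i < ?m \<Longrightarrow> snd (v i) \<noteq> 0"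
    and d: "\<And>i k. i < ?m \<Longrightarrow> k < ?m \<Longrightarrow> i \<noteq> k \<Longrightarrow> fst (v i) * snd (v k) \<noteq> fst (v k) * snd (v i)" for v
  proof -
    define phi where "phi q = differential {..?N} F (\<lambda>c. a * coeff (root_product es v) c) (coeff (reduced_product es v * q))" for q
    have phi_add: "phi (q + q') = phi q + phi q'" for q q'
    proof -
      have "coeff (reduced_product es v * (q + q')) = (\<lambda>c. coeff (reduced_product es v * q) c + coeff (reduced_product es v * q') c)"
        by (simp add: fun_eq_iff distrib_left)
      then show ?thesis unfolding phi_def using differential_add[OF F] by simp
    qed
    have phi_smult: "phi (smult b q) = b * phi q" for b q
    proof -
      have "coeff (reduced_product es v * smult b q) = (\<lambda>c. b * coeff (reduced_product es v * q) c)" by (simp add: fun_eq_iff)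
      then show ?thesis unfolding phi_def using differential_scale[OF F] by simp
    qed
    have phi_0: "phi 0 = 0" using phi_smult[of 0 0] by simp
    have phi_sum: "phi (\<Sum>i\<in>I. q i) = (\<Sum>i\<in>I. phi (q i))" for q :: "nat \<Rightarrow> complex poly" and I
      by (induction I rule: infinite_finite_induct) (simp_all add: phi_0 phi_add)
    have z: "phi (lin eta * (\<Prod>k\<in>{..<?m}-{i}. lin (v k))) = 0" if "i < ?m" for eta i
      unfolding phi_def by (rule vanishing_along_factor[OF F van v that a])
    have z1: "phi (\<Prod>k\<in>{..<?m}-{i}. lin (v k)) = 0" if "i < ?m" for i
      using z[OF that, of "(1, 0)"] by (simp add: lin_def one_pCons[symmetric])
    have m0: "0 < ?m" using ne by simp
    have "(\<Prod>k<?m. lin (v k)) = lin (v 0) * (\<Prod>k\<in>{..<?m}-{0}. lin (v k))" using m0 by (intro prod.remove) auto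
    then have z2: "phi (\<Prod>k<?m. lin (v k)) = 0" using z[OF m0] by simp
    obtain al c where "h = (\<Sum>i<?m. smult (al i) (\<Prod>k\<in>{..<?m}-{i}. lin (v k))) + smult c (\<Prod>k<?m. lin (v k))"
      using lagrange_interpolation[of ?m v h, OF m0 s d h] by blast
    then have "phi h = (\<Sum>i<?m. al i * phi (\<Prod>k\<in>{..<?m}-{i}. lin (v k))) + c * phi (\<Prod>k<?m. lin (v k))"
      by (simp add: phi_add phi_sum phi_smult)
    then have "phi h = 0" using z1 z2 by simp
    then show ?thesis by (simp add: phi_def)
  qed
  \<comment> \<open>the linear forms \<open>i x + y\<close>: pairwise independent, none with its root at infinity\<close>
  define w :: "nat \<Rightarrow> complex \<times> complex" where "w i = (of_nat i, 1)" for i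
  have pc: "poly_curve (\<lambda>t. root_product es (line v w t))" by (rule poly_curve_root_product_line)
  have pp: "poly_curve (\<lambda>t. reduced_product es (line v w t) * h)"
    unfolding reduced_product_def by (intro poly_curve_mult poly_curve_prod poly_curve_power poly_curve_lin_line poly_curve_const)
  define f where "f t = differential {..?N} F (\<lambda>c. a * coeff (root_product es (line v w t)) c) (coeff (reduced_product es (line v w t) * h))" for t
  have pf: "poly_fun f" unfolding f_def
    by (rule differential_poly_fun[OF F]) (use pc pp in \<open>auto simp: poly_curve_def intro: poly_fun_mult\<close>)
  have pfl: "poly_fun (\<lambda>t. fst (line v w t i))" "poly_fun (\<lambda>t. snd (line v w t i))" for i
    by (auto simp: line_def intro!: poly_fun_add poly_fun_mult)
  have f1: "finite {t. snd (line v w t i) = 0}" for i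
    by (rule finite_zeros_poly_fun[OF pfl(2), of 1]) (simp add: w_def)
  have f2: "finite {t. fst (line v w t i) * snd (line v w t k) - fst (line v w t k) * snd (line v w t i) = 0}" if "i \<noteq> k" for i k
    by (rule finite_zeros_poly_fun[of _ 1]) (use that in \<open>auto simp: w_def intro!: poly_fun_diff poly_fun_mult pfl\<close>)
  have f3: "finite {t. \<not> (\<forall>i<?m. line v w t i \<noteq> 0)}" by (rule finite_line_degenerate) (use v in auto)
  let ?bad = "(\<Union>i<?m. {t. snd (line v w t i) = 0}) \<union>
     (\<Union>i<?m. \<Union>k\<in>{..<?m}-{i}. {t. fst (line v w t i) * snd (line v w t k) - fst (line v w t k) * snd (line v w t i) = 0}) \<union>
     {t. \<not> (\<forall>i<?m. line v w t i \<noteq> 0)}"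
  have fin: "finite ?bad" using f1 f2 f3 by auto
  have good: "f t = 0" if "t \<notin> ?bad" for t
    unfolding f_def by (rule generic) (use that in auto)
  have "f 0 = 0"
  proof (rule ccontr)
    assume "f 0 \<noteq> 0"
    then have "finite ({t. f t = 0} \<union> ?bad)" using finite_zeros_poly_fun[OF pf] fin by simp
    moreover have "{t. f t = 0} \<union> ?bad = UNIV" using good by blast
    ultimately have "finite (UNIV :: complex set)" by (simp only:)
    then show False using infinite_UNIV_char_0[where 'a=complex] by blast
  qed
  then show ?thesis by (simp add: f_def)
qed

text \<open>
  All multiples of degree \<open>sum_list es\<close> of the reduced product. This is the tangent space at a
  smooth point.
\<close>
definition tangent_forms :: "(nat \<Rightarrow> complex \<times> complex) \<Rightarrow> bipoly set" where
  "tangent_forms v = (\<lambda>f. homog (sum_list es) (reduced_product es v * dehom f)) ` forms (length es)"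

lemma mem_tangent_forms: "degree h \<le> length es \<Longrightarrow> homog (sum_list es) (reduced_product es v * h) \<in> tangent_forms v"
  unfolding tangent_forms_def by (rule image_eqI[of _ _ "homog (length es) h"]) (simp_all add: dehom_homog)

lemma tangent_forms_forms: "tangent_forms v \<subseteq> forms (sum_list es)" by (auto simp: tangent_forms_def)

lemma reduced_product_nonzero: "(\<And>i. i < length es \<Longrightarrow> v i \<noteq> 0) \<Longrightarrow> reduced_product es v \<noteq> 0"
  by (simp add: reduced_product_def)

lemma tangent_forms_subspace_dim:
  assumes "\<And>i. i < length es \<Longrightarrow> v i \<noteq> 0"
  shows "bipoly.subspace (tangent_forms v)" "bipoly.dim (tangent_forms v) = length es + 1"
  unfolding tangent_forms_def using subspace_multiples dim_multiples[OF reduced_product_nonzero degree_reduced_product] assms by blast+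

lemma point_forms: "bipoly.span {homog N p} \<subseteq> forms N"
  by (rule bipoly.span_minimal) (simp_all add: subspace_forms)

lemma tangent_forms_subset_tangent_space:
  assumes v: "\<And>i. i < length es \<Longrightarrow> v i \<noteq> 0"
  shows "tangent_forms v \<subseteq> tangent_space (sum_list es) (root_locus es) (root_point es v)"
proof
  let ?N = "sum_list es"
  fix w assume "w \<in> tangent_forms v"
  then obtain f where f: "f \<in> forms (length es)" "w = homog ?N (reduced_product es v * dehom f)" unfolding tangent_forms_def by blast
  show "w \<in> tangent_space ?N (root_locus es) (root_point es v)"
    unfolding tangent_space_alt[OF point_forms]
  proof (intro CollectI conjI allI impI ballI)
    show "w \<in> forms ?N" by (simp add: f(2))
    fix e F u assume F: "hom_poly {..?N} e F \<and> (\<forall>z\<in>cone ?N (root_locus es). F z = 0)"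
      and u: "u \<in> (root_point es v) - {0}"
    obtain a where a: "u = smult [:a:] (homog ?N (root_product es v))" using u by (auto simp: span_single)
    then have a0: "a \<noteq> 0" using u by auto
    have van: "F (coeff (root_product es v)) = 0" if "\<forall>i<length es. v i \<noteq> 0" for v
      using F vanishing_on_root_locus_iff[of es e F] that by blast
    have "differential {..?N} F (\<lambda>c. a * coeff (root_product es v) c) (coeff (reduced_product es v * dehom f)) = 0"
      using vanishing_on_multiples[of e F v a "dehom f"] F van v a0 degree_dehom[OF f(1)] by blast
    moreover have "differential {..?N} F (coords ?N u) (coords ?N w) = differential {..?N} F (\<lambda>c. a * coeff (root_product es v) c) (coeff (reduced_product es v * dehom f))"
      by (rule differential_cong[of _ e]) (use F in \<open>auto simp: a f(2) coords_smult coords_homog\<close>)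
    ultimately show "differential {..?N} F (coords ?N u) (coords ?N w) = 0" by simp
  qed
qed

lemma common_nonzero_on_root_locus_finite:
  assumes "finite K" "\<And>k. k \<in> K \<Longrightarrow> hom_poly J (d k) (D k)"
    and "\<And>k. k \<in> K \<Longrightarrow> \<exists>v. (\<forall>i<length es. v i \<noteq> 0) \<and> D k (coeff (root_product es v)) \<noteq> 0"
  shows "\<exists>v. (\<forall>i<length es. v i \<noteq> 0) \<and> (\<Prod>k\<in>K. D k (coeff (root_product es v))) \<noteq> 0"
  using assms
proof (induction K rule: finite_induct)
  case empty
  show ?case by (intro exI[of _ "\<lambda>_. (1, 0)"]) (auto simp: zero_prod_def)
next
  case (insert k K)
  obtain v where v: "\<forall>i<length es. v i \<noteq> 0" "(\<Prod>k\<in>K. D k (coeff (root_product es v))) \<noteq> 0" using insert by blast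
  obtain w where w: "\<forall>i<length es. w i \<noteq> 0" "D k (coeff (root_product es w)) \<noteq> 0" using insert.prems(2)[of k] by blast
  have hp: "hom_poly J (\<Sum>k\<in>K. d k) (\<lambda>z. \<Prod>k\<in>K. D k z)" using insert by (intro hom_poly_prod) auto
  have "hom_poly J (d k) (D k)" using insert by blast
  then obtain u where "\<forall>i<length es. u i \<noteq> 0" "D k (coeff (root_product es u)) * (\<Prod>k\<in>K. D k (coeff (root_product es u))) \<noteq> 0"
    using common_nonzero_on_root_locus[of J "d k" "D k" es w "\<Sum>k\<in>K. d k" "\<lambda>z. \<Prod>k\<in>K. D k z" v] hp v w by blast
  then show ?case using insert by (intro exI[of _ u]) simp
qed

text \<open>
  Take a maximal set \<open>B\<close> of coordinates that are algebraically independent on the cone; it has at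
  most \<open>n + 1\<close> elements by \<open>hom_indep_card_bound\<close>, where \<open>n\<close> is the number of factors. For every
  other coordinate \<open>k\<close> choose a relation \<open>F k\<close> of minimal degree between \<open>B\<close> and \<open>k\<close>. Its
  derivative \<open>D k\<close> in the direction \<open>k\<close> is not the zero function, for otherwise \<open>F k\<close> would be a
  relation within \<open>B\<close>; and it does not vanish identically on the cone, since it has smaller degree
  than \<open>F k\<close>. Where no \<open>D k\<close> vanishes, the differential of \<open>F k\<close> recovers the coordinate \<open>k\<close> of a
  tangent vector from its coordinates in \<open>B\<close>. So a tangent vector with zero coordinates in \<open>B\<close> is
  zero, which bounds the dimension by the number of elements of \<open>B\<close>.
\<close>
lemma generically_small_tangent_space:
  "\<exists>e G v0. hom_poly {..sum_list es} e G \<and> (\<forall>i<length es. v0 i \<noteq> 0) \<and> G (coeff (root_product es v0)) \<noteq> 0 \<and>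
    (\<forall>v. (\<forall>i<length es. v i \<noteq> 0) \<and> G (coeff (root_product es v)) \<noteq> 0 \<longrightarrow>
       bipoly.dim (tangent_space (sum_list es) (root_locus es) (root_point es v)) \<le> length es + 1)"
proof -
  let ?N = "sum_list es" and ?m = "length es" and ?X = "root_locus es"
  let ?U = "cone ?N ?X"
  let ?co = "\<lambda>b z. z b :: complex"
  let ?S = "{B. B \<subseteq> {..?N} \<and> hom_indep ?U ?co B}"
  have finS: "finite ?S" by (rule finite_subset[of _ "Pow {..?N}"]) auto
  have Une: "?U \<noteq> {}"
  proof
    assume U: "?U = {}"
    then have "\<forall>z\<in>?U. (1::complex) = 0" by simp
    then have "\<forall>v :: nat \<Rightarrow> complex \<times> complex. (\<forall>i<?m. v i \<noteq> 0) \<longrightarrow> (1::complex) = 0"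
      using iffD1[OF vanishing_on_root_locus_iff[OF hom_poly.const[of "{..?N}" 1]]] by blast
    then have "(\<forall>i<?m. (\<lambda>_. (1::complex, 0::complex)) i \<noteq> 0) \<longrightarrow> (1::complex) = 0" by (rule spec)
    then show False by (simp add: zero_prod_def)
  qed
  have "{} \<in> ?S"
  proof -
    have "G y = 0" if G: "hom_poly {} e G" "\<forall>z\<in>?U. G (\<lambda>b. z b) = 0" for e G y
    proof -
      obtain z where "z \<in> ?U" using Une by blast
      then have "G z = 0" using G(2) by simp
      moreover have "G y = G z" using hom_poly_cong[OF G(1)] by blast
      ultimately show ?thesis by simp
    qed
    then show ?thesis unfolding hom_indep_def by blast
  qed
  then have neS: "?S \<noteq> {}" by blast
  from finite_has_maximal[OF finS neS]
  obtain B where BS: "B \<in> ?S" and Bmax: "\<forall>C\<in>?S. B \<subseteq> C \<longrightarrow> B = C" by (elim bexE)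
  have B: "B \<in> ?S" "\<And>C. C \<in> ?S \<Longrightarrow> B \<subseteq> C \<Longrightarrow> B = C"
    using BS by simp (rule Bmax[rule_format])
  then have BN: "B \<subseteq> {..?N}" and indB: "hom_indep ?U ?co B" by auto
  have fB: "finite B" using BN finite_subset by blast
  have cB: "card B \<le> ?m + 1"
  proof (cases "card B")
    case (Suc k)
    obtain h where h: "bij_betw h {0..<Suc k} B" using ex_bij_betw_nat_finite[OF fB] Suc by auto
    have hb: "h b \<in> B" if "b \<le> k" for b using h that by (auto simp: bij_betw_def)
    have inj: "inj_on h {..k}" using h by (simp add: bij_betw_def atLeast0LessThan lessThan_Suc_atMost)
    have "hom_indep ?U (\<lambda>b z. z (h b)) {..k}"
      unfolding hom_indep_def
    proof safe
      fix e G y assume G: "hom_poly {..k} e G" "\<forall>z\<in>?U. G (\<lambda>b. z (h b)) = 0"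
      have "hom_poly B (e * 1) (\<lambda>z. G (\<lambda>b. z (h b)))"
        by (rule hom_poly_compose[OF G(1)]) (use hb in \<open>auto intro: hom_poly.var[unfolded One_nat_def]\<close>)
      then have all: "\<And>y. G (\<lambda>b. y (h b)) = 0" using indB G(2) unfolding hom_indep_def by blast
      have "G y = G (\<lambda>b. (\<lambda>i. y (inv_into {..k} h i)) (h b))"
        by (rule hom_poly_cong[OF G(1)]) (simp add: inv_into_f_f[OF inj])
      then show "G y = 0" using all[of "\<lambda>i. y (inv_into {..k} h i)"] by simp
    qed
    moreover have "?U \<subseteq> {z. \<exists>a v. \<forall>i\<le>?N. z i = a * coeff (root_product es v) i}"
      using cone_crlD by blast
    ultimately have "k \<le> ?m"
      using hb BN by (intro hom_indep_card_bound[of k ?N 1 "\<lambda>b z. z (h b)" ?m _ "root_product es" ?U, OF _ multihom_poly_root_product]) (auto intro!: hom_poly.var[unfolded One_nat_def])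
    then show ?thesis using Suc by simp
  qed simp
  let ?K = "{..?N} - B"
  define Q where "Q k e F D d \<longleftrightarrow> hom_poly (insert k B) e F \<and> (\<forall>z\<in>?U. F z = 0) \<and> hom_poly (insert k B) d D \<and>
      (\<forall>y t. ((\<lambda>s. F (y(k := s))) has_field_derivative D (y(k := t))) (at t)) \<and> (\<exists>z\<in>?U. D z \<noteq> 0)"
    for k e F D d
  have "\<exists>e F D d. Q k e F D d" if k: "k \<in> ?K" for k
  proof -
    let ?P = "\<lambda>e. \<exists>G. hom_poly (insert k B) e G \<and> (\<forall>z\<in>?U. G z = 0) \<and> (\<exists>y. G y \<noteq> 0)"
    have "insert k B \<notin> ?S" using B(2)[of "insert k B"] k by blast
    then have exP: "\<exists>e. ?P e" using k BN unfolding hom_indep_def by auto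
    define e where "e = (LEAST e. ?P e)"
    have "?P e" unfolding e_def using exP by (rule LeastI_ex)
    then obtain F where F: "hom_poly (insert k B) e F" "\<forall>z\<in>?U. F z = 0" "\<exists>y. F y \<noteq> 0" by blast
    obtain D where D: "hom0_pred (insert k B) e D" "\<forall>y t. ((\<lambda>s. F (y(k := s))) has_field_derivative D (y(k := t))) (at t)"
      using hom_poly_partial[OF F(1), of k] by blast
    have "D \<noteq> (\<lambda>_. 0)"
    proof
      assume D0: "D = (\<lambda>_. 0)"
      obtain G0 G1 where G: "hom0 B e G0" "\<And>y. F y = G0 y + y k * G1 y" using hom_poly_split_variable[OF F(1)] by blast
      have const: "F y = F (y(k := 0))" for y
      proof -
        have "poly_fun (\<lambda>s. F (y(k := s)))" by (rule hom_poly_curve[OF F(1)]) (case_tac "i = k", auto)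
        then obtain p where p: "\<And>s. F (y(k := s)) = poly p s" unfolding poly_fun_def by blast
        have "poly (pderiv p) t = 0" for t
        proof -
          have "((\<lambda>s. poly p s) has_field_derivative 0) (at t)"
            using D(2)[rule_format, of y t] unfolding D0 p .
          then show ?thesis using DERIV_unique[OF poly_DERIV] by blast
        qed
        then have "pderiv p = 0" using poly_all_0_iff_0 by blast
        then obtain c where "p = [:c:]" using pderiv_eq_0_iff degree_eq_zeroE by blast
        then have "F (y(k := y k)) = F (y(k := 0))" unfolding p by simp
        then show ?thesis by simp
      qed
      have "F y = G0 y" for y
      proof -
        have "F y = G0 (y(k := 0))" using const[of y] G(2)[of "y(k := 0)"] by simp
        also have "\<dots> = G0 y"
        proof (cases "G0 = (\<lambda>_. 0)")
          case False
          then have "hom_poly B e G0" using G(1) by (simp add: hom0_def)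
          then show ?thesis by (rule hom_poly_cong) (use k in auto)
        qed simp
        finally show ?thesis .
      qed
      then have "F = G0" by blast
      then have "hom_poly B e F" using G(1) F(3) unfolding hom0_def by auto
      then show False using indB F(2,3) unfolding hom_indep_def by blast
    qed
    then obtain e' where e': "e = Suc e'" "hom_poly (insert k B) e' D" using D(1) unfolding hom0_pred_def by blast
    have "\<exists>y. D y \<noteq> 0" using \<open>D \<noteq> (\<lambda>_. 0)\<close> by blast
    moreover have "e' < (LEAST e. ?P e)" using e'(1) unfolding e_def[symmetric] by simp
    from not_less_Least[OF this] have "\<not> ?P e'" .
    ultimately have "\<exists>z\<in>?U. D z \<noteq> 0" using e'(2) by blast
    then have "Q k e F D e'" unfolding Q_def using F(1,2) D(2) e'(2) by blast
    then show ?thesis by blast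
  qed
  then obtain e F D d where Q: "\<And>k. k \<in> ?K \<Longrightarrow> Q k (e k) (F k) (D k) (d k)" by metis
  then have fam: "\<And>k. k \<in> ?K \<Longrightarrow> hom_poly (insert k B) (e k) (F k)" "\<And>k. k \<in> ?K \<Longrightarrow> \<forall>z\<in>?U. F k z = 0"
    "\<And>k. k \<in> ?K \<Longrightarrow> hom_poly (insert k B) (d k) (D k)"
    "\<And>k y t. k \<in> ?K \<Longrightarrow> ((\<lambda>s. F k (y(k := s))) has_field_derivative D k (y(k := t))) (at t)"
    "\<And>k. k \<in> ?K \<Longrightarrow> \<exists>z\<in>?U. D k z \<noteq> 0" unfolding Q_def by blast+
  have sub: "insert k B \<subseteq> {..?N}" if "k \<in> ?K" for k using that BN by auto
  have hF: "hom_poly {..?N} (e k) (F k)" if "k \<in> ?K" for k using fam(1)[OF that] sub[OF that] by (rule hom_poly_mono)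
  have hD: "hom_poly {..?N} (d k) (D k)" if "k \<in> ?K" for k using fam(3)[OF that] sub[OF that] by (rule hom_poly_mono)
  define G where "G z = (\<Prod>k\<in>?K. D k z)" for z
  have hG: "hom_poly {..?N} (\<Sum>k\<in>?K. d k) G" unfolding G_def[abs_def] using hD by (intro hom_poly_prod) auto
  have "\<exists>v. (\<forall>i<?m. v i \<noteq> 0) \<and> (\<Prod>k\<in>?K. D k (coeff (root_product es v))) \<noteq> 0"
  proof (rule common_nonzero_on_root_locus_finite[of ?K "{..?N}" d D])
    fix k assume k: "k \<in> ?K"
    show "\<exists>v. (\<forall>i<?m. v i \<noteq> 0) \<and> D k (coeff (root_product es v)) \<noteq> 0"
      using fam(5)[OF k] vanishing_on_root_locus_iff[OF hD[OF k]] by blast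
  qed (use hD in auto)
  then obtain v0 where v0: "\<forall>i<?m. v0 i \<noteq> 0" "G (coeff (root_product es v0)) \<noteq> 0" unfolding G_def by blast
  have "bipoly.dim (tangent_space ?N ?X (root_point es v)) \<le> ?m + 1"
    if v: "\<forall>i<?m. v i \<noteq> 0" and Gv: "G (coeff (root_product es v)) \<noteq> 0" for v
  proof (rule ccontr)
    let ?u = "homog ?N (root_product es v)"
    let ?T = "tangent_space ?N ?X (bipoly.span {?u})"
    assume big: "\<not> bipoly.dim ?T \<le> ?m + 1"
    let ?W = "{w \<in> forms ?N. \<forall>b\<in>B. coords ?N w b = 0}"
    have u0: "?u \<noteq> 0" using v root_product_nonzero homog_eq_0_iff[OF degree_root_product] by blast
    have subW: "bipoly.subspace ?W"
      using subspace_forms[of ?N] unfolding bipoly.subspace_def by (auto simp: coords_0 coords_add coords_smult)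
    have "bipoly.span (mono_form ?N ` ?K) \<subseteq> ?W"
      using BN by (intro bipoly.span_minimal subW) (auto simp: coords_mono_form)
    moreover have "bipoly.independent (mono_form ?N ` ?K)" by (rule bipoly.independent_mono[OF independent_mono_form]) auto
    moreover have "card (mono_form ?N ` ?K) = card ?K" by (rule card_image) (rule inj_on_subset[OF inj_mono_form], auto)
    ultimately have dW: "card ?K \<le> bipoly.dim ?W"
      using dim_mono_forms[of "bipoly.span (mono_form ?N ` ?K)" ?W ?N] bipoly.dim_span_eq_card_independent[of "mono_form ?N ` ?K"] by force
    have cK: "card ?K = ?N + 1 - card B" using card_Diff_subset[OF fB BN] by simp
    have cBN: "card B \<le> ?N + 1" using card_mono[OF _ BN] by simp
    have "card (mono_form ?N ` {..?N}) = ?N + 1" by (simp add: card_image[OF inj_mono_form])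
    then have lt: "card (mono_form ?N ` {..?N}) < bipoly.dim ?T + bipoly.dim ?W" using dW cK cB cBN big by linarith
    have subT: "bipoly.subspace ?T" by (rule subspace_tangent_space[OF point_forms])
    have "?T \<subseteq> forms ?N" by (auto simp: tangent_space_def)
    \<comment> \<open>a tangent space that is too large would contain a nonzero vector with zero coordinates in
       \<open>B\<close>\<close>
    then obtain w where w: "w \<noteq> 0" "w \<in> ?T" "w \<in> ?W"
      using bipoly.subspaces_meet[OF subT subW, of "mono_form ?N ` {..?N}"] lt unfolding span_mono_form by auto
    have "coords ?N w k = 0" if k: "k \<in> ?K" for k
    proof -
      let ?y = "coords ?N ?u"
      have van: "\<forall>y\<in>?X. \<forall>u\<in>y - {0}. F k (coords ?N u) = 0" using fam(2)[OF k] unfolding cone_def by blast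
      have "?u \<in> bipoly.span {?u} - {0}" using u0 bipoly.span_base[of ?u "{?u}"] by blast
      then have d0: "((\<lambda>t. F k (coords ?N (?u + smult [:t:] w))) has_field_derivative 0) (at 0)"
        using w(2) hF[OF k] van unfolding tangent_space_def by blast
      have eq: "F k (coords ?N (?u + smult [:t:] w)) = F k (?y(k := ?y k + t * coords ?N w k))" for t
        by (rule hom_poly_cong[OF fam(1)[OF k]]) (use w(3) in \<open>auto simp: coords_add coords_smult\<close>)
      have "((\<lambda>t. F k (?y(k := ?y k + t * coords ?N w k))) has_field_derivative D k (?y(k := ?y k + 0 * coords ?N w k)) * coords ?N w k) (at 0)"
        by (rule DERIV_chain2[where f = "\<lambda>s. F k (?y(k := s))" and g = "\<lambda>t. ?y k + t * coords ?N w k", OF fam(4)[OF k]])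
           (auto intro!: derivative_eq_intros)
      then have "D k ?y * coords ?N w k = 0" using d0 DERIV_unique unfolding eq by fastforce
      moreover have "D k ?y = D k (coeff (root_product es v))" by (rule hom_poly_cong[OF hD[OF k]]) (simp add: coords_homog)
      moreover have "D k (coeff (root_product es v)) \<noteq> 0" using Gv k unfolding G_def by auto
      ultimately show ?thesis by simp
    qed
    then have "w = 0" using w(3) subspace_forms[of ?N] bipoly.subspace_0
      by (intro forms_eqI[of w ?N 0]) (auto simp: coords_0)
    then show False using w(1) by simp
  qed
  then show ?thesis using hG v0 by blast
qed

text \<open>
  At a smooth point the inclusion of \<open>tangent_forms\<close> in the tangent space is an equality, as both
  have the same dimension.
\<close>
lemma smooth_pointD:
  assumes "smooth_point (sum_list es) (root_locus es) x"
  shows "\<exists>v. (\<forall>i<length es. v i \<noteq> 0) \<and> x = (root_point es v) \<and>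
    tangent_space (sum_list es) (root_locus es) x = tangent_forms v"
proof -
  let ?N = "sum_list es"
  obtain v where v: "x = (root_point es v)" "\<forall>i<length es. v i \<noteq> 0"
    using assms unfolding smooth_point_def root_locus_def by blast
  have d: "bipoly.dim (tangent_space ?N (root_locus es) x) = length es + 1"
    using assms var_dim_root_locus[OF pos] unfolding smooth_point_def by simp
  have "tangent_forms v = tangent_space ?N (root_locus es) x"
    by (rule subspace_eq_forms[of _ _ ?N])
       (use tangent_forms_subset_tangent_space[of v] v tangent_forms_subspace_dim[of v] d in \<open>auto simp: tangent_space_def\<close>)
  then show ?thesis using v by blast
qed

text \<open>
  From every point of the parameter space a line towards one fixed general point \<open>v0\<close> meets the
  exceptional locus in finitely many points.
\<close>
lemma smooth_points_on_lines:
  "\<exists>v0. \<forall>v. (\<forall>i<length es. v i \<noteq> 0) \<longrightarrow>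
    finite {t. \<not> ((\<forall>i<length es. line v v0 t i \<noteq> 0) \<and>
       smooth_point (sum_list es) (root_locus es) (root_point es (line v v0 t)))}"
proof -
  let ?N = "sum_list es" and ?m = "length es"
  obtain e G v0 where G: "hom_poly {..?N} e G" "\<forall>i<?m. v0 i \<noteq> 0" "G (coeff (root_product es v0)) \<noteq> 0"
    "\<And>v. (\<forall>i<?m. v i \<noteq> 0) \<Longrightarrow> G (coeff (root_product es v)) \<noteq> 0 \<Longrightarrow>
       bipoly.dim (tangent_space ?N (root_locus es) (root_point es v)) \<le> ?m + 1"
    using generically_small_tangent_space by blast
  have sm: "smooth_point ?N (root_locus es) (root_point es v)"
    if v: "\<forall>i<?m. v i \<noteq> 0" and Gv: "G (coeff (root_product es v)) \<noteq> 0" for v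
  proof -
    have "tangent_space ?N (root_locus es) (root_point es v) \<subseteq> forms ?N" by (auto simp: tangent_space_def)
    moreover have "tangent_forms v \<subseteq> tangent_space ?N (root_locus es) (root_point es v)"
      by (rule tangent_forms_subset_tangent_space) (use v in blast)
    ultimately have "bipoly.dim (tangent_forms v) \<le> bipoly.dim (tangent_space ?N (root_locus es) (root_point es v))"
      using dim_mono_forms by blast
    then have "?m + 1 \<le> bipoly.dim (tangent_space ?N (root_locus es) (root_point es v))"
      using v tangent_forms_subspace_dim(2)[of v] by simp
    then show ?thesis using G(4)[OF v Gv] v var_dim_root_locus[OF pos] unfolding smooth_point_def root_locus_def by auto
  qed
  have "finite {t. \<not> ((\<forall>i<?m. line v v0 t i \<noteq> 0) \<and> smooth_point ?N (root_locus es) (root_point es (line v v0 t)))}"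
    if v: "\<forall>i<?m. v i \<noteq> 0" for v
  proof -
    have "G (coeff (root_product es (line v v0 1))) \<noteq> 0" using G(3) by simp
    from finite_zeros_on_line[OF G(1) this] have "finite {t. G (coeff (root_product es (line v v0 t))) = 0}" .
    moreover have "finite {t. \<not> (\<forall>i<?m. line v v0 t i \<noteq> 0)}" by (rule finite_line_degenerate) (use v in auto)
    ultimately have "finite ({t. G (coeff (root_product es (line v v0 t))) = 0} \<union> {t. \<not> (\<forall>i<?m. line v v0 t i \<noteq> 0)})" by simp
    then show ?thesis by (rule rev_finite_subset) (use sm in auto)
  qed
  then show ?thesis by blast
qed

end

section \<open>Subspaces meeting a coincident root locus\<close>

lemma linear_factorization_up_to_scalar:
  assumes "p \<noteq> 0" "degree p \<le> D"
  shows "\<exists>c v. c \<noteq> 0 \<and> (\<forall>i<D. v i \<noteq> 0) \<and> p = smult c (\<Prod>i<D. lin (v i))"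
proof (cases D)
  case 0
  then obtain c where "p = [:c:]" using assms(2) degree_eq_zeroE by auto
  then show ?thesis using 0 assms(1) by (intro exI[of _ c]) (auto simp: one_pCons)
next
  case (Suc D')
  then obtain v where "\<forall>i<D. v i \<noteq> 0" "p = (\<Prod>i<D. lin (v i))"
    using linear_factorization[of p D'] assms by blast
  then show ?thesis by (intro exI[of _ 1] exI[of _ v]) simp
qed

lemma point_subset_iff:
  assumes "bipoly.subspace H"
  shows "bipoly.span {f} \<subseteq> H \<longleftrightarrow> f \<in> H"
  using bipoly.span_minimal[of "{f}" H] bipoly.span_base[of f "{f}"] assms by blast

lemma GrD: "H \<in> Gr N k \<Longrightarrow> bipoly.subspace H" "H \<in> Gr N k \<Longrightarrow> H \<subseteq> forms N"
  by (auto simp: Gr_def)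

text \<open>
  Move the point along a line to a general one, which is smooth, and \<open>H\<close> with it.
\<close>
lemma Xi0_lower:
  assumes pos: "0 \<notin> set fs" and ne: "fs \<noteq> []" and H: "H \<in> Gr (sum_list fs) (l + 1)" and x: "x \<in> root_locus fs" "x \<subseteq> H"
  shows "H \<in> Xi0 (sum_list fs) l (root_locus fs)"
proof -
  let ?N = "sum_list fs"
  obtain v where v: "x = (root_point fs v)" "\<forall>i<length fs. v i \<noteq> 0" using x(1) unfolding root_locus_def by blast
  obtain v0 where v0: "finite {t. \<not> ((\<forall>i<length fs. line v v0 t i \<noteq> 0) \<and>
       smooth_point ?N (root_locus fs) (root_point fs (line v v0 t)))}"
    using smooth_points_on_lines[OF pos ne] v(2) by blast
  let ?S = "{H \<in> Gr ?N (l + 1). \<exists>x. smooth_point ?N (root_locus fs) x \<and> x \<subseteq> H}"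
  have "H \<in> zariski_Gr ?N (l + 1) closure_of ?S"
  proof (rule in_closure_of_Gr_by_moving_factor[where q = "\<lambda>t. root_product fs (line v v0 t)" and j = 0])
    show "root_product fs (line v v0 0) \<noteq> 0" using root_product_nonzero v(2) by simp
    fix c :: "complex poly" assume "degree c \<le> 0"
    then obtain b where b: "c = [:b:]" using degree_eq_zeroE by auto
    have "homog ?N (root_product fs v) \<in> H" using x(2) point_subset_iff[OF GrD(1)[OF H]] unfolding v(1) by blast
    then show "homog ?N (root_product fs (line v v0 0) * c) \<in> H" using bipoly.subspace_scale[OF GrD(1)[OF H]] by (simp add: b homog_smult)
  next
    have "H' \<in> ?S" if "H' \<in> Gr ?N (l + 1)" "\<forall>c. degree c \<le> 0 \<longrightarrow> homog ?N (root_product fs (line v v0 t) * c) \<in> H'"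
      "smooth_point ?N (root_locus fs) (root_point fs (line v v0 t))" for t H'
    proof -
      have "homog ?N (root_product fs (line v v0 t) * 1) \<in> H'" using that(2) degree_1 by (metis le0)
      then have "(root_point fs (line v v0 t)) \<subseteq> H'" using point_subset_iff[OF GrD(1)[OF that(1)]] by simp
      then show ?thesis using that(1,3) by blast
    qed
    then show "finite {t. \<not> (\<forall>H'\<in>Gr ?N (l + 1). (\<forall>c. degree c \<le> 0 \<longrightarrow> homog ?N (root_product fs (line v v0 t) * c) \<in> H') \<longrightarrow> H' \<in> ?S)}"
      by (intro finite_subset[OF _ v0]) blast
  qed (use poly_curve_root_product_line degree_root_product H in auto)
  then show ?thesis unfolding Xi0_def .
qed

text \<open>
  Containing the form with given roots is a closed condition on \<open>H\<close> and the roots, so it stays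
  closed after the roots have been eliminated.
\<close>
lemma Xi0_upper:
  assumes l: "l + 1 \<le> sum_list fs + 1" and H: "H \<in> Xi0 (sum_list fs) l (root_locus fs)"
  shows "\<exists>x\<in>root_locus fs. x \<subseteq> H"
proof -
  let ?N = "sum_list fs" and ?m = "length fs"
  let ?J = "pluecker_index ?N (l + 1)"
  let ?C = "\<lambda>y v. \<exists>w. (\<forall>i<0. w i = v i) \<and> (\<forall>i. 0 \<le> i \<and> i < 0 + ?m \<longrightarrow> w i \<noteq> 0) \<and> incident ?N (l + 1) y (root_product fs w)"
  have "closed_cond ?J (0 + ?m) (\<lambda>y v. incident ?N (l + 1) y (root_product fs v))"
    using multihom_poly_root_product[of fs ?m ?J] unfolding multihom_poly_def by (intro closed_cond_incident) auto
  then have C: "closed_cond ?J 0 ?C" by (rule closed_cond_project)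
  let ?K = "\<lambda>H. \<exists>w. (\<forall>i<?m. w i \<noteq> 0) \<and> homog ?N (root_product fs w) \<in> H"
  have "zariski_Gr ?N (l + 1) closure_of {H \<in> Gr ?N (l + 1). \<exists>x. smooth_point ?N (root_locus fs) x \<and> x \<subseteq> H} \<subseteq> {H \<in> Gr ?N (l + 1). ?K H}"
  proof (rule closure_of_Gr_subset[OF C l])
    fix H z v assume "H \<in> Gr ?N (l + 1)" "z \<in> pluecker_coords ?N (l + 1) H"
    then show "?C z v \<longleftrightarrow> ?K H" using incident_iff[OF _ _ degree_root_product] by auto
  next
    show "{H \<in> Gr ?N (l + 1). \<exists>x. smooth_point ?N (root_locus fs) x \<and> x \<subseteq> H} \<subseteq> {H \<in> Gr ?N (l + 1). ?K H}"
    proof safe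
      fix H x assume H: "H \<in> Gr ?N (l + 1)" "smooth_point ?N (root_locus fs) x" "x \<subseteq> H"
      then obtain v where "x = (root_point fs v)" "\<forall>i<?m. v i \<noteq> 0"
        unfolding smooth_point_def root_locus_def by blast
      then show "?K H" using H(3) point_subset_iff[OF GrD(1)[OF H(1)]] by blast
    qed
  qed
  then obtain w where w: "H \<in> Gr ?N (l + 1)" "\<forall>i<?m. w i \<noteq> 0" "homog ?N (root_product fs w) \<in> H" using H unfolding Xi0_def by blast
  then have "(root_point fs w) \<subseteq> H" using point_subset_iff[OF GrD(1)[OF w(1)]] by blast
  then show ?thesis using w(2) unfolding root_locus_def by blast
qed

section \<open>Higher associated varieties of coincident root loci\<close>

lemma sum_list_map2_minus:
  assumes "length ks = length ls" "set ks \<subseteq> {0, 1::nat}" "0 \<notin> set ls"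
  shows "sum_list (map2 (-) ls ks) + sum_list ks = sum_list ls"
  using assms by (induction ks ls rule: list_induct2) auto

lemma root_product_map2_minus:
  assumes len: "length ks = length ls" and ks: "set ks \<subseteq> {0, 1::nat}" and pos: "0 \<notin> set ls"
  shows "root_product (map2 (-) ls ks) v = reduced_product ls v * (\<Prod>i\<in>{i. i < length ls \<and> ks ! i = 0}. lin (v i))"
proof -
  let ?n = "length ls"
  have "root_product (map2 (-) ls ks) v = (\<Prod>i<?n. lin (v i) ^ (ls ! i - 1) * (if ks ! i = 0 then lin (v i) else 1))"
    unfolding root_product_def
  proof (rule prod.cong)
    fix i assume "i \<in> {..<?n}"
    then have i: "i < ?n" by simp
    have "ks ! i \<in> set ks" using i len by simp
    then have ki: "ks ! i = 0 \<or> ks ! i = 1" using ks by blast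
    have "ls ! i \<noteq> 0" using pos i nth_mem by metis
    then have "lin (v i) ^ (ls ! i) = lin (v i) ^ (ls ! i - 1) * lin (v i)" by (metis Suc_pred' neq0_conv power_Suc2)
    then show "lin (v i) ^ (map2 (-) ls ks ! i) = lin (v i) ^ (ls ! i - 1) * (if ks ! i = 0 then lin (v i) else 1)"
      using ki i len by auto
  qed (use len in simp)
  also have "\<dots> = reduced_product ls v * (\<Prod>i<?n. if ks ! i = 0 then lin (v i) else 1)"
    unfolding reduced_product_def by (rule prod.distrib)
  also have "(\<Prod>i<?n. if ks ! i = 0 then lin (v i) else 1) = (\<Prod>i\<in>{i\<in>{..<?n}. ks ! i = 0}. lin (v i))"
    by (rule prod.inter_filter[symmetric]) simp
  also have "{i\<in>{..<?n}. ks ! i = 0} = {i. i < ?n \<and> ks ! i = 0}" by auto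
  finally show ?thesis .
qed

lemma sum_list_01: "set ks \<subseteq> {0, 1::nat} \<Longrightarrow> sum_list ks = card {i. i < length ks \<and> ks ! i = 1}"
proof -
  assume ks: "set ks \<subseteq> {0, 1}"
  have "sum_list ks = (\<Sum>i<length ks. ks ! i)" by (simp add: sum_list_sum_nth lessThan_atLeast0)
  also have "\<dots> = (\<Sum>i<length ks. if ks ! i = 1 then 1 else 0)"
    using ks nth_mem by (intro sum.cong) fastforce+
  also have "\<dots> = card {i\<in>{..<length ks}. ks ! i = 1}" by (simp add: sum.If_cases Int_def)
  also have "{i\<in>{..<length ks}. ks ! i = 1} = {i. i < length ks \<and> ks ! i = 1}" by auto
  finally show ?thesis .
qed

text \<open>
  Let \<open>q\<close> be the product with the reduced exponents and \<open>H\<close> a subspace that contains all multiples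
  of \<open>q\<close>. Those multiples have linear dimension \<open>j + 1\<close>, they lie among the multiples of the
  reduced product, which are tangent, and one of them is the point itself. So \<open>H\<close> satisfies the
  defining condition if the point is smooth; the general case is a limit, with \<open>q\<close> as the moving
  factor.
\<close>
lemma CH_lower:
  assumes pos: "0 \<notin> set ls" and ne: "ls \<noteq> []"
    and ks: "length ks = length ls" "set ks \<subseteq> {0, 1}" "sum_list ks = j"
    and H: "H \<in> Gr (sum_list ls) (sum_list ls - length ls + j)"
    and v: "\<And>i. i < length ls \<Longrightarrow> v i \<noteq> 0"
    and vH: "\<And>c. degree c \<le> j \<Longrightarrow> homog (sum_list ls) (root_product (map2 (-) ls ks) v * c) \<in> H"
  shows "H \<in> CH (sum_list ls) j (root_locus ls)"
proof -
  let ?r = "sum_list ls" and ?n = "length ls" and ?es = "map2 (-) ls ks"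
  let ?k = "?r - ?n + j"
  have ses: "sum_list ?es + j = ?r" using sum_list_map2_minus[OF ks(1,2) pos] ks(3) by simp
  obtain v0 where v0: "finite {t. \<not> ((\<forall>i<?n. line v v0 t i \<noteq> 0) \<and>
       smooth_point ?r (root_locus ls) (root_point ls (line v v0 t)))}"
    using smooth_points_on_lines[OF pos ne] v by blast
  let ?S = "{H \<in> Gr ?r ?k. \<exists>x. smooth_point ?r (root_locus ls) x \<and> x \<subseteq> H \<and> bipoly.dim (H \<inter> tangent_space ?r (root_locus ls) x) \<ge> j + 1}"
  have inS: "H' \<in> ?S" if H': "H' \<in> Gr ?r ?k" "\<forall>c. degree c \<le> j \<longrightarrow> homog ?r (root_product ?es u * c) \<in> H'"
    and u: "\<forall>i<?n. u i \<noteq> 0" and sm: "smooth_point ?r (root_locus ls) (root_point ls u)" for u H'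
  proof -
    let ?I0 = "{i. i < ?n \<and> ks ! i = 0}" and ?I1 = "{i. i < ?n \<and> ks ! i = 1}"
    let ?x = "(root_point ls u)"
    have fin: "finite ?I0" "finite ?I1" by auto
    have "ks ! i = 0 \<or> ks ! i = 1" if "i < ?n" for i using that ks(1,2) nth_mem[of i ks] by (metis empty_iff insert_iff subsetD)
    then have un: "{..<?n} = ?I0 \<union> ?I1" "?I0 \<inter> ?I1 = {}" by auto
    have c1: "card ?I1 = j" using sum_list_01[OF ks(2)] ks(1,3) by simp
    have "card {..<?n} = card ?I0 + card ?I1" unfolding un(1) by (rule card_Un_disjoint[OF fin un(2)])
    then have c0: "card ?I0 + j = ?n" using c1 by simp
    have "root_product ls u = reduced_product ls u * ((\<Prod>i\<in>?I0. lin (u i)) * (\<Prod>i\<in>?I1. lin (u i)))"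
      unfolding root_product_eq_reduced_product[OF pos ne] using prod.union_disjoint[OF fin un(2), of "\<lambda>i. lin (u i)"] un(1) by simp
    then have rpe: "root_product ls u = root_product ?es u * (\<Prod>i\<in>?I1. lin (u i))"
      unfolding root_product_map2_minus[OF ks(1,2) pos] by (simp add: mult.assoc)
    have "degree (\<Prod>i\<in>?I1. lin (u i)) \<le> j" using degree_prod_lin[of u ?I1] c1 by simp
    then have "homog ?r (root_product ls u) \<in> H'" using H'(2) unfolding rpe by blast
    then have xH: "?x \<subseteq> H'" using point_subset_iff[OF GrD(1)[OF H'(1)]] by blast
    let ?M = "(\<lambda>f. homog ?r (root_product ?es u * dehom f)) ` forms j"
    have nz: "root_product ?es u \<noteq> 0" by (rule root_product_nonzero) (use u ks(1) in auto)
    have dM: "bipoly.dim ?M = j + 1" by (rule dim_multiples[OF nz]) (use degree_root_product[of ?es u] ses in linarith)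
    have "?M \<subseteq> tangent_space ?r (root_locus ls) ?x"
    proof
      fix w assume "w \<in> ?M"
      then obtain f where f: "f \<in> forms j" "w = homog ?r (root_product ?es u * dehom f)" by blast
      have "degree ((\<Prod>i\<in>?I0. lin (u i)) * dehom f) \<le> ?n"
        using degree_mult_le[of "\<Prod>i\<in>?I0. lin (u i)" "dehom f"] degree_prod_lin[of u ?I0] degree_dehom[OF f(1)] c0 by linarith
      then have "homog ?r (reduced_product ls u * ((\<Prod>i\<in>?I0. lin (u i)) * dehom f)) \<in> tangent_forms ls u" by (rule mem_tangent_forms[OF pos ne])
      then have "w \<in> tangent_forms ls u" unfolding f(2) root_product_map2_minus[OF ks(1,2) pos] by (simp add: mult.assoc)
      then show "w \<in> tangent_space ?r (root_locus ls) ?x" using tangent_forms_subset_tangent_space[OF pos ne, of u] u by blast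
    qed
    moreover have "?M \<subseteq> H'" using H'(2) degree_dehom by auto
    ultimately have "?M \<subseteq> H' \<inter> tangent_space ?r (root_locus ls) ?x" by blast
    moreover have "H' \<inter> tangent_space ?r (root_locus ls) ?x \<subseteq> forms ?r" using GrD(2)[OF H'(1)] by blast
    ultimately have "j + 1 \<le> bipoly.dim (H' \<inter> tangent_space ?r (root_locus ls) ?x)" using dim_mono_forms dM by metis
    then show ?thesis using H'(1) sm xH by blast
  qed
  have "H \<in> zariski_Gr ?r ?k closure_of ?S"
  proof (rule in_closure_of_Gr_by_moving_factor[where q = "\<lambda>t. root_product ?es (line v v0 t)" and j = j])
    show "root_product ?es (line v v0 0) \<noteq> 0" using v ks(1) by (intro root_product_nonzero) auto
    show "degree (root_product ?es (line v v0 t)) + j \<le> ?r" for t using degree_root_product[of ?es "line v v0 t"] ses by linarith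
    show "homog ?r (root_product ?es (line v v0 0) * c) \<in> H" if "degree c \<le> j" for c using vH[OF that] by simp
    show "finite {t. \<not> (\<forall>H'\<in>Gr ?r ?k. (\<forall>c. degree c \<le> j \<longrightarrow> homog ?r (root_product ?es (line v v0 t) * c) \<in> H') \<longrightarrow> H' \<in> ?S)}"
      by (intro finite_subset[OF _ v0]) (use inS in blast)
  qed (use poly_curve_root_product_line H in auto)
  then show ?thesis unfolding CH_def var_dim_root_locus[OF pos] Let_def .
qed

text \<open>
  The image of \<open>p\<close> under the linear map that sends the monomial of degree \<open>i\<close> to \<open>g i\<close>.
\<close>
definition combination :: "nat \<Rightarrow> (nat \<Rightarrow> complex poly) \<Rightarrow> complex poly \<Rightarrow> complex poly" where
  "combination D g p = (\<Sum>i\<le>D. smult (coeff p i) (g i))"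

text \<open>
  The tuples \<open>g\<close> for which \<open>combination D g\<close> embeds the polynomials of degree at most \<open>D\<close> in those
  of degree at most \<open>n\<close>.
\<close>
definition indep_polys :: "nat \<Rightarrow> nat \<Rightarrow> (nat \<Rightarrow> complex poly) set" where
  "indep_polys D n = {g. (\<forall>i\<le>D. degree (g i) \<le> n) \<and> (\<forall>c. (\<Sum>i\<le>D. smult (c i) (g i)) = 0 \<longrightarrow> (\<forall>i\<le>D. c i = 0))}"

lemma combination_add: "combination D g (p + q) = combination D g p + combination D g q"
  by (simp add: combination_def smult_add_left sum.distrib)

lemma smult_sum_right: "smult c (sum f A) = (\<Sum>a\<in>A. smult c (f a))"
  by (induction A rule: infinite_finite_induct) (simp_all add: smult_add_right)

lemma combination_smult: "combination D g (smult c p) = smult c (combination D g p)"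
  by (simp add: combination_def smult_sum_right)

lemma degree_combination: "g \<in> indep_polys D n \<Longrightarrow> degree (combination D g p) \<le> n"
  unfolding combination_def indep_polys_def
  by (intro degree_sum_le) (auto intro: order_trans[OF degree_smult_le])

lemma combination_eq_0:
  assumes "g \<in> indep_polys D n" "degree p \<le> D" "combination D g p = 0"
  shows "p = 0"
proof (rule poly_eqI)
  fix i
  have "\<forall>i\<le>D. coeff p i = 0" using assms(1,3) unfolding combination_def indep_polys_def by blast
  then show "coeff p i = coeff 0 i" using assms(2) by (cases "i \<le> D") (auto simp: coeff_eq_0)
qed

lemma multihom_poly_combination:
  assumes "multihom_poly J m dl f"
  shows "multihom_poly J m dl (\<lambda>v. combination D g (f v))"
  unfolding multihom_poly_def
proof
  fix c
  have "multihom J m 0 dl (\<lambda>y v. \<Sum>i\<le>D. coeff (g i) c * coeff (f v) i)"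
    using assms unfolding multihom_poly_def by (intro multihom_sum multihom_cmult) auto
  then show "multihom J m 0 dl (\<lambda>y v. coeff (combination D g (f v)) c)"
    by (simp add: combination_def coeff_sum mult.commute)
qed

lemma multihom_poly_reduced_product:
  assumes "length es \<le> m"
  shows "\<exists>dl. multihom_poly J m dl (reduced_product es)"
proof -
  have "multihom_poly J m (\<lambda>l. \<Sum>i<length es. (es ! i - 1) * (if l = i then 1 else 0)) (\<lambda>v. \<Prod>i<length es. lin (v i) ^ (es ! i - 1))"
    using assms by (intro multihom_poly_prod multihom_poly_power multihom_poly_lin) auto
  then show ?thesis unfolding reduced_product_def[abs_def] by blast
qed

text \<open>
  Dimension at least \<open>j + 1\<close> inside a space of dimension \<open>n + 1\<close> means meeting every subspace of
  dimension \<open>n - j + 1\<close> nontrivially. Each such subspace is the image of the polynomials of degree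
  at most \<open>n - j\<close> under some \<open>combination g\<close>, and these factor into linear forms. In this form
  tangency is an intersection, over all \<open>g\<close>, of existential conditions over projective lines; so
  it is closed and passes to the closure.
\<close>
lemma CH_upper:
  assumes pos: "0 \<notin> set ls" and ne: "ls \<noteq> []" and j: "j \<le> length ls"
    and H: "H \<in> CH (sum_list ls) j (root_locus ls)"
  shows "\<exists>v. (\<forall>i<length ls. v i \<noteq> 0) \<and> homog (sum_list ls) (root_product ls v) \<in> H \<and>
    (\<forall>g\<in>indep_polys (length ls - j) (length ls). \<exists>u. (\<forall>i<length ls - j. u i \<noteq> 0) \<and>
       homog (sum_list ls) (reduced_product ls v * combination (length ls - j) g (\<Prod>i<length ls - j. lin (u i))) \<in> H)"
proof -
  let ?r = "sum_list ls" and ?n = "length ls"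
  let ?e = "?n - j" and ?k = "?r - ?n + j"
  let ?J = "pluecker_index ?r ?k" and ?G = "indep_polys ?e ?n"
  \<comment> \<open>the point \<open>w\<close> carries \<open>n\<close> linear forms of the locus followed by the \<open>n - j\<close> factors of the
     polynomial\<close>
  let ?P = "\<lambda>g w. reduced_product ls w * combination ?e g (\<Prod>i<?e. lin (w (?n + i)))"
  have nr: "?n \<le> ?r" using sum_pred[OF pos ne] by linarith
  have kr: "?k \<le> ?r + 1" using nr j by linarith
  have degP: "degree (?P g w) \<le> ?r" if "g \<in> ?G" for g w
    using degree_mult_le[of "reduced_product ls w" "combination ?e g (\<Prod>i<?e. lin (w (?n + i)))"] degree_reduced_product[OF pos ne, of w] degree_combination[OF that, of "\<Prod>i<?e. lin (w (?n + i))"] by linarith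
  let ?Cg = "\<lambda>g y v. \<exists>w. (\<forall>i<?n. w i = v i) \<and> (\<forall>i. ?n \<le> i \<and> i < ?n + ?e \<longrightarrow> w i \<noteq> 0) \<and> incident ?r ?k y (?P g w)"
  have Cg: "closed_cond ?J ?n (?Cg g)" for g
  proof (rule closed_cond_project)
    obtain dl where dl: "multihom_poly ?J (?n + ?e) dl (reduced_product ls)" using multihom_poly_reduced_product[of ls "?n + ?e"] by auto
    have "multihom_poly ?J (?n + ?e) (\<lambda>l. \<Sum>i<?e. if l = ?n + i then 1 else 0) (\<lambda>v. \<Prod>i<?e. lin (v (?n + i)))"
      by (intro multihom_poly_prod multihom_poly_lin) auto
    from multihom_poly_mult[OF dl multihom_poly_combination[OF this, of ?e g]]
    show "closed_cond ?J (?n + ?e) (\<lambda>y v. incident ?r ?k y (?P g v))"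
      unfolding multihom_poly_def by (intro closed_cond_incident) auto
  qed
  let ?D = "\<lambda>y v. incident ?r ?k y (root_product ls v) \<and> (\<forall>g\<in>?G. ?Cg g y v)"
  have "closed_cond ?J (0 + ?n) ?D"
    using multihom_poly_root_product[of ls ?n ?J] unfolding multihom_poly_def
    by (intro closed_cond_conj closed_cond_incident closed_cond_all Cg) (auto intro: Cg)
  then have C: "closed_cond ?J 0 (\<lambda>y v. \<exists>w. (\<forall>i<0. w i = v i) \<and> (\<forall>i. 0 \<le> i \<and> i < 0 + ?n \<longrightarrow> w i \<noteq> 0) \<and> ?D y w)"
    by (rule closed_cond_project)
  let ?K = "\<lambda>H. \<exists>v. (\<forall>i<?n. v i \<noteq> 0) \<and> homog ?r (root_product ls v) \<in> H \<and>
     (\<forall>g\<in>?G. \<exists>w. (\<forall>i<?n. w i = v i) \<and> (\<forall>i. ?n \<le> i \<and> i < ?n + ?e \<longrightarrow> w i \<noteq> 0) \<and> homog ?r (?P g w) \<in> H)"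
  let ?S = "{H \<in> Gr ?r ?k. \<exists>x. smooth_point ?r (root_locus ls) x \<and> x \<subseteq> H \<and> bipoly.dim (H \<inter> tangent_space ?r (root_locus ls) x) \<ge> j + 1}"
  have "zariski_Gr ?r ?k closure_of ?S \<subseteq> {H \<in> Gr ?r ?k. ?K H}"
  proof (rule closure_of_Gr_subset[OF C kr])
    fix H z v assume H: "H \<in> Gr ?r ?k" "z \<in> pluecker_coords ?r ?k H"
    show "(\<exists>w. (\<forall>i<0. w i = v i) \<and> (\<forall>i. 0 \<le> i \<and> i < 0 + ?n \<longrightarrow> w i \<noteq> 0) \<and> ?D z w) \<longleftrightarrow> ?K H"
      using incident_iff[OF H degree_root_product] incident_iff[OF H degP] by simp
  next
    show "?S \<subseteq> {H \<in> Gr ?r ?k. ?K H}"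
    proof
      fix H assume "H \<in> ?S"
      then obtain x where H: "H \<in> Gr ?r ?k" "smooth_point ?r (root_locus ls) x" "x \<subseteq> H" "bipoly.dim (H \<inter> tangent_space ?r (root_locus ls) x) \<ge> j + 1"
        by blast
      obtain v where v: "\<forall>i<?n. v i \<noteq> 0" "x = (root_point ls v)" "tangent_space ?r (root_locus ls) x = tangent_forms ls v"
        using smooth_pointD[OF pos ne H(2)] by blast
      have xH: "homog ?r (root_product ls v) \<in> H" using H(3) point_subset_iff[OF GrD(1)[OF H(1)]] unfolding v(2) by blast
      have v': "\<And>i. i < ?n \<Longrightarrow> v i \<noteq> 0" using v(1) by blast
      note TSv = tangent_forms_subspace_dim[OF pos ne v'] tangent_forms_forms[OF pos ne, of v]
      obtain B where B: "B \<subseteq> tangent_forms ls v" "bipoly.independent B" "tangent_forms ls v \<subseteq> bipoly.span B" "card B = bipoly.dim (tangent_forms ls v)"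
        using bipoly.basis_exists by blast
      have fB: "finite B" using finite_independent_forms[OF B(2)] B(1) TSv(3) by blast
      have "\<exists>w. (\<forall>i<?n. w i = v i) \<and> (\<forall>i. ?n \<le> i \<and> i < ?n + ?e \<longrightarrow> w i \<noteq> 0) \<and> homog ?r (?P g w) \<in> H" if g: "g \<in> ?G" for g
      proof -
        let ?f = "\<lambda>f. homog ?r (reduced_product ls v * combination ?e g (dehom f))"
        have lin: "Vector_Spaces.linear scale_form scale_form ?f"
          by unfold_locales (simp_all add: dehom_add dehom_smult combination_add combination_smult distrib_left homog_add homog_smult)
        interpret L: Vector_Spaces.linear scale_form scale_form ?f
          by (rule lin)
        let ?U = "?f ` forms ?e"
        have "bipoly.dim ?U = ?e + 1"
        proof (rule dim_injective_image[OF lin])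
          fix f assume f: "f \<in> forms ?e" "?f f = 0"
          have "degree (reduced_product ls v * combination ?e g (dehom f)) \<le> ?r"
            using degree_mult_le[of "reduced_product ls v" "combination ?e g (dehom f)"] degree_reduced_product[OF pos ne, of v] degree_combination[OF g, of "dehom f"] by linarith
          then have "reduced_product ls v * combination ?e g (dehom f) = 0" using f(2) homog_eq_0_iff by blast
          then have "combination ?e g (dehom f) = 0" using reduced_product_nonzero[OF pos ne v'] by simp
          then show "f = 0" using combination_eq_0[OF g degree_dehom[OF f(1)]] dehom_eq_0_iff[OF f(1)] by blast
        qed
        moreover have "bipoly.subspace ?U" by (rule L.subspace_image) (rule subspace_forms)
        moreover have UT: "?U \<subseteq> tangent_forms ls v" using mem_tangent_forms[OF pos ne degree_combination[OF g]] by blast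
        moreover have "bipoly.subspace (H \<inter> tangent_forms ls v)" by (rule bipoly.subspace_inter[OF GrD(1)[OF H(1)] TSv(1)])
        moreover have "bipoly.dim (H \<inter> tangent_forms ls v) \<ge> j + 1" using H(4) v(3) by simp
        \<comment> \<open>the dimensions \<open>n - j + 1\<close> and \<open>j + 1\<close> add up to more than \<open>n + 1\<close>\<close>
        ultimately obtain x where x: "x \<noteq> 0" "x \<in> ?U" "x \<in> H"
          using bipoly.subspaces_meet[of ?U "H \<inter> tangent_forms ls v" B] B(3,4) fB TSv(2) j by fastforce
        then obtain f where f: "f \<in> forms ?e" "x = ?f f" by blast
        then have "dehom f \<noteq> 0" using x(1) by (auto simp: combination_def)
        then obtain c u where cu: "c \<noteq> 0" "\<forall>i<?e. u i \<noteq> 0" "dehom f = smult c (\<Prod>i<?e. lin (u i))"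
          using linear_factorization_up_to_scalar degree_dehom[OF f(1)] by blast
        define w where "w i = (if i < ?n then v i else u (i - ?n))" for i
        have "reduced_product ls w = reduced_product ls v" unfolding reduced_product_def w_def by (intro prod.cong) auto
        then have Pw: "?P g w = reduced_product ls v * combination ?e g (\<Prod>i<?e. lin (u i))" by (simp add: w_def)
        have "x = smult [:c:] (homog ?r (?P g w))"
          unfolding f(2) cu(3) combination_smult Pw by (simp add: homog_smult)
        then have "smult [:inverse c:] x = homog ?r (?P g w)" using cu(1) by (simp add: one_pCons[symmetric])
        moreover have "smult [:inverse c:] x \<in> H" by (rule bipoly.subspace_scale[OF GrD(1)[OF H(1)] x(3)])
        ultimately have "homog ?r (?P g w) \<in> H" by simp
        then show ?thesis using cu(2) by (intro exI[of _ w]) (auto simp: w_def)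
      qed
      then show "H \<in> {H \<in> Gr ?r ?k. ?K H}" using H(1) v(1) xH by blast
    qed
  qed
  then have "?K H" using H unfolding CH_def var_dim_root_locus[OF pos] Let_def by blast
  then obtain v where v: "\<forall>i<?n. v i \<noteq> 0" "homog ?r (root_product ls v) \<in> H"
     "\<forall>g\<in>?G. \<exists>w. (\<forall>i<?n. w i = v i) \<and> (\<forall>i. ?n \<le> i \<and> i < ?n + ?e \<longrightarrow> w i \<noteq> 0) \<and> homog ?r (?P g w) \<in> H" by blast
  have "\<exists>u. (\<forall>i<?e. u i \<noteq> 0) \<and> homog ?r (reduced_product ls v * combination ?e g (\<Prod>i<?e. lin (u i))) \<in> H" if g: "g \<in> ?G" for g
  proof -
    obtain w where w: "\<forall>i<?n. w i = v i" "\<forall>i. ?n \<le> i \<and> i < ?n + ?e \<longrightarrow> w i \<noteq> 0" "homog ?r (?P g w) \<in> H"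
      using v(3) g by blast
    have "reduced_product ls w = reduced_product ls v" unfolding reduced_product_def using w(1) by (intro prod.cong) auto
    then show ?thesis using w(2,3) by (intro exI[of _ "\<lambda>i. w (?n + i)"]) auto
  qed
  then show ?thesis using v(1,2) by blast
qed

section \<open>From tangency to a smaller annihilating product\<close>

text \<open>
  Let \<open>F\<close> be the image of \<open>a\<close> under the reduced product. If no nonzero form of degree \<open>e = n - j\<close>
  killed \<open>F\<close>, then the rows \<open>R g\<close>, the contractions of \<open>F\<close> by \<open>g\<close> of degree at most \<open>n\<close>, would
  span all sequences of length \<open>e + 1\<close>. Choose \<open>e + 1\<close> operators \<open>g\<close> with independent rows. The
  tangency condition for this family gives a nonzero combination of the \<open>g\<close> that kills \<open>F\<close>, a
  contradiction. So a nonzero form of degree \<open>e\<close> kills \<open>F\<close>, as does the product of the \<open>n\<close> linear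
  forms, and \<open>annihilating_subproduct\<close> applies with \<open>d = e + n\<close>. Unused factors are added to reach
  exactly \<open>e\<close>.
\<close>
lemma annihilated_by_subproduct:
  assumes pos: "0 \<notin> set ls" and ne: "ls \<noteq> []" and j: "j \<le> length ls" and d: "d = sum_list ls + length ls - j"
    and v: "\<And>i. i < length ls \<Longrightarrow> v i \<noteq> 0"
    and rpv: "annih d (sum_list ls) (root_product ls v) a"
    and tan: "\<And>g. g \<in> indep_polys (length ls - j) (length ls) \<Longrightarrow> \<exists>u. (\<forall>i<length ls - j. u i \<noteq> 0) \<and>
       annih d (sum_list ls) (reduced_product ls v * combination (length ls - j) g (\<Prod>i<length ls - j. lin (u i))) a"
  shows "\<exists>I\<subseteq>{..<length ls}. card I = length ls - j \<and> annih d (sum_list ls - j) (reduced_product ls v * (\<Prod>i\<in>I. lin (v i))) a"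
proof -
  let ?r = "sum_list ls" and ?n = "length ls"
  \<comment> \<open>\<open>?D\<close> is the degree of \<open>F\<close> as a form\<close>
  let ?e = "?n - j" and ?D = "2 * ?n - j"
  have nr: "?n \<le> ?r" using sum_pred[OF pos ne] by linarith
  define F where "F = act (reduced_product ls v) a"
  have actF: "act (reduced_product ls v * q) a = act q F" for q by (simp add: F_def act_mult[symmetric] mult.commute)
  have shift: "annih d (s + (?r - ?n)) (reduced_product ls v * q) a \<longleftrightarrow> annih ?D s q F" for s q
  proof -
    have "m + (s + (?r - ?n)) \<le> d \<longleftrightarrow> m + s \<le> ?D" for m using d j nr by linarith
    then show ?thesis unfolding annih_def actF by simp
  qed
  have full: "annih ?D (card {..<?n}) (\<Prod>i<?n. lin (v i)) F"
    using shift[of ?n "\<Prod>i<?n. lin (v i)"] rpv nr unfolding root_product_eq_reduced_product[OF pos ne] by simp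
  have "\<exists>p. p \<noteq> 0 \<and> degree p \<le> ?e \<and> annih ?D ?e p F"
  proof (rule ccontr)
    assume no: "\<not> ?thesis"
    define R where "R g = (\<Sum>l\<le>?e. monom (act g F l) l)" for g
    have cR: "coeff (R g) l = (if l \<le> ?e then act g F l else 0)" for g l by (simp add: R_def coeff_sum)
    have "\<exists>rows. (\<forall>i<Suc ?e. rows i \<in> R ` {g. degree g \<le> ?n}) \<and> det (mat (Suc ?e) (Suc ?e) (\<lambda>(i, c). coeff (rows i) c)) \<noteq> 0"
    proof (rule rows_with_nonzero_det)
      fix p assume "p \<in> R ` {g. degree g \<le> ?n}"
      then show "degree p \<le> ?e" using cR by (auto intro!: degree_le)
    next
      fix b :: "nat \<Rightarrow> complex" assume b: "\<And>p. p \<in> R ` {g. degree g \<le> ?n} \<Longrightarrow> (\<Sum>k\<le>?e. coeff p k * b k) = 0"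
      define h where "h = (\<Sum>l\<le>?e. monom (b l) l)"
      have ch: "coeff h l = (if l \<le> ?e then b l else 0)" for l by (simp add: h_def coeff_sum)
      have dh: "degree h \<le> ?e" by (rule degree_le) (simp add: ch)
      have "annih ?D ?e h F" unfolding annih_def
      proof safe
        fix i assume "i + ?e \<le> ?D"
        then have i: "i \<le> ?n" using j by linarith
        have "act h F i = (\<Sum>k\<le>?e. coeff (R (monom 1 i)) k * b k)"
          unfolding act_bound[OF dh] by (intro sum.cong) (auto simp: ch cR act_monom add.commute)
        also have "\<dots> = 0" using i by (intro b) (auto simp: degree_monom_eq)
        finally show "act h F i = 0" .
      qed
      then have "h = 0" using no dh by blast
      then show "\<forall>k\<le>?e. b k = 0" using ch by (metis coeff_0)
    qed
    then obtain rows where rows: "\<And>i. i < Suc ?e \<Longrightarrow> \<exists>g. degree g \<le> ?n \<and> rows i = R g"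
      "det (mat (Suc ?e) (Suc ?e) (\<lambda>(i, c). coeff (rows i) c)) \<noteq> 0" by blast
    then obtain g where g: "\<And>i. i < Suc ?e \<Longrightarrow> degree (g i) \<le> ?n \<and> rows i = R (g i)" by metis
    have solve: "\<forall>i\<le>?e. c i = 0" if "\<And>l. l \<le> ?e \<Longrightarrow> (\<Sum>i\<le>?e. c i * act (g i) F l) = 0" for c
    proof (rule ccontr)
      assume "\<not> ?thesis"
      moreover have "(\<Sum>i<Suc ?e. c i * coeff (rows i) l) = 0" if l: "l < Suc ?e" for l
      proof -
        have "(\<Sum>i<Suc ?e. c i * coeff (rows i) l) = (\<Sum>i\<le>?e. c i * act (g i) F l)"
          using l g by (intro sum.cong) (auto simp: cR)
        then show ?thesis using \<open>\<And>l. l \<le> ?e \<Longrightarrow> (\<Sum>i\<le>?e. c i * act (g i) F l) = 0\<close> l by simp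
      qed
      ultimately have "det (mat (Suc ?e) (Suc ?e) (\<lambda>(i, c). coeff (rows i) c)) = 0"
        unfolding det_eq_0_iff_left by (intro exI[of _ c]) (auto simp: less_Suc_eq_le)
      then show False using rows(2) by simp
    qed
    have act_sum: "act (\<Sum>i\<le>?e. smult (c i) (g i)) F l = (\<Sum>i\<le>?e. c i * act (g i) F l)" for c l
    proof -
      have "act (\<Sum>i\<in>A. smult (c i) (g i)) F l = (\<Sum>i\<in>A. c i * act (g i) F l)" for A
        by (induction A rule: infinite_finite_induct) (simp_all add: act_add act_smult)
      then show ?thesis .
    qed
    have gG: "g \<in> indep_polys ?e ?n"
      unfolding indep_polys_def
    proof (intro CollectI conjI allI impI)
      show "degree (g i) \<le> ?n" if "i \<le> ?e" for i using g that by auto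
      fix c i assume "(\<Sum>i\<le>?e. smult (c i) (g i)) = 0" "i \<le> ?e"
      then show "c i = 0" using solve[of c] act_sum[of c] by simp
    qed
    obtain u where u: "\<forall>i<?e. u i \<noteq> 0" "annih d ?r (reduced_product ls v * combination ?e g (\<Prod>i<?e. lin (u i))) a" using tan[OF gG] by blast
    let ?p = "\<Prod>i<?e. lin (u i)"
    have "annih ?D ?n (combination ?e g ?p) F" using shift[of ?n] u(2) nr by simp
    moreover have "?e + ?n \<le> ?D" using j by linarith
    ultimately have "(\<Sum>i\<le>?e. coeff ?p i * act (g i) F l) = 0" if "l \<le> ?e" for l
      using that unfolding annih_def combination_def act_sum by auto
    then have "\<forall>i\<le>?e. coeff ?p i = 0" by (rule solve)
    moreover have "degree ?p \<le> ?e" using degree_prod_lin[of u "{..<?e}"] by simp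
    ultimately have "?p = 0" by (intro poly_eqI) (metis coeff_0 coeff_eq_0 le_less_trans not_le)
    then show False using u(1) by simp
  qed
  then obtain p where p: "p \<noteq> 0" "degree p \<le> ?e" "annih ?D ?e p F" by blast
  have "?e + card {..<?n} \<le> ?D" using j by simp
  from annihilating_subproduct[OF _ _ p(1,2) this p(3) full] v
  obtain B where B: "B \<subseteq> {..<?n}" "card B \<le> ?e" "annih ?D (card B) (\<Prod>i\<in>B. lin (v i)) F" by auto
  have fB: "finite B" using B(1) finite_subset by blast
  obtain I where I: "B \<subseteq> I" "I \<subseteq> {..<?n}" "card I = ?e"
    using exists_subset_between[OF B(2) _ B(1)] by auto
  have fI: "finite I" using I(2) finite_subset by blast
  have "(\<Prod>i\<in>I. lin (v i)) = (\<Prod>i\<in>I - B. lin (v i)) * (\<Prod>i\<in>B. lin (v i))"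
    by (rule prod.subset_diff[OF I(1) fI])
  moreover have "card B + card (I - B) = ?e" using card_Diff_subset[OF fB I(1)] card_mono[OF fI I(1)] I(3) by simp
  ultimately have "annih ?D ?e (\<Prod>i\<in>I. lin (v i)) F"
    using annih_mult[OF B(3) degree_prod_lin[of v "I - B"]] by simp
  then have "annih d (?e + (?r - ?n)) (reduced_product ls v * (\<Prod>i\<in>I. lin (v i))) a" using shift by blast
  moreover have "?e + (?r - ?n) = ?r - j" using nr j by simp
  ultimately show ?thesis using I(2,3) by auto
qed

section \<open>Approximation by forms in the domain of the apolar map\<close>

lemma annih_smult: "c \<noteq> 0 \<Longrightarrow> annih d s (smult c p) a \<longleftrightarrow> annih d s p a"
  by (simp add: annih_def act_smult)

text \<open>
  \<open>generic_perturbation\<close> joins \<open>f\<close> to forms killed by the same product and in the domain of the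
  apolar map. For such a form the apolar subspace contains a point of the locus and has the right
  dimension.
\<close>
lemma in_closure_of_apolar_preimage:
  assumes pos: "0 \<notin> set fs" and ne: "fs \<noteq> []" and n: "n < sum_list fs" and d: "d = sum_list fs + n"
    and f: "f \<in> forms d" "f \<noteq> 0" and v: "\<And>i. i < length fs \<Longrightarrow> v i \<noteq> 0" and annih: "annih d (sum_list fs) (root_product fs v) (apolar_seq d f)"
  shows "bipoly.span {f} \<in> zariski_proj d closure_of
     apolar_preimage d (sum_list fs) (Xi0 (sum_list fs) (sum_list fs - n - 1) (root_locus fs))"
proof -
  let ?s = "sum_list fs"
  have rp0: "root_product fs v \<noteq> 0" using root_product_nonzero v by blast
  obtain b u where bu: "b \<noteq> 0" "\<forall>i<?s. u i \<noteq> 0" "root_product fs v = smult b (\<Prod>i<?s. lin (u i))"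
    using linear_factorization_up_to_scalar[OF rp0 degree_root_product] by blast
  have annu: "annih d ?s (\<Prod>i<?s. lin (u i)) a \<longleftrightarrow> annih d ?s (root_product fs v) a" for a
    unfolding bu(3) using annih_smult[OF bu(1)] by simp
  have u': "\<And>i. i < ?s \<Longrightarrow> u i \<noteq> 0" using bu(2) by blast
  have nd: "n + ?s \<le> d" using d by simp
  have "annih d ?s (\<Prod>i<?s. lin (u i)) (apolar_seq d f)" using annih annu by blast
  from generic_perturbation[OF u' n nd this] obtain c where
    c: "finite {t. \<not> (annih d ?s (\<Prod>i<?s. lin (u i)) (\<lambda>m. apolar_seq d f m + (\<Sum>i<?s. t ^ Suc i * c i m)) \<and>
           (\<forall>g. g \<noteq> 0 \<and> degree g \<le> n \<longrightarrow> \<not> annih d n g (\<lambda>m. apolar_seq d f m + (\<Sum>i<?s. t ^ Suc i * c i m))))}" by blast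
  let ?a = "\<lambda>t m. apolar_seq d f m + (\<Sum>i<?s. t ^ Suc i * c i m)"
  define ft where "ft t = form_of_seq d (?a t)" for t
  have ftF: "ft t \<in> forms d" for t by (simp add: ft_def)
  have f0: "ft 0 = f" using form_of_seq_apolar_seq[OF f(1)] by (simp add: ft_def)
  have pf: "poly_fun (\<lambda>t. coords d (ft t) i)" if "i \<le> d" for i
  proof -
    have "poly_fun (\<lambda>t. ?a t i * (1 / (fact i * fact (d - i))))"
      by (intro poly_fun_mult poly_fun_add poly_fun_sum poly_fun_power poly_fun_const poly_fun_id)
    then show ?thesis using that by (simp add: ft_def coords_form_of_seq)
  qed
  have seq: "annih d s p (apolar_seq d (ft t)) \<longleftrightarrow> annih d s p (?a t)" if "degree p \<le> s" for s p t
    by (rule annih_cong[OF that]) (simp add: ft_def apolar_seq_form_of_seq)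
  let ?S = "apolar_preimage d ?s (Xi0 ?s (?s - n - 1) (root_locus fs))"
  have inS: "bipoly.span {ft t} \<in> ?S"
    if t: "annih d ?s (\<Prod>i<?s. lin (u i)) (?a t)" "\<forall>g. g \<noteq> 0 \<and> degree g \<le> n \<longrightarrow> \<not> annih d n g (?a t)" for t
  proof -
    have nd': "\<forall>h. h \<noteq> 0 \<and> degree h \<le> d - ?s \<longrightarrow> \<not> annih d (d - ?s) h (apolar_seq d (ft t))" using t(2) seq d by auto
    have ft0: "ft t \<noteq> 0"
    proof
      assume "ft t = 0"
      then have "annih d (d - ?s) 1 (apolar_seq d (ft t))" by (simp add: annih_def apolar_seq_def coords_0)
      then show False using nd' by auto
    qed
    have dom: "bipoly.span {ft t} \<in> apolar_domain d ?s" using apolar_domain_iff[of ?s d] d ftF ft0 nd' by auto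
    let ?H = "apolar_map ?s (bipoly.span {ft t})"
    have H: "?H \<in> Gr ?s (?s - n - 1 + 1)"
      using apolar_map_in_Gr[OF ftF, of ?s t] nd' d n by (simp add: Suc_diff_Suc)
    have "annih d ?s (root_product fs v) (apolar_seq d (ft t))" using t(1) annu seq[OF degree_root_product] by blast
    then have "homog ?s (root_product fs v) \<in> ?H" using apolar_map_span[OF ftF, of ?s t] d by (simp add: dehom_homog degree_root_product)
    then have "bipoly.span {homog ?s (root_product fs v)} \<subseteq> ?H" using point_subset_iff[OF GrD(1)[OF H]] by blast
    moreover have "bipoly.span {homog ?s (root_product fs v)} \<in> root_locus fs" unfolding root_locus_def using v by blast
    ultimately have "?H \<in> Xi0 ?s (?s - n - 1) (root_locus fs)" using Xi0_lower[OF pos ne H] by blast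
    then show ?thesis using dom unfolding apolar_preimage_def by blast
  qed
  have "finite {t. bipoly.span {ft t} \<notin> ?S}" by (rule finite_subset[OF _ c]) (use inS in blast)
  then have "bipoly.span {ft 0} \<in> zariski_proj d closure_of ?S"
    using f(2) f0 by (intro in_closure_of_proj_curve[of ft d 0, OF ftF pf]) auto
  then show ?thesis by (simp add: f0)
qed

section \<open>Preimages of higher associated varieties under apolar maps\<close>

lemma finite_D_set: "finite (D_set j lam)"
proof -
  let ?A = "{ls. set ls \<subseteq> set_mset lam \<and> length ls = size lam}"
  let ?B = "{ks. set ks \<subseteq> {0, 1::nat} \<and> length ks = size lam}"
  have "D_set j lam \<subseteq> (\<lambda>(ls, ks). filter_mset (\<lambda>a. a \<noteq> 0) (mset (map2 (-) ls ks))) ` (?A \<times> ?B)"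
    unfolding D_set_def by force
  moreover have "finite (?A \<times> ?B)" by (intro finite_cartesian_product finite_lists_length_eq) auto
  ultimately show ?thesis using finite_subset by blast
qed

lemma apolar_preimageE:
  assumes "x \<in> apolar_preimage d s S" "s \<le> d" "d - s \<le> s"
  obtains f where "f \<in> forms d" "f \<noteq> 0" "x = bipoly.span {f}"
    "\<And>h. h \<noteq> 0 \<Longrightarrow> degree h \<le> d - s \<Longrightarrow> \<not> annih d (d - s) h (apolar_seq d f)"
    "apolar_map s x \<in> S" "\<And>p. degree p \<le> s \<Longrightarrow> homog s p \<in> apolar_map s x \<longleftrightarrow> annih d s p (apolar_seq d f)"
proof -
  have x: "x \<in> apolar_domain d s" "apolar_map s x \<in> S" using assms(1) unfolding apolar_preimage_def by auto
  then obtain f where f: "f \<in> forms d" "f \<noteq> 0" "x = bipoly.span {f}"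
    "\<forall>h. h \<noteq> 0 \<and> degree h \<le> d - s \<longrightarrow> \<not> annih d (d - s) h (apolar_seq d f)" using apolar_domain_iff[OF assms(2)] by auto
  have "homog s p \<in> apolar_map s x \<longleftrightarrow> annih d s p (apolar_seq d f)" if "degree p \<le> s" for p
    unfolding f(3) apolar_map_span[OF f(1) assms(2)] by (simp add: dehom_homog that)
  then show ?thesis using that f x(2) by blast
qed

theorem theorem2p1:
  fixes r n j d :: nat and lam :: "nat multiset"
  assumes "r > 0"
    and "is_partition lam r"
    and "size lam = n"
    and "int j \<le> min (int n) (int r - int n - 1)"
    and "d = r + n - j"
  shows "zariski_proj d closure_of apolar_preimage d r (CH r j (coincident_root_locus lam)) =
    (\<Union>mu \<in> D_set j lam.
       zariski_proj d closure_of
         apolar_preimage d (r - j) (Xi0 (r - j) (r - j - n - 1) (coincident_root_locus mu)))"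
proof -
  have jn: "j \<le> n" and rn: "j + n + 1 \<le> r" using assms(4) by auto
  have dr: "r \<le> d" "d - r \<le> r" "d - r = n - j" and ds: "r - j \<le> d" "d - (r - j) \<le> r - j" "d - (r - j) = n"
    using assms(5) jn rn by auto
  let ?L = "apolar_preimage d r (CH r j (coincident_root_locus lam))"
  let ?R = "\<lambda>mu. apolar_preimage d (r - j) (Xi0 (r - j) (r - j - n - 1) (coincident_root_locus mu))"
  have part: "0 \<notin># lam" "sum_mset lam = r" using assms(2) by (auto simp: is_partition_def)
  have order: "0 \<notin> set ls \<and> sum_list ls = r \<and> length ls = n \<and> ls \<noteq> []" if "mset ls = lam" for ls
  proof -
    have "sum_list ls = r" using part(2) that sum_mset_sum_list[of ls] by simp
    moreover have "0 \<notin> set ls" using part(1) that by (metis set_mset_mset)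
    moreover have "length ls = n" using assms(3) that by (metis size_mset)
    ultimately show ?thesis using assms(1) by auto
  qed
  have reduced: "sum_list (filter (\<lambda>a. a \<noteq> 0) es) = sum_list es" for es :: "nat list"
    by (induction es) auto
  have shorter: "sum_list (map2 (-) ls ks) = r - j \<and> filter (\<lambda>a. a \<noteq> 0) (map2 (-) ls ks) \<noteq> []"
    if "mset ls = lam" "length ks = length ls" "set ks \<subseteq> {0, 1}" "sum_list ks = j" for ls ks
  proof -
    have s: "sum_list (map2 (-) ls ks) = r - j" using sum_list_map2_minus[OF that(2,3)] order[OF that(1)] that(4) by simp
    have "filter (\<lambda>a. a \<noteq> 0) (map2 (-) ls ks) \<noteq> []"
    proof
      assume "filter (\<lambda>a. a \<noteq> 0) (map2 (-) ls ks) = []"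
      then have "sum_list (map2 (-) ls ks) = 0" using reduced[of "map2 (-) ls ks"] by simp
      then show False using s rn by simp
    qed
    then show ?thesis using s by blast
  qed
  have left: "?L \<subseteq> (\<Union>mu\<in>D_set j lam. zariski_proj d closure_of ?R mu)"
  proof
    fix x assume "x \<in> ?L"
    then obtain f where f: "f \<in> forms d" "f \<noteq> 0" "x = bipoly.span {f}"
      "apolar_map r x \<in> CH r j (coincident_root_locus lam)"
      "\<And>p. degree p \<le> r \<Longrightarrow> homog r p \<in> apolar_map r x \<longleftrightarrow> annih d r p (apolar_seq d f)"
      using apolar_preimageE[OF _ dr(1,2)] by metis
    obtain ls where ls: "mset ls = lam" using ex_mset by blast
    note lso = order[OF ls]
    have pos: "0 \<notin> set ls" and ne: "ls \<noteq> []" and sl: "sum_list ls = r" and ll: "length ls = n" using lso by auto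
    have "apolar_map r x \<in> CH (sum_list ls) j (root_locus ls)" using f(4) coincident_root_locus_conv[of ls] ls sl by simp
    from CH_upper[OF pos ne _ this] jn obtain v where v: "\<forall>i<n. v i \<noteq> 0" "homog r (root_product ls v) \<in> apolar_map r x"
      "\<forall>g\<in>indep_polys (n - j) n. \<exists>u. (\<forall>i<n - j. u i \<noteq> 0) \<and> homog r (reduced_product ls v * combination (n - j) g (\<Prod>i<n - j. lin (u i))) \<in> apolar_map r x"
      unfolding sl ll by blast
    have "\<exists>I\<subseteq>{..<length ls}. card I = length ls - j \<and> annih d (sum_list ls - j) (reduced_product ls v * (\<Prod>i\<in>I. lin (v i))) (apolar_seq d f)"
    proof (rule annihilated_by_subproduct[OF pos ne])
      show "annih d (sum_list ls) (root_product ls v) (apolar_seq d f)" using v(2) f(5) degree_root_product[of ls v] sl by simp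
      fix g assume g: "g \<in> indep_polys (length ls - j) (length ls)"
      have "degree (reduced_product ls v * combination (n - j) g p) \<le> r" for p
        using degree_mult_le[of "reduced_product ls v" "combination (n - j) g p"] degree_reduced_product[OF pos ne, of v] degree_combination[OF g[unfolded ll], of p] sl ll by linarith
      then show "\<exists>u. (\<forall>i<length ls - j. u i \<noteq> 0) \<and>
         annih d (sum_list ls) (reduced_product ls v * combination (length ls - j) g (\<Prod>i<length ls - j. lin (u i))) (apolar_seq d f)"
        using v(3) g f(5) unfolding sl ll by blast
    qed (use jn ll sl assms(5) v(1) in auto)
    then obtain I where I: "I \<subseteq> {..<n}" "card I = n - j" "annih d (r - j) (reduced_product ls v * (\<Prod>i\<in>I. lin (v i))) (apolar_seq d f)"
      unfolding sl ll by blast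
    \<comment> \<open>lower the exponent by one at the indices whose extra linear factor was dropped\<close>
    define ks where "ks = map (\<lambda>i. if i \<in> I then 0 else 1::nat) [0..<n]"
    have ks: "length ks = length ls" "set ks \<subseteq> {0, 1}" by (auto simp: ks_def ll)
    have ks0: "{i. i < length ls \<and> ks ! i = 0} = I" using I(1) by (auto simp: ks_def ll split: if_splits)
    have ks1: "{i. i < length ks \<and> ks ! i = 1} = {..<n} - I" using I(1) by (auto simp: ks_def split: if_splits)
    have sks: "sum_list ks = j"
      unfolding sum_list_01[OF ks(2)] ks1 using card_Diff_subset[OF finite_subset[OF I(1)] I(1)] I(2) jn by simp
    let ?es = "map2 (-) ls ks"
    let ?fs = "filter (\<lambda>a. a \<noteq> 0) ?es"
    let ?mu = "filter_mset (\<lambda>a. a \<noteq> 0) (mset ?es)"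
    have mu: "?mu \<in> D_set j lam" unfolding D_set_def using ls ks sks by blast
    note sh = shorter[OF ls ks sks]
    have sfs: "sum_list ?fs = r - j" using sh reduced by metis
    have root_locus: "root_locus ?fs = root_locus ?es" "coincident_root_locus ?mu = root_locus ?fs"
      using root_locus_drop_zeros[of ?es] coincident_root_locus_conv[of ?fs] by (simp_all add: mset_filter)
    have "\<forall>i<length ?es. v i \<noteq> 0" using v(1) ks(1) ll by simp
    then have "bipoly.span {homog (r - j) (root_product ?es v)} \<in> root_locus ?fs" unfolding root_locus(1) unfolding root_locus_def conjunct1[OF sh] by blast
    \<comment> \<open>leave out the linear forms whose exponent has become zero\<close>
    then obtain w where w: "bipoly.span {homog (r - j) (root_product ?es v)} = bipoly.span {homog (r - j) (root_product ?fs w)}" "\<forall>i<length ?fs. w i \<noteq> 0"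
      unfolding root_locus_def sfs by blast
    have des: "degree (root_product ?es v) \<le> r - j" "degree (root_product ?fs w) \<le> r - j"
      using degree_root_product[of ?es v] degree_root_product[of ?fs w] sh sfs by auto
    have "homog (r - j) (root_product ?fs w) \<in> bipoly.span {homog (r - j) (root_product ?es v)}" using w(1) bipoly.span_base by blast
    then obtain c where "homog (r - j) (root_product ?fs w) = smult [:c:] (homog (r - j) (root_product ?es v))" by (auto simp: span_single)
    then have "root_product ?fs w = smult c (root_product ?es v)" using dehom_homog[OF des(1)] dehom_homog[OF des(2)] dehom_smult by metis
    moreover have "annih d (r - j) (root_product ?es v) (apolar_seq d f)" using I(3) unfolding root_product_map2_minus[OF ks pos] ks0 .
    ultimately have "annih d (sum_list ?fs) (root_product ?fs w) (apolar_seq d f)" unfolding sfs by (simp add: annih_def act_smult)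
    from in_closure_of_apolar_preimage[of ?fs n d f w, OF _ _ _ _ f(1,2) _ this]
    have "x \<in> zariski_proj d closure_of ?R ?mu"
      unfolding f(3) sfs root_locus(2) using sh w(2) rn ds assms(5) jn by auto
    then show "x \<in> (\<Union>mu\<in>D_set j lam. zariski_proj d closure_of ?R mu)" using mu by blast
  qed
  have right: "?R mu \<subseteq> ?L" if mu: "mu \<in> D_set j lam" for mu
  proof
    fix x assume "x \<in> ?R mu"
    then obtain f where f: "f \<in> forms d" "f \<noteq> 0" "x = bipoly.span {f}"
      "\<And>h. h \<noteq> 0 \<Longrightarrow> degree h \<le> n \<Longrightarrow> \<not> annih d n h (apolar_seq d f)"
      "apolar_map (r - j) x \<in> Xi0 (r - j) (r - j - n - 1) (coincident_root_locus mu)"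
      "\<And>p. degree p \<le> r - j \<Longrightarrow> homog (r - j) p \<in> apolar_map (r - j) x \<longleftrightarrow> annih d (r - j) p (apolar_seq d f)"
      using apolar_preimageE[OF _ ds(1,2)] unfolding ds(3) by metis
    obtain ls ks where lk: "mu = filter_mset (\<lambda>a. a \<noteq> 0) (mset (map2 (-) ls ks))" "mset ls = lam"
      "length ks = length ls" "set ks \<subseteq> {0, 1}" "sum_list ks = j" using mu unfolding D_set_def by blast
    have pos: "0 \<notin> set ls" and ne: "ls \<noteq> []" and sl: "sum_list ls = r" and ll: "length ls = n" using order[OF lk(2)] by auto
    let ?es = "map2 (-) ls ks"
    let ?fs = "filter (\<lambda>a. a \<noteq> 0) ?es"
    note sh = shorter[OF lk(2-5)]
    have sfs: "sum_list ?fs = r - j" using sh reduced by metis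
    have root_locus: "root_locus ?fs = root_locus ?es" "coincident_root_locus mu = root_locus ?fs"
      using root_locus_drop_zeros[of ?es] coincident_root_locus_conv[of ?fs] unfolding lk(1) by (simp_all add: mset_filter)
    have le: "r - j - n - 1 + 1 \<le> sum_list ?fs + 1" unfolding sfs using rn by linarith
    have "apolar_map (r - j) x \<in> Xi0 (sum_list ?fs) (r - j - n - 1) (root_locus ?fs)" using f(5) unfolding sfs root_locus(2) .
    from Xi0_upper[OF le this] obtain y where y: "y \<in> root_locus ?es" "y \<subseteq> apolar_map (r - j) x"
      unfolding root_locus(1) by blast
    then obtain v where v: "y = bipoly.span {homog (r - j) (root_product ?es v)}" "\<forall>i<length ?es. v i \<noteq> 0"
      unfolding root_locus_def conjunct1[OF sh] by blast
    have des: "degree (root_product ?es v) \<le> r - j" using degree_root_product[of ?es v] sh by simp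
    have "homog (r - j) (root_product ?es v) \<in> apolar_map (r - j) x" using y(2) bipoly.span_base[of _ "{_}"] unfolding v(1) by blast
    then have av: "annih d (r - j) (root_product ?es v) (apolar_seq d f)" using f(6)[OF des] by blast
    \<comment> \<open>raising the formal degree from \<open>n - j\<close> to \<open>n\<close> multiplies an operator that kills \<open>f\<close> by a
       power of \<open>x\<close>\<close>
    have nd: "\<forall>h. h \<noteq> 0 \<and> degree h \<le> d - r \<longrightarrow> \<not> annih d (d - r) h (apolar_seq d f)"
    proof safe
      fix h :: "complex poly" assume h: "h \<noteq> 0" "degree h \<le> d - r" "annih d (d - r) h (apolar_seq d f)"
      then have "annih d n h (apolar_seq d f)" unfolding annih_def dr(3) by auto
      then show False using f(4)[OF h(1)] h(2) dr(3) by simp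
    qed
    have dom: "x \<in> apolar_domain d r" using apolar_domain_iff[OF dr(1)] f(1-3) nd by blast
    let ?H = "apolar_map r x"
    have "?H \<in> Gr r (2 * r - d)" unfolding f(3) by (rule apolar_map_in_Gr[OF f(1) dr(1,2) nd])
    moreover have "2 * r - d = r - n + j" using assms(5) jn rn by linarith
    ultimately have H: "?H \<in> Gr (sum_list ls) (sum_list ls - length ls + j)" by (simp add: sl ll)
    have "?H \<in> CH (sum_list ls) j (root_locus ls)"
    proof (rule CH_lower[OF pos ne lk(3-5) H])
      show "v i \<noteq> 0" if "i < length ls" for i using v(2) lk(3) that by simp
      fix c :: "complex poly" assume c: "degree c \<le> j"
      have "annih d (r - j + j) (c * root_product ?es v) (apolar_seq d f)" by (rule annih_mult[OF av c])
      then have "annih d r (root_product ?es v * c) (apolar_seq d f)" using rn by (simp add: mult.commute)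
      moreover have "degree (root_product ?es v * c) \<le> r" using degree_mult_le[of "root_product ?es v" c] des c rn by linarith
      ultimately show "homog (sum_list ls) (root_product ?es v * c) \<in> ?H"
        unfolding sl f(3) apolar_map_span[OF f(1) dr(1)] by (simp add: dehom_homog)
    qed
    then show "x \<in> ?L" using dom coincident_root_locus_conv[of ls] lk(2) sl unfolding apolar_preimage_def by simp
  qed
  show ?thesis
  proof
    \<comment> \<open>the right-hand side is a finite union of closed sets\<close>
    show "zariski_proj d closure_of ?L \<subseteq> (\<Union>mu\<in>D_set j lam. zariski_proj d closure_of ?R mu)"
      by (rule closure_of_minimal[OF left]) (intro closedin_Union finite_imageI finite_D_set, auto)
    show "(\<Union>mu\<in>D_set j lam. zariski_proj d closure_of ?R mu) \<subseteq> zariski_proj d closure_of ?L"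
      using closure_of_mono[OF right] by blast
  qed
qed

end
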